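(* Let $f\in W^{-1,p'}(\Omega)$. Assume that $\alpha,\beta\in\mathbb{R}$ are such that one of the following assumptions is satisfied: (i) $G_\beta(u)<0$ for all $u\in ES(p;\alpha)\setminus\{0\}$; (ii) $G_\beta(u)>0$ for all $u\in ES(p;\alpha)\setminus\{0\}$. Then the problem $$-\Delta_p u-\Delta_q u=\alpha|u|^{p-2}u+\beta|u|^{q-2}u+f(x)\ \text{ in }\Omega,\qquad u=0\ \text{ on }\partial\Omega,$$ has at least one (weak) solution.
   Context: Standing assumptions: $N\ge 1$, $\Omega\subset\mathbb{R}^N$ is a bounded domain with $C^2$-boundary, $1<q<p<\infty$, $p'=p/(p-1)$; $\Delta_r u=\mathrm{div}(|\nabla u|^{r-2}\nabla u)$. $W_0^{1,p}=W_0^{1,p}(\Omega)$ has the norm $\|\nabla u\|_p$, where $\|\cdot\|_p$ is the $L^p(\Omega)$-norm; $W^{-1,p'}(\Omega)$ is its dual and $\langle f,u\rangle$ (written formally as $\int_\Omega fu\,dx$) is the dual pairing. A (weak) solution of the problem is a function $u\in W_0^{1,p}$ such that $\int_\Omega(|\nabla u|^{p-2}+|\nabla u|^{q-2})\nabla u\cdot\nabla\varphi\,dx=\int_\Omega(\alpha|u|^{p-2}u+\beta|u|^{q-2}u)\varphi\,dx+\langle f,\varphi\rangle$ for all $\varphi\in W_0^{1,p}$. $G_\beta(u):=\|\nabla u\|_q^q-\beta\|u\|_q^q$. $ES(p;\alpha)$ is the set of all weak solutions $u\in W_0^{1,p}$ of $-\Delta_p u=\alpha|u|^{p-2}u$ in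 $\Omega$, $u=0$ on $\partial\Omega$ (so $ES(p;\alpha)=\{0\}$ if $\alpha$ is not an eigenvalue of the $p$-Laplacian). *)

theory Defs
  imports "HOL-Analysis.Analysis"
begin

text \<open>
  The space \<open>\<real>\<^sup>N\<close>, \<open>N \<ge> 1\<close>, is an arbitrary Euclidean space \<open>'a\<close>; functions on \<open>\<Omega>\<close> are total functions
  of which only the values on \<open>\<Omega>\<close> matter. Elements of Lebesgue and Sobolev spaces are
  representatives: equality of elements is equality almost everywhere on \<open>\<Omega>\<close>.
\<close>

subsection \<open>Classical differentiability, \<open>C\<^sup>2\<close> domains, test functions\<close>

definition grad :: "('a::euclidean_space \<Rightarrow> real) \<Rightarrow> 'a \<Rightarrow> 'a" where
  "grad f x = (\<Sum>i\<in>Basis. frechet_derivative f (at x) i *\<^sub>R i)"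

primrec Ck :: "nat \<Rightarrow> ('a::euclidean_space \<Rightarrow> real) \<Rightarrow> bool" where
  "Ck 0 f \<longleftrightarrow> continuous_on UNIV f"
| "Ck (Suc k) f \<longleftrightarrow> f differentiable_on UNIV \<and> (\<forall>i\<in>Basis. Ck k (\<lambda>x. grad f x \<bullet> i))"

text \<open>
  Near each boundary point, \<open>\<Omega>\<close> is the region above the graph of a \<open>C\<^sup>2\<close> function in the direction of
  some unit vector \<open>\<nu>\<close>. The graph function is evaluated only on the hyperplane orthogonal to \<open>\<nu>\<close>; a
  function on that hyperplane is \<open>C\<^sup>2\<close> iff it is the restriction of a \<open>C\<^sup>2\<close> function \<open>\<gamma>\<close> on the whole
  space (extend it constantly in direction \<open>\<nu>\<close>).
\<close>
definition C2_boundary :: "'a::euclidean_space set \<Rightarrow> bool" where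
  "C2_boundary \<Omega> \<longleftrightarrow> (\<forall>x0\<in>frontier \<Omega>. \<exists>r>0. \<exists>\<nu> \<gamma>. norm \<nu> = 1 \<and> Ck 2 \<gamma> \<and>
     \<Omega> \<inter> ball x0 r = {x \<in> ball x0 r. \<gamma> (x - (x \<bullet> \<nu>) *\<^sub>R \<nu>) < x \<bullet> \<nu>})"

definition bounded_C2_domain :: "'a::euclidean_space set \<Rightarrow> bool" where
  "bounded_C2_domain \<Omega> \<longleftrightarrow>
     open \<Omega> \<and> connected \<Omega> \<and> \<Omega> \<noteq> {} \<and> bounded \<Omega> \<and> C2_boundary \<Omega>"

definition test_functions :: "'a::euclidean_space set \<Rightarrow> ('a \<Rightarrow> real) set" where
  "test_functions \<Omega> = {\<phi>. (\<forall>k. Ck k \<phi>) \<and> compact (closure (support_on UNIV \<phi>)) \<and>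
     closure (support_on UNIV \<phi>) \<subseteq> \<Omega>}"

subsection \<open>Lebesgue and Sobolev spaces\<close>

definition Lp_space :: "real \<Rightarrow> 'a::euclidean_space set \<Rightarrow> ('a \<Rightarrow> 'b::euclidean_space) set" where
  "Lp_space r \<Omega> = {h \<in> borel_measurable (lebesgue_on \<Omega>).
     integrable (lebesgue_on \<Omega>) (\<lambda>x. norm (h x) powr r)}"

definition Lp_norm :: "real \<Rightarrow> 'a::euclidean_space set \<Rightarrow> ('a \<Rightarrow> 'b::euclidean_space) \<Rightarrow> real" where
  "Lp_norm r \<Omega> h = (LINT x|lebesgue_on \<Omega>. norm (h x) powr r) powr (1 / r)"

definition locally_integrable ::
  "'a::euclidean_space set \<Rightarrow> ('a \<Rightarrow> 'b::euclidean_space) \<Rightarrow> bool" where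
  "locally_integrable \<Omega> h \<longleftrightarrow> (\<forall>K. compact K \<and> K \<subseteq> \<Omega> \<longrightarrow> integrable (lebesgue_on K) h)"

definition has_weak_grad ::
  "'a::euclidean_space set \<Rightarrow> ('a \<Rightarrow> real) \<Rightarrow> ('a \<Rightarrow> 'a) \<Rightarrow> bool" where
  "has_weak_grad \<Omega> u g \<longleftrightarrow> locally_integrable \<Omega> u \<and> locally_integrable \<Omega> g \<and>
     (\<forall>\<phi>\<in>test_functions \<Omega>.
        (LINT x|lebesgue_on \<Omega>. u x *\<^sub>R grad \<phi> x) = - (LINT x|lebesgue_on \<Omega>. \<phi> x *\<^sub>R g x))"

text \<open>Weak gradients are unique almost everywhere on \<open>\<Omega>\<close>, so the choice below is immaterial.\<close>
definition weak_grad :: "'a::euclidean_space set \<Rightarrow> ('a \<Rightarrow> real) \<Rightarrow> 'a \<Rightarrow> 'a" where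
  "weak_grad \<Omega> u = (SOME g. has_weak_grad \<Omega> u g)"

definition W1 :: "real \<Rightarrow> 'a::euclidean_space set \<Rightarrow> ('a \<Rightarrow> real) set" where
  "W1 r \<Omega> = {u \<in> Lp_space r \<Omega>. \<exists>g\<in>Lp_space r \<Omega>. has_weak_grad \<Omega> u g}"

text \<open>The closure of the test functions in the norm of \<open>W1 r \<Omega>\<close>.\<close>
definition W10 :: "real \<Rightarrow> 'a::euclidean_space set \<Rightarrow> ('a \<Rightarrow> real) set" where
  "W10 r \<Omega> = {u \<in> W1 r \<Omega>. \<exists>\<phi>. (\<forall>n::nat. \<phi> n \<in> test_functions \<Omega>) \<and>
     (\<lambda>n. Lp_norm r \<Omega> (\<lambda>x. \<phi> n x - u x)) \<longlonglongrightarrow> 0 \<and>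
     (\<lambda>n. Lp_norm r \<Omega> (\<lambda>x. grad (\<phi> n) x - weak_grad \<Omega> u x)) \<longlonglongrightarrow> 0}"

text \<open>
  The dual of \<open>W10 p \<Omega>\<close> with norm \<open>\<parallel>\<nabla>u\<parallel>\<^sub>p\<close>, i.e. \<open>W\<close> with exponents \<open>-1, p'\<close>; the parameter is \<open>p\<close>, not
  \<open>p'\<close>, and the pairing \<open>\<langle>F, u\<rangle>\<close> is application \<open>F u\<close>. Linearity and boundedness together force
  \<open>F u = F v\<close> whenever \<open>u, v\<close> agree almost everywhere on \<open>\<Omega>\<close>.
\<close>
definition W10_dual :: "real \<Rightarrow> 'a::euclidean_space set \<Rightarrow> (('a \<Rightarrow> real) \<Rightarrow> real) set" where
  "W10_dual p \<Omega> = {F.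
     (\<forall>u\<in>W10 p \<Omega>. \<forall>v\<in>W10 p \<Omega>. F (\<lambda>x. u x + v x) = F u + F v) \<and>
     (\<forall>c. \<forall>u\<in>W10 p \<Omega>. F (\<lambda>x. c * u x) = c * F u) \<and>
     (\<exists>C. \<forall>u\<in>W10 p \<Omega>. \<bar>F u\<bar> \<le> C * Lp_norm p \<Omega> (weak_grad \<Omega> u))}"

subsection \<open>The problem\<close>

text \<open>At points where the base vanishes, the factors \<open>0 powr _ = 0\<close> give the usual convention
  \<open>|z|\<^sup>r\<^sup>-\<^sup>2 z = 0\<close> for \<open>z = 0\<close>.\<close>
definition weak_solution ::
  "'a::euclidean_space set \<Rightarrow> real \<Rightarrow> real \<Rightarrow> real \<Rightarrow> real \<Rightarrow> (('a \<Rightarrow> real) \<Rightarrow> real) \<Rightarrow> ('a \<Rightarrow> real) \<Rightarrow> bool"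
where
  "weak_solution \<Omega> p q \<alpha> \<beta> f u \<longleftrightarrow> u \<in> W10 p \<Omega> \<and>
     (\<forall>\<phi>\<in>W10 p \<Omega>.
        (LINT x|lebesgue_on \<Omega>.
           (norm (weak_grad \<Omega> u x) powr (p - 2) + norm (weak_grad \<Omega> u x) powr (q - 2))
           * (weak_grad \<Omega> u x \<bullet> weak_grad \<Omega> \<phi> x))
        = (LINT x|lebesgue_on \<Omega>.
             (\<alpha> * \<bar>u x\<bar> powr (p - 2) * u x + \<beta> * \<bar>u x\<bar> powr (q - 2) * u x) * \<phi> x) + f \<phi>)"

definition G :: "'a::euclidean_space set \<Rightarrow> real \<Rightarrow> real \<Rightarrow> ('a \<Rightarrow> real) \<Rightarrow> real" where
  "G \<Omega> q \<beta> u = Lp_norm q \<Omega> (weak_grad \<Omega> u) powr q - \<beta> * Lp_norm q \<Omega> u powr q"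

definition ES :: "'a::euclidean_space set \<Rightarrow> real \<Rightarrow> real \<Rightarrow> ('a \<Rightarrow> real) set" where
  "ES \<Omega> p \<alpha> = {u \<in> W10 p \<Omega>. \<forall>\<phi>\<in>W10 p \<Omega>.
     (LINT x|lebesgue_on \<Omega>.
        norm (weak_grad \<Omega> u x) powr (p - 2) * (weak_grad \<Omega> u x \<bullet> weak_grad \<Omega> \<phi> x))
     = (LINT x|lebesgue_on \<Omega>. \<alpha> * \<bar>u x\<bar> powr (p - 2) * u x * \<phi> x)}"

text \<open>The representatives of the zero element; \<open>ES \<setminus> {0}\<close> becomes \<open>ES \<Omega> p \<alpha> - null_functions \<Omega>\<close>.\<close>
definition null_functions :: "'a::euclidean_space set \<Rightarrow> ('a \<Rightarrow> real) set" where
  "null_functions \<Omega> = {u. AE x in lebesgue_on \<Omega>. u x = 0}"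

end

theory Submission
  imports Defs "HOL-Homology.Homology" "HOL-Library.Function_Algebras"
begin

text \<open>
The solutions are the critical points of the energy
\<open>E\<^sub>\<alpha>(u) = (\<parallel>\<nabla>u\<parallel>\<^sub>p\<^sup>p - \<alpha> \<parallel>u\<parallel>\<^sub>p\<^sup>p) / p + G(u) / q - \<langle>f, u\<rangle>\<close>. When \<open>\<alpha>\<close> is an eigenvalue of the \<open>p\<close>-Laplacian,
almost critical sequences of \<open>E\<^sub>\<alpha>\<close> may be unbounded, and the condition on \<open>G\<close> is what prevents this.

\<^emph>\<open>Almost critical sequences.\<close> Suppose that \<open>u\<^sub>n\<close> is almost critical for \<open>E\<close> with parameter \<open>a\<^sub>n\<close>, where \<open>a\<^sub>n\<close>
tends to \<open>\<alpha>\<close>. If \<open>u\<^sub>n\<close> is bounded, a subsequence converges strongly to a solution, by Rellich's theorem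
and strong monotonicity of the \<open>p\<close>-Laplacian (\<open>almost_solutions_converge\<close>). If it is unbounded, the
normalised sequence converges to some \<open>v \<noteq> 0\<close> in \<open>ES(p; \<alpha>)\<close>, because the terms of exponent \<open>q\<close> and \<open>f\<close> scale
away. In \<open>p E(u) - E'(u) u = (p/q - 1) G(u) - (p - 1) \<langle>f, u\<rangle>\<close> the terms of order \<open>p\<close> cancel. Dividing by
\<open>\<parallel>\<nabla>u\<^sub>n\<parallel>\<^sub>p\<^sup>q\<close> shows that \<open>G(v) \<le> 0\<close> if the energies are bounded above, and \<open>G(v) \<ge> 0\<close> if they are bounded
below. So it suffices to find almost critical points with energies bounded above if \<open>G > 0\<close> on the
eigenfunctions, and bounded below if \<open>G < 0\<close> (\<open>almost_critical_sequence_solves\<close>).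

\<^emph>\<open>Linking.\<close> Let \<open>C\<^sub>\<Lambda>\<close> be the cone of the functions with \<open>\<parallel>\<nabla>u\<parallel>\<^sub>p\<^sup>p < \<Lambda> \<parallel>u\<parallel>\<^sub>p\<^sup>p\<close>. For \<open>\<Lambda>\<^sub>1 < a < \<Lambda>\<^sub>2\<close> the energy with
parameter \<open>a\<close> tends to \<open>-\<infinity>\<close> at infinity in \<open>C\<^sub>\<Lambda>\<^sub>1\<close> and is bounded below outside \<open>C\<^sub>\<Lambda>\<^sub>2\<close>. If \<open>C\<^sub>\<Lambda>\<^sub>1\<close> contains an odd
image of the sphere of \<open>\<real>\<^sup>k\<close>, but \<open>C\<^sub>\<Lambda>\<^sub>2\<close> none of the sphere of \<open>\<real>\<^sup>k\<^sup>+\<^sup>1\<close>, then the cone over a large multiple of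
the image cannot be deformed into \<open>C\<^sub>\<Lambda>\<^sub>2\<close> with its base fixed, and there are almost critical points
(\<open>odd_linking_almost_critical_point\<close>, \<open>almost_critical_point_between_cones\<close>). Their energies are below the
supremum over \<open>C\<^sub>\<Lambda>\<^sub>1\<close> and, up to a constant, above the infimum outside \<open>C\<^sub>\<Lambda>\<^sub>2\<close>. The index, the largest \<open>k\<close>
possible in \<open>C\<^sub>\<Lambda>\<close>, is finite and increases with \<open>\<Lambda>\<close>, so it is constant on an interval to the left of
\<open>\<alpha>\<close> and on one to the right. Letting \<open>a\<^sub>n\<close> tend to \<open>\<alpha>\<close> from the left, with \<open>\<Lambda>\<^sub>1\<close> fixed, gives energies
bounded above; from the right, with \<open>\<Lambda>\<^sub>2\<close> fixed, energies bounded below.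

\<^emph>\<open>Finiteness of the index.\<close> Up to a small fraction of the gradient norm, the \<open>L\<^sup>p\<close> norm is controlled by the
integrals over finitely many cubes (\<open>Lp_norm_le_gradient_and_averages\<close>). An odd map on a sphere of large
dimension would take a value for which all these integrals vanish, by the Borsuk-Ulam theorem
(\<open>Borsuk_Ulam_sphere_nat\<close>), and such a function is not in \<open>C\<^sub>\<Lambda>\<close>. The same estimate yields Rellich's theorem.

The variational part takes place in the space of test functions, where gradients are classical. As this
space is not complete, the deformation is made of finitely many steps instead of a flow; the Sobolev
space is entered with the limits.
\<close>

section \<open>The Borsuk-Ulam theorem\<close>

text \<open>The unit sphere of \<open>\<real>\<^sup>k\<close>, with \<open>\<real>\<^sup>k\<close> taken as the sequences that vanish from index \<open>k\<close> on. All spheres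
then live in one type and are nested, the sphere of \<open>\<real>\<^sup>k\<close> being the equator of that of \<open>\<real>\<^sup>k\<^sup>+\<^sup>1\<close>, so
that the dimension can vary inside a statement. For \<open>k = 0\<close> the sphere is empty.\<close>
definition sphere_nat :: "nat \<Rightarrow> (nat \<Rightarrow> real) set" where
  "sphere_nat k = {x. (\<Sum>i<k. (x i)\<^sup>2) = 1 \<and> (\<forall>i\<ge>k. x i = 0)}"

definition normalize_upto :: "nat \<Rightarrow> (nat \<Rightarrow> real) \<Rightarrow> nat \<Rightarrow> real" where
  "normalize_upto k y = (\<lambda>i. if i < k then y i / sqrt (\<Sum>j<k. (y j)\<^sup>2) else 0)"

lemma topspace_nsphere_eq: "topspace (nsphere n) = sphere_nat (Suc n)"
  by (auto simp: nsphere sphere_nat_def lessThan_Suc_atMost Suc_le_eq)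

lemma nsphere_eq_top_of_set: "nsphere n = top_of_set (sphere_nat (Suc n))"
  by (auto simp: nsphere sphere_nat_def lessThan_Suc_atMost Suc_le_eq euclidean_product_topology
      intro!: arg_cong2[where f=subtopology])

lemma sphere_nat_uminus: "x \<in> sphere_nat k \<Longrightarrow> (\<lambda>i. - x i) \<in> sphere_nat k"
  by (auto simp: sphere_nat_def)

lemma sphere_nat_coord_le: assumes "x \<in> sphere_nat k" shows "\<bar>x i\<bar> \<le> 1"
proof (cases "i < k")
  case True
  have "(x i)\<^sup>2 \<le> (\<Sum>i<k. (x i)\<^sup>2)"
    by (rule member_le_sum) (use True in auto)
  then show ?thesis using assms abs_square_le_1 by (auto simp: sphere_nat_def)
qed (use assms in \<open>auto simp: sphere_nat_def\<close>)

lemma continuous_on_coord: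
  fixes f :: "'c::topological_space \<Rightarrow> nat \<Rightarrow> real"
  shows "continuous_on S f \<Longrightarrow> continuous_on S (\<lambda>x. f x i)"
  by (rule continuous_on_product_then_coordinatewise)

lemma compact_sphere_nat: "compact (sphere_nat k)"
proof -
  have c: "compact (PiE UNIV (\<lambda>_. {-1..1::real}) :: (nat \<Rightarrow> real) set)"
    using compactin_PiE[of "\<lambda>_. euclideanreal" UNIV "\<lambda>_. {-1..1::real}"]
    by (metis compactin_euclidean_iff compact_Icc euclidean_product_topology)
  have cl: "closed (sphere_nat k)"
  proof -
    have "closed {x::nat\<Rightarrow>real. (\<Sum>i<k. (x i)\<^sup>2) = 1}"
      by (intro closed_Collect_eq continuous_intros continuous_on_coord[OF continuous_on_id])
    moreover have "closed {x::nat\<Rightarrow>real. \<forall>i\<ge>k. x i = 0}"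
      by (intro closed_Collect_all closed_Collect_imp closed_Collect_eq continuous_intros continuous_on_coord[OF continuous_on_id]) simp
    ultimately show ?thesis
      unfolding sphere_nat_def Collect_conj_eq by (rule closed_Int)
  qed
  have "sphere_nat k \<subseteq> PiE UNIV (\<lambda>_. {-1..1})"
    using sphere_nat_coord_le by (fastforce simp: PiE_def abs_le_iff)
  then show ?thesis
    using compact_Int_closed[OF c cl] by (simp add: inf.absorb2)
qed

lemma normalize_upto_in_sphere:
  assumes "j < k" "y j \<noteq> 0"
  shows "normalize_upto k y \<in> sphere_nat k"
proof -
  have pos: "(\<Sum>j<k. (y j)\<^sup>2) > 0"
    by (rule sum_pos2[of _ j]) (use assms in auto)
  show ?thesis
    using pos unfolding sphere_nat_def normalize_upto_def
    by (auto simp: power_divide simp flip: sum_divide_distrib)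
qed

lemma normalize_upto_sphere_id: "x \<in> sphere_nat k \<Longrightarrow> normalize_upto k x = x"
  by (auto simp: sphere_nat_def normalize_upto_def fun_eq_iff)

lemma normalize_upto_uminus: "normalize_upto k (\<lambda>i. - y i) = (\<lambda>i. - normalize_upto k y i)"
  by (auto simp: normalize_upto_def fun_eq_iff)

lemma continuous_on_normalize:
  fixes f :: "'c::topological_space \<Rightarrow> nat \<Rightarrow> real"
  assumes f: "\<And>i. i < k \<Longrightarrow> continuous_on S (\<lambda>x. f x i)"
    and nz: "\<And>x. x \<in> S \<Longrightarrow> \<exists>j<k. f x j \<noteq> 0"
  shows "continuous_on S (\<lambda>x. normalize_upto k (f x))"
proof (rule continuous_on_coordinatewise_then_product)
  fix i
  show "continuous_on S (\<lambda>x. normalize_upto k (f x) i)"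
  proof (cases "i < k")
    case True
    have "sqrt (\<Sum>j<k. (f x j)\<^sup>2) \<noteq> 0" if x: "x \<in> S" for x
    proof -
      obtain j where "j < k" "f x j \<noteq> 0" using nz[OF x] by blast
      then have "(\<Sum>j<k. (f x j)\<^sup>2) > 0"
        by (intro sum_pos2[of _ j]) auto
      then show ?thesis by simp
    qed
    with True show ?thesis unfolding normalize_upto_def
      by (auto intro!: continuous_intros f)
  qed (simp add: normalize_upto_def)
qed

text \<open>If the segments joining \<open>f x\<close> and \<open>g x\<close> avoid the origin, normalising them is a homotopy.\<close>
lemma degree_linear_homotopy:
  fixes f g :: "(nat \<Rightarrow> real) \<Rightarrow> nat \<Rightarrow> real"
  assumes f: "\<And>i. i \<le> n \<Longrightarrow> continuous_on (sphere_nat (Suc n)) (\<lambda>x. f x i)"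
    and g: "\<And>i. i \<le> n \<Longrightarrow> continuous_on (sphere_nat (Suc n)) (\<lambda>x. g x i)"
    and nz: "\<And>x t. x \<in> sphere_nat (Suc n) \<Longrightarrow> 0 \<le> t \<Longrightarrow> t \<le> 1 \<Longrightarrow> \<exists>j\<le>n. (1 - t) * f x j + t * g x j \<noteq> 0"
  shows "Brouwer_degree2 n (\<lambda>x. normalize_upto (Suc n) (f x))
       = Brouwer_degree2 n (\<lambda>x. normalize_upto (Suc n) (g x))"
proof (rule Brouwer_degree2_homotopic)
  let ?S = "sphere_nat (Suc n)"
  let ?h = "\<lambda>(t, x). normalize_upto (Suc n) (\<lambda>i. (1 - t) * f x i + t * g x i)"
  have fs: "continuous_on ({0..1::real} \<times> ?S) (\<lambda>z. f (snd z) i)" if "i \<le> n" for i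
    by (rule continuous_on_compose2[OF f[OF that], of _ snd]) (auto intro: continuous_intros)
  have gs: "continuous_on ({0..1::real} \<times> ?S) (\<lambda>z. g (snd z) i)" if "i \<le> n" for i
    by (rule continuous_on_compose2[OF g[OF that], of _ snd]) (auto intro: continuous_intros)
  have c: "continuous_on ({0..1::real} \<times> ?S) ?h"
    unfolding case_prod_beta
    by (rule continuous_on_normalize) (use nz in \<open>auto intro!: continuous_intros fs gs simp: less_Suc_eq_le\<close>)
  have "?h \<in> {0..1} \<times> ?S \<rightarrow> ?S"
  proof clarsimp
    fix t x assume "0 \<le> t" "t \<le> (1::real)" "x \<in> ?S"
    then obtain j where "j < Suc n" "(1 - t) * f x j + t * g x j \<noteq> 0"
      using nz by (metis less_Suc_eq_le)
    then show "normalize_upto (Suc n) (\<lambda>i. (1 - t) * f x i + t * g x i) \<in> ?S"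
      by (rule normalize_upto_in_sphere)
  qed
  with c have "continuous_map (top_of_set ({0..1} \<times> ?S)) (top_of_set ?S) ?h"
    by auto
  then have cm: "continuous_map (prod_topology (top_of_set {0..1}) (nsphere n)) (nsphere n) ?h"
    by (simp add: nsphere_eq_top_of_set)
  show "homotopic_with (\<lambda>x. True) (nsphere n) (nsphere n)
     (\<lambda>x. normalize_upto (Suc n) (f x)) (\<lambda>x. normalize_upto (Suc n) (g x))"
    unfolding homotopic_with_def
    by (rule exI[of _ ?h]) (use cm in auto)
qed

text \<open>Lipschitz functions form a point-separating algebra on the sphere, so the Stone-Weierstrass theorem
supplies a Lipschitz approximation; its odd part is as close to the odd function \<open>f\<close> and has the same
Lipschitz constant.\<close>
lemma odd_lipschitz_approximation:
  fixes f :: "(nat \<Rightarrow> real) \<Rightarrow> real"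
  assumes f: "continuous_on (sphere_nat k) f"
    and odd: "\<And>x. x \<in> sphere_nat k \<Longrightarrow> f (\<lambda>i. - x i) = - f x"
    and e: "e > 0"
  obtains g L where "continuous_on (sphere_nat k) g" "0 \<le> L"
    "\<And>x. x \<in> sphere_nat k \<Longrightarrow> g (\<lambda>i. - x i) = - g x"
    "\<And>x. x \<in> sphere_nat k \<Longrightarrow> \<bar>g x - f x\<bar> < e"
    "\<And>x y. x \<in> sphere_nat k \<Longrightarrow> y \<in> sphere_nat k \<Longrightarrow> \<bar>g x - g y\<bar> \<le> L * (\<Sum>i<k. \<bar>x i - y i\<bar>)"
proof -
  let ?S = "sphere_nat k"
  let ?d = "\<lambda>x y. \<Sum>i<k. \<bar>x i - y i\<bar> :: real"
  define R where "R = {g. continuous_on ?S g \<and> (\<exists>L\<ge>0. \<forall>x\<in>?S. \<forall>y\<in>?S. \<bar>g x - g y\<bar> \<le> L * ?d x y)}"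
  have d0: "?d x y \<ge> 0" for x y by (simp add: sum_nonneg)
  interpret function_ring_on R ?S
  proof
    show "compact ?S" by (rule compact_sphere_nat)
    show "continuous_on ?S g" if "g \<in> R" for g using that by (simp add: R_def)
    fix g h assume "g \<in> R" "h \<in> R"
    then obtain L M where g: "continuous_on ?S g" "L \<ge> 0" "\<And>x y. x \<in> ?S \<Longrightarrow> y \<in> ?S \<Longrightarrow> \<bar>g x - g y\<bar> \<le> L * ?d x y"
      and h: "continuous_on ?S h" "M \<ge> 0" "\<And>x y. x \<in> ?S \<Longrightarrow> y \<in> ?S \<Longrightarrow> \<bar>h x - h y\<bar> \<le> M * ?d x y"
      unfolding R_def by blast
    show "(\<lambda>x. g x + h x) \<in> R"
    proof -
      have "\<bar>(g x + h x) - (g y + h y)\<bar> \<le> (L + M) * ?d x y" if "x \<in> ?S" "y \<in> ?S" for x y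
        using g(3)[OF that] h(3)[OF that] unfolding distrib_right by linarith
      then show ?thesis unfolding R_def using g h by (auto intro!: continuous_intros exI[of _ "L + M"])
    qed
    obtain A where A: "\<And>x. x \<in> ?S \<Longrightarrow> \<bar>g x\<bar> \<le> A"
      using compact_imp_bounded[OF compact_continuous_image[OF g(1) compact_sphere_nat]]
      unfolding bounded_iff by fastforce
    obtain B where B: "\<And>x. x \<in> ?S \<Longrightarrow> \<bar>h x\<bar> \<le> B"
      using compact_imp_bounded[OF compact_continuous_image[OF h(1) compact_sphere_nat]]
      unfolding bounded_iff by fastforce
    show "(\<lambda>x. g x * h x) \<in> R"
    proof -
      have "\<bar>g x * h x - g y * h y\<bar> \<le> (L * \<bar>B\<bar> + \<bar>A\<bar> * M) * ?d x y" if x: "x \<in> ?S" and y: "y \<in> ?S" for x y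
      proof -
        have "g x * h x - g y * h y = (g x - g y) * h x + g y * (h x - h y)" by (simp add: algebra_simps)
        then have "\<bar>g x * h x - g y * h y\<bar> \<le> \<bar>g x - g y\<bar> * \<bar>h x\<bar> + \<bar>g y\<bar> * \<bar>h x - h y\<bar>"
          by (metis abs_mult abs_triangle_ineq)
        also have "\<dots> \<le> (L * ?d x y) * \<bar>B\<bar> + \<bar>A\<bar> * (M * ?d x y)"
          by (intro add_mono mult_mono g(3) h(3) x y) (use A[OF y] B[OF x] d0 g(2) h(2) in auto)
        finally show ?thesis by (simp add: algebra_simps)
      qed
      moreover have "L * \<bar>B\<bar> + \<bar>A\<bar> * M \<ge> 0" using g(2) h(2) by simp
      ultimately show ?thesis unfolding R_def using g h by (blast intro!: continuous_intros)
    qed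
  next
    show "(\<lambda>_. c) \<in> R" for c by (auto simp: R_def intro!: exI[of _ 0])
    fix x y assume xy: "x \<in> ?S" "y \<in> ?S" "x \<noteq> y"
    then obtain i where i: "x i \<noteq> y i" by blast
    have "i < k" using xy i by (metis (mono_tags, lifting) mem_Collect_eq not_le sphere_nat_def)
    then have "(\<lambda>x. x i) \<in> R"
      unfolding R_def
    proof (intro CollectI conjI exI[of _ 1] ballI continuous_on_coord[OF continuous_on_id])
      show "\<bar>x i - y i\<bar> \<le> 1 * ?d x y" for x y :: "nat \<Rightarrow> real"
        using member_le_sum[of i "{..<k}" "\<lambda>i. \<bar>x i - y i\<bar>"] \<open>i < k\<close> by simp
    qed simp
    with i show "\<exists>f\<in>R. f x \<noteq> f y" by (intro bexI[of _ "\<lambda>x. x i"])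
  qed
  obtain h where h: "h \<in> R" "\<And>x. x \<in> ?S \<Longrightarrow> \<bar>f x - h x\<bar> < e"
    using Stone_Weierstrass_basic[OF f e] by blast
  then obtain L where L: "continuous_on ?S h" "L \<ge> 0" "\<And>x y. x \<in> ?S \<Longrightarrow> y \<in> ?S \<Longrightarrow> \<bar>h x - h y\<bar> \<le> L * ?d x y"
    unfolding R_def by auto
  define g where "g x = (h x - h (\<lambda>i. - x i)) / 2" for x
  have neg: "(\<lambda>i. - x i) \<in> ?S" if "x \<in> ?S" for x using that by (rule sphere_nat_uminus)
  show thesis
  proof (rule that[of g L])
    have "continuous_on ?S (\<lambda>x::nat \<Rightarrow> real. \<lambda>i. - x i)"
      by (intro continuous_on_coordinatewise_then_product continuous_intros continuous_on_coord[OF continuous_on_id])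
    then have "continuous_on ?S (\<lambda>x. h (\<lambda>i. - x i))"
      by (rule continuous_on_compose2[OF L(1)]) (use neg in auto)
    then show "continuous_on ?S g"
      unfolding g_def by (intro continuous_intros L(1)) auto
    show "L \<ge> 0" by fact
    show "g (\<lambda>i. - x i) = - g x" for x by (simp add: g_def field_simps)
    show "\<bar>g x - f x\<bar> < e" if "x \<in> ?S" for x
      using h(2)[OF that] h(2)[OF neg[OF that]] odd[OF that] unfolding g_def abs_less_iff by (auto simp: field_simps)
    show "\<bar>g x - g y\<bar> \<le> L * ?d x y" if "x \<in> ?S" "y \<in> ?S" for x y
    proof -
      have "?d (\<lambda>i. - x i) (\<lambda>i. - y i) = ?d x y" by (intro sum.cong) auto
      with L(3)[OF neg[OF that(1)] neg[OF that(2)]]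
      have "\<bar>h (\<lambda>i. - x i) - h (\<lambda>i. - y i)\<bar> \<le> L * ?d x y" by simp
      moreover have "2 * (g x - g y) = (h x - h y) - (h (\<lambda>i. - x i) - h (\<lambda>i. - y i))"
        by (simp add: g_def diff_divide_distrib)
      ultimately have "\<bar>2 * (g x - g y)\<bar> \<le> 2 * (L * ?d x y)"
        using L(3)[OF that] by linarith
      then show ?thesis by simp
    qed
  qed
qed

text \<open>A point of the sphere is determined, with a Lipschitz constant, by all its coordinates except one, as
long as the remaining coordinate keeps its sign and stays away from \<open>0\<close>.\<close>
lemma sphere_nat_close:
  assumes x: "x \<in> sphere_nat n" and y: "y \<in> sphere_nat n" and i0: "i0 < n"
    and big: "1 / real n \<le> \<bar>x i0\<bar>" "1 / real n \<le> \<bar>y i0\<bar>" and sgn: "(x i0 > 0) = (y i0 > 0)"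
    and close: "\<And>i. i < n \<Longrightarrow> i \<noteq> i0 \<Longrightarrow> \<bar>x i - y i\<bar> \<le> e"
    and i: "i < n" and e: "e \<ge> 0"
  shows "\<bar>x i - y i\<bar> \<le> real (n^2) * e"
proof -
  have n: "n > 0" using i0 by auto
  have n1: "1 \<le> real (n^2)" using n by simp
  show ?thesis
  proof (cases "i = i0")
    case False
    have "\<bar>x i - y i\<bar> \<le> 1 * e" using close[OF i False] by simp
    also have "\<dots> \<le> real (n^2) * e" by (rule mult_right_mono) (use e n1 in auto)
    finally show ?thesis .
  next
    case True
    have split: "(\<Sum>j<n. f j) = f i0 + (\<Sum>j\<in>{..<n}-{i0}. f j)" for f :: "nat \<Rightarrow> real"
      using i0 by (simp add: sum.remove)
    have "\<bar>(x i0)\<^sup>2 - (y i0)\<^sup>2\<bar> = \<bar>\<Sum>j\<in>{..<n}-{i0}. (y j)\<^sup>2 - (x j)\<^sup>2\<bar>"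
      using x y split[of "\<lambda>j. (x j)\<^sup>2"] split[of "\<lambda>j. (y j)\<^sup>2"]
      unfolding sphere_nat_def sum_subtractf mem_Collect_eq by linarith
    also have "\<dots> \<le> (\<Sum>j\<in>{..<n}-{i0}. \<bar>(y j)\<^sup>2 - (x j)\<^sup>2\<bar>)" by (rule sum_abs)
    also have "\<dots> \<le> (\<Sum>j\<in>{..<n}-{i0}. 2 * e)"
    proof (rule sum_mono)
      fix j assume j: "j \<in> {..<n}-{i0}"
      have "\<bar>(y j)\<^sup>2 - (x j)\<^sup>2\<bar> = \<bar>x j - y j\<bar> * \<bar>x j + y j\<bar>"
        by (simp add: power2_eq_square algebra_simps flip: abs_mult)
      also have "\<dots> \<le> e * 2"
      proof (rule mult_mono)
        show "\<bar>x j + y j\<bar> \<le> 2" using sphere_nat_coord_le[OF x, of j] sphere_nat_coord_le[OF y, of j] by linarith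
      qed (use close[of j] j in auto)
      finally show "\<bar>(y j)\<^sup>2 - (x j)\<^sup>2\<bar> \<le> 2 * e" by simp
    qed
    also have "\<dots> = real (n - 1) * (2 * e)" using i0 by simp
    finally have a: "\<bar>(x i0)\<^sup>2 - (y i0)\<^sup>2\<bar> \<le> real (n - 1) * (2 * e)" .
    have "\<bar>x i0 + y i0\<bar> \<ge> 2 / real n"
      using big sgn by (cases "x i0 > 0") auto
    moreover have "\<bar>(x i0)\<^sup>2 - (y i0)\<^sup>2\<bar> = \<bar>x i0 - y i0\<bar> * \<bar>x i0 + y i0\<bar>"
      unfolding abs_mult[symmetric] by (simp only: power2_eq_square square_diff_square_factored mult.commute)
    ultimately have "\<bar>x i0 - y i0\<bar> * (2 / real n) \<le> real (n - 1) * (2 * e)"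
      using a mult_left_mono[of "2 / real n" "\<bar>x i0 + y i0\<bar>" "\<bar>x i0 - y i0\<bar>"] by simp
    then have *: "\<bar>x i0 - y i0\<bar> \<le> real n * real (n - 1) * e" using n by (simp add: field_simps)
    also have "\<dots> \<le> real (n^2) * e"
      by (intro mult_right_mono e) (auto simp: power2_eq_square intro!: mult_left_mono)
    finally show ?thesis using True by simp
  qed
qed

text \<open>A Lipschitz map cannot raise dimension: if the image of a sphere of dimension \<open>m\<close> stays away from the
origin of \<open>\<real>\<^sup>m\<^sup>+\<^sup>2\<close>, it does not meet every line through the origin, since these lines form a space of
dimension \<open>m + 1\<close>. The lines used here are those
spanned by \<open>(z, 1)\<close>, with \<open>z\<close> on a grid of the unit cube of \<open>\<real>\<^sup>m\<^sup>+\<^sup>1\<close>. If each of them met the image,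
the preimages would be so far apart that they would have different codes, where the code of a point
is the rounding of \<open>m\<close> of its coordinates; there are fewer codes than grid points.\<close>
lemma lipschitz_sphere_image_misses_direction:
  fixes g :: "nat \<Rightarrow> (nat \<Rightarrow> real) \<Rightarrow> real"
  assumes lip: "\<And>j x y. j \<le> Suc m \<Longrightarrow> x \<in> sphere_nat (Suc m) \<Longrightarrow> y \<in> sphere_nat (Suc m) \<Longrightarrow>
                   \<bar>g j x - g j y\<bar> \<le> L * (\<Sum>i<Suc m. \<bar>x i - y i\<bar>)"
    and L: "L \<ge> 0"
    and nz: "\<And>x. x \<in> sphere_nat (Suc m) \<Longrightarrow> (\<Sum>j\<le>Suc m. (g j x)\<^sup>2) \<ge> 1/4"
  shows "\<exists>z. \<forall>x\<in>sphere_nat (Suc m). \<exists>j<Suc m. g j x \<noteq> z j * g (Suc m) x"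
proof (rule ccontr)
  assume "\<not> ?thesis"
  then have "\<forall>z. \<exists>x\<in>sphere_nat (Suc m). \<forall>j<Suc m. g j x = z j * g (Suc m) x" by simp
  then obtain X where X: "\<And>z. X z \<in> sphere_nat (Suc m)" "\<And>z j. j < Suc m \<Longrightarrow> g j (X z) = z j * g (Suc m) (X z)"
    by metis
  define n where "n = Suc m"
  note X = X[folded n_def] and lip = lip[folded n_def] and nz = nz[folded n_def]
  have n: "n > 0" by (simp add: n_def)
  \<comment> \<open>At a point of the image on the line through \<open>(z, 1)\<close> the last coordinate carries a fixed part of the norm.\<close>
  define b where "b = 1 / (2 * sqrt (1 + real n))"
  have b: "b > 0" by (simp add: b_def add_pos_nonneg)
  have gn: "\<bar>g n (X z)\<bar> \<ge> b" if z: "\<And>j. j < n \<Longrightarrow> 0 \<le> z j \<and> z j \<le> 1" for z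
  proof -
    have "1/4 \<le> (\<Sum>j\<le>n. (g j (X z))\<^sup>2)" by (rule nz[OF X(1)])
    also have "\<dots> = (\<Sum>j<n. (g j (X z))\<^sup>2) + (g n (X z))\<^sup>2"
      by (simp add: lessThan_Suc flip: lessThan_Suc_atMost)
    also have "(\<Sum>j<n. (g j (X z))\<^sup>2) \<le> (\<Sum>j<n. (g n (X z))\<^sup>2)"
    proof (rule sum_mono)
      fix j assume "j \<in> {..<n}"
      then have "(g j (X z))\<^sup>2 = (z j)\<^sup>2 * (g n (X z))\<^sup>2" "(z j)\<^sup>2 \<le> 1"
        using X(2)[of j z] z[of j] by (auto simp: power_mult_distrib power_le_one)
      then show "(g j (X z))\<^sup>2 \<le> (g n (X z))\<^sup>2"
        using mult_right_mono[of "(z j)\<^sup>2" 1 "(g n (X z))\<^sup>2"] by simp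
    qed
    finally have "1/4 \<le> (1 + real n) * (g n (X z))\<^sup>2" by (simp add: algebra_simps)
    then have "1 / (4 * (1 + real n)) \<le> (g n (X z))\<^sup>2"
      by (simp add: field_simps add_pos_nonneg)
    moreover have "b\<^sup>2 = 1 / (4 * (1 + real n))"
      by (simp add: b_def power_divide power_mult_distrib)
    ultimately have "b\<^sup>2 \<le> \<bar>g n (X z)\<bar>\<^sup>2" by simp
    then show ?thesis by (rule power2_le_imp_le) simp
  qed
  \<comment> \<open>The grid has width \<open>1 / P\<close>, coordinates are rounded to multiples of \<open>1 / M\<close>. With \<open>M = C P\<close>, where \<open>C\<close>
    beats the Lipschitz constant, equal codes force equal grid points; then \<open>P\<close> is chosen so that the
    \<open>(P + 1)\<^sup>m\<^sup>+\<^sup>1\<close> grid points outnumber the codes.\<close>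
  define C where "C = nat \<lceil>2 * L * real (n^3) / b\<rceil> + 1"
  have C: "2 * L * real (n^3) / b < real C" "C > 0" unfolding C_def by linarith+
  define P where "P = 2 * n * (2 * C + 1)^m"
  have P: "P > 0" using n by (simp add: P_def)
  define M where "M = C * P"
  have M: "M > 0" using C P by (simp add: M_def)
  have "\<exists>i<n. 1 / real n \<le> \<bar>x i\<bar>" if x: "x \<in> sphere_nat n" for x
  proof (rule ccontr)
    assume "\<not> ?thesis"
    then have small: "\<bar>x i\<bar> < 1 / real n" if "i < n" for i using that by force
    have "(\<Sum>i<n. (x i)\<^sup>2) < (\<Sum>i<n. 1 / real n)"
    proof (rule sum_strict_mono)
      fix i assume "i \<in> {..<n}"
      then have "\<bar>x i\<bar> < 1 / real n" using small by auto
      moreover have "\<bar>x i\<bar> * \<bar>x i\<bar> \<le> 1 * \<bar>x i\<bar>"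
        by (intro mult_right_mono sphere_nat_coord_le[OF x]) auto
      ultimately show "(x i)\<^sup>2 < 1 / real n" by (simp add: power2_eq_square)
    qed (use n in auto)
    then show False using x n by (simp add: sphere_nat_def)
  qed
  then obtain I where I: "\<And>x. x \<in> sphere_nat n \<Longrightarrow> I x < n" "\<And>x. x \<in> sphere_nat n \<Longrightarrow> 1 / real n \<le> \<bar>x (I x)\<bar>"
    by metis
  \<comment> \<open>A coordinate of modulus at least \<open>1 / n\<close> is recorded by its position and sign only; the others are
    rounded. Skipping position \<open>I x\<close> renumbers the remaining ones as \<open>0, ..., m - 1\<close>.\<close>
  define code where "code x = (I x, x (I x) > 0,
      restrict (\<lambda>j. \<lfloor>real M * x (if j < I x then j else Suc j)\<rfloor>) {..<m})" for x :: "nat \<Rightarrow> real"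
  let ?codes = "{..<n} \<times> (UNIV :: bool set) \<times> PiE {..<m} (\<lambda>_. {- int M..int M})"
  have code_in: "code x \<in> ?codes" if x: "x \<in> sphere_nat n" for x
  proof -
    have "- int M \<le> \<lfloor>real M * x i\<rfloor> \<and> \<lfloor>real M * x i\<rfloor> \<le> int M" for i
    proof -
      have "\<bar>real M * x i\<bar> \<le> real M"
        using mult_left_mono[OF sphere_nat_coord_le[OF x, of i], of "real M"] by (simp add: abs_mult)
      then show ?thesis by linarith
    qed
    then show ?thesis using I(1)[OF x] by (auto simp: code_def)
  qed
  have code_close: "(\<Sum>i<n. \<bar>x i - y i\<bar>) \<le> real (n^3) / real M"
    if x: "x \<in> sphere_nat n" and y: "y \<in> sphere_nat n" and eq: "code x = code y" for x y
  proof -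
    have I_eq: "I x = I y" and sg: "(x (I x) > 0) = (y (I x) > 0)" using eq by (auto simp: code_def)
    have cl: "\<bar>x i - y i\<bar> \<le> 1 / real M" if i: "i < n" "i \<noteq> I x" for i
    proof -
      define j where "j = (if i < I x then i else i - 1)"
      have j: "j < m" "i = (if j < I x then j else Suc j)"
        using i I(1)[OF x] by (auto simp: j_def n_def)
      have "\<lfloor>real M * x i\<rfloor> = \<lfloor>real M * y i\<rfloor>"
        using eq j I_eq unfolding code_def by (auto dest!: restrict_cong fun_cong[where x=j])
      then have "\<bar>real M * x i - real M * y i\<bar> \<le> 1" by linarith
      then have "real M * \<bar>x i - y i\<bar> \<le> 1" by (simp add: abs_mult flip: right_diff_distrib)
      then show ?thesis using M by (simp add: field_simps)
    qed
    have "\<bar>x i - y i\<bar> \<le> real (n^2) * (1 / real M)" if "i < n" for i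
      using sphere_nat_close[OF x y I(1)[OF x] I(2)[OF x] _ sg cl that] I(2)[OF y] I_eq by auto
    then have "(\<Sum>i<n. \<bar>x i - y i\<bar>) \<le> (\<Sum>i<n. real (n^2) * (1 / real M))"
      by (intro sum_mono) auto
    also have "\<dots> = real (n^3) / real M" by (simp add: power3_eq_cube power2_eq_square)
    finally show ?thesis .
  qed
  let ?grid = "PiE {..<n} (\<lambda>_. {..P})"
  define Z where "Z k = (\<lambda>j. real (k j) / real P)" for k :: "nat \<Rightarrow> nat"
  have Z01: "0 \<le> Z k j \<and> Z k j \<le> 1" if "k \<in> ?grid" "j < n" for k j
    using that P by (auto simp: Z_def PiE_def Pi_def)
  have inj: "inj_on (\<lambda>k. code (X (Z k))) ?grid"
  proof (rule inj_onI)
    fix k k' assume k: "k \<in> ?grid" and k': "k' \<in> ?grid" and eq: "code (X (Z k)) = code (X (Z k'))"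
    let ?x = "X (Z k)" and ?y = "X (Z k')"
    define d where "d = L * (real (n^3) / real M)"
    have cl: "\<bar>g j ?x - g j ?y\<bar> \<le> d" if "j \<le> n" for j
      using lip[OF that X(1) X(1), of "Z k" "Z k'"]
        mult_left_mono[OF code_close[OF X(1) X(1) eq] L] unfolding d_def by linarith
    have "Z k j = Z k' j" if j: "j < n" for j
    proof -
      have "(Z k j - Z k' j) * g n ?x = (g j ?x - g j ?y) - Z k' j * (g n ?x - g n ?y)"
        using X(2)[OF j, of "Z k"] X(2)[OF j, of "Z k'"] by (simp add: algebra_simps)
      then have "\<bar>Z k j - Z k' j\<bar> * \<bar>g n ?x\<bar> \<le> \<bar>g j ?x - g j ?y\<bar> + \<bar>Z k' j\<bar> * \<bar>g n ?x - g n ?y\<bar>"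
        by (metis abs_mult abs_triangle_ineq4)
      also have "\<dots> \<le> d + 1 * d"
        by (intro add_mono mult_mono cl) (use j Z01[OF k' j] in auto)
      finally have "\<bar>Z k j - Z k' j\<bar> * b \<le> 2 * d"
        using mult_left_mono[OF gn[of "Z k"], of "\<bar>Z k j - Z k' j\<bar>"] Z01[OF k] by force
      then have "\<bar>Z k j - Z k' j\<bar> \<le> 2 * d / b" using b by (simp add: field_simps)
      also have "\<dots> = (2 * L * real (n^3) / b) / real M" by (simp add: d_def mult_ac)
      also have "\<dots> < real C / real M" using C(1) M by (intro divide_strict_right_mono) auto
      also have "\<dots> = 1 / real P" using C P by (simp add: M_def)
      finally have "\<bar>real (k j) - real (k' j)\<bar> < 1"
        using P by (simp add: Z_def field_simps flip: diff_divide_distrib)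
      then have "k j = k' j" by linarith
      then show ?thesis by (simp add: Z_def)
    qed
    then have "k j = k' j" if "j < n" for j using that P by (auto simp: Z_def)
    then show "k = k'" using k k' by (intro PiE_ext) auto
  qed
  have "card ?grid \<le> card ?codes"
  proof (rule card_inj_on_le[OF inj])
    show "(\<lambda>k. code (X (Z k))) ` ?grid \<subseteq> ?codes"
      using code_in[OF X(1)] by (intro image_subsetI)
  qed (simp add: finite_PiE)
  then have "(P + 1)^n \<le> 2 * n * (2 * M + 1)^m"
    by (simp add: card_PiE card_cartesian_product nat_add_distrib mult_ac nat_mult_distrib)
  also have "\<dots> \<le> 2 * n * ((2 * C + 1) * (P + 1))^m"
    by (intro mult_left_mono power_mono) (auto simp: M_def algebra_simps)
  also have "\<dots> = P * (P + 1)^m" by (simp only: power_mult_distrib P_def mult.assoc)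
  finally show False by (simp add: n_def)
qed

text \<open>Borsuk's odd mapping theorem. An odd self map that preserves the equator has, modulo 2, the same degree
as its restriction to the equator, which gives an induction on the dimension. To make an odd map \<open>f\<close>
preserve the equator, approximate it by a Lipschitz map \<open>g\<close>; the image of the equator under \<open>g\<close> misses
some line, spanned by \<open>(z, 1)\<close>, and projecting along that line pushes the image of the equator into the
hyperplane of the equator without passing through the origin.\<close>
lemma odd_self_map_odd_degree:
  assumes "continuous_on (sphere_nat (Suc n)) f"
    and "f \<in> sphere_nat (Suc n) \<rightarrow> sphere_nat (Suc n)"
    and "\<And>x. x \<in> sphere_nat (Suc n) \<Longrightarrow> f (\<lambda>i. - x i) = (\<lambda>i. - f x i)"
  shows "odd (Brouwer_degree2 n f)"
  using assms
proof (induction n arbitrary: f)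
  case 0
  let ?S = "sphere_nat (Suc 0)"
  have S: "x \<in> ?S \<longleftrightarrow> (x 0 = 1 \<or> x 0 = -1) \<and> (\<forall>i>0. x i = 0)" for x
    by (auto simp: sphere_nat_def power2_eq_1_iff Suc_le_eq)
  have eq: "y = x \<or> y = (\<lambda>i. - x i)" if "x \<in> ?S" "y \<in> ?S" for x y
  proof -
    have "y 0 = x 0 \<or> y 0 = - x 0" using that unfolding S by auto
    moreover have "y i = x i \<and> y i = - x i" if "i \<noteq> 0" for i
      using that \<open>x \<in> ?S\<close> \<open>y \<in> ?S\<close> unfolding S by auto
    ultimately show ?thesis by (metis ext)
  qed
  have ff: "(f \<circ> f) x = x" if x: "x \<in> ?S" for x
  proof -
    have "f x \<in> ?S" using 0(2) x by blast
    from eq[OF x this] show ?thesis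
    proof
      assume "f x = (\<lambda>i. - x i)"
      then show ?thesis using 0(3)[OF x] by simp
    qed simp
  qed
  have cm: "continuous_map (nsphere 0) (nsphere 0) f"
    using 0(1,2) by (simp add: nsphere_eq_top_of_set)
  have "homotopic_with (\<lambda>x. True) (nsphere 0) (nsphere 0) (f \<circ> f) id"
    by (rule homotopic_with_equal) (use ff cm in \<open>auto simp: topspace_nsphere_eq intro: continuous_map_compose\<close>)
  then have "Brouwer_degree2 0 f * Brouwer_degree2 0 f = 1"
    using Brouwer_degree2_homotopic Brouwer_degree2_compose[OF cm cm] by fastforce
  then show ?case by (metis even_mult_iff odd_one)
next
  case (Suc m)
  define n where "n = Suc m"
  let ?S = "sphere_nat (Suc n)" and ?E = "sphere_nat (Suc m)"
  have cf: "continuous_on ?S f" and ff: "\<And>x. x \<in> ?S \<Longrightarrow> f x \<in> ?S"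
    and of: "\<And>x. x \<in> ?S \<Longrightarrow> f (\<lambda>i. - x i) = (\<lambda>i. - f x i)"
    using Suc.prems by (auto simp: n_def)
  have E_S: "x \<in> ?S \<and> x n = 0" if "x \<in> ?E" for x using that by (auto simp: sphere_nat_def n_def)
  have S_E: "x \<in> ?E" if "x \<in> ?S" "x n = 0" for x
    using that by (auto simp: sphere_nat_def n_def) (metis Suc_leI le_neq_implies_less)
  \<comment> \<open>Coordinatewise errors of at most \<open>e\<close> lower the squared norm \<open>1\<close> by at most \<open>3/4\<close>.\<close>
  define e where "e = 3 / (8 * real (Suc n))"
  have e: "e > 0" by (simp add: e_def)
  have "\<forall>j. \<exists>g L. continuous_on ?S g \<and> 0 \<le> L \<and> (\<forall>x\<in>?S. g (\<lambda>i. - x i) = - g x) \<and>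
     (\<forall>x\<in>?S. \<bar>g x - f x j\<bar> < e) \<and> (\<forall>x\<in>?S. \<forall>y\<in>?S. \<bar>g x - g y\<bar> \<le> L * (\<Sum>i<Suc n. \<bar>x i - y i\<bar>))"
    (is "\<forall>j. ?P j")
  proof
    fix j
    obtain g L where "continuous_on ?S g" "0 \<le> L" "\<And>x. x \<in> ?S \<Longrightarrow> g (\<lambda>i. - x i) = - g x"
      "\<And>x. x \<in> ?S \<Longrightarrow> \<bar>g x - f x j\<bar> < e"
      "\<And>x y. x \<in> ?S \<Longrightarrow> y \<in> ?S \<Longrightarrow> \<bar>g x - g y\<bar> \<le> L * (\<Sum>i<Suc n. \<bar>x i - y i\<bar>)"
      by (rule odd_lipschitz_approximation[of "Suc n" "\<lambda>x. f x j" e])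
         (use of e in \<open>auto intro: continuous_on_coord cf\<close>)
    then show "?P j" by (intro exI[of _ g] exI[of _ L]) blast
  qed
  then obtain g L where cg: "\<And>j. continuous_on ?S (g j)" and L: "\<And>j. 0 \<le> L j"
    and og: "\<And>j x. x \<in> ?S \<Longrightarrow> g j (\<lambda>i. - x i) = - g j x"
    and gf: "\<And>j x. x \<in> ?S \<Longrightarrow> \<bar>g j x - f x j\<bar> < e"
    and lip: "\<And>j x y. x \<in> ?S \<Longrightarrow> y \<in> ?S \<Longrightarrow> \<bar>g j x - g j y\<bar> \<le> L j * (\<Sum>i<Suc n. \<bar>x i - y i\<bar>)"
    unfolding choice_iff by blast
  have near: "(\<Sum>j\<le>n. (h j)\<^sup>2) \<ge> 1/4" if x: "x \<in> ?S" and h: "\<And>j. \<bar>h j - f x j\<bar> \<le> e" for x h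
  proof -
    have "(\<Sum>j\<le>n. (f x j)\<^sup>2 - 2 * e) \<le> (\<Sum>j\<le>n. (h j)\<^sup>2)"
    proof (rule sum_mono)
      fix j
      have "\<bar>f x j\<bar> * \<bar>h j - f x j\<bar> \<le> 1 * e"
        by (intro mult_mono h sphere_nat_coord_le[OF ff[OF x]]) auto
      moreover have "(h j)\<^sup>2 = (f x j)\<^sup>2 + 2 * (f x j * (h j - f x j)) + (h j - f x j)\<^sup>2"
        by (simp add: power2_eq_square algebra_simps)
      ultimately show "(f x j)\<^sup>2 - 2 * e \<le> (h j)\<^sup>2"
        using abs_ge_minus_self[of "f x j * (h j - f x j)"] zero_le_power2[of "h j - f x j"]
        unfolding abs_mult by linarith
    qed
    moreover have "(\<Sum>j\<le>n. (f x j)\<^sup>2) = 1"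
      using ff[OF x] by (simp add: sphere_nat_def lessThan_Suc_atMost)
    moreover have "(\<Sum>j\<le>n. 2 * e) = 3/4" by (simp add: e_def field_simps)
    ultimately show ?thesis by (simp add: sum_subtractf)
  qed
  define K where "K = (\<Sum>j\<le>n. L j)"
  have "\<exists>z. \<forall>x\<in>?E. \<exists>j<Suc m. g j x \<noteq> z j * g (Suc m) x"
  proof (rule lipschitz_sphere_image_misses_direction)
    show "K \<ge> 0" unfolding K_def by (intro sum_nonneg L)
    show "(\<Sum>j\<le>Suc m. (g j x)\<^sup>2) \<ge> 1/4" if "x \<in> ?E" for x
      using near[of x "\<lambda>j. g j x"] E_S[OF that] gf[of x] by (auto simp: n_def less_imp_le)
    fix j x y assume j: "j \<le> Suc m" and x: "x \<in> ?E" and y: "y \<in> ?E"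
    have "\<bar>g j x - g j y\<bar> \<le> L j * (\<Sum>i<Suc n. \<bar>x i - y i\<bar>)"
      using lip E_S x y by blast
    also have "(\<Sum>i<Suc n. \<bar>x i - y i\<bar>) = (\<Sum>i<Suc m. \<bar>x i - y i\<bar>)"
      using E_S[OF x] E_S[OF y] by (simp add: n_def)
    also have "L j * \<dots> \<le> K * \<dots>"
      unfolding K_def by (intro mult_right_mono member_le_sum sum_nonneg) (use j L in \<open>auto simp: n_def\<close>)
    finally show "\<bar>g j x - g j y\<bar> \<le> K * (\<Sum>i<Suc m. \<bar>x i - y i\<bar>)" .
  qed
  then obtain z where z: "\<And>x. x \<in> ?E \<Longrightarrow> \<exists>j<n. g j x \<noteq> z j * g n x"
    unfolding n_def by blast
  have g_nz: "\<exists>j\<le>n. g j x \<noteq> 0" if "x \<in> ?S" for x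
  proof (rule ccontr)
    assume "\<not> ?thesis"
    then have "(\<Sum>j\<le>n. (g j x)\<^sup>2) = 0" by simp
    then show False using near[OF that, of "\<lambda>j. g j x"] gf[OF that] by (simp add: less_imp_le)
  qed
  \<comment> \<open>The projection along \<open>(z, 1)\<close>; the last component is damped by \<open>\<bar>x n\<bar>\<close>, which vanishes exactly on the
    equator, so that \<open>h\<close> maps the equator into its hyperplane and remains odd.\<close>
  define h where "h x = (\<lambda>j. if j = n then \<bar>x n\<bar> * g n x else g j x - z j * g n x)" for x
  let ?G = "\<lambda>x. normalize_upto (Suc n) (\<lambda>j. g j x)" and ?H = "\<lambda>x. normalize_upto (Suc n) (h x)"
  have ch: "continuous_on ?S (\<lambda>x. h x j)" for j
    unfolding h_def by (cases "j = n") (auto intro!: continuous_intros cg continuous_on_coord[OF continuous_on_id])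
  have gh_nz: "\<exists>j\<le>n. (1 - t) * g j x + t * h x j \<noteq> 0" if x: "x \<in> ?S" and t: "0 \<le> t" "t \<le> 1" for x t
  proof (rule ccontr)
    assume "\<not> ?thesis"
    then have 0: "(1 - t) * g j x + t * h x j = 0" if "j \<le> n" for j using that by auto
    have a: "((1 - t) + t * \<bar>x n\<bar>) * g n x = 0" using 0[of n] by (simp add: h_def algebra_simps)
    have b: "g j x = t * (z j * g n x)" if "j < n" for j
      using 0[of j] that by (simp add: h_def algebra_simps)
    show False
    proof (cases "g n x = 0")
      case True
      then have "g j x = 0" if "j \<le> n" for j using b[of j] that by (cases "j = n") auto
      then show False using g_nz[OF x] by blast
    next
      case False
      then have "(1 - t) + t * \<bar>x n\<bar> = 0" using a by simp
      then have "t = 1" "x n = 0" using t by (smt (verit) mult_nonneg_nonneg abs_ge_zero mult_cancel_right1)+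
      then show False using z[OF S_E[OF x]] b by auto
    qed
  qed
  have "Brouwer_degree2 n (\<lambda>x. normalize_upto (Suc n) (f x)) = Brouwer_degree2 n ?G"
  proof (rule degree_linear_homotopy)
    fix x t assume x: "x \<in> ?S" and t: "0 \<le> t" "t \<le> (1::real)"
    show "\<exists>j\<le>n. (1 - t) * f x j + t * g j x \<noteq> 0"
    proof (rule ccontr)
      assume "\<not> ?thesis"
      then have "(\<Sum>j\<le>n. ((1 - t) * f x j + t * g j x)\<^sup>2) = 0" by simp
      moreover have "\<bar>((1 - t) * f x j + t * g j x) - f x j\<bar> \<le> e" for j
      proof -
        have "\<bar>t * (g j x - f x j)\<bar> \<le> 1 * e"
          unfolding abs_mult by (intro mult_mono) (use t gf[OF x, of j] in auto)
        then show ?thesis by (simp add: algebra_simps)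
      qed
      ultimately show False using near[OF x, of "\<lambda>j. (1 - t) * f x j + t * g j x"] by simp
    qed
  qed (auto intro: continuous_on_coord cf cg)
  also have "\<dots> = Brouwer_degree2 n ?H"
    by (rule degree_linear_homotopy) (use gh_nz cg ch in auto)
  finally have fH: "Brouwer_degree2 n (\<lambda>x. normalize_upto (Suc n) (f x)) = Brouwer_degree2 n ?H" .
  have cm: "continuous_map (nsphere n) (nsphere n) f"
    using cf ff by (auto simp: nsphere_eq_top_of_set)
  have "homotopic_with (\<lambda>x. True) (nsphere n) (nsphere n) f (\<lambda>x. normalize_upto (Suc n) (f x))"
    by (rule homotopic_with_equal)
       (use ff cm in \<open>auto simp: topspace_nsphere_eq normalize_upto_sphere_id\<close>)
  then have fH: "Brouwer_degree2 n f = Brouwer_degree2 n ?H"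
    using Brouwer_degree2_homotopic fH by metis
  have h_nz: "\<exists>j<Suc n. h x j \<noteq> 0" if "x \<in> ?S" for x
    using gh_nz[OF that, of 1] by (auto simp: less_Suc_eq_le)
  have cH: "continuous_on ?S ?H"
    by (rule continuous_on_normalize) (use ch h_nz in auto)
  have HS: "?H x \<in> ?S" if "x \<in> ?S" for x
  proof -
    obtain j where "j < Suc n" "h x j \<noteq> 0" using h_nz \<open>x \<in> ?S\<close> by auto
    then show ?thesis by (rule normalize_upto_in_sphere)
  qed
  have oH: "?H (\<lambda>i. - x i) = (\<lambda>i. - ?H x i)" if "x \<in> ?S" for x
  proof -
    have "h (\<lambda>i. - x i) = (\<lambda>j. - h x j)"
      using og[OF that] by (auto simp: h_def fun_eq_iff algebra_simps)
    then show ?thesis by (simp only: normalize_upto_uminus)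
  qed
  have HE: "?H x \<in> ?E" if "x \<in> ?E" for x
    using S_E[OF HS] E_S[OF that] by (simp add: normalize_upto_def h_def)
  have "even (Brouwer_degree2 n ?H - Brouwer_degree2 (n - Suc 0) ?H)"
    by (rule Borsuk_odd_mapping_degree_step)
       (use cH HS oH HE in \<open>auto simp: nsphere_eq_top_of_set topspace_nsphere_eq n_def\<close>)
  moreover have "odd (Brouwer_degree2 m ?H)"
    by (rule Suc.IH) (use HE oH E_S in \<open>auto intro: continuous_on_subset[OF cH]\<close>)
  ultimately have "odd (Brouwer_degree2 n ?H)" by (simp add: n_def)
  then show ?case using fH by (simp add: n_def)
qed

text \<open>Without a common zero, the normalised map would be an odd map of the sphere into its equator, which
has odd degree by Borsuk's theorem, but degree zero because it is not surjective.\<close>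
theorem Borsuk_Ulam_sphere_nat:
  fixes g :: "nat \<Rightarrow> (nat \<Rightarrow> real) \<Rightarrow> real"
  assumes cont: "\<And>j. j < k \<Longrightarrow> continuous_on (sphere_nat (Suc k)) (g j)"
    and odd: "\<And>j x. j < k \<Longrightarrow> x \<in> sphere_nat (Suc k) \<Longrightarrow> g j (\<lambda>i. - x i) = - g j x"
  shows "\<exists>x\<in>sphere_nat (Suc k). \<forall>j<k. g j x = 0"
proof (rule ccontr)
  let ?S = "sphere_nat (Suc k)"
  assume "\<not> ?thesis"
  then have nz: "\<exists>j<k. g j x \<noteq> 0" if "x \<in> ?S" for x using that by blast
  define f where "f x = normalize_upto k (\<lambda>j. g j x)" for x
  have f_S: "f x \<in> sphere_nat k" if "x \<in> ?S" for x
  proof -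
    obtain j where "j < k" "g j x \<noteq> 0" using nz \<open>x \<in> ?S\<close> by auto
    then show ?thesis unfolding f_def by (rule normalize_upto_in_sphere)
  qed
  have f_S': "f x \<in> ?S \<and> f x k = 0" if "x \<in> ?S" for x
    using f_S[OF that] by (simp add: sphere_nat_def)
  have cf: "continuous_on ?S f"
    unfolding f_def by (rule continuous_on_normalize) (use cont nz in auto)
  have of: "f (\<lambda>i. - x i) = (\<lambda>i. - f x i)" if "x \<in> ?S" for x
  proof -
    have "f (\<lambda>i. - x i) = normalize_upto k (\<lambda>j. - g j x)"
      using odd[OF _ that] by (auto simp: f_def normalize_upto_def fun_eq_iff)
    then show ?thesis by (simp only: f_def normalize_upto_uminus)
  qed
  have "odd (Brouwer_degree2 k f)"
    by (rule odd_self_map_odd_degree) (use cf f_S' of in auto)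
  moreover have "Brouwer_degree2 k f = 0"
  proof (rule Brouwer_degree2_nonsurjective)
    show "continuous_map (nsphere k) (nsphere k) f"
      using cf f_S' by (auto simp: nsphere_eq_top_of_set)
    have "(\<lambda>i. if i = k then 1 else 0) \<in> ?S"
      by (simp add: sphere_nat_def if_distrib[of "\<lambda>x. x\<^sup>2"] cong: if_cong)
    then have "(\<lambda>i. if i = k then 1 else 0) \<in> topspace (nsphere k) - f ` topspace (nsphere k)"
      unfolding topspace_nsphere_eq
    proof (intro DiffI notI)
      assume "(\<lambda>i. if i = k then 1 else 0) \<in> f ` ?S"
      then obtain x where x: "x \<in> ?S" "(\<lambda>i. if i = k then 1 else 0) = f x" by auto
      from fun_cong[OF x(2), of k] f_S'[OF x(1)] show False by simp
    qed
    then show "f ` topspace (nsphere k) \<noteq> topspace (nsphere k)" by blast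
  qed
  ultimately show False by simp
qed

section \<open>Odd linking for functionals of class C1\<close>

text \<open>The setting for the deformation argument: a subspace \<open>T\<close> of a vector space without topology, with a
seminorm \<open>N\<close>. It will be the space of test functions with the norm \<open>\<parallel>\<nabla>u\<parallel>\<^sub>p\<close>. As the type of \<open>T\<close> does not
carry the topology of \<open>N\<close>, continuity is expressed by hand: \<open>ncontinuous_on\<close> for maps into \<open>T\<close> and
\<open>ncontinuous\<close> for functionals on \<open>T\<close>.\<close>
locale seminormed_subspace =
  fixes T :: "'v::real_vector set" and N :: "'v \<Rightarrow> real"
  assumes subspace: "subspace T"
    and N_scale: "u \<in> T \<Longrightarrow> N (c *\<^sub>R u) = \<bar>c\<bar> * N u"
    and N_triangle: "u \<in> T \<Longrightarrow> v \<in> T \<Longrightarrow> N (u + v) \<le> N u + N v"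
begin

lemmas T_0 = subspace_0[OF subspace]
lemmas T_add = subspace_add[OF subspace]
lemmas T_diff = subspace_diff[OF subspace]
lemmas T_scale = subspace_scale[OF subspace]
lemmas T_uminus = subspace_neg[OF subspace]
lemmas T_sum = subspace_sum[OF subspace]

lemma N_0: "N 0 = 0"
  using N_scale[OF T_0, of 0] by simp

lemma N_uminus: "u \<in> T \<Longrightarrow> N (- u) = N u"
  using N_scale[of u "-1"] by simp

lemma N_nonneg: "u \<in> T \<Longrightarrow> N u \<ge> 0"
  using N_triangle[of u "- u"] by (simp add: N_uminus N_0 T_uminus)

lemma N_minus_commute: "u \<in> T \<Longrightarrow> v \<in> T \<Longrightarrow> N (u - v) = N (v - u)"
  using N_uminus[of "u - v"] by (simp add: T_diff)

lemma N_diff_triangle: "u \<in> T \<Longrightarrow> v \<in> T \<Longrightarrow> w \<in> T \<Longrightarrow> N (u - w) \<le> N (u - v) + N (v - w)"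
  using N_triangle[of "u - v" "v - w"] by (simp add: T_diff)

lemma N_le_diff: "u \<in> T \<Longrightarrow> v \<in> T \<Longrightarrow> N v \<le> N u + N (v - u)"
  using N_triangle[of "u" "v - u"] by (simp add: T_diff)

lemma N_sum: "finite I \<Longrightarrow> (\<And>i. i \<in> I \<Longrightarrow> f i \<in> T) \<Longrightarrow> N (\<Sum>i\<in>I. f i) \<le> (\<Sum>i\<in>I. N (f i))"
proof (induction I rule: finite_induct)
  case (insert x F)
  then show ?case using N_triangle[of "f x" "\<Sum>i\<in>F. f i"] by (force intro: T_sum)
qed (simp add: N_0)

definition ncontinuous_on :: "'k::topological_space set \<Rightarrow> ('k \<Rightarrow> 'v) \<Rightarrow> bool" where
  "ncontinuous_on K \<gamma> \<longleftrightarrow> (\<forall>x\<in>K. \<gamma> x \<in> T) \<and>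
     (\<forall>x\<in>K. \<forall>e>0. \<exists>U. open U \<and> x \<in> U \<and> (\<forall>y\<in>K. y \<in> U \<longrightarrow> N (\<gamma> y - \<gamma> x) < e))"

definition ncontinuous :: "('v \<Rightarrow> real) \<Rightarrow> bool" where
  "ncontinuous F \<longleftrightarrow> (\<forall>u\<in>T. \<forall>e>0. \<exists>d>0. \<forall>v\<in>T. N (v - u) < d \<longrightarrow> \<bar>F v - F u\<bar> < e)"

lemma ncontinuous_on_T: "ncontinuous_on K \<gamma> \<Longrightarrow> x \<in> K \<Longrightarrow> \<gamma> x \<in> T"
  by (simp add: ncontinuous_on_def)

lemma ncontinuous_onE:
  assumes "ncontinuous_on K \<gamma>" "x \<in> K" "e > 0"
  obtains U where "open U" "x \<in> U" "\<And>y. y \<in> K \<Longrightarrow> y \<in> U \<Longrightarrow> N (\<gamma> y - \<gamma> x) < e"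
proof -
  have "\<exists>U. open U \<and> x \<in> U \<and> (\<forall>y\<in>K. y \<in> U \<longrightarrow> N (\<gamma> y - \<gamma> x) < e)"
    using assms by (simp add: ncontinuous_on_def)
  then show thesis using that by auto
qed

lemma ncontinuous_on_cong:
  "ncontinuous_on K \<gamma> \<Longrightarrow> (\<And>x. x \<in> K \<Longrightarrow> \<gamma> x = \<gamma>' x) \<Longrightarrow> ncontinuous_on K \<gamma>'"
  unfolding ncontinuous_on_def by simp

lemma ncontinuous_on_subset: "ncontinuous_on K \<gamma> \<Longrightarrow> L \<subseteq> K \<Longrightarrow> ncontinuous_on L \<gamma>"
  unfolding ncontinuous_on_def by (meson subsetD)

lemma ncontinuous_on_const: "v \<in> T \<Longrightarrow> ncontinuous_on K (\<lambda>_. v)"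
  unfolding ncontinuous_on_def by (auto simp: N_0)

lemma ncontinuous_on_compose:
  assumes \<gamma>: "ncontinuous_on K \<gamma>" and g: "continuous_on L g" "\<And>x. x \<in> L \<Longrightarrow> g x \<in> K"
  shows "ncontinuous_on L (\<lambda>x. \<gamma> (g x))"
  unfolding ncontinuous_on_def
proof (intro conjI ballI allI impI)
  fix x and e :: real assume x: "x \<in> L" and e: "e > 0"
  obtain U where U: "open U" "g x \<in> U" "\<And>y. y \<in> K \<Longrightarrow> y \<in> U \<Longrightarrow> N (\<gamma> y - \<gamma> (g x)) < e"
    using ncontinuous_onE[OF \<gamma> g(2)[OF x] e] by blast
  obtain V where "open V" "x \<in> V" "\<And>y. y \<in> L \<Longrightarrow> y \<in> V \<Longrightarrow> g y \<in> U"
    using g(1) x U(1,2) unfolding continuous_on_topological by meson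
  then show "\<exists>V. open V \<and> x \<in> V \<and> (\<forall>y\<in>L. y \<in> V \<longrightarrow> N (\<gamma> (g y) - \<gamma> (g x)) < e)"
    using U(3) g(2) by blast
qed (use ncontinuous_on_T[OF \<gamma>] g(2) in auto)

lemma ncontinuous_on_add:
  assumes f: "ncontinuous_on K f" and g: "ncontinuous_on K g"
  shows "ncontinuous_on K (\<lambda>x. f x + g x)"
  unfolding ncontinuous_on_def
proof (intro conjI ballI allI impI)
  fix x and e :: real assume x: "x \<in> K" and "e > 0"
  then have e: "e / 2 > 0" by simp
  obtain U where U: "open U" "x \<in> U" "\<And>y. y \<in> K \<Longrightarrow> y \<in> U \<Longrightarrow> N (f y - f x) < e / 2"
    by (rule ncontinuous_onE[OF f x e], rule that) auto
  obtain V where V: "open V" "x \<in> V" "\<And>y. y \<in> K \<Longrightarrow> y \<in> V \<Longrightarrow> N (g y - g x) < e / 2"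
    by (rule ncontinuous_onE[OF g x e], rule that) auto
  have "N (f y + g y - (f x + g x)) < e" if y: "y \<in> K" "y \<in> U" "y \<in> V" for y
    using U(3)[OF y(1,2)] V(3)[OF y(1,3)] N_triangle[of "f y - f x" "g y - g x"]
      ncontinuous_on_T[OF f] ncontinuous_on_T[OF g] x y
    by (auto simp: T_diff algebra_simps)
  then show "\<exists>U. open U \<and> x \<in> U \<and> (\<forall>y\<in>K. y \<in> U \<longrightarrow> N (f y + g y - (f x + g x)) < e)"
    using U V by (intro exI[of _ "U \<inter> V"]) auto
qed (use ncontinuous_on_T[OF f] ncontinuous_on_T[OF g] in \<open>auto intro: T_add\<close>)

lemma ncontinuous_on_scaleR:
  assumes f: "ncontinuous_on K f" and c: "continuous_on K c"
  shows "ncontinuous_on K (\<lambda>x. c x *\<^sub>R f x)"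
  unfolding ncontinuous_on_def
proof (intro conjI ballI allI impI)
  fix x and e :: real assume x: "x \<in> K" and e: "e > 0"
  note fT = ncontinuous_on_T[OF f]
  define a where "a = e / (2 * (\<bar>c x\<bar> + 1))"
  define b where "b = min 1 (e / (2 * (N (f x) + 1)))"
  have a: "a > 0" using e by (simp add: a_def add_nonneg_pos)
  have b: "b > 0" using e N_nonneg[OF fT[OF x]] by (simp add: b_def add_nonneg_pos)
  obtain U where U: "open U" "x \<in> U" "\<And>y. y \<in> K \<Longrightarrow> y \<in> U \<Longrightarrow> N (f y - f x) < a"
    by (rule ncontinuous_onE[OF f x a], rule that) auto
  have "open (ball (c x) b)" "c x \<in> ball (c x) b" using b by auto
  then obtain V where V: "open V" "x \<in> V" "\<And>y. y \<in> K \<Longrightarrow> y \<in> V \<Longrightarrow> c y \<in> ball (c x) b"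
    using c x unfolding continuous_on_topological by meson
  have "N (c y *\<^sub>R f y - c x *\<^sub>R f x) < e" if y: "y \<in> K" "y \<in> U" "y \<in> V" for y
  proof -
    have cy: "\<bar>c y - c x\<bar> < b" using V(3)[OF y(1,3)] by (simp add: dist_real_def abs_minus_commute)
    have "c y *\<^sub>R f y - c x *\<^sub>R f x = c y *\<^sub>R (f y - f x) + (c y - c x) *\<^sub>R f x"
      by (simp add: algebra_simps)
    then have "N (c y *\<^sub>R f y - c x *\<^sub>R f x) \<le> \<bar>c y\<bar> * N (f y - f x) + \<bar>c y - c x\<bar> * N (f x)"
      using N_triangle[of "c y *\<^sub>R (f y - f x)" "(c y - c x) *\<^sub>R f x"] fT x y
      by (simp add: T_scale T_diff N_scale)
    also have "\<bar>c y\<bar> * N (f y - f x) \<le> (\<bar>c x\<bar> + 1) * N (f y - f x)"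
      using cy fT x y by (intro mult_right_mono N_nonneg) (auto simp: b_def intro: T_diff)
    also have "\<dots> < (\<bar>c x\<bar> + 1) * a"
      by (intro mult_strict_left_mono U(3) y) simp
    also have "\<dots> = e / 2" by (simp add: a_def field_simps)
    also have "\<bar>c y - c x\<bar> * N (f x) \<le> e / (2 * (N (f x) + 1)) * N (f x)"
      using cy N_nonneg[OF fT[OF x]] by (intro mult_right_mono) (auto simp: b_def)
    also have "\<dots> \<le> e / 2" using N_nonneg[OF fT[OF x]] e by (simp add: field_simps)
    finally show ?thesis by simp
  qed
  then show "\<exists>U. open U \<and> x \<in> U \<and> (\<forall>y\<in>K. y \<in> U \<longrightarrow> N (c y *\<^sub>R f y - c x *\<^sub>R f x) < e)"
    using U V by (intro exI[of _ "U \<inter> V"]) auto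
qed (use ncontinuous_on_T[OF f] in \<open>auto intro: T_scale\<close>)

lemma ncontinuous_on_sum:
  "finite I \<Longrightarrow> (\<And>i. i \<in> I \<Longrightarrow> ncontinuous_on K (f i)) \<Longrightarrow> ncontinuous_on K (\<lambda>x. \<Sum>i\<in>I. f i x)"
  by (induction I rule: finite_induct) (auto intro: ncontinuous_on_add ncontinuous_on_const T_0)

lemma ncontinuous_on_If_closed:
  assumes f: "ncontinuous_on K f" and g: "ncontinuous_on L g" and cl: "closed K" "closed L"
    and eq: "\<And>x. x \<in> K \<Longrightarrow> x \<in> L \<Longrightarrow> f x = g x"
    and PK: "\<And>x. x \<in> K \<Longrightarrow> h x = f x" and PL: "\<And>x. x \<in> L \<Longrightarrow> h x = g x"
  shows "ncontinuous_on (K \<union> L) h"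
  unfolding ncontinuous_on_def
proof (intro conjI ballI allI impI)
  fix x and e :: real assume x: "x \<in> K \<union> L" and e: "e > 0"
  have 1: "\<exists>U. open U \<and> x \<in> U \<and> (\<forall>y\<in>K. y \<in> U \<longrightarrow> N (h y - h x) < e)"
  proof (cases "x \<in> K")
    case True
    obtain U where "open U" "x \<in> U" "\<And>y. y \<in> K \<Longrightarrow> y \<in> U \<Longrightarrow> N (f y - f x) < e"
      by (rule ncontinuous_onE[OF f True e], rule that) auto
    then show ?thesis using PK True by (intro exI[of _ U]) auto
  next
    case False
    then show ?thesis using cl by (intro exI[of _ "- K"]) auto
  qed
  have 2: "\<exists>U. open U \<and> x \<in> U \<and> (\<forall>y\<in>L. y \<in> U \<longrightarrow> N (h y - h x) < e)"
  proof (cases "x \<in> L")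
    case True
    obtain U where "open U" "x \<in> U" "\<And>y. y \<in> L \<Longrightarrow> y \<in> U \<Longrightarrow> N (g y - g x) < e"
      by (rule ncontinuous_onE[OF g True e], rule that) auto
    then show ?thesis using PL True by (intro exI[of _ U]) auto
  next
    case False
    then show ?thesis using cl by (intro exI[of _ "- L"]) auto
  qed
  obtain U V where "open U" "x \<in> U" "(\<forall>y\<in>K. y \<in> U \<longrightarrow> N (h y - h x) < e)"
    "open V" "x \<in> V" "(\<forall>y\<in>L. y \<in> V \<longrightarrow> N (h y - h x) < e)"
    using 1 2 by blast
  then show "\<exists>U. open U \<and> x \<in> U \<and> (\<forall>y\<in>K \<union> L. y \<in> U \<longrightarrow> N (h y - h x) < e)"
    by (intro exI[of _ "U \<inter> V"]) auto
qed (use ncontinuous_on_T[OF f] ncontinuous_on_T[OF g] PK PL in auto)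

lemma continuous_on_ncontinuous:
  assumes F: "ncontinuous F" and \<gamma>: "ncontinuous_on K \<gamma>"
  shows "continuous_on K (\<lambda>x. F (\<gamma> x))"
  unfolding continuous_on_topological
proof (intro ballI allI impI)
  fix x B assume x: "x \<in> K" and B: "open B" "F (\<gamma> x) \<in> B"
  then obtain e where e: "e > 0" "\<And>s. \<bar>s - F (\<gamma> x)\<bar> < e \<Longrightarrow> s \<in> B"
    unfolding open_dist dist_real_def by blast
  obtain d where d: "d > 0" "\<And>v. v \<in> T \<Longrightarrow> N (v - \<gamma> x) < d \<Longrightarrow> \<bar>F v - F (\<gamma> x)\<bar> < e"
    using F ncontinuous_on_T[OF \<gamma> x] e(1) unfolding ncontinuous_def by blast
  obtain U where "open U" "x \<in> U" "\<And>y. y \<in> K \<Longrightarrow> y \<in> U \<Longrightarrow> N (\<gamma> y - \<gamma> x) < d"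
    by (rule ncontinuous_onE[OF \<gamma> x d(1)], rule that) auto
  then show "\<exists>A. open A \<and> x \<in> A \<and> (\<forall>y\<in>K. y \<in> A \<longrightarrow> F (\<gamma> y) \<in> B)"
    using d(2) e(2) ncontinuous_on_T[OF \<gamma>] by (intro exI[of _ U]) auto
qed

lemma ncontinuous_N: "ncontinuous N"
  unfolding ncontinuous_def
proof (intro ballI allI impI)
  fix u and e :: real assume u: "u \<in> T" and e: "e > 0"
  have "\<bar>N v - N u\<bar> < e" if "v \<in> T" "N (v - u) < e" for v
    using N_le_diff[OF u that(1)] N_le_diff[OF that(1) u] N_minus_commute[OF u that(1)] that(2) by linarith
  then show "\<exists>d>0. \<forall>v\<in>T. N (v - u) < d \<longrightarrow> \<bar>N v - N u\<bar> < e" using e by blast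
qed

lemma ncontinuous_linear:
  assumes diff: "\<And>u v. u \<in> T \<Longrightarrow> v \<in> T \<Longrightarrow> l (u - v) = l u - l v"
    and bd: "\<And>u. u \<in> T \<Longrightarrow> \<bar>l u\<bar> \<le> C * N u"
  shows "ncontinuous l"
  unfolding ncontinuous_def
proof (intro ballI allI impI)
  fix u and e :: real assume u: "u \<in> T" and e: "e > 0"
  have "\<bar>l v - l u\<bar> < e" if v: "v \<in> T" "N (v - u) < e / (\<bar>C\<bar> + 1)" for v
  proof -
    have "\<bar>l v - l u\<bar> \<le> C * N (v - u)" using diff[OF v(1) u] bd[of "v - u"] u v by (simp add: T_diff)
    also have "\<dots> \<le> (\<bar>C\<bar> + 1) * N (v - u)" using u v by (intro mult_right_mono N_nonneg T_diff) auto
    also have "\<dots> < e" using v by (simp add: field_simps add_nonneg_pos)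
    finally show ?thesis .
  qed
  then show "\<exists>d>0. \<forall>v\<in>T. N (v - u) < d \<longrightarrow> \<bar>l v - l u\<bar> < e"
    using e by (intro exI[of _ "e / (\<bar>C\<bar> + 1)"]) (auto simp: add_nonneg_pos)
qed

text \<open>The existence of such a map says that the symmetric set \<open>C\<close> has size at least \<open>k\<close>; the largest such \<open>k\<close>
is, up to a shift by one, the co-index of Conner and Floyd.\<close>
definition odd_sphere_map :: "nat \<Rightarrow> 'v set \<Rightarrow> ((nat \<Rightarrow> real) \<Rightarrow> 'v) \<Rightarrow> bool" where
  "odd_sphere_map k C h \<longleftrightarrow> ncontinuous_on (sphere_nat k) h \<and>
     (\<forall>x\<in>sphere_nat k. h x \<in> C \<and> h (\<lambda>i. - x i) = - h x)"

end

text \<open>A functional \<open>E\<close> with derivative \<open>D u\<close> at \<open>u\<close>, for which first-order expansion and continuity of the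
derivative hold uniformly on bounded sets.\<close>
locale C1_functional = seminormed_subspace +
  fixes E :: "'a \<Rightarrow> real" and D :: "'a \<Rightarrow> 'a \<Rightarrow> real"
  assumes D_add: "u \<in> T \<Longrightarrow> v \<in> T \<Longrightarrow> w \<in> T \<Longrightarrow> D u (v + w) = D u v + D u w"
    and D_scale: "u \<in> T \<Longrightarrow> v \<in> T \<Longrightarrow> D u (c *\<^sub>R v) = c * D u v"
    and D_bounded: "u \<in> T \<Longrightarrow> \<exists>C. \<forall>v\<in>T. \<bar>D u v\<bar> \<le> C * N v"
    and C1: "\<eta> > 0 \<Longrightarrow> \<exists>s>0. \<forall>u\<in>T. \<forall>v\<in>T. N u \<le> R \<longrightarrow> N (v - u) \<le> s \<longrightarrow>
        \<bar>E v - E u - D u (v - u)\<bar> \<le> \<eta> * N (v - u) \<and> (\<forall>w\<in>T. \<bar>D v w - D u w\<bar> \<le> \<eta> * N w)"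
begin

lemma D_sum: "finite I \<Longrightarrow> u \<in> T \<Longrightarrow> (\<And>i. i \<in> I \<Longrightarrow> f i \<in> T) \<Longrightarrow> D u (\<Sum>i\<in>I. f i) = (\<Sum>i\<in>I. D u (f i))"
proof (induction I rule: finite_induct)
  case empty
  then show ?case using D_scale[OF \<open>u \<in> T\<close> T_0, of 0] by simp
next
  case (insert x F)
  then show ?case using D_add[of u "f x" "\<Sum>i\<in>F. f i"] by (auto intro: T_sum)
qed

lemma ncontinuous_E: "ncontinuous E"
  unfolding ncontinuous_def
proof (intro ballI allI impI)
  fix u and e :: real assume u: "u \<in> T" and e: "e > 0"
  obtain C where C: "\<And>v. v \<in> T \<Longrightarrow> \<bar>D u v\<bar> \<le> C * N v" using D_bounded[OF u] by auto
  obtain s where s: "s > 0" "\<And>v. v \<in> T \<Longrightarrow> N (v - u) \<le> s \<Longrightarrow> \<bar>E v - E u - D u (v - u)\<bar> \<le> 1 * N (v - u)"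
    using C1[of 1 "N u"] u by auto
  define d where "d = min s (e / (\<bar>C\<bar> + 2))"
  have "\<bar>E v - E u\<bar> < e" if v: "v \<in> T" "N (v - u) < d" for v
  proof -
    have "\<bar>E v - E u\<bar> \<le> 1 * N (v - u) + C * N (v - u)"
      using s(2)[OF v(1)] C[of "v - u"] v u by (auto simp: d_def T_diff)
    also have "\<dots> \<le> (\<bar>C\<bar> + 2) * N (v - u)"
      unfolding distrib_right[symmetric] using u v by (intro mult_right_mono N_nonneg T_diff) auto
    also have "\<dots> < e" using v by (simp add: d_def field_simps add_nonneg_pos)
    finally show ?thesis .
  qed
  then show "\<exists>d>0. \<forall>v\<in>T. N (v - u) < d \<longrightarrow> \<bar>E v - E u\<bar> < e"
    using e s(1) by (intro exI[of _ d]) (auto simp: d_def add_nonneg_pos)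
qed

lemma ncontinuous_D: assumes w: "w \<in> T" shows "ncontinuous (\<lambda>u. D u w)"
  unfolding ncontinuous_def
proof (intro ballI allI impI)
  fix u and e :: real assume u: "u \<in> T" and e: "e > 0"
  define \<eta> where "\<eta> = e / (N w + 1)"
  have \<eta>: "\<eta> > 0" "\<eta> * N w < e"
    using e N_nonneg[OF w] by (auto simp: \<eta>_def field_simps add_nonneg_pos)
  obtain s where "s > 0" "\<And>v. v \<in> T \<Longrightarrow> N (v - u) \<le> s \<Longrightarrow> \<bar>D v w - D u w\<bar> \<le> \<eta> * N w"
    using C1[OF \<eta>(1), of "N u"] u w by auto
  then show "\<exists>d>0. \<forall>v\<in>T. N (v - u) < d \<longrightarrow> \<bar>D v w - D u w\<bar> < e"
    using \<eta>(2) by (intro exI[of _ s]) force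
qed

text \<open>A pseudogradient along a compact family: directions that are steep at a point are steep nearby, and
finitely many of them are glued with a partition of unity.\<close>
lemma descent_field:
  fixes K :: "'k::t2_space set"
  assumes K: "compact K" and \<gamma>: "ncontinuous_on K \<gamma>"
    and steep: "\<And>x. x \<in> K \<Longrightarrow> \<exists>v\<in>T. N v \<le> 1 \<and> D (\<gamma> x) v > \<epsilon>"
  obtains X where "ncontinuous_on K X" "\<And>x. x \<in> K \<Longrightarrow> N (X x) \<le> 1" "\<And>x. x \<in> K \<Longrightarrow> D (\<gamma> x) (X x) \<ge> \<epsilon>"
proof -
  note \<gamma>T = ncontinuous_on_T[OF \<gamma>]
  obtain V where V: "\<And>x. x \<in> K \<Longrightarrow> V x \<in> T" "\<And>x. x \<in> K \<Longrightarrow> N (V x) \<le> 1" "\<And>x. x \<in> K \<Longrightarrow> D (\<gamma> x) (V x) > \<epsilon>"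
    using bchoice[of K "\<lambda>x v. v \<in> T \<and> N v \<le> 1 \<and> D (\<gamma> x) v > \<epsilon>"] steep by auto
  \<comment> \<open>The weight at \<open>y\<close> of the direction chosen at \<open>x\<close>; it is positive exactly where that direction is steep.\<close>
  define c where "c x y = max 0 (D (\<gamma> y) (V x) - \<epsilon>)" for x y
  have cc: "continuous_on K (c x)" if "x \<in> K" for x
    unfolding c_def[abs_def] by (intro continuous_intros continuous_on_ncontinuous[OF ncontinuous_D \<gamma>] V that)
  have "\<exists>U. open U \<and> {y \<in> K. c x y > 0} = K \<inter> U" if x: "x \<in> K" for x
  proof -
    obtain A where "open A" "A \<inter> K = c x -` {0<..} \<inter> K"
      using continuous_on_open_invariant[of K "c x"] cc[OF x] open_greaterThan[of "0::real"] by blast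
    then show ?thesis by (intro exI[of _ A]) auto
  qed
  then have "\<forall>x\<in>K. \<exists>U. open U \<and> {y \<in> K. c x y > 0} = K \<inter> U" by simp
  from bchoice[OF this] obtain U where
    U: "\<And>x. x \<in> K \<Longrightarrow> open (U x)" "\<And>x. x \<in> K \<Longrightarrow> {y \<in> K. c x y > 0} = K \<inter> U x"
    by auto
  have cover: "K \<subseteq> (\<Union>x\<in>K. U x)"
  proof
    fix x assume x: "x \<in> K"
    then have "x \<in> {y \<in> K. c x y > 0}" using V(3)[OF x] by (simp add: c_def)
    then show "x \<in> (\<Union>x\<in>K. U x)" using U(2)[OF x] x by blast
  qed
  obtain F where F: "F \<subseteq> K" "finite F" "K \<subseteq> (\<Union>x\<in>F. U x)"
    using compactE_image[OF K _ cover] U(1) by (metis (no_types))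
  define \<sigma> where "\<sigma> y = (\<Sum>x\<in>F. c x y)" for y
  have c0: "c x y \<ge> 0" for x y by (simp add: c_def)
  have \<sigma>: "\<sigma> y > 0" if y: "y \<in> K" for y
  proof -
    obtain x where x: "x \<in> F" "y \<in> U x" using F(3) y by blast
    then have "c x y > 0" using U(2)[of x] F(1) y by blast
    then show ?thesis unfolding \<sigma>_def using F(2) x(1) c0 by (intro sum_pos2[of _ x]) auto
  qed
  have c\<sigma>: "continuous_on K \<sigma>"
    unfolding \<sigma>_def[abs_def] using F(1) by (intro continuous_on_sum cc) auto
  define X where "X y = (\<Sum>x\<in>F. (c x y / \<sigma> y) *\<^sub>R V x)" for y
  have VT: "V x \<in> T" if "x \<in> F" for x using V(1) F(1) that by auto
  have w1: "(\<Sum>x\<in>F. c x y / \<sigma> y) = 1" if "y \<in> K" for y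
    using \<sigma>[OF that] by (simp add: \<sigma>_def flip: sum_divide_distrib)
  show thesis
  proof (rule that[of X])
    show "ncontinuous_on K X"
      unfolding X_def[abs_def]
    proof (intro ncontinuous_on_sum ncontinuous_on_scaleR ncontinuous_on_const VT)
      fix x assume "x \<in> F"
      then have "continuous_on K (c x)" using F(1) by (intro cc) auto
      then show "continuous_on K (\<lambda>y. c x y / \<sigma> y)"
        by (rule continuous_on_divide[OF _ c\<sigma>]) (use \<sigma> in force)
    qed (use F in auto)
  next
    fix y assume y: "y \<in> K"
    have "N (X y) \<le> (\<Sum>x\<in>F. N ((c x y / \<sigma> y) *\<^sub>R V x))"
      unfolding X_def by (intro N_sum F T_scale VT)
    also have "\<dots> \<le> (\<Sum>x\<in>F. c x y / \<sigma> y)"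
    proof (rule sum_mono)
      fix x assume x: "x \<in> F"
      have "N ((c x y / \<sigma> y) *\<^sub>R V x) = (c x y / \<sigma> y) * N (V x)"
        using c0[of x y] \<sigma>[OF y] by (simp add: N_scale[OF VT[OF x]])
      also have "\<dots> \<le> (c x y / \<sigma> y) * 1"
        using c0[of x y] \<sigma>[OF y] V(2)[of x] F(1) x by (intro mult_left_mono) auto
      finally show "N ((c x y / \<sigma> y) *\<^sub>R V x) \<le> c x y / \<sigma> y" by simp
    qed
    finally show "N (X y) \<le> 1" using w1[OF y] by simp
    have "\<epsilon> = (\<Sum>x\<in>F. (c x y / \<sigma> y) * \<epsilon>)" using w1[OF y] by (simp flip: sum_distrib_right del: times_divide_eq_left)
    also have "\<dots> \<le> (\<Sum>x\<in>F. (c x y / \<sigma> y) * D (\<gamma> y) (V x))"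
    proof (rule sum_mono)
      fix x assume x: "x \<in> F"
      show "(c x y / \<sigma> y) * \<epsilon> \<le> (c x y / \<sigma> y) * D (\<gamma> y) (V x)"
      proof (cases "c x y = 0")
        case False
        then have "\<epsilon> \<le> D (\<gamma> y) (V x)" by (auto simp: c_def max_def split: if_splits)
        then show ?thesis using c0[of x y] \<sigma>[OF y] by (intro mult_left_mono) auto
      qed simp
    qed
    also have "\<dots> = D (\<gamma> y) (X y)"
      unfolding X_def using \<gamma>T[OF y] VT F(2) by (simp add: D_sum D_scale T_scale)
    finally show "D (\<gamma> y) (X y) \<ge> \<epsilon>" .
  qed
qed

text \<open>Steepest descent in finitely many explicit Euler steps, because the integral curves of a descent field
may leave a space that is not complete. Each step of length \<open>t\<close> lowers the energy by at least
\<open>t \<epsilon> / 2\<close>, if steps are short enough for the first-order expansion. The smallness needed depends on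
the size of the points reached, so the distance travelled is controlled along the way: down to the
level \<open>A\<close>, it is at most \<open>2 / \<epsilon>\<close> times the energy lost.\<close>
lemma deformation_below_level:
  fixes K :: "'k::t2_space set"
  assumes K: "compact K" and \<gamma>0: "ncontinuous_on K \<gamma>0" and \<epsilon>: "\<epsilon> > 0" and AB: "A \<le> B"
    and B: "\<And>x. x \<in> K \<Longrightarrow> E (\<gamma>0 x) \<le> B"
    and steep: "\<And>u. u \<in> T \<Longrightarrow> A \<le> E u \<Longrightarrow> E u \<le> B \<Longrightarrow> \<exists>v\<in>T. N v \<le> 1 \<and> D u v > \<epsilon>"
  obtains \<gamma> where "ncontinuous_on K \<gamma>" "\<And>x. x \<in> K \<Longrightarrow> E (\<gamma> x) \<le> A + 1"
    "\<And>x. x \<in> K \<Longrightarrow> E (\<gamma>0 x) \<le> A \<Longrightarrow> \<gamma> x = \<gamma>0 x"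
proof -
  obtain R0 where R0: "\<And>x. x \<in> K \<Longrightarrow> N (\<gamma>0 x) \<le> R0"
    using compact_imp_bounded[OF compact_continuous_image[OF continuous_on_ncontinuous[OF ncontinuous_N \<gamma>0] K]]
    unfolding bounded_iff by (force simp: abs_le_iff)
  \<comment> \<open>The distance bound for points that have dropped below \<open>A\<close>: the last step may start just above \<open>A\<close> and
    has length at most \<open>1\<close>; afterwards the point rests.\<close>
  define P where "P = 2 / \<epsilon> * (B - A) + 1"
  obtain s0 where s0: "s0 > 0" "\<And>u v. u \<in> T \<Longrightarrow> v \<in> T \<Longrightarrow> N u \<le> R0 + P \<Longrightarrow> N (v - u) \<le> s0 \<Longrightarrow>
        \<bar>E v - E u - D u (v - u)\<bar> \<le> \<epsilon> / 2 * N (v - u)"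
    using C1[of "\<epsilon> / 2" "R0 + P"] \<epsilon> by auto
  define s where "s = min 1 s0"
  have s: "s > 0" "s \<le> 1" "s \<le> s0" using s0 by (auto simp: s_def)
  \<comment> \<open>The admissible distance from the starting point, as a function of the energy that is left.\<close>
  define travel where "travel u = (if E u \<ge> A then 2 / \<epsilon> * (B - E u) else P)" for u
  have "\<exists>\<gamma>. ncontinuous_on K \<gamma> \<and> (\<forall>x\<in>K. E (\<gamma> x) \<le> B \<and> E (\<gamma> x) \<le> max (A + 1) (B - real j * (s * \<epsilon> / 2)) \<and>
      (E (\<gamma>0 x) \<le> A \<longrightarrow> \<gamma> x = \<gamma>0 x) \<and> N (\<gamma> x - \<gamma>0 x) \<le> travel (\<gamma> x))" for j
  proof (induction j)
    case 0
    have "0 \<le> travel (\<gamma>0 x)" if "x \<in> K" for x using B[OF that] AB \<epsilon> by (simp add: travel_def P_def)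
    then show ?case using \<gamma>0 B by (intro exI[of _ \<gamma>0]) (auto simp: N_0 le_max_iff_disj)
  next
    case (Suc j)
    then obtain \<gamma> where \<gamma>: "ncontinuous_on K \<gamma>"
      and EB: "\<And>x. x \<in> K \<Longrightarrow> E (\<gamma> x) \<le> B"
      and Emax: "\<And>x. x \<in> K \<Longrightarrow> E (\<gamma> x) \<le> max (A + 1) (B - real j * (s * \<epsilon> / 2))"
      and fix_low: "\<And>x. x \<in> K \<Longrightarrow> E (\<gamma>0 x) \<le> A \<Longrightarrow> \<gamma> x = \<gamma>0 x"
      and tr: "\<And>x. x \<in> K \<Longrightarrow> N (\<gamma> x - \<gamma>0 x) \<le> travel (\<gamma> x)"
      by blast
    note \<gamma>T = ncontinuous_on_T[OF \<gamma>] and \<gamma>0T = ncontinuous_on_T[OF \<gamma>0]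
    define H where "H = {x \<in> K. A \<le> E (\<gamma> x)}"
    define L where "L = {x \<in> K. E (\<gamma> x) \<le> A}"
    have cE: "continuous_on K (\<lambda>x. E (\<gamma> x))" by (rule continuous_on_ncontinuous[OF ncontinuous_E \<gamma>])
    have clK: "closed K" using K by (rule compact_imp_closed)
    have cl: "closed H" "closed L"
      unfolding H_def L_def
      using continuous_closed_preimage[OF cE clK closed_atLeast[of A]]
        continuous_closed_preimage[OF cE clK closed_atMost[of A]]
      by (simp_all add: vimage_def Int_def)
    have cH: "compact H" using compact_Int_closed[OF K cl(1)] by (simp add: H_def Int_def conj_commute)
    have \<gamma>H: "ncontinuous_on H \<gamma>" by (rule ncontinuous_on_subset[OF \<gamma>]) (auto simp: H_def)
    have stp: "\<exists>v\<in>T. N v \<le> 1 \<and> D (\<gamma> x) v > \<epsilon>" if "x \<in> H" for x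
      using that EB \<gamma>T by (intro steep) (auto simp: H_def)
    obtain X where X: "ncontinuous_on H X" "\<And>x. x \<in> H \<Longrightarrow> N (X x) \<le> 1"
       "\<And>x. x \<in> H \<Longrightarrow> D (\<gamma> x) (X x) \<ge> \<epsilon>"
      by (rule descent_field[OF cH \<gamma>H stp], assumption) (erule that; simp)
    note XT = ncontinuous_on_T[OF X(1)]
    \<comment> \<open>Full steps above level \<open>A + 1\<close>, shrinking continuously to rest at level \<open>A\<close>.\<close>
    define t where "t x = s * min 1 (E (\<gamma> x) - A)" for x
    define \<gamma>' where "\<gamma>' x = (if A \<le> E (\<gamma> x) then \<gamma> x + (- t x) *\<^sub>R X x else \<gamma> x)" for x
    have "continuous_on H (\<lambda>x. - t x)"
      unfolding t_def using continuous_on_subset[OF cE, of H] by (auto intro!: continuous_intros simp: H_def)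
    then have "ncontinuous_on H (\<lambda>x. \<gamma> x + (- t x) *\<^sub>R X x)"
      by (intro ncontinuous_on_add \<gamma>H ncontinuous_on_scaleR X)
    then have "ncontinuous_on (H \<union> L) \<gamma>'"
      by (rule ncontinuous_on_If_closed[OF _ ncontinuous_on_subset[OF \<gamma>, of L] cl])
         (auto simp: H_def L_def \<gamma>'_def t_def)
    moreover have "H \<union> L = K" by (auto simp: H_def L_def)
    ultimately have c': "ncontinuous_on K \<gamma>'" by simp
    have step: "E (\<gamma>' x) \<le> E (\<gamma> x) - t x * (\<epsilon> / 2)" "0 \<le> t x" "t x \<le> s" "N (\<gamma>' x - \<gamma>0 x) \<le> N (\<gamma> x - \<gamma>0 x) + t x"
      if x: "x \<in> K" and high: "A \<le> E (\<gamma> x)" for x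
    proof -
      have xH: "x \<in> H" using that by (simp add: H_def)
      show t: "0 \<le> t x" "t x \<le> s" using high s by (auto simp: t_def mult_le_cancel_left1 intro!: mult_nonneg_nonneg)
      have g': "\<gamma>' x = \<gamma> x + (- t x) *\<^sub>R X x" using high by (simp add: \<gamma>'_def)
      have d: "\<gamma>' x - \<gamma> x = (- t x) *\<^sub>R X x" by (simp add: g')
      have T': "\<gamma>' x \<in> T" using ncontinuous_on_T[OF c' x] .
      have Nd: "N (\<gamma>' x - \<gamma> x) \<le> t x"
        unfolding d N_scale[OF XT[OF xH]] using t X(2)[OF xH] by (simp add: mult_left_le)
      have "2 / \<epsilon> * (B - E (\<gamma> x)) \<le> 2 / \<epsilon> * (B - A)" using high \<epsilon> by (intro mult_left_mono) auto
      then have "travel (\<gamma> x) \<le> P" using high unfolding travel_def P_def by simp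
      then have "N (\<gamma> x) \<le> R0 + P"
        using N_le_diff[OF \<gamma>0T[OF x] \<gamma>T[OF x]] R0[OF x] tr[OF x] by linarith
      then have "\<bar>E (\<gamma>' x) - E (\<gamma> x) - D (\<gamma> x) (\<gamma>' x - \<gamma> x)\<bar> \<le> \<epsilon> / 2 * N (\<gamma>' x - \<gamma> x)"
        using Nd t s by (intro s0(2) \<gamma>T x T') auto
      also have "\<dots> \<le> \<epsilon> / 2 * t x" using Nd \<epsilon> by (intro mult_left_mono) auto
      finally have "E (\<gamma>' x) \<le> E (\<gamma> x) + D (\<gamma> x) (\<gamma>' x - \<gamma> x) + \<epsilon> / 2 * t x" by linarith
      also have "D (\<gamma> x) (\<gamma>' x - \<gamma> x) = - (t x * D (\<gamma> x) (X x))"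
        unfolding d using D_scale[OF \<gamma>T[OF x] XT[OF xH], of "- t x"] by simp
      also have "\<dots> \<le> - (t x * \<epsilon>)" using X(3)[OF xH] t by (simp add: mult_left_mono)
      finally show "E (\<gamma>' x) \<le> E (\<gamma> x) - t x * (\<epsilon> / 2)" by (simp add: algebra_simps)
      show "N (\<gamma>' x - \<gamma>0 x) \<le> N (\<gamma> x - \<gamma>0 x) + t x"
        using N_diff_triangle[OF T' \<gamma>T[OF x] \<gamma>0T[OF x]] Nd by linarith
    qed
    have low: "\<gamma>' x = \<gamma> x" if "E (\<gamma> x) \<le> A" for x using that by (auto simp: \<gamma>'_def t_def)
    have E': "E (\<gamma>' x) \<le> E (\<gamma> x)" if "x \<in> K" for x
      using step(1,2)[OF that] low[of x] \<epsilon> by (cases "A \<le> E (\<gamma> x)") (auto simp: mult_nonneg_nonneg intro: order_trans)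
    show ?case
    proof (intro exI[of _ \<gamma>'] conjI ballI c' impI)
      fix x assume x: "x \<in> K"
      show "E (\<gamma>' x) \<le> B" using E'[OF x] EB[OF x] by linarith
      show "\<gamma>' x = \<gamma>0 x" if "E (\<gamma>0 x) \<le> A" using fix_low[OF x that] low[of x] that by simp
      show "E (\<gamma>' x) \<le> max (A + 1) (B - real (Suc j) * (s * \<epsilon> / 2))"
      proof (cases "E (\<gamma> x) \<le> A + 1")
        case True
        then show ?thesis using E'[OF x] by simp
      next
        case False
        then have "t x = s" by (simp add: t_def)
        then have "E (\<gamma>' x) \<le> E (\<gamma> x) - s * (\<epsilon> / 2)" using step(1)[OF x] False by simp
        also have "E (\<gamma> x) \<le> B - real j * (s * \<epsilon> / 2)" using Emax[OF x] False by simp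
        finally show ?thesis by (simp add: algebra_simps add_divide_distrib le_max_iff_disj)
      qed
      show "N (\<gamma>' x - \<gamma>0 x) \<le> travel (\<gamma>' x)"
      proof (cases "A \<le> E (\<gamma> x)")
        case False
        then show ?thesis using low[of x] tr[OF x] by simp
      next
        case True
        have 1: "N (\<gamma>' x - \<gamma>0 x) \<le> 2 / \<epsilon> * (B - E (\<gamma> x)) + t x"
          using step(4)[OF x True] tr[OF x] True by (simp add: travel_def)
        show ?thesis
        proof (cases "A \<le> E (\<gamma>' x)")
          case T': True
          have "2 / \<epsilon> * (t x * (\<epsilon> / 2)) \<le> 2 / \<epsilon> * (E (\<gamma> x) - E (\<gamma>' x))"
            using step(1)[OF x True] \<epsilon> by (intro mult_left_mono) auto
          then have "t x \<le> 2 / \<epsilon> * (E (\<gamma> x) - E (\<gamma>' x))" using \<epsilon> by simp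
          then have "N (\<gamma>' x - \<gamma>0 x) \<le> 2 / \<epsilon> * (B - E (\<gamma> x)) + 2 / \<epsilon> * (E (\<gamma> x) - E (\<gamma>' x))" using 1 by linarith
          also have "\<dots> = 2 / \<epsilon> * (B - E (\<gamma>' x))"
            unfolding distrib_left[symmetric] by simp
          finally show ?thesis using T' by (simp add: travel_def)
        next
          case F: False
          have "2 / \<epsilon> * (B - E (\<gamma> x)) \<le> 2 / \<epsilon> * (B - A)" using True \<epsilon> by (intro mult_left_mono) auto
          then have "N (\<gamma>' x - \<gamma>0 x) \<le> P" using 1 step(3)[OF x True] s unfolding P_def by linarith
          then show ?thesis using F by (simp add: travel_def)
        qed
      qed
    qed
  qed
  note iter = this
  obtain j :: nat where j: "(B - (A + 1)) / (s * \<epsilon> / 2) \<le> real j" using real_arch_simple by blast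
  have "s * \<epsilon> / 2 > 0" using s \<epsilon> by simp
  with j have "B - real j * (s * \<epsilon> / 2) \<le> A + 1" by (simp add: pos_divide_le_eq)
  then show thesis using iter[of j] that by (metis max.absorb1)
qed

text \<open>The cone over a sphere map, extended radially to all of \<open>\<real>\<^sup>k\<close>; it is continuous at the apex because the
map is bounded. Restricted to a hemisphere of one dimension more, it fills in the sphere map.\<close>
lemma ncontinuous_on_cone:
  assumes h: "ncontinuous_on (sphere_nat k) h"
  defines "\<rho> \<equiv> \<lambda>x::nat \<Rightarrow> real. sqrt (\<Sum>i<k. (x i)\<^sup>2)"
  shows "ncontinuous_on UNIV (\<lambda>x. if \<rho> x = 0 then 0 else (R * \<rho> x) *\<^sub>R h (normalize_upto k x))"
    (is "ncontinuous_on UNIV ?g")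
proof -
  have \<rho>0: "\<rho> x \<ge> 0" for x by (simp add: \<rho>_def sum_nonneg)
  have c\<rho>: "continuous_on A \<rho>" for A
    unfolding \<rho>_def by (intro continuous_intros continuous_on_coord[OF continuous_on_id])
  define V where "V = {x. \<rho> x \<noteq> 0}"
  have nzV: "\<exists>j<k. x j \<noteq> 0" if "x \<in> V" for x
  proof (rule ccontr)
    assume "\<not> ?thesis"
    then have "(\<Sum>i<k. (x i)\<^sup>2) = 0" by simp
    then show False using that by (simp add: V_def \<rho>_def)
  qed
  have openV: "open V"
    unfolding V_def by (intro open_Collect_neq c\<rho> continuous_intros)
  have nV: "normalize_upto k x \<in> sphere_nat k" if "x \<in> V" for x
    using nzV[OF that] by (auto intro: normalize_upto_in_sphere)
  have onV: "ncontinuous_on V ?g"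
  proof (rule ncontinuous_on_cong)
    have "continuous_on V (\<lambda>x. normalize_upto k x)"
      by (rule continuous_on_normalize) (use nzV in \<open>auto intro: continuous_on_coord[OF continuous_on_id]\<close>)
    then show "ncontinuous_on V (\<lambda>x. (R * \<rho> x) *\<^sub>R h (normalize_upto k x))"
      by (intro ncontinuous_on_scaleR ncontinuous_on_compose[OF h] continuous_on_mult c\<rho> nV continuous_on_const)
  qed (auto simp: V_def)
  obtain M where M: "\<And>x. x \<in> sphere_nat k \<Longrightarrow> N (h x) \<le> M" "M \<ge> 0"
  proof -
    obtain M where "\<And>x. x \<in> sphere_nat k \<Longrightarrow> \<bar>N (h x)\<bar> \<le> M"
      using compact_imp_bounded[OF compact_continuous_image[OF continuous_on_ncontinuous[OF ncontinuous_N h] compact_sphere_nat]]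
      unfolding bounded_iff by auto
    then show thesis by (intro that[of "max M 0"]) (auto simp: le_max_iff_disj abs_le_iff)
  qed
  have gT: "?g x \<in> T" for x
    using ncontinuous_on_T[OF onV, of x] T_0 by (cases "x \<in> V") (auto simp: V_def)
  show ?thesis
    unfolding ncontinuous_on_def
  proof (intro conjI ballI allI impI gT)
    fix x and e :: real assume e: "e > 0"
    show "\<exists>U. open U \<and> x \<in> U \<and> (\<forall>y\<in>UNIV. y \<in> U \<longrightarrow> N (?g y - ?g x) < e)"
    proof (cases "x \<in> V")
      case True
      obtain U where U: "open U" "x \<in> U" "\<And>y. y \<in> V \<Longrightarrow> y \<in> U \<Longrightarrow> N (?g y - ?g x) < e"
        by (rule ncontinuous_onE[OF onV True e]) (erule that; blast)
      have "\<forall>y\<in>UNIV. y \<in> U \<inter> V \<longrightarrow> N (?g y - ?g x) < e" using U(3) by auto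
      then show ?thesis using U(1,2) True openV by (intro exI[of _ "U \<inter> V"] conjI open_Int) auto
    next
      case False
      define d where "d = e / (\<bar>R\<bar> * M + 1)"
      have d: "d > 0" using e M(2) by (simp add: d_def add_nonneg_pos)
      have "open {y. \<rho> y < d}" by (intro open_Collect_less c\<rho> continuous_intros)
      moreover have "N (?g y - ?g x) < e" if y: "\<rho> y < d" for y
      proof (cases "\<rho> y = 0")
        case True
        then show ?thesis using False e by (simp add: V_def N_0)
      next
        case nz: False
        then have y: "normalize_upto k y \<in> sphere_nat k" by (intro nV) (simp add: V_def)
        have "N (?g y - ?g x) = \<bar>R\<bar> * \<rho> y * N (h (normalize_upto k y))"
          using nz False \<rho>0[of y] by (simp add: V_def N_scale[OF ncontinuous_on_T[OF h y]] abs_mult)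
        also have "\<dots> \<le> \<bar>R\<bar> * \<rho> y * M" by (intro mult_left_mono M y) (simp add: \<rho>0)
        also have "\<dots> \<le> (\<bar>R\<bar> * M + 1) * \<rho> y" using \<rho>0[of y] by (simp add: algebra_simps)
        also have "\<dots> < e"
        proof -
          have "\<bar>R\<bar> * M + 1 > 0" using M(2) by (simp add: add_nonneg_pos)
          then show ?thesis using \<open>\<rho> y < d\<close> by (simp add: d_def pos_less_divide_eq mult.commute)
        qed
        finally show ?thesis .
      qed
      ultimately show ?thesis using False d by (intro exI[of _ "{y. \<rho> y < d}"]) (auto simp: V_def)
    qed
  qed
qed

text \<open>Reflect a map of the upper hemisphere to the lower one; oddness on the equator makes the two halves fit.\<close>
lemma odd_sphere_map_extend:
  assumes h: "odd_sphere_map k C h" and C: "\<And>u. u \<in> C \<Longrightarrow> - u \<in> C"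
    and \<gamma>: "ncontinuous_on {x \<in> sphere_nat (Suc k). 0 \<le> x k} \<gamma>"
    and \<gamma>C: "\<And>x. x \<in> sphere_nat (Suc k) \<Longrightarrow> 0 \<le> x k \<Longrightarrow> \<gamma> x \<in> C"
    and bdry: "\<And>x. x \<in> sphere_nat k \<Longrightarrow> \<gamma> x = R *\<^sub>R h x"
  shows "\<exists>g. odd_sphere_map (Suc k) C g"
proof -
  let ?S = "sphere_nat (Suc k)"
  let ?U = "{x \<in> ?S. 0 \<le> x k}" and ?L = "{x \<in> ?S. x k \<le> 0}"
  let ?m = "\<lambda>x::nat \<Rightarrow> real. \<lambda>i. - x i"
  define g where "g x = (if 0 \<le> x k then \<gamma> x else - \<gamma> (?m x))" for x
  have clS: "closed ?S" using compact_sphere_nat by (rule compact_imp_closed)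
  have cl: "closed ?U" "closed ?L"
    unfolding Collect_conj_eq Collect_mem_eq
    by (intro closed_Int clS closed_Collect_le continuous_intros continuous_on_coord[OF continuous_on_id])+
  have eqv: "x \<in> sphere_nat k" if "x \<in> ?S" "x k = 0" for x
    using that by (auto simp: sphere_nat_def) (metis Suc_leI le_neq_implies_less)
  have eq: "\<gamma> x = - \<gamma> (?m x)" if "x \<in> ?S" "x k = 0" for x
    using bdry[OF eqv[OF that]] bdry[OF sphere_nat_uminus[OF eqv[OF that]]] h eqv[OF that]
    by (simp add: odd_sphere_map_def)
  have m: "continuous_on A ?m" for A
    by (intro continuous_on_coordinatewise_then_product continuous_intros continuous_on_coord[OF continuous_on_id])
  have "ncontinuous_on ?L (\<lambda>x. (-1) *\<^sub>R \<gamma> (?m x))"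
    by (intro ncontinuous_on_scaleR ncontinuous_on_compose[OF \<gamma>] m continuous_intros)
       (auto simp: sphere_nat_def)
  then have "ncontinuous_on (?U \<union> ?L) g"
    by (rule ncontinuous_on_If_closed[OF \<gamma> _ cl]) (use eq in \<open>auto simp: g_def\<close>)
  moreover have "?U \<union> ?L = ?S" by auto
  moreover have "g x \<in> C" if "x \<in> ?S" for x
    using \<gamma>C[OF that] \<gamma>C[OF sphere_nat_uminus[OF that]] C by (auto simp: g_def)
  moreover have "g (?m x) = - g x" if "x \<in> ?S" for x
    using eq[OF that] eq[OF sphere_nat_uminus[OF that]] by (auto simp: g_def)
  ultimately show ?thesis by (auto simp: odd_sphere_map_def)
qed

text \<open>The linking principle. If all points with energy between \<open>A\<close> and \<open>B\<close> were steep, the cone over \<open>R h\<close>,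
whose base already lies below \<open>A\<close>, could be pushed below \<open>A + 1\<close> with its base fixed. Its points would
then be in \<open>C2\<close>, and reflecting would produce an odd map of a sphere of the next dimension into \<open>C2\<close>.\<close>
theorem odd_linking_almost_critical_point:
  assumes h: "odd_sphere_map k C1 h"
    and C12: "C1 \<subseteq> C2" and C2: "\<And>u. u \<in> C2 \<Longrightarrow> - u \<in> C2"
    and no: "\<nexists>g. odd_sphere_map (Suc k) C2 g"
    and outside: "\<And>u. u \<in> T \<Longrightarrow> u \<notin> C2 \<Longrightarrow> A + 1 < E u"
    and R: "R \<ge> 0" "\<And>x. x \<in> sphere_nat k \<Longrightarrow> E (R *\<^sub>R h x) \<le> A"
    and B: "E 0 \<le> B" "\<And>x s. x \<in> sphere_nat k \<Longrightarrow> s \<ge> 0 \<Longrightarrow> E (s *\<^sub>R h x) \<le> B"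
    and AB: "A \<le> B" and \<epsilon>: "\<epsilon> > 0"
  shows "\<exists>u\<in>T. A \<le> E u \<and> E u \<le> B \<and> (\<forall>v\<in>T. N v \<le> 1 \<longrightarrow> \<bar>D u v\<bar> \<le> \<epsilon>)"
proof (rule ccontr)
  assume neg: "\<not> ?thesis"
  have steep: "\<exists>v\<in>T. N v \<le> 1 \<and> D u v > \<epsilon>" if u: "u \<in> T" "A \<le> E u" "E u \<le> B" for u
  proof -
    obtain v where v: "v \<in> T" "N v \<le> 1" "\<bar>D u v\<bar> > \<epsilon>" using neg u by force
    show ?thesis
    proof (cases "D u v \<ge> 0")
      case True then show ?thesis using v by auto
    next
      case False
      then show ?thesis using v D_scale[OF u(1) v(1), of "-1"] N_uminus[OF v(1)]
        by (intro bexI[of _ "- v"]) (auto simp: T_uminus)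
    qed
  qed
  let ?S = "sphere_nat (Suc k)"
  define K where "K = {x \<in> ?S. 0 \<le> x k}"
  have "compact K"
    unfolding K_def Collect_conj_eq Collect_mem_eq
    by (intro compact_Int_closed compact_sphere_nat closed_Collect_le continuous_intros
        continuous_on_coord[OF continuous_on_id])
  define \<rho> where "\<rho> x = sqrt (\<Sum>i<k. (x i)\<^sup>2)" for x :: "nat \<Rightarrow> real"
  define \<gamma>0 where "\<gamma>0 x = (if \<rho> x = 0 then 0 else (R * \<rho> x) *\<^sub>R h (normalize_upto k x))" for x
  have "ncontinuous_on (sphere_nat k) h" using h by (simp add: odd_sphere_map_def)
  from ncontinuous_on_cone[OF this, of R] have c0: "ncontinuous_on K \<gamma>0"
    unfolding \<gamma>0_def \<rho>_def by (rule ncontinuous_on_subset) simp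
  have \<gamma>0B: "E (\<gamma>0 x) \<le> B" for x
  proof (cases "\<rho> x = 0")
    case False
    have "\<exists>j<k. x j \<noteq> 0"
    proof (rule ccontr)
      assume "\<not> ?thesis"
      then have "(\<Sum>i<k. (x i)\<^sup>2) = 0" by simp
      with False show False by (simp add: \<rho>_def)
    qed
    then obtain j where "j < k" "x j \<noteq> 0" by blast
    then have "normalize_upto k x \<in> sphere_nat k" by (rule normalize_upto_in_sphere)
    then show ?thesis using B(2)[of "normalize_upto k x" "R * \<rho> x"] R(1) False
      by (simp add: \<gamma>0_def \<rho>_def sum_nonneg)
  qed (simp add: \<gamma>0_def B)
  have bd0: "\<gamma>0 x = R *\<^sub>R h x" if "x \<in> sphere_nat k" for x
    using that normalize_upto_sphere_id[OF that] by (simp add: \<gamma>0_def \<rho>_def sphere_nat_def)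
  obtain \<gamma> where \<gamma>: "ncontinuous_on K \<gamma>" "\<And>x. x \<in> K \<Longrightarrow> E (\<gamma> x) \<le> A + 1"
    "\<And>x. x \<in> K \<Longrightarrow> E (\<gamma>0 x) \<le> A \<Longrightarrow> \<gamma> x = \<gamma>0 x"
    by (rule deformation_below_level[OF \<open>compact K\<close> c0 \<epsilon> AB \<gamma>0B steep], assumption+) (erule that; simp)
  have "\<exists>g. odd_sphere_map (Suc k) C2 g"
  proof (rule odd_sphere_map_extend[where \<gamma>=\<gamma> and R=R and h=h])
    show "odd_sphere_map k C2 h" using h C12 by (auto simp: odd_sphere_map_def)
    show "ncontinuous_on {x \<in> ?S. 0 \<le> x k} \<gamma>" using \<gamma>(1) by (simp add: K_def)
    show "\<gamma> x \<in> C2" if "x \<in> ?S" "0 \<le> x k" for x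
      using outside[of "\<gamma> x"] \<gamma>(2)[of x] ncontinuous_on_T[OF \<gamma>(1), of x] that by (force simp: K_def)
    show "\<gamma> x = R *\<^sub>R h x" if "x \<in> sphere_nat k" for x
    proof -
      have "x \<in> K" using that by (auto simp: K_def sphere_nat_def)
      then show ?thesis using \<gamma>(3)[of x] bd0[OF that] R(2)[OF that] by simp
    qed
  qed (use C2 in auto)
  with no show False by blast
qed

end

section \<open>Pointwise inequalities for the duality map\<close>

text \<open>By homogeneity it suffices to look at the unit sphere. Where \<open>F \<ge> \<eta>\<close> there, \<open>P\<close> is bounded below by a
positive constant. The quantitative inequalities for the duality map follow from this for all exponents
\<open>r > 1\<close> at once, without a distinction between \<open>r \<le> 2\<close> and \<open>r \<ge> 2\<close>.\<close>
lemma homogeneous_compactness: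
  fixes F P :: "'x::euclidean_space \<Rightarrow> real"
  assumes F: "continuous_on UNIV F" and P: "continuous_on UNIV P"
    and hF: "\<And>t x. t > 0 \<Longrightarrow> F (t *\<^sub>R x) = t powr r * F x"
    and hP: "\<And>t x. t > 0 \<Longrightarrow> P (t *\<^sub>R x) = t powr r * P x"
    and P0: "\<And>x. P x \<ge> 0" and PF: "\<And>x. P x = 0 \<Longrightarrow> F x \<le> 0"
    and r: "r > 0" and \<eta>: "\<eta> > 0"
  shows "\<exists>C\<ge>0. \<forall>x. F x \<le> \<eta> * norm x powr r + C * P x"
proof -
  define K where "K = sphere 0 1 \<inter> {x. F x \<ge> \<eta>}"
  have "closed {x. F x \<ge> \<eta>}" by (intro closed_Collect_le F continuous_intros)
  then have K: "compact K" unfolding K_def by (intro compact_Int_closed) auto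
  have "\<exists>C\<ge>0. \<forall>x\<in>K. F x \<le> C * P x"
  proof (cases "K = {}")
    case False
    obtain x0 where x0: "x0 \<in> K" "\<And>x. x \<in> K \<Longrightarrow> P x0 \<le> P x"
      using continuous_attains_inf[OF K False continuous_on_subset[OF P]] by auto
    obtain x1 where x1: "x1 \<in> K" "\<And>x. x \<in> K \<Longrightarrow> F x \<le> F x1"
      using continuous_attains_sup[OF K False continuous_on_subset[OF F]] by auto
    have pos: "P x0 > 0" using P0[of x0] PF[of x0] x0(1) \<eta> by (force simp: K_def)
    have F1: "F x1 \<ge> 0" using x1(1) \<eta> by (auto simp: K_def)
    have "F x \<le> F x1 / P x0 * P x" if "x \<in> K" for x
    proof -
      have "F x \<le> F x1 / P x0 * P x0" using x1(2)[OF that] pos by simp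
      also have "\<dots> \<le> F x1 / P x0 * P x" using x0(2)[OF that] pos F1 by (intro mult_left_mono) auto
      finally show ?thesis .
    qed
    then show ?thesis using pos F1 by (intro exI[of _ "F x1 / P x0"]) auto
  qed auto
  then obtain C where C: "C \<ge> 0" "\<And>x. x \<in> K \<Longrightarrow> F x \<le> C * P x" by blast
  have "F x \<le> \<eta> * norm x powr r + C * P x" for x
  proof (cases "x = 0")
    case True
    have "F 0 = 2 powr r * F 0" using hF[of 2 0] by simp
    moreover have "2 powr r > (1::real)" using r by (simp add: less_powr_iff)
    ultimately have "F 0 = 0" using r by auto
    then show ?thesis using True C P0[of 0] by simp
  next
    case False
    define y where "y = (1 / norm x) *\<^sub>R x"
    have y: "norm y = 1" "x = norm x *\<^sub>R y" using False by (auto simp: y_def)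
    have "F y \<le> \<eta> + C * P y"
    proof (cases "y \<in> K")
      case True
      then show ?thesis using C(2)[OF True] \<eta> by simp
    next
      case F: False
      have "C * P y \<ge> 0" using C(1) P0 by simp
      then show ?thesis using F y(1) by (simp add: K_def)
    qed
    then have "norm x powr r * F y \<le> norm x powr r * (\<eta> + C * P y)" by (intro mult_left_mono) auto
    moreover have "F x = norm x powr r * F y" "P x = norm x powr r * P y"
      using hF[of "norm x" y] hP[of "norm x" y] y False by auto
    ultimately show ?thesis by (simp add: algebra_simps)
  qed
  with C(1) show ?thesis by blast
qed

lemma powr_add_le:
  fixes x y r :: real
  assumes "x \<ge> 0" "y \<ge> 0" "r > 0"
  shows "(x + y) powr r \<le> 2 powr r * (x powr r + y powr r)"
proof -
  have "(x + y) powr r \<le> (2 * max x y) powr r" using assms by (intro powr_mono2) auto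
  also have "\<dots> = 2 powr r * (max x y) powr r" using assms by (intro powr_mult)
  also have "\<dots> \<le> 2 powr r * (x powr r + y powr r)" by (intro mult_left_mono) (auto simp: max_def)
  finally show ?thesis .
qed

lemma powr_le_one_plus:
  fixes x q r :: real
  assumes "0 < q" "q \<le> r" "x \<ge> 0"
  shows "x powr q \<le> 1 + x powr r"
proof (cases "x \<le> 1")
  case True
  then have "x powr q \<le> 1" using assms by (simp add: powr_le1)
  then show ?thesis by (simp add: add_increasing2)
next
  case False
  then show ?thesis using powr_mono[of q r x] assms by linarith
qed

text \<open>The vector field \<open>\<bar>a\<bar>\<^sup>r\<^sup>-\<^sup>2 a\<close>, the gradient of \<open>\<bar>a\<bar>\<^sup>r / r\<close>. It is used for \<open>a = \<nabla>u\<close> and for \<open>a = u\<close>.\<close>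
definition duality_map :: "real \<Rightarrow> 'b::real_normed_vector \<Rightarrow> 'b" where
  "duality_map r a = norm a powr (r - 2) *\<^sub>R a"

lemma norm_duality_map: "r > 1 \<Longrightarrow> norm (duality_map r a) = norm a powr (r - 1)"
  by (cases "a = 0") (auto simp: duality_map_def powr_mult_base[symmetric] powr_diff field_simps power2_eq_square powr_numeral)

lemma duality_map_0 [simp]: "duality_map r 0 = 0" by (simp add: duality_map_def)

lemma duality_map_scale:
  assumes "t > 0" shows "duality_map r (t *\<^sub>R a) = t powr (r - 1) *\<^sub>R duality_map r a"
proof -
  have "t powr (r - 1) = t powr (r - 2) * t"
    using assms powr_add[of t "r - 2" 1] by simp
  then show ?thesis using assms by (simp add: duality_map_def powr_mult mult_ac)
qed

lemma duality_map_inner_self: "duality_map r (a::'b::real_inner) \<bullet> a = norm a powr r"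
proof (cases "a = 0")
  case False
  have "norm a powr r = norm a powr (r - 2) * norm a powr 2"
    by (metis diff_add_cancel powr_add)
  then show ?thesis using False by (simp add: duality_map_def dot_square_norm powr_numeral)
qed (simp add: duality_map_def)

lemma continuous_duality_map:
  assumes r: "r > 1"
  shows "continuous_on UNIV (duality_map r :: 'b::real_normed_vector \<Rightarrow> 'b)"
proof -
  have "isCont (duality_map r) a" for a :: 'b
  proof (cases "a = 0")
    case True
    have "((\<lambda>x::'b. norm x powr (r - 1)) \<longlongrightarrow> norm (0::'b) powr (r - 1)) (at 0)"
      using r by (intro tendsto_powr' tendsto_intros) auto
    then have "((\<lambda>x::'b. norm (duality_map r x)) \<longlongrightarrow> 0) (at 0)"
      using r by (simp add: norm_duality_map)
    then show ?thesis using True by (simp add: isCont_def tendsto_norm_zero_iff)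
  next
    case False
    then show ?thesis unfolding duality_map_def[abs_def] by (intro continuous_intros) auto
  qed
  then show ?thesis by (simp add: continuous_on_eq_continuous_at)
qed

lemma duality_map_inner_le:
  fixes a w :: "'b::real_inner"
  assumes r: "r > 1"
  shows "\<bar>duality_map r a \<bullet> w\<bar> \<le> (r - 1) / r * norm a powr r + norm w powr r / r"
proof -
  have "\<bar>duality_map r a \<bullet> w\<bar> \<le> norm a powr (r - 1) * norm w"
    using Cauchy_Schwarz_ineq2[of "duality_map r a" w] by (simp add: norm_duality_map[OF r])
  also have "\<dots> \<le> (norm a powr (r - 1)) powr (r / (r - 1)) / (r / (r - 1)) + norm w powr r / r"
    by (rule Youngs_inequality) (use r in \<open>auto simp: field_simps\<close>)
  also have "(norm a powr (r - 1)) powr (r / (r - 1)) = norm a powr r"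
    using r by (simp add: powr_powr)
  finally show ?thesis by (simp add: mult.commute)
qed

text \<open>Convexity of \<open>\<bar>\<cdot>\<bar>\<^sup>r\<close>, obtained from Young's inequality.\<close>
lemma duality_map_tangent_le:
  fixes a b :: "'b::real_inner"
  assumes r: "r > 1"
  shows "r * (duality_map r a \<bullet> (b - a)) \<le> norm b powr r - norm a powr r"
proof -
  have "r * (duality_map r a \<bullet> b) \<le> r * ((r - 1) / r * norm a powr r + norm b powr r / r)"
    using duality_map_inner_le[OF r, of a b] r by (intro mult_left_mono) auto
  also have "\<dots> = (r - 1) * norm a powr r + norm b powr r" using r by (simp add: distrib_left)
  finally show ?thesis by (simp add: inner_diff_right duality_map_inner_self algebra_simps)
qed

text \<open>The expression splits into two nonnegative parts, one measuring the difference of the lengths and one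
the angle between the vectors.\<close>
lemma duality_map_monotone:
  fixes a b :: "'b::real_inner"
  assumes r: "r > 1"
  shows "(duality_map r a - duality_map r b) \<bullet> (a - b) \<ge> 0"
    and "(duality_map r a - duality_map r b) \<bullet> (a - b) = 0 \<Longrightarrow> a = b"
proof -
  let ?x = "norm a" and ?y = "norm b"
  have *: "(duality_map r a - duality_map r b) \<bullet> (a - b) =
     (?x powr (r-1) - ?y powr (r-1)) * (?x - ?y)
     + (?x powr (r-2) + ?y powr (r-2)) * (?x * ?y - a \<bullet> b)"
  proof -
    have p: "t powr (r - 1) = t powr (r - 2) * t" if "t \<ge> 0" for t :: real
      using that powr_mult_base[of t "r - 2"] by (simp add: mult.commute)
    show ?thesis unfolding p[OF norm_ge_zero]
      by (simp add: duality_map_def inner_diff_left inner_diff_right inner_commute[of b a]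
          dot_square_norm power2_eq_square algebra_simps)
  qed
  have 1: "(?x powr (r-1) - ?y powr (r-1)) * (?x - ?y) \<ge> 0"
    using r powr_mono2[of "r - 1" ?x ?y] powr_mono2[of "r - 1" ?y ?x]
    by (cases "?x \<le> ?y") (auto intro: mult_nonpos_nonpos)
  have 2: "?x * ?y - a \<bullet> b \<ge> 0" using norm_cauchy_schwarz[of a b] by simp
  have 3: "(?x powr (r-2) + ?y powr (r-2)) * (?x * ?y - a \<bullet> b) \<ge> 0" using 2 by simp
  show "(duality_map r a - duality_map r b) \<bullet> (a - b) \<ge> 0" using * 1 3 by simp
  assume 0: "(duality_map r a - duality_map r b) \<bullet> (a - b) = 0"
  have e1: "(?x powr (r-1) - ?y powr (r-1)) * (?x - ?y) = 0" and
    e2: "(?x powr (r-2) + ?y powr (r-2)) * (?x * ?y - a \<bullet> b) = 0" using 0 * 1 3 by linarith+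
  have xy: "?x = ?y"
  proof (rule ccontr)
    assume "?x \<noteq> ?y"
    moreover from this have "?x powr (r-1) \<noteq> ?y powr (r-1)"
      using r powr_less_mono2[of "r - 1" ?x ?y] powr_less_mono2[of "r - 1" ?y ?x] by (metis diff_gt_0_iff_gt less_irrefl linorder_neqE_linordered_idom norm_ge_zero)
    ultimately show False using e1 by simp
  qed
  show "a = b"
  proof (cases "a = 0")
    case True then show ?thesis using xy by simp
  next
    case False
    then have "?x powr (r-2) > 0" by simp
    then have "?x powr (r-2) + ?y powr (r-2) > 0" by (simp add: add_pos_nonneg)
    then have "a \<bullet> b = ?x * ?y" using e2 by simp
    then show ?thesis
      using xy vector_eq[of a b] by (simp add: dot_square_norm power2_eq_square)
  qed
qed

lemma duality_map_strongly_monotone: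
  assumes r: "r > 1" and \<eta>: "\<eta> > 0"
  shows "\<exists>C\<ge>0. \<forall>a b::'b::euclidean_space. norm (a - b) powr r \<le>
     \<eta> * (norm a powr r + norm b powr r) + C * ((duality_map r a - duality_map r b) \<bullet> (a - b))"
proof -
  let ?F = "\<lambda>z::'b \<times> 'b. norm (fst z - snd z) powr r"
  let ?P = "\<lambda>z::'b \<times> 'b. (duality_map r (fst z) - duality_map r (snd z)) \<bullet> (fst z - snd z)"
  note cont = continuous_on_compose2[OF continuous_duality_map[OF r]]
  have "\<exists>C\<ge>0. \<forall>z. ?F z \<le> (\<eta> / 2 powr r) * norm z powr r + C * ?P z"
  proof (rule homogeneous_compactness)
    show "continuous_on UNIV ?F" using r by (intro continuous_on_powr' continuous_intros) auto
    show "continuous_on UNIV ?P" by (intro continuous_intros cont) auto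
    fix t :: real and z :: "'b \<times> 'b" assume t: "t > 0"
    show "?F (t *\<^sub>R z) = t powr r * ?F z"
      using t by (simp add: powr_mult flip: scaleR_diff_right)
    have "t powr r = t powr (r - 1) * t" using t powr_add[of t "r - 1" 1] by simp
    then show "?P (t *\<^sub>R z) = t powr r * ?P z"
      using t by (simp add: duality_map_scale flip: scaleR_diff_right)
  next
    fix z show "?P z \<ge> 0" by (rule duality_map_monotone[OF r])
    show "?P z = 0 \<Longrightarrow> ?F z \<le> 0" using duality_map_monotone(2)[OF r, of "fst z" "snd z"] r by simp
  qed (use r \<eta> in auto)
  then obtain C where C: "C \<ge> 0" "\<And>z. ?F z \<le> (\<eta> / 2 powr r) * norm z powr r + C * ?P z" by blast
  show ?thesis
  proof (intro exI[of _ C] conjI C allI)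
    fix a b :: 'b
    have "norm (a, b) powr r \<le> (norm a + norm b) powr r"
      using r by (intro powr_mono2 norm_Pair_le) auto
    also have "\<dots> \<le> 2 powr r * (norm a powr r + norm b powr r)" using r by (intro powr_add_le) auto
    finally have "(\<eta> / 2 powr r) * norm (a, b) powr r \<le> (\<eta> / 2 powr r) * (2 powr r * (norm a powr r + norm b powr r))"
      using \<eta> by (intro mult_left_mono) auto
    then show "norm (a - b) powr r \<le> \<eta> * (norm a powr r + norm b powr r) + C * ((duality_map r a - duality_map r b) \<bullet> (a - b))"
      using C(2)[of "(a, b)"] by simp
  qed
qed

lemma duality_map_uniformly_continuous:
  assumes r: "r > 1" and \<eta>: "\<eta> > 0"
  shows "\<exists>C\<ge>0. \<forall>a b w::'b::euclidean_space. \<bar>(duality_map r b - duality_map r a) \<bullet> w\<bar> \<le>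
     \<eta> * (norm a powr r + norm b powr r + norm w powr r) + C * norm (b - a) powr r"
proof -
  let ?F = "\<lambda>z::'b \<times> 'b \<times> 'b. \<bar>(duality_map r (fst (snd z)) - duality_map r (fst z)) \<bullet> snd (snd z)\<bar>"
  let ?P = "\<lambda>z::'b \<times> 'b \<times> 'b. norm (fst (snd z) - fst z) powr r"
  note cont = continuous_on_compose2[OF continuous_duality_map[OF r]]
  have r0: "r > 0" using r by simp
  define \<eta>' where "\<eta>' = \<eta> / (2 powr r * 2 powr r)"
  have "\<exists>C\<ge>0. \<forall>z. ?F z \<le> \<eta>' * norm z powr r + C * ?P z"
  proof (rule homogeneous_compactness)
    show "continuous_on UNIV ?F" by (intro continuous_intros cont) auto
    show "continuous_on UNIV ?P" using r by (intro continuous_on_powr' continuous_intros) auto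
    fix t :: real and z :: "'b \<times> 'b \<times> 'b" assume t: "t > 0"
    show "?P (t *\<^sub>R z) = t powr r * ?P z"
      using t by (simp add: powr_mult flip: scaleR_diff_right)
    have "t powr r = t powr (r - 1) * t" using t powr_add[of t "r - 1" 1] by simp
    then show "?F (t *\<^sub>R z) = t powr r * ?F z"
      using t by (simp add: duality_map_scale abs_mult flip: scaleR_diff_right)
  next
    fix z show "?P z \<ge> 0" by simp
    show "?P z = 0 \<Longrightarrow> ?F z \<le> 0" by simp
  qed (use r \<eta> in \<open>auto simp: \<eta>'_def\<close>)
  then obtain C where C: "C \<ge> 0" "\<And>z. ?F z \<le> \<eta>' * norm z powr r + C * ?P z" by blast
  show ?thesis
  proof (intro exI[of _ C] conjI C allI)
    fix a b w :: 'b
    have "norm (b, w) powr r \<le> (norm b + norm w) powr r"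
      using r by (intro powr_mono2 norm_Pair_le) auto
    also have "\<dots> \<le> 2 powr r * (norm b powr r + norm w powr r)" using r by (intro powr_add_le) auto
    finally have 1: "norm (b, w) powr r \<le> 2 powr r * (norm b powr r + norm w powr r)" .
    have "norm (a, b, w) powr r \<le> (norm a + norm (b, w)) powr r"
      using r by (intro powr_mono2 norm_Pair_le) auto
    also have "\<dots> \<le> 2 powr r * (norm a powr r + norm (b, w) powr r)" using r by (intro powr_add_le) auto
    also have "\<dots> \<le> 2 powr r * (2 powr r * norm a powr r + 2 powr r * (norm b powr r + norm w powr r))"
      using r by (intro mult_left_mono add_mono 1) (auto simp: mult_le_cancel_right1 ge_one_powr_ge_zero)
    finally have "\<eta>' * norm (a, b, w) powr r \<le> \<eta>' * (2 powr r * (2 powr r * norm a powr r + 2 powr r * (norm b powr r + norm w powr r)))"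
      using \<eta> by (intro mult_left_mono) (auto simp: \<eta>'_def)
    also have "\<dots> = \<eta> * (norm a powr r + norm b powr r + norm w powr r)"
      by (simp add: \<eta>'_def field_simps)
    finally show "\<bar>(duality_map r b - duality_map r a) \<bullet> w\<bar> \<le>
       \<eta> * (norm a powr r + norm b powr r + norm w powr r) + C * norm (b - a) powr r"
      using C(2)[of "(a, b, w)"] by simp
  qed
qed

section \<open>Lebesgue spaces\<close>

lemma Lp_spaceD:
  assumes "u \<in> Lp_space r \<Omega>"
  shows "u \<in> borel_measurable (lebesgue_on \<Omega>)" "integrable (lebesgue_on \<Omega>) (\<lambda>x. norm (u x) powr r)"
  using assms by (auto simp: Lp_space_def)

lemma Lp_norm_nonneg: "Lp_norm r \<Omega> u \<ge> 0"
  by (simp add: Lp_norm_def)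

lemma Lp_norm_powr: "r > 0 \<Longrightarrow> Lp_norm r \<Omega> u powr r = (LINT x|lebesgue_on \<Omega>. norm (u x) powr r)"
  by (simp add: Lp_norm_def powr_powr)

lemma Lp_norm_scale: "r > 0 \<Longrightarrow> Lp_norm r \<Omega> (\<lambda>x. c *\<^sub>R u x) = \<bar>c\<bar> * Lp_norm r \<Omega> u"
  by (simp add: Lp_norm_def powr_mult powr_powr)

lemma Lp_norm_minus_commute: "Lp_norm r \<Omega> (\<lambda>x. u x - v x) = Lp_norm r \<Omega> (\<lambda>x. v x - u x)"
  by (simp add: Lp_norm_def norm_minus_commute)

lemma Lp_norm_cong_AE:
  assumes "u \<in> borel_measurable (lebesgue_on \<Omega>)" "v \<in> borel_measurable (lebesgue_on \<Omega>)"
    "AE x in lebesgue_on \<Omega>. u x = v x"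
  shows "Lp_norm r \<Omega> u = Lp_norm r \<Omega> v"
proof -
  have "(LINT x|lebesgue_on \<Omega>. norm (u x) powr r) = (LINT x|lebesgue_on \<Omega>. norm (v x) powr r)"
    by (rule integral_cong_AE) (use assms in auto)
  then show ?thesis by (simp add: Lp_norm_def)
qed

lemma Lp_space_scale: "u \<in> Lp_space r \<Omega> \<Longrightarrow> (\<lambda>x. c *\<^sub>R u x) \<in> Lp_space r \<Omega>"
  by (auto simp: Lp_space_def powr_mult)

lemma Lp_space_minus: "u \<in> Lp_space r \<Omega> \<Longrightarrow> (\<lambda>x. - u x) \<in> Lp_space r \<Omega>"
  using Lp_space_scale[of u r \<Omega> "-1"] by simp

lemma Lp_space_add:
  assumes "r > 0" and u: "u \<in> Lp_space r \<Omega>" and v: "v \<in> Lp_space r \<Omega>"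
  shows "(\<lambda>x. u x + v x) \<in> Lp_space r \<Omega>"
  unfolding Lp_space_def
proof (intro CollectI conjI)
  note [measurable] = Lp_spaceD[OF u] Lp_spaceD[OF v]
  show "(\<lambda>x. u x + v x) \<in> borel_measurable (lebesgue_on \<Omega>)" by measurable
  have "norm (u x + v x) powr r \<le> 2 powr r * (norm (u x) powr r + norm (v x) powr r)" for x
    using powr_add_le[of "norm (u x)" "norm (v x)" r] \<open>r > 0\<close>
      powr_mono2[OF _ _ norm_triangle_ineq[of "u x" "v x"], of r] by simp
  note le = this
  show "integrable (lebesgue_on \<Omega>) (\<lambda>x. norm (u x + v x) powr r)"
    by (rule Bochner_Integration.integrable_bound[where
          f="\<lambda>x. 2 powr r * (norm (u x) powr r + norm (v x) powr r)"])
       (use Lp_spaceD(2)[OF u] Lp_spaceD(2)[OF v] le in auto)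
qed

lemma Lp_space_diff:
  assumes "r > 0" "u \<in> Lp_space r \<Omega>" "v \<in> Lp_space r \<Omega>"
  shows "(\<lambda>x. u x - v x) \<in> Lp_space r \<Omega>"
  using Lp_space_add[OF assms(1,2) Lp_space_minus[OF assms(3)]] by simp

lemma Lp_space_subset:
  assumes fin: "\<Omega> \<in> lmeasurable" and qr: "0 < q" "q \<le> r" and u: "u \<in> Lp_space r \<Omega>"
  shows "u \<in> Lp_space q \<Omega>"
  unfolding Lp_space_def
proof (intro CollectI conjI)
  note [measurable] = Lp_spaceD(1)[OF u]
  show "u \<in> borel_measurable (lebesgue_on \<Omega>)" by measurable
  interpret finite_measure "lebesgue_on \<Omega>" using fin by (rule finite_measure_lebesgue_on)
  have "norm (u x) powr q \<le> 1 + norm (u x) powr r" for x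
    using qr by (intro powr_le_one_plus) auto
  note le = this
  show "integrable (lebesgue_on \<Omega>) (\<lambda>x. norm (u x) powr q)"
    by (rule Bochner_Integration.integrable_bound[where f="\<lambda>x. 1 + norm (u x) powr r"])
       (use Lp_spaceD(2)[OF u] le in auto)
qed

text \<open>The pairing \<open>\<integral> \<bar>u\<bar>\<^sup>r\<^sup>-\<^sup>2 u \<cdot> w\<close>, so that all terms of the weak equation are values of it.\<close>
definition duality_pairing ::
  "real \<Rightarrow> 'a::euclidean_space set \<Rightarrow> ('a \<Rightarrow> 'b::euclidean_space) \<Rightarrow> ('a \<Rightarrow> 'b) \<Rightarrow> real" where
  "duality_pairing r \<Omega> u w = (LINT x|lebesgue_on \<Omega>. duality_map r (u x) \<bullet> w x)"

lemma duality_map_measurable [measurable]: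
  assumes "r > 1"
  shows "(duality_map r :: 'b::euclidean_space \<Rightarrow> 'b) \<in> borel_measurable borel"
  using continuous_duality_map[OF assms] by (rule borel_measurable_continuous_onI)

lemma integrable_duality:
  assumes r: "r > 1" and u: "u \<in> Lp_space r \<Omega>" and w: "w \<in> Lp_space r \<Omega>"
  shows "integrable (lebesgue_on \<Omega>) (\<lambda>x. duality_map r (u x) \<bullet> w x)"
proof (rule Bochner_Integration.integrable_bound)
  note [measurable] = Lp_spaceD[OF u] Lp_spaceD[OF w] duality_map_measurable[OF r]
  show "(\<lambda>x. duality_map r (u x) \<bullet> w x) \<in> borel_measurable (lebesgue_on \<Omega>)" by measurable
  show "integrable (lebesgue_on \<Omega>) (\<lambda>x. (r - 1) / r * norm (u x) powr r + norm (w x) powr r / r)"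
    by (intro Bochner_Integration.integrable_add integrable_mult_right integrable_divide Lp_spaceD[OF u] Lp_spaceD[OF w])
  show "AE x in lebesgue_on \<Omega>. norm (duality_map r (u x) \<bullet> w x)
     \<le> norm ((r - 1) / r * norm (u x) powr r + norm (w x) powr r / r)"
  proof (rule AE_I2)
    fix x
    show "norm (duality_map r (u x) \<bullet> w x) \<le> norm ((r - 1) / r * norm (u x) powr r + norm (w x) powr r / r)"
      using duality_map_inner_le[OF r, of "u x" "w x"] by simp
  qed
qed

lemma duality_pairing_add:
  assumes "r > 1" "u \<in> Lp_space r \<Omega>" "v \<in> Lp_space r \<Omega>" "w \<in> Lp_space r \<Omega>"
  shows "duality_pairing r \<Omega> u (\<lambda>x. v x + w x) = duality_pairing r \<Omega> u v + duality_pairing r \<Omega> u w"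
  unfolding duality_pairing_def inner_add_right
  by (intro Bochner_Integration.integral_add integrable_duality assms)

lemma duality_pairing_diff:
  assumes "r > 1" "u \<in> Lp_space r \<Omega>" "v \<in> Lp_space r \<Omega>" "w \<in> Lp_space r \<Omega>"
  shows "duality_pairing r \<Omega> u (\<lambda>x. v x - w x) = duality_pairing r \<Omega> u v - duality_pairing r \<Omega> u w"
  unfolding duality_pairing_def inner_diff_right
  by (intro Bochner_Integration.integral_diff integrable_duality assms)

lemma duality_pairing_scale: "duality_pairing r \<Omega> u (\<lambda>x. c *\<^sub>R w x) = c * duality_pairing r \<Omega> u w"
  by (simp add: duality_pairing_def)

lemma duality_pairing_scale_left:
  "t > 0 \<Longrightarrow> duality_pairing r \<Omega> (\<lambda>x. t *\<^sub>R u x) w = t powr (r - 1) * duality_pairing r \<Omega> u w"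
  by (simp add: duality_pairing_def duality_map_scale)

lemma duality_pairing_self: "r > 0 \<Longrightarrow> duality_pairing r \<Omega> u u = Lp_norm r \<Omega> u powr r"
  by (simp add: duality_pairing_def duality_map_inner_self Lp_norm_powr)

lemma duality_pairing_cong_AE:
  assumes r: "r > 1"
    and "u \<in> borel_measurable (lebesgue_on \<Omega>)" "u' \<in> borel_measurable (lebesgue_on \<Omega>)"
    and "w \<in> borel_measurable (lebesgue_on \<Omega>)" "w' \<in> borel_measurable (lebesgue_on \<Omega>)"
    and "AE x in lebesgue_on \<Omega>. u x = u' x" "AE x in lebesgue_on \<Omega>. w x = w' x"
  shows "duality_pairing r \<Omega> u w = duality_pairing r \<Omega> u' w'"
proof -
  note [measurable] = assms(2-5) duality_map_measurable[OF r]
  have "AE x in lebesgue_on \<Omega>. duality_map r (u x) \<bullet> w x = duality_map r (u' x) \<bullet> w' x"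
    using assms(6,7) by eventually_elim simp
  then show ?thesis unfolding duality_pairing_def by (intro integral_cong_AE) measurable
qed

lemma Lp_norm_eq_0_AE:
  assumes r: "r > 0" and u: "u \<in> Lp_space r \<Omega>" and 0: "Lp_norm r \<Omega> u = 0"
  shows "AE x in lebesgue_on \<Omega>. u x = 0"
proof -
  have "(LINT x|lebesgue_on \<Omega>. norm (u x) powr r) = 0"
    using Lp_norm_powr[OF r, of \<Omega> u] 0 by simp
  then have "AE x in lebesgue_on \<Omega>. norm (u x) powr r = 0"
    using integral_nonneg_eq_0_iff_AE[OF Lp_spaceD(2)[OF u]] by simp
  then show ?thesis by simp
qed

text \<open>Young's inequality for normalised functions; this also yields the triangle inequality for the norm, by
testing \<open>u + v\<close> against itself.\<close>
lemma duality_pairing_Holder: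
  assumes r: "r > 1" and u: "u \<in> Lp_space r \<Omega>" and w: "w \<in> Lp_space r \<Omega>"
  shows "\<bar>duality_pairing r \<Omega> u w\<bar> \<le> Lp_norm r \<Omega> u powr (r - 1) * Lp_norm r \<Omega> w"
proof -
  note meas = Lp_spaceD(1)[OF u] Lp_spaceD(1)[OF w]
  have r0: "r > 0" using r by simp
  have main: "\<bar>duality_pairing r \<Omega> a b\<bar> \<le> (r - 1) / r * Lp_norm r \<Omega> a powr r + Lp_norm r \<Omega> b powr r / r"
    if a: "a \<in> Lp_space r \<Omega>" and b: "b \<in> Lp_space r \<Omega>" for a b :: "'a \<Rightarrow> 'b"
  proof -
    have "\<bar>duality_pairing r \<Omega> a b\<bar> \<le> (LINT x|lebesgue_on \<Omega>. \<bar>duality_map r (a x) \<bullet> b x\<bar>)"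
      unfolding duality_pairing_def by (rule integral_abs_bound)
    also have "\<dots> \<le> (LINT x|lebesgue_on \<Omega>. (r - 1) / r * norm (a x) powr r + norm (b x) powr r / r)"
      by (intro integral_mono integrable_abs integrable_duality[OF r a b] duality_map_inner_le[OF r]
          Bochner_Integration.integrable_add integrable_mult_right integrable_divide Lp_spaceD[OF a] Lp_spaceD[OF b])
    also have "\<dots> = (r - 1) / r * Lp_norm r \<Omega> a powr r + Lp_norm r \<Omega> b powr r / r"
      using Lp_spaceD[OF a] Lp_spaceD[OF b] by (simp add: Lp_norm_powr[OF r0])
    finally show ?thesis .
  qed
  consider "Lp_norm r \<Omega> u = 0" | "Lp_norm r \<Omega> w = 0" | "Lp_norm r \<Omega> u > 0" "Lp_norm r \<Omega> w > 0"
    using Lp_norm_nonneg[of r \<Omega> u] Lp_norm_nonneg[of r \<Omega> w] by linarith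
  then show ?thesis
  proof cases
    case 1
    have "duality_pairing r \<Omega> u w = duality_pairing r \<Omega> (\<lambda>x. 0) w"
      using Lp_norm_eq_0_AE[OF r0 u 1] by (intro duality_pairing_cong_AE[OF r]) (use meas in auto)
    then show ?thesis by (simp add: duality_pairing_def Lp_norm_nonneg)
  next
    case 2
    have "duality_pairing r \<Omega> u w = duality_pairing r \<Omega> u (\<lambda>x. 0)"
      using Lp_norm_eq_0_AE[OF r0 w 2] by (intro duality_pairing_cong_AE[OF r]) (use meas in auto)
    then show ?thesis by (simp add: duality_pairing_def Lp_norm_nonneg)
  next
    case 3
    let ?s = "Lp_norm r \<Omega> u" and ?t = "Lp_norm r \<Omega> w"
    have "\<bar>duality_pairing r \<Omega> (\<lambda>x. (1 / ?s) *\<^sub>R u x) (\<lambda>x. (1 / ?t) *\<^sub>R w x)\<bar> \<le>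
       (r - 1) / r * 1 powr r + 1 powr r / r"
      using main[OF Lp_space_scale[OF u, of "1 / ?s"] Lp_space_scale[OF w, of "1 / ?t"]] 3
      by (simp add: Lp_norm_scale[OF r0])
    also have "\<dots> = 1" using r by (simp add: field_simps)
    finally have "\<bar>duality_pairing r \<Omega> (\<lambda>x. (1 / ?s) *\<^sub>R u x) (\<lambda>x. (1 / ?t) *\<^sub>R w x)\<bar> \<le> 1" .
    moreover have "duality_pairing r \<Omega> (\<lambda>x. (1 / ?s) *\<^sub>R u x) (\<lambda>x. (1 / ?t) *\<^sub>R w x) =
       duality_pairing r \<Omega> u w / (?s powr (r - 1) * ?t)"
      using 3 by (simp only: duality_pairing_scale) (simp add: duality_pairing_scale_left powr_divide field_simps)
    ultimately show ?thesis using 3 by (simp add: abs_mult field_simps)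
  qed
qed

lemma Lp_norm_triangle:
  assumes r: "r > 1" and u: "u \<in> Lp_space r \<Omega>" and v: "v \<in> Lp_space r \<Omega>"
  shows "Lp_norm r \<Omega> (\<lambda>x. u x + v x) \<le> Lp_norm r \<Omega> u + Lp_norm r \<Omega> v"
proof -
  let ?w = "\<lambda>x. u x + v x"
  have w: "?w \<in> Lp_space r \<Omega>" using r by (intro Lp_space_add u v) auto
  let ?n = "Lp_norm r \<Omega> ?w"
  have "?n powr r = duality_pairing r \<Omega> ?w ?w" using duality_pairing_self[of r \<Omega> ?w] r by simp
  also have "\<dots> = duality_pairing r \<Omega> ?w u + duality_pairing r \<Omega> ?w v"
    by (rule duality_pairing_add[OF r w u v])
  also have "\<dots> \<le> ?n powr (r - 1) * Lp_norm r \<Omega> u + ?n powr (r - 1) * Lp_norm r \<Omega> v"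
    using duality_pairing_Holder[OF r w u] duality_pairing_Holder[OF r w v] by linarith
  finally have le: "?n powr r \<le> ?n powr (r - 1) * (Lp_norm r \<Omega> u + Lp_norm r \<Omega> v)" by (simp add: distrib_left)
  have eq: "?n powr r = ?n powr (r - 1) * ?n"
    using powr_mult_base[OF Lp_norm_nonneg, of r \<Omega> ?w "r - 1"] by (simp add: mult.commute)
  show ?thesis
  proof (cases "?n = 0")
    case True
    then show ?thesis using Lp_norm_nonneg[of r \<Omega> u] Lp_norm_nonneg[of r \<Omega> v] by linarith
  next
    case False
    then have "?n powr (r - 1) > 0" by simp
    then show ?thesis
      using le eq by (simp only: mult_le_cancel_left_pos)
  qed
qed

lemma Lp_norm_diff_le:
  assumes r: "r > 1" and u: "u \<in> Lp_space r \<Omega>" and v: "v \<in> Lp_space r \<Omega>"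
  shows "\<bar>Lp_norm r \<Omega> u - Lp_norm r \<Omega> v\<bar> \<le> Lp_norm r \<Omega> (\<lambda>x. u x - v x)"
  using Lp_norm_triangle[OF r v Lp_space_diff[OF _ u v]] Lp_norm_triangle[OF r u Lp_space_diff[OF _ v u]] r
    Lp_norm_minus_commute[of r \<Omega> u v] by simp

lemma Lp_norm_embedding:
  assumes fin: "\<Omega> \<in> lmeasurable" and qr: "0 < q" "q \<le> r"
  shows "\<exists>K\<ge>0. \<forall>u::'a::euclidean_space \<Rightarrow> 'b::euclidean_space. u \<in> Lp_space r \<Omega> \<longrightarrow> Lp_norm q \<Omega> u \<le> K * Lp_norm r \<Omega> u"
proof -
  interpret finite_measure "lebesgue_on \<Omega>" using fin by (rule finite_measure_lebesgue_on)
  define m where "m = measure (lebesgue_on \<Omega>) (space (lebesgue_on \<Omega>))"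
  have r: "r > 0" using qr by simp
  have key: "Lp_norm q \<Omega> u \<le> (m + 1) powr (1 / q)" if u: "u \<in> Lp_space r \<Omega>" and 1: "Lp_norm r \<Omega> u = 1"
    for u :: "'a \<Rightarrow> 'b"
  proof -
    have "norm (u x) powr q \<le> 1 + norm (u x) powr r" for x
      using qr by (intro powr_le_one_plus) auto
    then have "(LINT x|lebesgue_on \<Omega>. norm (u x) powr q) \<le> (LINT x|lebesgue_on \<Omega>. 1 + norm (u x) powr r)"
      by (intro integral_mono Lp_spaceD(2)[OF Lp_space_subset[OF fin qr u]])
         (auto intro!: Bochner_Integration.integrable_add Lp_spaceD[OF u])
    also have "\<dots> = m + 1"
      using Lp_spaceD[OF u] Lp_norm_powr[OF r, of \<Omega> u] 1 by (simp add: m_def)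
    finally show ?thesis
      unfolding Lp_norm_def using qr by (intro powr_mono2 Bochner_Integration.integral_nonneg) auto
  qed
  show ?thesis
  proof (intro exI[of _ "(m + 1) powr (1 / q)"] conjI allI impI)
    fix u :: "'a \<Rightarrow> 'b" assume u: "u \<in> Lp_space r \<Omega>"
    let ?n = "Lp_norm r \<Omega> u"
    show "Lp_norm q \<Omega> u \<le> (m + 1) powr (1 / q) * ?n"
    proof (cases "?n = 0")
      case True
      have "Lp_norm q \<Omega> u = Lp_norm q \<Omega> (\<lambda>_. 0 :: 'b)"
        by (rule Lp_norm_cong_AE) (use Lp_norm_eq_0_AE[OF r u True] Lp_spaceD[OF u] in auto)
      then show ?thesis using True by (simp add: Lp_norm_def)
    next
      case False
      then have n: "?n > 0" using Lp_norm_nonneg[of r \<Omega> u] by linarith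
      have "Lp_norm q \<Omega> (\<lambda>x. (1 / ?n) *\<^sub>R u x) \<le> (m + 1) powr (1 / q)"
        by (rule key[OF Lp_space_scale[OF u]]) (use n in \<open>simp add: Lp_norm_scale[OF r]\<close>)
      then show ?thesis using n qr by (simp add: Lp_norm_scale field_simps)
    qed
  qed simp
qed

lemma duality_pairing_uniformly_continuous:
  assumes r: "r > 1" and \<eta>: "\<eta> > 0"
  shows "\<exists>s>0. \<forall>u v w :: 'a::euclidean_space \<Rightarrow> 'b::euclidean_space.
    u \<in> Lp_space r \<Omega> \<longrightarrow> v \<in> Lp_space r \<Omega> \<longrightarrow> w \<in> Lp_space r \<Omega> \<longrightarrow> Lp_norm r \<Omega> u \<le> R \<longrightarrow>
    Lp_norm r \<Omega> (\<lambda>x. v x - u x) \<le> s \<longrightarrow>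
    \<bar>duality_pairing r \<Omega> v w - duality_pairing r \<Omega> u w\<bar> \<le> \<eta> * Lp_norm r \<Omega> w"
proof -
  have r0: "r > 0" using r by simp
  define Q where "Q = \<bar>R\<bar> powr r + (\<bar>R\<bar> + 1) powr r + 1"
  have Q: "Q > 0" by (simp add: Q_def add_nonneg_pos)
  obtain C where C: "C \<ge> 0" "\<And>a b w :: 'b. \<bar>(duality_map r b - duality_map r a) \<bullet> w\<bar> \<le>
     \<eta> / (2 * Q) * (norm a powr r + norm b powr r + norm w powr r) + C * norm (b - a) powr r"
    using duality_map_uniformly_continuous[OF r, of "\<eta> / (2 * Q)"] \<eta> Q by force
  define s where "s = min 1 ((\<eta> / (2 * (C + 1))) powr (1 / r))"
  have s: "s > 0" "s \<le> 1" using \<eta> C by (auto simp: s_def)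
  have sr: "s powr r \<le> \<eta> / (2 * (C + 1))"
  proof -
    have "s powr r \<le> ((\<eta> / (2 * (C + 1))) powr (1 / r)) powr r"
      using s r by (intro powr_mono2) (auto simp: s_def)
    then show ?thesis using r \<eta> C by (simp add: powr_powr)
  qed
  have key: "\<bar>duality_pairing r \<Omega> v w - duality_pairing r \<Omega> u w\<bar> \<le> \<eta>"
    if u: "u \<in> Lp_space r \<Omega>" and v: "v \<in> Lp_space r \<Omega>" and w: "w \<in> Lp_space r \<Omega>"
      and nu: "Lp_norm r \<Omega> u \<le> R" and d: "Lp_norm r \<Omega> (\<lambda>x. v x - u x) \<le> s" and w1: "Lp_norm r \<Omega> w = 1"
    for u v w :: "'a \<Rightarrow> 'b"
  proof -
    let ?d = "\<lambda>x. v x - u x"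
    have dL: "?d \<in> Lp_space r \<Omega>" using r0 by (intro Lp_space_diff u v)
    have nv: "Lp_norm r \<Omega> v \<le> \<bar>R\<bar> + 1"
      using Lp_norm_triangle[OF r u dL] nu d s by simp
    note ints = Lp_spaceD(2)[OF u] Lp_spaceD(2)[OF v] Lp_spaceD(2)[OF w] Lp_spaceD(2)[OF dL]
    have "\<bar>duality_pairing r \<Omega> v w - duality_pairing r \<Omega> u w\<bar> =
       \<bar>LINT x|lebesgue_on \<Omega>. (duality_map r (v x) - duality_map r (u x)) \<bullet> w x\<bar>"
      unfolding duality_pairing_def inner_diff_left
      by (subst Bochner_Integration.integral_diff) (auto intro: integrable_duality r u v w)
    also have "\<dots> \<le> (LINT x|lebesgue_on \<Omega>. \<bar>(duality_map r (v x) - duality_map r (u x)) \<bullet> w x\<bar>)"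
      by (rule integral_abs_bound)
    also have "\<dots> \<le> (LINT x|lebesgue_on \<Omega>. \<eta> / (2 * Q) * (norm (u x) powr r + norm (v x) powr r + norm (w x) powr r) + C * norm (v x - u x) powr r)"
    proof (rule integral_mono)
      show "integrable (lebesgue_on \<Omega>) (\<lambda>x. \<bar>(duality_map r (v x) - duality_map r (u x)) \<bullet> w x\<bar>)"
        unfolding inner_diff_left
        by (intro integrable_abs Bochner_Integration.integrable_diff integrable_duality r u v w)
      show "integrable (lebesgue_on \<Omega>) (\<lambda>x. \<eta> / (2 * Q) * (norm (u x) powr r + norm (v x) powr r + norm (w x) powr r) + C * norm (v x - u x) powr r)"
        by (intro Bochner_Integration.integrable_add integrable_mult_right ints)
    qed (use C in blast)
    also have "\<dots> = \<eta> / (2 * Q) * (Lp_norm r \<Omega> u powr r + Lp_norm r \<Omega> v powr r + 1) + C * Lp_norm r \<Omega> ?d powr r"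
      using ints w1 Lp_norm_powr[OF r0, of \<Omega> w] by (simp add: Lp_norm_powr[OF r0])
    also have "\<dots> \<le> \<eta> / (2 * Q) * Q + C * s powr r"
      unfolding Q_def using \<eta> Q C(1) nu nv d r0
      by (intro add_mono mult_left_mono powr_mono2 Lp_norm_nonneg order.refl) (auto simp: Q_def)
    also have "C * s powr r \<le> C * (\<eta> / (2 * (C + 1)))" using sr C by (intro mult_left_mono)
    also have "\<dots> \<le> \<eta> / 2" using C \<eta> by (simp add: field_simps)
    finally show ?thesis using Q by simp
  qed
  show ?thesis
  proof (intro exI[of _ s] conjI s(1) allI impI)
    fix u v w :: "'a \<Rightarrow> 'b"
    assume u: "u \<in> Lp_space r \<Omega>" and v: "v \<in> Lp_space r \<Omega>" and w: "w \<in> Lp_space r \<Omega>"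
      and nu: "Lp_norm r \<Omega> u \<le> R" and d: "Lp_norm r \<Omega> (\<lambda>x. v x - u x) \<le> s"
    let ?n = "Lp_norm r \<Omega> w"
    show "\<bar>duality_pairing r \<Omega> v w - duality_pairing r \<Omega> u w\<bar> \<le> \<eta> * ?n"
    proof (cases "?n = 0")
      case True
      then show ?thesis using duality_pairing_Holder[OF r v w] duality_pairing_Holder[OF r u w] by simp
    next
      case False
      then have n: "?n > 0" using Lp_norm_nonneg[of r \<Omega> w] by linarith
      have "\<bar>duality_pairing r \<Omega> v (\<lambda>x. (1 / ?n) *\<^sub>R w x) - duality_pairing r \<Omega> u (\<lambda>x. (1 / ?n) *\<^sub>R w x)\<bar> \<le> \<eta>"
        by (rule key[OF u v Lp_space_scale[OF w] nu d]) (use n in \<open>simp add: Lp_norm_scale[OF r0]\<close>)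
      then show ?thesis using n
        by (simp only: duality_pairing_scale flip: right_diff_distrib) (simp add: abs_mult field_simps)
    qed
  qed
qed

text \<open>The convexity inequality, used at both endpoints, bounds the remainder of the first-order expansion
by the variation of the derivative.\<close>
lemma Lp_norm_powr_derivative:
  assumes r: "r > 1" and u: "u \<in> Lp_space r \<Omega>" and v: "v \<in> Lp_space r \<Omega>"
  shows "\<bar>Lp_norm r \<Omega> v powr r - Lp_norm r \<Omega> u powr r - r * duality_pairing r \<Omega> u (\<lambda>x. v x - u x)\<bar>
     \<le> r * \<bar>duality_pairing r \<Omega> v (\<lambda>x. v x - u x) - duality_pairing r \<Omega> u (\<lambda>x. v x - u x)\<bar>"
proof -
  have r0: "r > 0" using r by simp
  have tangent: "r * duality_pairing r \<Omega> a (\<lambda>x. b x - a x) \<le> Lp_norm r \<Omega> b powr r - Lp_norm r \<Omega> a powr r"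
    if a: "a \<in> Lp_space r \<Omega>" and b: "b \<in> Lp_space r \<Omega>" for a b :: "'a \<Rightarrow> 'b"
  proof -
    have "r * duality_pairing r \<Omega> a (\<lambda>x. b x - a x) = (LINT x|lebesgue_on \<Omega>. r * (duality_map r (a x) \<bullet> (b x - a x)))"
      by (simp add: duality_pairing_def)
    also have "\<dots> \<le> (LINT x|lebesgue_on \<Omega>. norm (b x) powr r - norm (a x) powr r)"
      by (intro integral_mono duality_map_tangent_le[OF r] integrable_mult_right integrable_duality r a b
          Lp_space_diff r0 Bochner_Integration.integrable_diff Lp_spaceD[OF a] Lp_spaceD[OF b])
    also have "\<dots> = Lp_norm r \<Omega> b powr r - Lp_norm r \<Omega> a powr r"
      using Lp_spaceD[OF a] Lp_spaceD[OF b] by (simp add: Lp_norm_powr[OF r0])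
    finally show ?thesis .
  qed
  have "duality_pairing r \<Omega> v (\<lambda>x. u x - v x) = - duality_pairing r \<Omega> v (\<lambda>x. v x - u x)"
    using duality_pairing_scale[of r \<Omega> v "-1" "\<lambda>x. v x - u x"] by simp
  then have "Lp_norm r \<Omega> v powr r - Lp_norm r \<Omega> u powr r \<le> r * duality_pairing r \<Omega> v (\<lambda>x. v x - u x)"
    using tangent[OF v u] by simp
  moreover note tangent[OF u v]
  moreover have "r * \<bar>duality_pairing r \<Omega> v (\<lambda>x. v x - u x) - duality_pairing r \<Omega> u (\<lambda>x. v x - u x)\<bar> \<ge>
     r * duality_pairing r \<Omega> v (\<lambda>x. v x - u x) - r * duality_pairing r \<Omega> u (\<lambda>x. v x - u x)"
    using r by (simp flip: right_diff_distrib)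
  ultimately show ?thesis by linarith
qed

lemma duality_pairing_monotone:
  assumes r: "r > 1" and u: "u \<in> Lp_space r \<Omega>" and v: "v \<in> Lp_space r \<Omega>"
  shows "duality_pairing r \<Omega> u (\<lambda>x. u x - v x) - duality_pairing r \<Omega> v (\<lambda>x. u x - v x) \<ge> 0"
proof -
  have d: "(\<lambda>x. u x - v x) \<in> Lp_space r \<Omega>" using r by (intro Lp_space_diff u v) auto
  have "duality_pairing r \<Omega> u (\<lambda>x. u x - v x) - duality_pairing r \<Omega> v (\<lambda>x. u x - v x) =
    (LINT x|lebesgue_on \<Omega>. (duality_map r (u x) - duality_map r (v x)) \<bullet> (u x - v x))"
    unfolding duality_pairing_def inner_diff_left
    by (subst Bochner_Integration.integral_diff) (auto intro: integrable_duality r u v d)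
  also have "\<dots> \<ge> 0" by (intro Bochner_Integration.integral_nonneg duality_map_monotone[OF r])
  finally show ?thesis .
qed

text \<open>The property \<open>(S\<^sub>+)\<close> of the \<open>p\<close>-Laplacian in quantitative form: on bounded sets, smallness of the
monotonicity expression forces smallness of the distance in norm.\<close>
lemma duality_pairing_strongly_monotone:
  assumes r: "r > 1" and e: "e > 0"
  shows "\<exists>s>0. \<forall>u v :: 'a::euclidean_space \<Rightarrow> 'b::euclidean_space.
    u \<in> Lp_space r \<Omega> \<longrightarrow> v \<in> Lp_space r \<Omega> \<longrightarrow> Lp_norm r \<Omega> u \<le> R \<longrightarrow> Lp_norm r \<Omega> v \<le> R \<longrightarrow>
    duality_pairing r \<Omega> u (\<lambda>x. u x - v x) - duality_pairing r \<Omega> v (\<lambda>x. u x - v x) \<le> s \<longrightarrow>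
    Lp_norm r \<Omega> (\<lambda>x. u x - v x) \<le> e"
proof -
  have r0: "r > 0" using r by simp
  define Q where "Q = 2 * \<bar>R\<bar> powr r + 1"
  have Q: "Q > 0" by (simp add: Q_def add_nonneg_pos)
  define \<eta> where "\<eta> = e powr r / (2 * Q)"
  have \<eta>: "\<eta> > 0" using e Q by (simp add: \<eta>_def)
  obtain C where C: "C \<ge> 0" "\<And>a b :: 'b. norm (a - b) powr r \<le>
     \<eta> * (norm a powr r + norm b powr r) + C * ((duality_map r a - duality_map r b) \<bullet> (a - b))"
    using duality_map_strongly_monotone[OF r \<eta>] by blast
  define s where "s = e powr r / (2 * (C + 1))"
  have s: "s > 0" using e C by (simp add: s_def)
  show ?thesis
  proof (intro exI[of _ s] conjI s allI impI)
    fix u v :: "'a \<Rightarrow> 'b"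
    assume u: "u \<in> Lp_space r \<Omega>" and v: "v \<in> Lp_space r \<Omega>"
      and nu: "Lp_norm r \<Omega> u \<le> R" and nv: "Lp_norm r \<Omega> v \<le> R"
      and le: "duality_pairing r \<Omega> u (\<lambda>x. u x - v x) - duality_pairing r \<Omega> v (\<lambda>x. u x - v x) \<le> s"
    let ?d = "\<lambda>x. u x - v x"
    have d: "?d \<in> Lp_space r \<Omega>" using r by (intro Lp_space_diff u v) auto
    note ints = Lp_spaceD(2)[OF u] Lp_spaceD(2)[OF v] Lp_spaceD(2)[OF d]
    have eq: "duality_pairing r \<Omega> u ?d - duality_pairing r \<Omega> v ?d =
      (LINT x|lebesgue_on \<Omega>. (duality_map r (u x) - duality_map r (v x)) \<bullet> (u x - v x))"
      unfolding duality_pairing_def inner_diff_left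
      by (subst Bochner_Integration.integral_diff) (auto intro: integrable_duality r u v d)
    have i: "integrable (lebesgue_on \<Omega>) (\<lambda>x. (duality_map r (u x) - duality_map r (v x)) \<bullet> (u x - v x))"
      unfolding inner_diff_left
      by (intro Bochner_Integration.integrable_diff integrable_duality r u v d)
    have "Lp_norm r \<Omega> ?d powr r = (LINT x|lebesgue_on \<Omega>. norm (u x - v x) powr r)" by (rule Lp_norm_powr[OF r0])
    also have "\<dots> \<le> (LINT x|lebesgue_on \<Omega>. \<eta> * (norm (u x) powr r + norm (v x) powr r) +
         C * ((duality_map r (u x) - duality_map r (v x)) \<bullet> (u x - v x)))"
      by (intro integral_mono C(2) Bochner_Integration.integrable_add integrable_mult_right ints i)
    also have "\<dots> = \<eta> * (Lp_norm r \<Omega> u powr r + Lp_norm r \<Omega> v powr r) + C * (duality_pairing r \<Omega> u ?d - duality_pairing r \<Omega> v ?d)"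
      unfolding eq using ints i by (simp add: Lp_norm_powr[OF r0])
    also have "\<dots> \<le> \<eta> * (\<bar>R\<bar> powr r + \<bar>R\<bar> powr r) + C * s"
      using \<eta> C(1) le nu nv r0 by (intro add_mono mult_left_mono powr_mono2 Lp_norm_nonneg) auto
    also have "\<dots> \<le> \<eta> * Q + C * s" using \<eta> C(1) by (intro add_mono mult_left_mono) (auto simp: Q_def)
    also have "\<eta> * Q = e powr r / 2" using Q by (simp add: \<eta>_def)
    also have "C * s \<le> e powr r / 2" using C e by (simp add: s_def field_simps)
    finally have "Lp_norm r \<Omega> ?d powr r \<le> e powr r" by simp
    then show "Lp_norm r \<Omega> ?d \<le> e"
      using e r0 powr_less_mono2[of r e "Lp_norm r \<Omega> ?d"] by (meson less_imp_le not_le)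
  qed
qed

section \<open>Smooth functions\<close>

lemma grad_eqI:
  assumes "(f has_derivative (\<lambda>h. g \<bullet> h)) (at x)"
  shows "grad f x = g"
proof -
  have "frechet_derivative f (at x) = (\<lambda>h. g \<bullet> h)" using frechet_derivative_at[OF assms] by simp
  then show ?thesis by (simp add: grad_def euclidean_representation)
qed

lemma has_derivative_grad:
  assumes "f differentiable (at x)"
  shows "(f has_derivative (\<lambda>h. grad f x \<bullet> h)) (at x)"
proof -
  have d: "(f has_derivative frechet_derivative f (at x)) (at x)"
    using assms frechet_derivative_works by blast
  then have lin: "linear (frechet_derivative f (at x))" by (rule has_derivative_linear)
  have "frechet_derivative f (at x) h = grad f x \<bullet> h" for h
  proof -
    have "frechet_derivative f (at x) h = frechet_derivative f (at x) (\<Sum>i\<in>Basis. (h \<bullet> i) *\<^sub>R i)"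
      by (simp add: euclidean_representation)
    also have "\<dots> = grad f x \<bullet> h"
      by (simp add: linear_sum[OF lin] linear_cmul[OF lin] grad_def inner_sum_left inner_commute[of h] mult.commute)
    finally show ?thesis .
  qed
  then have "frechet_derivative f (at x) = (\<lambda>h. grad f x \<bullet> h)" by auto
  then show ?thesis using d by simp
qed

lemma Ck_SucD:
  assumes "Ck (Suc k) f"
  shows "\<And>x. f differentiable (at x)" "\<And>x. (f has_derivative (\<lambda>h. grad f x \<bullet> h)) (at x)"
    "\<And>i. i \<in> Basis \<Longrightarrow> Ck k (\<lambda>x. grad f x \<bullet> i)"
  using assms by (auto simp: differentiable_on_def intro: has_derivative_grad)

lemma Ck_SucI:
  assumes "\<And>x. (f has_derivative (\<lambda>h. g x \<bullet> h)) (at x)" "\<And>i. i \<in> Basis \<Longrightarrow> Ck k (\<lambda>x. g x \<bullet> i)"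
  shows "Ck (Suc k) f"
  using assms grad_eqI[OF assms(1)] by (auto simp: differentiable_on_def intro!: differentiableI)

lemma Ck_Suc_imp: "Ck (Suc k) f \<Longrightarrow> Ck k f"
proof (induction k arbitrary: f)
  case 0
  then show ?case by (auto intro: differentiable_imp_continuous_on)
next
  case (Suc k)
  show ?case
    by (rule Ck_SucI[OF Ck_SucD(2)[OF Suc.prems]]) (intro Suc.IH Ck_SucD(3)[OF Suc.prems])
qed

lemma Ck_const: "Ck k (\<lambda>x. c)"
proof (induction k arbitrary: c)
  case (Suc k)
  have "((\<lambda>x::'a. c) has_derivative (\<lambda>h. 0 \<bullet> h)) (at x)" for x by simp
  then show ?case by (rule Ck_SucI) (simp add: Suc)
qed simp

lemma Ck_add: "Ck k f \<Longrightarrow> Ck k g \<Longrightarrow> Ck k (\<lambda>x. f x + g x)"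
proof (induction k arbitrary: f g)
  case 0
  then show ?case by (auto intro: continuous_intros)
next
  case (Suc k)
  show ?case
  proof (rule Ck_SucI)
    show "((\<lambda>x. f x + g x) has_derivative (\<lambda>h. (grad f x + grad g x) \<bullet> h)) (at x)" for x
      unfolding inner_add_left by (intro has_derivative_add Ck_SucD(2)[OF Suc.prems(1)] Ck_SucD(2)[OF Suc.prems(2)])
    show "Ck k (\<lambda>x. (grad f x + grad g x) \<bullet> i)" if "i \<in> Basis" for i
      unfolding inner_add_left by (intro Suc.IH Ck_SucD(3)[OF Suc.prems(1) that] Ck_SucD(3)[OF Suc.prems(2) that])
  qed
qed

lemma Ck_mult: "Ck k f \<Longrightarrow> Ck k g \<Longrightarrow> Ck k (\<lambda>x. f x * g x)"
proof (induction k arbitrary: f g)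
  case 0
  then show ?case by (auto intro: continuous_intros)
next
  case (Suc k)
  note f = Ck_SucD[OF Suc.prems(1)] and g = Ck_SucD[OF Suc.prems(2)]
  show ?case
  proof (rule Ck_SucI)
    show "((\<lambda>x. f x * g x) has_derivative (\<lambda>h. (f x *\<^sub>R grad g x + g x *\<^sub>R grad f x) \<bullet> h)) (at x)" for x
      using has_derivative_mult[OF f(2)[of x] g(2)[of x]] by (simp add: inner_add_left mult.commute)
    show "Ck k (\<lambda>x. (f x *\<^sub>R grad g x + g x *\<^sub>R grad f x) \<bullet> i)" if "i \<in> Basis" for i
      unfolding inner_add_left inner_scaleR_left
      by (rule Ck_add[OF Suc.IH[OF Ck_Suc_imp[OF Suc.prems(1)] g(3)[OF that]]
            Suc.IH[OF Ck_Suc_imp[OF Suc.prems(2)] f(3)[OF that]]])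
  qed
qed

lemma Ck_prod: "finite I \<Longrightarrow> (\<And>i. i \<in> I \<Longrightarrow> Ck k (f i)) \<Longrightarrow> Ck k (\<lambda>x. \<Prod>i\<in>I. f i x)"
  by (induction I rule: finite_induct) (auto intro: Ck_const Ck_mult)

text \<open>Smoothness of a function of one linear coordinate, for any class of functions on the line closed under
differentiation.\<close>
lemma Ck_ridge:
  assumes closed_under_deriv: "\<And>\<psi>. \<psi> \<in> F \<Longrightarrow> \<exists>\<psi>'\<in>F. \<forall>t. (\<psi> has_real_derivative \<psi>' t) (at t)"
    and "\<psi> \<in> F"
  shows "Ck k (\<lambda>x. \<psi> (b \<bullet> x + a))"
  using \<open>\<psi> \<in> F\<close>
proof (induction k arbitrary: \<psi>)
  case 0
  obtain \<psi>' where "\<And>t. (\<psi> has_real_derivative \<psi>' t) (at t)" using closed_under_deriv[OF 0] by blast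
  then have "continuous_on UNIV \<psi>" by (intro DERIV_continuous_on) auto
  then show ?case by (auto intro!: continuous_on_compose2[of UNIV \<psi>] continuous_intros)
next
  case (Suc k)
  obtain \<psi>' where d: "\<psi>' \<in> F" "\<And>t. (\<psi> has_real_derivative \<psi>' t) (at t)"
    using closed_under_deriv[OF Suc.prems] by blast
  show ?case
  proof (rule Ck_SucI)
    fix x
    have "((\<lambda>x. b \<bullet> x + a) has_derivative (\<lambda>h. b \<bullet> h)) (at x)" by (auto intro!: derivative_eq_intros)
    from DERIV_compose_FDERIV[OF d(2) this]
    show "((\<lambda>x. \<psi> (b \<bullet> x + a)) has_derivative (\<lambda>h. (\<psi>' (b \<bullet> x + a) *\<^sub>R b) \<bullet> h)) (at x)"
      by (simp add: mult.commute)
  next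
    fix i :: 'a assume "i \<in> Basis"
    show "Ck k (\<lambda>x. (\<psi>' (b \<bullet> x + a) *\<^sub>R b) \<bullet> i)"
      unfolding inner_scaleR_left by (intro Ck_mult Ck_const Suc.IH d)
  qed
qed

text \<open>The functions \<open>p(1/t) e\<^sup>-\<^sup>1\<^sup>/\<^sup>t\<close>, continued by \<open>0\<close> to \<open>t \<le> 0\<close>. The polynomial factor makes this class closed
under differentiation; \<open>p = 1\<close> is the standard smooth step.\<close>
definition flat :: "real poly \<Rightarrow> real \<Rightarrow> real" where
  "flat p t = (if t > 0 then poly p (1 / t) * exp (- (1 / t)) else 0)"

lemma poly_over_exp_tendsto_0: "((\<lambda>s. poly p s * exp (- s)) \<longlongrightarrow> (0::real)) at_top"
proof -
  have "((\<lambda>s. \<Sum>i\<le>degree p. Polynomial.coeff p i * (s ^ i / exp s)) \<longlongrightarrow> (\<Sum>i\<le>degree p. Polynomial.coeff p i * 0)) at_top"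
    by (intro tendsto_sum tendsto_mult tendsto_const tendsto_power_div_exp_0)
  then show ?thesis
    by (simp add: poly_altdef sum_distrib_right exp_minus divide_inverse mult.assoc)
qed

lemma flat_tendsto_0: "(flat p \<longlongrightarrow> 0) (at 0)"
proof (rule filterlim_split_at)
  have "((\<lambda>t. poly p (1 / t) * exp (- (1 / t))) \<longlongrightarrow> 0) (at_right 0)"
    using filterlim_compose[OF poly_over_exp_tendsto_0 filterlim_inverse_at_top_right]
    by (simp add: inverse_eq_divide)
  then show "(flat p \<longlongrightarrow> 0) (at_right 0)"
    by (rule Lim_transform_eventually) (auto simp: flat_def eventually_at_right_less eventually_at_filter)
  have "((\<lambda>t. 0) \<longlongrightarrow> 0) (at_left (0::real))" by simp
  then show "(flat p \<longlongrightarrow> 0) (at_left 0)"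
    by (rule Lim_transform_eventually) (auto simp: flat_def eventually_at_filter)
qed

lemma flat_derivative:
  "(flat p has_real_derivative flat ([:0, 0, 1:] * (p - pderiv p)) t) (at t)"
proof -
  let ?q = "[:0, 0, 1:] * (p - pderiv p)"
  consider "t > 0" | "t < 0" | "t = 0" by linarith
  then show ?thesis
  proof cases
    case 1
    have "((\<lambda>t. poly p (1 / t) * exp (- (1 / t))) has_real_derivative flat ?q t) (at t)"
      using 1 by (auto intro!: derivative_eq_intros simp: flat_def field_simps power2_eq_square)
    then show ?thesis
      by (rule has_field_derivative_transform_within_open[of _ _ _ "{0<..}"]) (use 1 in \<open>auto simp: flat_def\<close>)
  next
    case 2
    have "((\<lambda>t. 0) has_real_derivative flat ?q t) (at t)" using 2 by (simp add: flat_def)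
    then show ?thesis
      by (rule has_field_derivative_transform_within_open[of _ _ _ "{..<0}"]) (use 2 in \<open>auto simp: flat_def\<close>)
  next
    case 3
    have "(flat ([:0, 1:] * p) \<longlongrightarrow> 0) (at 0)" by (rule flat_tendsto_0)
    then have "((\<lambda>h. (flat p (0 + h) - flat p 0) / h) \<longlongrightarrow> 0) (at 0)"
      by (rule Lim_transform_eventually) (auto simp: flat_def eventually_at_filter field_simps)
    then show ?thesis using 3 by (simp add: DERIV_def flat_def)
  qed
qed

lemma Ck_flat_ridge: "Ck k (\<lambda>x. flat p (b \<bullet> x + a))"
  by (rule Ck_ridge[where F="range flat"]) (use flat_derivative in auto)

section \<open>Test functions\<close>

lemma test_functionsD:
  assumes "\<phi> \<in> test_functions \<Omega>"
  shows "\<And>k. Ck k \<phi>" "compact (closure (support_on UNIV \<phi>))" "closure (support_on UNIV \<phi>) \<subseteq> \<Omega>"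
  using assms by (auto simp: test_functions_def)

lemma test_function_derivative:
  "\<phi> \<in> test_functions \<Omega> \<Longrightarrow> (\<phi> has_derivative (\<lambda>h. grad \<phi> x \<bullet> h)) (at x)"
  using Ck_SucD(2)[OF test_functionsD(1)[of \<phi> \<Omega> "Suc 0"]] by blast

lemma test_function_continuous:
  assumes "\<phi> \<in> test_functions \<Omega>"
  shows "continuous_on UNIV \<phi>" "continuous_on UNIV (grad \<phi>)"
proof -
  show "continuous_on UNIV \<phi>" using test_functionsD(1)[OF assms, of 0] by simp
  have "continuous_on UNIV (\<lambda>x. grad \<phi> x \<bullet> i)" if "i \<in> Basis" for i
    using Ck_SucD(3)[OF test_functionsD(1)[OF assms, of "Suc 0"] that] by simp
  then show "continuous_on UNIV (grad \<phi>)" by (subst continuous_on_componentwise) auto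
qed

lemma test_function_outside:
  assumes \<phi>: "\<phi> \<in> test_functions \<Omega>" and x: "x \<notin> closure (support_on UNIV \<phi>)"
  shows "\<phi> x = 0" "grad \<phi> x = 0"
proof -
  have 0: "\<phi> y = 0" if "y \<in> - closure (support_on UNIV \<phi>)" for y
    using that closure_subset[of "support_on UNIV \<phi>"] by (auto simp: support_on_def)
  then show "\<phi> x = 0" using x by simp
  have "((\<lambda>_. 0) has_derivative (\<lambda>h. 0 \<bullet> h)) (at x)" by simp
  then have "(\<phi> has_derivative (\<lambda>h. 0 \<bullet> h)) (at x)"
    by (rule has_derivative_transform_within_open[OF _ open_Compl[OF closed_closure]])
       (use x 0 in auto)
  then show "grad \<phi> x = 0" by (rule grad_eqI)
qed

lemma test_functionI:
  assumes "\<And>k. Ck k \<phi>" "compact K" "K \<subseteq> \<Omega>" "\<And>x. x \<notin> K \<Longrightarrow> \<phi> x = 0"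
  shows "\<phi> \<in> test_functions \<Omega>"
proof -
  have "support_on UNIV \<phi> \<subseteq> K" using assms(4) by (auto simp: support_on_def)
  then have "closure (support_on UNIV \<phi>) \<subseteq> K"
    using assms(2) compact_imp_closed by (intro closure_minimal) auto
  then show ?thesis
    using assms \<open>support_on UNIV \<phi> \<subseteq> K\<close> bounded_subset[OF compact_imp_bounded[OF assms(2)]]
    unfolding test_functions_def by auto
qed

lemma test_function_zero: "(\<lambda>_. 0) \<in> test_functions \<Omega>"
  by (rule test_functionI[of _ "{}"]) (auto intro: Ck_const)

lemma test_function_add:
  assumes \<phi>: "\<phi> \<in> test_functions \<Omega>" and \<psi>: "\<psi> \<in> test_functions \<Omega>"
  shows "(\<lambda>x. \<phi> x + \<psi> x) \<in> test_functions \<Omega>"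
    and "grad (\<lambda>x. \<phi> x + \<psi> x) x = grad \<phi> x + grad \<psi> x"
proof -
  show "(\<lambda>x. \<phi> x + \<psi> x) \<in> test_functions \<Omega>"
    by (rule test_functionI[of _ "closure (support_on UNIV \<phi>) \<union> closure (support_on UNIV \<psi>)"])
       (use test_functionsD[OF \<phi>] test_functionsD[OF \<psi>] test_function_outside(1)[OF \<phi>] test_function_outside(1)[OF \<psi>]
        in \<open>auto intro: Ck_add\<close>)
  show "grad (\<lambda>x. \<phi> x + \<psi> x) x = grad \<phi> x + grad \<psi> x"
    by (rule grad_eqI) (use has_derivative_add[OF test_function_derivative[OF \<phi>] test_function_derivative[OF \<psi>]]
      in \<open>simp add: inner_add_left\<close>)
qed

lemma test_function_mult:
  assumes \<phi>: "\<phi> \<in> test_functions \<Omega>" and \<psi>: "\<psi> \<in> test_functions \<Omega>"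
  shows "(\<lambda>x. \<phi> x * \<psi> x) \<in> test_functions \<Omega>"
    and "grad (\<lambda>x. \<phi> x * \<psi> x) x = \<phi> x *\<^sub>R grad \<psi> x + \<psi> x *\<^sub>R grad \<phi> x"
proof -
  show "(\<lambda>x. \<phi> x * \<psi> x) \<in> test_functions \<Omega>"
    by (rule test_functionI[of _ "closure (support_on UNIV \<phi>)"])
       (use test_functionsD[OF \<phi>] test_functionsD[OF \<psi>] test_function_outside(1)[OF \<phi>]
        in \<open>auto intro: Ck_mult\<close>)
  show "grad (\<lambda>x. \<phi> x * \<psi> x) x = \<phi> x *\<^sub>R grad \<psi> x + \<psi> x *\<^sub>R grad \<phi> x"
    by (rule grad_eqI) (use has_derivative_mult[OF test_function_derivative[OF \<phi>, of x] test_function_derivative[OF \<psi>, of x]]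
      in \<open>simp add: inner_add_left mult.commute\<close>)
qed

lemma test_function_scale:
  assumes \<phi>: "\<phi> \<in> test_functions \<Omega>"
  shows "(\<lambda>x. c * \<phi> x) \<in> test_functions \<Omega>" and "grad (\<lambda>x. c * \<phi> x) x = c *\<^sub>R grad \<phi> x"
proof -
  show "(\<lambda>x. c * \<phi> x) \<in> test_functions \<Omega>"
    by (rule test_functionI[of _ "closure (support_on UNIV \<phi>)"])
       (use test_functionsD[OF \<phi>] test_function_outside(1)[OF \<phi>] in \<open>auto intro: Ck_mult Ck_const\<close>)
  show "grad (\<lambda>x. c * \<phi> x) x = c *\<^sub>R grad \<phi> x"
    by (rule grad_eqI) (use has_derivative_mult_right[OF test_function_derivative[OF \<phi>, of x], of c]
      in simp)
qed

lemma test_function_bounded: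
  assumes \<phi>: "\<phi> \<in> test_functions \<Omega>"
  obtains M where "M \<ge> 0" "\<And>x. \<bar>\<phi> x\<bar> \<le> M" "\<And>x. norm (grad \<phi> x) \<le> M"
proof -
  let ?K = "closure (support_on UNIV \<phi>)"
  note K = test_functionsD(2)[OF \<phi>]
  have "bounded (\<phi> ` ?K)" "bounded (grad \<phi> ` ?K)"
    by (intro compact_imp_bounded compact_continuous_image K continuous_on_subset[OF test_function_continuous(1)[OF \<phi>]]
        continuous_on_subset[OF test_function_continuous(2)[OF \<phi>]] subset_UNIV)+
  then obtain A B where A: "\<And>x. x \<in> ?K \<Longrightarrow> \<bar>\<phi> x\<bar> \<le> A" and B: "\<And>x. x \<in> ?K \<Longrightarrow> norm (grad \<phi> x) \<le> B"
    unfolding bounded_iff by auto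
  show thesis
  proof (rule that[of "max 0 (max A B)"])
    fix x
    show "\<bar>\<phi> x\<bar> \<le> max 0 (max A B)" "norm (grad \<phi> x) \<le> max 0 (max A B)"
      using A[of x] B[of x] test_function_outside[OF \<phi>, of x] by (cases "x \<in> ?K"; force)+
  qed simp
qed

text \<open>Products of smooth steps at the faces of the box, made steeper and steeper.\<close>
lemma indicator_box_test_functions:
  fixes c d :: "'a::euclidean_space"
  assumes sub: "cbox c d \<subseteq> \<Omega>"
  obtains \<phi> where "\<And>n. \<phi> n \<in> test_functions \<Omega>" "\<And>n x. 0 \<le> \<phi> n x" "\<And>n x. \<phi> n x \<le> indicator (box c d) x"
    "\<And>x. (\<lambda>n. \<phi> n x) \<longlonglongrightarrow> indicator (box c d) x"
proof -
  define e where "e = flat 1"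
  have e: "0 \<le> e t" "e t \<le> 1" "t \<le> 0 \<Longrightarrow> e t = 0" for t by (auto simp: e_def flat_def)
  define \<phi> where "\<phi> n x = (\<Prod>i\<in>Basis. e (real (Suc n) * (x \<bullet> i - c \<bullet> i)) * e (real (Suc n) * (d \<bullet> i - x \<bullet> i)))" for n x
  have smooth: "Ck k (\<phi> n)" for k n
  proof -
    have 1: "Ck k (\<lambda>x. e (real (Suc n) * (x \<bullet> i - c \<bullet> i)))" for i
      using Ck_flat_ridge[of k 1 "real (Suc n) *\<^sub>R i" "- (real (Suc n) * (c \<bullet> i))"]
      by (simp add: e_def inner_commute right_diff_distrib)
    have 2: "Ck k (\<lambda>x. e (real (Suc n) * (d \<bullet> i - x \<bullet> i)))" for i
      using Ck_flat_ridge[of k 1 "- (real (Suc n) *\<^sub>R i)" "real (Suc n) * (d \<bullet> i)"]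
      by (simp add: e_def inner_commute algebra_simps)
    show ?thesis unfolding \<phi>_def[abs_def] by (intro Ck_prod Ck_mult 1 2) simp
  qed
  have out: "\<phi> n x = 0" if "x \<notin> box c d" for n x
  proof -
    have "\<exists>i\<in>Basis. \<not> (c \<bullet> i < x \<bullet> i \<and> x \<bullet> i < d \<bullet> i)" using that by (simp add: mem_box)
    then obtain i where i: "i \<in> Basis" "x \<bullet> i \<le> c \<bullet> i \<or> d \<bullet> i \<le> x \<bullet> i" by (auto simp: not_less)
    then have "e (real (Suc n) * (x \<bullet> i - c \<bullet> i)) * e (real (Suc n) * (d \<bullet> i - x \<bullet> i)) = 0"
      by (auto intro!: e(3) mult_nonneg_nonpos simp del: of_nat_Suc)
    then show ?thesis unfolding \<phi>_def using i(1) by (intro prod_zero) auto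
  qed
  have ee: "0 \<le> e s * e t \<and> e s * e t \<le> 1" for s t using e by (simp add: mult_le_one)
  have le1: "0 \<le> \<phi> n x" "\<phi> n x \<le> 1" for n x
    unfolding \<phi>_def by (intro prod_nonneg ballI, simp add: ee) (intro prod_le_1, simp add: ee)
  have lim: "(\<lambda>n. e (real (Suc n) * s)) \<longlonglongrightarrow> 1" if s: "s > 0" for s
  proof -
    have "(\<lambda>n. exp (- (1 / (real (Suc n) * s)))) \<longlonglongrightarrow> exp (- 0)"
    proof (intro tendsto_intros)
      have "(\<lambda>n. (1 / s) * inverse (real (Suc n))) \<longlonglongrightarrow> (1 / s) * 0"
        by (intro tendsto_intros LIMSEQ_inverse_real_of_nat)
      then show "(\<lambda>n. 1 / (real (Suc n) * s)) \<longlonglongrightarrow> 0" by (simp add: field_simps)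
    qed
    then show ?thesis using s by (simp add: e_def flat_def)
  qed
  have out': "\<phi> n x = 0" if "x \<notin> cbox c d" for n x
    using that box_subset_cbox[of c d] by (intro out) auto
  show thesis
  proof (rule that[of \<phi>])
    show "\<phi> n \<in> test_functions \<Omega>" for n
      by (rule test_functionI[of _ "cbox c d"]) (use smooth out' sub in auto)
    show "0 \<le> \<phi> n x" for n x by (rule le1)
    show "\<phi> n x \<le> indicator (box c d) x" for n x
      using le1 out by (auto simp: indicator_def)
    show "(\<lambda>n. \<phi> n x) \<longlonglongrightarrow> indicator (box c d) x" for x
    proof (cases "x \<in> box c d")
      case True
      have "(\<lambda>n. \<phi> n x) \<longlonglongrightarrow> (\<Prod>i\<in>(Basis::'a set). 1 * 1)"
        unfolding \<phi>_def by (intro tendsto_prod tendsto_mult lim) (use True in \<open>auto simp: box_def\<close>)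
      then show ?thesis using True by simp
    qed (use out in simp)
  qed
qed

section \<open>Integrals of continuous functions with bounded support\<close>

lemma integral_lebesgue_on_eq_lborel:
  fixes f :: "'a::euclidean_space \<Rightarrow> 'b::euclidean_space"
  assumes \<Omega>: "\<Omega> \<in> sets lebesgue" and f: "continuous_on UNIV f" and 0: "\<And>x. x \<notin> \<Omega> \<Longrightarrow> f x = 0"
  shows "integral\<^sup>L (lebesgue_on \<Omega>) f = integral\<^sup>L lborel f"
    and "integrable (lebesgue_on \<Omega>) f \<longleftrightarrow> integrable lborel f"
proof -
  have [measurable]: "f \<in> borel_measurable borel" using f by (rule borel_measurable_continuous_onI)
  have ind: "(\<lambda>x. indicator \<Omega> x *\<^sub>R f x) = f" using 0 by (auto simp: indicator_def fun_eq_iff)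
  show "integral\<^sup>L (lebesgue_on \<Omega>) f = integral\<^sup>L lborel f"
    using \<Omega> by (simp add: integral_restrict_space ind integral_completion)
  show "integrable (lebesgue_on \<Omega>) f \<longleftrightarrow> integrable lborel f"
    using \<Omega> by (simp add: integrable_restrict_space ind integrable_completion)
qed

lemma integrable_lborel_bounded_support:
  fixes f :: "'a::euclidean_space \<Rightarrow> 'b::euclidean_space"
  assumes f: "continuous_on UNIV f" and K: "bounded K" and 0: "\<And>x. x \<notin> K \<Longrightarrow> f x = 0"
  shows "integrable lborel f"
proof -
  have "integrable lborel (\<lambda>x. indicator (closure K) x *\<^sub>R f x)"
    by (rule borel_integrable_compact) (use f K continuous_on_subset in auto)
  moreover have "(\<lambda>x. indicator (closure K) x *\<^sub>R f x) = f"
    using 0 closure_subset[of K] by (auto simp: indicator_def fun_eq_iff)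
  ultimately show ?thesis by simp
qed

lemma integral_lborel_translation:
  fixes f :: "'a::euclidean_space \<Rightarrow> 'b::euclidean_space"
  assumes "continuous_on UNIV f"
  shows "(LINT x|lborel. f (x + h)) = integral\<^sup>L lborel f"
proof -
  have [measurable]: "f \<in> borel_measurable borel" using assms by (rule borel_measurable_continuous_onI)
  have "integral\<^sup>L (distr lborel borel ((+) h)) f = (LINT x|lborel. f (h + x))"
    by (rule integral_distr) auto
  then show ?thesis by (simp add: lborel_distr_plus add.commute)
qed

lemma continuous_on_norm_powr:
  assumes "continuous_on UNIV f" "r > 0"
  shows "continuous_on UNIV (\<lambda>x. norm (f x) powr r)"
  using assms by (intro continuous_on_powr' continuous_intros) auto

lemma Lp_norm_continuous_eq:
  fixes f :: "'a::euclidean_space \<Rightarrow> 'b::euclidean_space"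
  assumes \<Omega>: "\<Omega> \<in> sets lebesgue" and f: "continuous_on UNIV f" and 0: "\<And>x. x \<notin> \<Omega> \<Longrightarrow> f x = 0" and r: "r > 0"
  shows "Lp_norm r \<Omega> f = (LINT x|lborel. norm (f x) powr r) powr (1 / r)"
  unfolding Lp_norm_def
  by (subst integral_lebesgue_on_eq_lborel(1)[OF \<Omega> continuous_on_norm_powr[OF f r]]) (use 0 in auto)

lemma Lp_norm_UNIV:
  fixes f :: "'a::euclidean_space \<Rightarrow> 'b::euclidean_space"
  assumes "continuous_on UNIV f" "r > 0"
  shows "Lp_norm r UNIV f = (LINT x|lborel. norm (f x) powr r) powr (1 / r)"
  by (rule Lp_norm_continuous_eq) (use assms in auto)

lemma Lp_space_bounded_support:
  fixes f :: "'a::euclidean_space \<Rightarrow> 'b::euclidean_space"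
  assumes \<Omega>: "\<Omega> \<in> sets lebesgue" and f: "continuous_on UNIV f" and r: "r > 0"
    and 0: "\<And>x. x \<notin> K \<Longrightarrow> f x = 0" and K: "bounded K" "K \<subseteq> \<Omega>"
  shows "f \<in> Lp_space r \<Omega>"
proof -
  have "f \<in> borel_measurable borel" using f by (rule borel_measurable_continuous_onI)
  then have "f \<in> borel_measurable (lebesgue_on \<Omega>)"
    by (intro measurable_restrict_space1 measurable_completion) simp
  moreover have "integrable lborel (\<lambda>x. norm (f x) powr r)"
    by (rule integrable_lborel_bounded_support[OF continuous_on_norm_powr[OF f r] K(1)]) (use 0 in auto)
  then have "integrable (lebesgue_on \<Omega>) (\<lambda>x. norm (f x) powr r)"
    by (subst integral_lebesgue_on_eq_lborel(2)[OF \<Omega> continuous_on_norm_powr[OF f r]]) (use 0 K(2) in auto)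
  ultimately show ?thesis by (simp add: Lp_space_def)
qed

lemma test_function_Lp:
  assumes \<phi>: "\<phi> \<in> test_functions \<Omega>" and \<Omega>: "\<Omega> \<in> sets lebesgue" and r: "r > 0"
  shows "\<phi> \<in> Lp_space r \<Omega>" "grad \<phi> \<in> Lp_space r \<Omega>"
  using test_function_outside[OF \<phi>] test_functionsD[OF \<phi>] compact_imp_bounded
    Lp_space_bounded_support[OF \<Omega> test_function_continuous(1)[OF \<phi>] r]
    Lp_space_bounded_support[OF \<Omega> test_function_continuous(2)[OF \<phi>] r]
  by metis+

lemma test_function_outside_domain:
  assumes \<phi>: "\<phi> \<in> test_functions \<Omega>" and x: "x \<notin> \<Omega>"
  shows "\<phi> x = 0" "grad \<phi> x = 0"
  using test_function_outside[OF \<phi>, of x] test_functionsD(3)[OF \<phi>] x by auto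

lemma test_function_Lp_norm_UNIV:
  assumes \<phi>: "\<phi> \<in> test_functions \<Omega>" and \<Omega>: "\<Omega> \<in> sets lebesgue" and r: "r > 0"
  shows "Lp_norm r UNIV \<phi> = Lp_norm r \<Omega> \<phi>" "Lp_norm r UNIV (grad \<phi>) = Lp_norm r \<Omega> (grad \<phi>)"
  using test_function_outside_domain[OF \<phi>] \<Omega>
    Lp_norm_continuous_eq[OF _ test_function_continuous(1)[OF \<phi>] _ r, of \<Omega>]
    Lp_norm_continuous_eq[OF _ test_function_continuous(1)[OF \<phi>] _ r, of UNIV]
    Lp_norm_continuous_eq[OF _ test_function_continuous(2)[OF \<phi>] _ r, of \<Omega>]
    Lp_norm_continuous_eq[OF _ test_function_continuous(2)[OF \<phi>] _ r, of UNIV] by auto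

section \<open>Difference quotients\<close>

lemma test_function_lipschitz:
  assumes \<phi>: "\<phi> \<in> test_functions \<Omega>" and M: "\<And>x. norm (grad \<phi> x) \<le> M"
  shows "\<bar>\<phi> x - \<phi> y\<bar> \<le> M * norm (x - y)"
proof -
  have M0: "M \<ge> 0" using M[of 0] norm_ge_zero order_trans by blast
  have "norm (\<phi> x - \<phi> y) \<le> M * norm (x - y)"
  proof (rule differentiable_bound[where S=UNIV and f'="\<lambda>x h. grad \<phi> x \<bullet> h"])
    fix z
    show "onorm (\<lambda>h. grad \<phi> z \<bullet> h) \<le> M"
    proof (rule onorm_bound[OF M0])
      fix h show "norm (grad \<phi> z \<bullet> h) \<le> M * norm h"
        using Cauchy_Schwarz_ineq2[of "grad \<phi> z" h] mult_right_mono[OF M[of z] norm_ge_zero[of h]] by simp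
    qed
  qed (use test_function_derivative[OF \<phi>] in auto)
  then show ?thesis by simp
qed

lemma difference_quotient_tendsto:
  assumes \<phi>: "\<phi> \<in> test_functions \<Omega>"
  shows "(\<lambda>n. real (Suc n) * (\<phi> (x + (1 / real (Suc n)) *\<^sub>R h) - \<phi> x)) \<longlonglongrightarrow> grad \<phi> x \<bullet> h"
proof -
  have "((\<lambda>t. x + t *\<^sub>R h) has_derivative (\<lambda>t. t *\<^sub>R h)) (at (0::real))"
    by (auto intro!: derivative_eq_intros)
  from has_derivative_compose[OF this, of \<phi> "\<lambda>k. grad \<phi> x \<bullet> k"] test_function_derivative[OF \<phi>, of x]
  have "((\<lambda>t. \<phi> (x + t *\<^sub>R h)) has_derivative (\<lambda>t. t * (grad \<phi> x \<bullet> h))) (at 0)" by simp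
  then have "((\<lambda>t. \<phi> (x + t *\<^sub>R h)) has_real_derivative (grad \<phi> x \<bullet> h)) (at 0)"
    by (simp add: has_field_derivative_def mult_commute_abs)
  then have "((\<lambda>t. (\<phi> (x + t *\<^sub>R h) - \<phi> x) / t) \<longlongrightarrow> grad \<phi> x \<bullet> h) (at 0)"
    by (simp add: DERIV_def)
  moreover have "filterlim (\<lambda>n. 1 / real (Suc n)) (at 0) sequentially"
    unfolding filterlim_at using LIMSEQ_inverse_real_of_nat by (auto simp: inverse_eq_divide)
  ultimately have "(\<lambda>n. (\<phi> (x + (1 / real (Suc n)) *\<^sub>R h) - \<phi> x) / (1 / real (Suc n))) \<longlonglongrightarrow> grad \<phi> x \<bullet> h"
    by (rule filterlim_compose)
  then show ?thesis by (simp add: mult.commute)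
qed

lemma difference_quotient_bound:
  assumes \<phi>: "\<phi> \<in> test_functions \<Omega>"
  shows "\<exists>M K. M \<ge> 0 \<and> bounded K \<and> K \<in> sets borel \<and>
    (\<forall>n x. \<bar>real (Suc n) * (\<phi> (x + (1 / real (Suc n)) *\<^sub>R h) - \<phi> x)\<bar> \<le> M * indicator K x)"
proof -
  obtain M where M: "M \<ge> 0" "\<And>x. norm (grad \<phi> x) \<le> M" by (rule test_function_bounded[OF \<phi>]) (erule that, simp)
  obtain R where R: "\<And>x. x \<in> closure (support_on UNIV \<phi>) \<Longrightarrow> norm x \<le> R"
    using compact_imp_bounded[OF test_functionsD(2)[OF \<phi>]] unfolding bounded_iff by blast
  have 0: "\<phi> x = 0" if "norm x > R" for x using test_function_outside(1)[OF \<phi>] R[of x] that by force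
  show ?thesis
  proof (intro exI[of _ "M * norm h"] exI[of _ "cball 0 (R + norm h)"] conjI allI)
    fix n x
    let ?t = "1 / real (Suc n)"
    show "\<bar>real (Suc n) * (\<phi> (x + ?t *\<^sub>R h) - \<phi> x)\<bar> \<le> M * norm h * indicator (cball 0 (R + norm h)) x"
    proof (cases "norm x \<le> R + norm h")
      case True
      have "real (Suc n) * \<bar>\<phi> (x + ?t *\<^sub>R h) - \<phi> x\<bar> \<le> real (Suc n) * (M * norm (?t *\<^sub>R h))"
        using test_function_lipschitz[OF \<phi> M(2), of "x + ?t *\<^sub>R h" x] by (intro mult_left_mono) auto
      also have "\<dots> = M * norm h" by simp
      finally show ?thesis using True by (simp add: abs_mult)
    next
      case False
      have "norm (?t *\<^sub>R h) \<le> norm h" by (simp add: divide_le_eq mult_le_cancel_left1)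
      then have "norm (x + ?t *\<^sub>R h) > R" using norm_diff_ineq[of x "?t *\<^sub>R h"] False by linarith
      moreover have "norm x > R" using False norm_ge_zero[of h] by linarith
      ultimately show ?thesis using False 0 by simp
    qed
  qed (use M in auto)
qed

lemma integral_directional_derivative_zero:
  assumes \<phi>: "\<phi> \<in> test_functions \<Omega>"
  shows "(LINT x|lborel. grad \<phi> x \<bullet> h) = 0"
proof -
  note c = test_function_continuous[OF \<phi>]
  obtain M K where M: "M \<ge> 0" "bounded K" "K \<in> sets borel"
    "\<And>n x. \<bar>real (Suc n) * (\<phi> (x + (1 / real (Suc n)) *\<^sub>R h) - \<phi> x)\<bar> \<le> M * indicator K x"
    using difference_quotient_bound[OF \<phi>, of h] by blast
  have cs: "continuous_on UNIV (\<lambda>x. \<phi> (x + k))" for k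
    by (intro continuous_on_compose2[OF c(1)] continuous_intros) auto
  have i0: "integrable lborel \<phi>"
    by (rule integrable_lborel_bounded_support[OF c(1) compact_imp_bounded[OF test_functionsD(2)[OF \<phi>]]])
       (rule test_function_outside[OF \<phi>])
  have ik: "integrable lborel (\<lambda>x. \<phi> (x + k))" for k
  proof -
    have "integrable (distr lborel borel ((+) k)) \<phi>" using i0 by (simp add: lborel_distr_plus)
    then show ?thesis using c(1) borel_measurable_continuous_onI
      by (subst (asm) integrable_distr_eq) (auto simp: add.commute)
  qed
  have "(\<lambda>n. LINT x|lborel. real (Suc n) * (\<phi> (x + (1 / real (Suc n)) *\<^sub>R h) - \<phi> x))
      \<longlonglongrightarrow> (LINT x|lborel. grad \<phi> x \<bullet> h)"
  proof (rule integral_dominated_convergence[where w="\<lambda>x. M * indicator K x"])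
    show "(\<lambda>x. grad \<phi> x \<bullet> h) \<in> borel_measurable lborel"
      using borel_measurable_continuous_onI[OF continuous_on_inner[OF c(2) continuous_on_const]] by simp
    show "(\<lambda>x. real (Suc n) * (\<phi> (x + (1 / real (Suc n)) *\<^sub>R h) - \<phi> x)) \<in> borel_measurable lborel" for n
      using borel_measurable_continuous_onI[OF continuous_on_mult[OF continuous_on_const[of _ "real (Suc n)"]
            continuous_on_diff[OF cs[of "(1 / real (Suc n)) *\<^sub>R h"] c(1)]]] by simp
    show "integrable lborel (\<lambda>x. M * indicator K x)"
      using M(2,3) emeasure_bounded_finite[of K] by (intro integrable_mult_right) (auto simp: top.not_eq_extremum)
  qed (use M(4) difference_quotient_tendsto[OF \<phi>] in auto)
  moreover have "(LINT x|lborel. real (Suc n) * (\<phi> (x + (1 / real (Suc n)) *\<^sub>R h) - \<phi> x)) = 0" for n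
    using integral_lborel_translation[OF c(1), of "(1 / real (Suc n)) *\<^sub>R h"] ik i0 by simp
  ultimately show ?thesis by (simp add: LIMSEQ_const_iff)
qed

text \<open>The translation by \<open>h\<close> is made up of \<open>n\<close> translations by \<open>h / n\<close>, each contributing the same norm, so
the left-hand side is bounded by the norm of the difference quotient with step \<open>h / n\<close>. For \<open>n\<close> to
infinity this becomes the norm of the directional derivative.\<close>
lemma Lp_norm_translation_le:
  assumes \<phi>: "\<phi> \<in> test_functions \<Omega>" and r: "r > 1"
  shows "Lp_norm r UNIV (\<lambda>x. \<phi> (x + h) - \<phi> x) \<le> norm h * Lp_norm r UNIV (grad \<phi>)"
proof -
  note c = test_function_continuous[OF \<phi>]
  have r0: "r > 0" using r by simp
  obtain M K where M: "M \<ge> 0" "bounded K" "K \<in> sets borel"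
    "\<And>n x. \<bar>real (Suc n) * (\<phi> (x + (1 / real (Suc n)) *\<^sub>R h) - \<phi> x)\<bar> \<le> M * indicator K x"
    using difference_quotient_bound[OF \<phi>, of h] by blast
  have cs: "continuous_on UNIV (\<lambda>x. \<phi> (x + k))" for k
    by (intro continuous_on_compose2[OF c(1)] continuous_intros) auto
  obtain R where R: "\<And>x. x \<in> closure (support_on UNIV \<phi>) \<Longrightarrow> norm x \<le> R"
    using compact_imp_bounded[OF test_functionsD(2)[OF \<phi>]] unfolding bounded_iff by blast
  have 0: "\<phi> x = 0" if "norm x > R" for x using test_function_outside(1)[OF \<phi>] R[of x] that by force
  have LpT: "(\<lambda>x. \<phi> (x + k) - \<phi> (x + l)) \<in> Lp_space r UNIV" for k l
  proof (rule Lp_space_bounded_support[where K="cball 0 (R + norm k + norm l)"])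
    show "continuous_on UNIV (\<lambda>x. \<phi> (x + k) - \<phi> (x + l))" by (intro continuous_intros cs)
    show "\<phi> (x + k) - \<phi> (x + l) = 0" if "x \<notin> cball 0 (R + norm k + norm l)" for x
    proof -
      have "norm x > R + norm k + norm l" using that by simp
      then have "norm (x + k) > R" "norm (x + l) > R"
        using norm_diff_ineq[of x k] norm_diff_ineq[of x l] norm_ge_zero[of k] norm_ge_zero[of l] by linarith+
      then show ?thesis using 0 by simp
    qed
  qed (use r0 in auto)
  have shift: "Lp_norm r UNIV (\<lambda>x. \<phi> (x + (k + l)) - \<phi> (x + l)) = Lp_norm r UNIV (\<lambda>x. \<phi> (x + k) - \<phi> x)" for k l
  proof -
    have ck: "continuous_on UNIV (\<lambda>x. \<phi> (x + k) - \<phi> x)" by (intro continuous_intros cs c)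
    have "(LINT x|lborel. norm (\<phi> (x + l + k) - \<phi> (x + l)) powr r) = (LINT x|lborel. norm (\<phi> (x + k) - \<phi> x) powr r)"
      by (rule integral_lborel_translation[OF continuous_on_norm_powr[OF ck r0], of l])
    then show ?thesis
      using Lp_norm_UNIV[OF ck r0] Lp_norm_UNIV[OF continuous_on_diff[OF cs[of "k + l"] cs[of l]] r0]
      by (simp add: add_ac)
  qed
  have sum: "Lp_norm r UNIV (\<lambda>x. \<phi> (x + real m *\<^sub>R k) - \<phi> x) \<le> real m * Lp_norm r UNIV (\<lambda>x. \<phi> (x + k) - \<phi> x)" for m k
  proof (induction m)
    case (Suc m)
    have "(\<lambda>x. \<phi> (x + real (Suc m) *\<^sub>R k) - \<phi> x) =
       (\<lambda>x. (\<phi> (x + (k + real m *\<^sub>R k)) - \<phi> (x + real m *\<^sub>R k)) + (\<phi> (x + real m *\<^sub>R k) - \<phi> (x + 0)))"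
      by (simp add: algebra_simps)
    then have "Lp_norm r UNIV (\<lambda>x. \<phi> (x + real (Suc m) *\<^sub>R k) - \<phi> x) \<le>
       Lp_norm r UNIV (\<lambda>x. \<phi> (x + (k + real m *\<^sub>R k)) - \<phi> (x + real m *\<^sub>R k)) + Lp_norm r UNIV (\<lambda>x. \<phi> (x + real m *\<^sub>R k) - \<phi> (x + 0))"
      using Lp_norm_triangle[OF r LpT[of "k + real m *\<^sub>R k" "real m *\<^sub>R k"] LpT[of "real m *\<^sub>R k" 0]] by simp
    also have "\<dots> \<le> Lp_norm r UNIV (\<lambda>x. \<phi> (x + k) - \<phi> x) + real m * Lp_norm r UNIV (\<lambda>x. \<phi> (x + k) - \<phi> x)"
      using shift[of k "real m *\<^sub>R k"] Suc by simp
    finally show ?case by (simp add: algebra_simps)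
  qed (simp add: Lp_norm_def)
  define dq where "dq n x = real (Suc n) * (\<phi> (x + (1 / real (Suc n)) *\<^sub>R h) - \<phi> x)" for n x
  have le: "Lp_norm r UNIV (\<lambda>x. \<phi> (x + h) - \<phi> x) \<le> Lp_norm r UNIV (dq n)" for n
  proof -
    have "Lp_norm r UNIV (dq n) = real (Suc n) * Lp_norm r UNIV (\<lambda>x. \<phi> (x + (1 / real (Suc n)) *\<^sub>R h) - \<phi> x)"
      using Lp_norm_scale[OF r0, of UNIV "real (Suc n)" "\<lambda>x. \<phi> (x + (1 / real (Suc n)) *\<^sub>R h) - \<phi> x"]
      by (simp add: dq_def[abs_def])
    then show ?thesis using sum[of "Suc n" "(1 / real (Suc n)) *\<^sub>R h"] by simp
  qed
  have cdq: "continuous_on UNIV (dq n)" for n unfolding dq_def[abs_def] by (intro continuous_intros cs c)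
  have cg: "continuous_on UNIV (\<lambda>x. grad \<phi> x \<bullet> h)" by (intro continuous_intros c)
  have "(\<lambda>n. LINT x|lborel. norm (dq n x) powr r) \<longlonglongrightarrow> (LINT x|lborel. norm (grad \<phi> x \<bullet> h) powr r)"
  proof (rule integral_dominated_convergence[where w="\<lambda>x. M powr r * indicator K x"])
    show "(\<lambda>x. norm (grad \<phi> x \<bullet> h) powr r) \<in> borel_measurable lborel"
      using borel_measurable_continuous_onI[OF continuous_on_norm_powr[OF cg r0]] by simp
    show "(\<lambda>x. norm (dq n x) powr r) \<in> borel_measurable lborel" for n
      using borel_measurable_continuous_onI[OF continuous_on_norm_powr[OF cdq r0]] by simp
    show "integrable lborel (\<lambda>x. M powr r * indicator K x)"
      using M(2,3) emeasure_bounded_finite[of K] by (intro integrable_mult_right) (auto simp: top.not_eq_extremum)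
    show "AE x in lborel. (\<lambda>n. norm (dq n x) powr r) \<longlonglongrightarrow> norm (grad \<phi> x \<bullet> h) powr r"
      unfolding dq_def using r0
      by (intro AE_I2 tendsto_powr' tendsto_norm difference_quotient_tendsto[OF \<phi>] tendsto_const) auto
    show "AE x in lborel. norm (norm (dq n x) powr r) \<le> M powr r * indicator K x" for n
    proof (rule AE_I2)
      fix x
      have "norm (dq n x) powr r \<le> (M * indicator K x) powr r"
        using M(4)[of n x] r0 by (intro powr_mono2) (auto simp: dq_def)
      then show "norm (norm (dq n x) powr r) \<le> M powr r * indicator K x"
        by (auto simp: indicator_def split: if_splits)
    qed
  qed
  then have "(\<lambda>n. Lp_norm r UNIV (dq n)) \<longlonglongrightarrow> Lp_norm r UNIV (\<lambda>x. grad \<phi> x \<bullet> h)"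
    unfolding Lp_norm_UNIV[OF cg r0] Lp_norm_UNIV[OF cdq r0]
    using r0 by (intro tendsto_powr' tendsto_const) auto
  then have 1: "Lp_norm r UNIV (\<lambda>x. \<phi> (x + h) - \<phi> x) \<le> Lp_norm r UNIV (\<lambda>x. grad \<phi> x \<bullet> h)"
    by (rule LIMSEQ_le_const) (use le in auto)
  have "(LINT x|lborel. norm (grad \<phi> x \<bullet> h) powr r) \<le> (LINT x|lborel. norm h powr r * norm (grad \<phi> x) powr r)"
  proof (rule integral_mono)
    have out: "grad \<phi> x = 0" if "x \<notin> closure (support_on UNIV \<phi>)" for x
      using test_function_outside[OF \<phi> that] by simp
    note b = compact_imp_bounded[OF test_functionsD(2)[OF \<phi>]]
    show "integrable lborel (\<lambda>x. norm (grad \<phi> x \<bullet> h) powr r)"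
      by (rule integrable_lborel_bounded_support[OF continuous_on_norm_powr[OF cg r0] b]) (use out in simp)
    show "integrable lborel (\<lambda>x. norm h powr r * norm (grad \<phi> x) powr r)"
      by (intro integrable_mult_right integrable_lborel_bounded_support[OF continuous_on_norm_powr[OF c(2) r0] b])
         (use out in simp)
    fix x
    have "norm (grad \<phi> x \<bullet> h) powr r \<le> (norm h * norm (grad \<phi> x)) powr r"
      using r0 Cauchy_Schwarz_ineq2[of "grad \<phi> x" h] by (intro powr_mono2) (auto simp: mult.commute)
    then show "norm (grad \<phi> x \<bullet> h) powr r \<le> norm h powr r * norm (grad \<phi> x) powr r" by (simp add: powr_mult)
  qed
  then have "Lp_norm r UNIV (\<lambda>x. grad \<phi> x \<bullet> h) \<le> (norm h powr r * (LINT x|lborel. norm (grad \<phi> x) powr r)) powr (1 / r)"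
    unfolding Lp_norm_UNIV[OF cg r0]
    using r0 by (intro powr_mono2 Bochner_Integration.integral_nonneg) auto
  also have "\<dots> = norm h * Lp_norm r UNIV (grad \<phi>)"
    unfolding Lp_norm_UNIV[OF c(2) r0]
    using r0 by (simp add: powr_mult powr_powr)
  finally show ?thesis using 1 by linarith
qed

text \<open>Translation by the diameter of a ball around \<open>\<Omega>\<close> moves a test function off its support.\<close>
lemma Poincare_inequality:
  fixes \<Omega> :: "'a::euclidean_space set"
  assumes \<Omega>: "\<Omega> \<in> sets lebesgue" "bounded \<Omega>" and r: "r > 1"
  shows "\<exists>C>0. \<forall>\<phi>\<in>test_functions \<Omega>. Lp_norm r \<Omega> \<phi> \<le> C * Lp_norm r \<Omega> (grad \<phi>)"
proof -
  have r0: "r > 0" using r by simp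
  obtain R where R: "R > 0" "\<And>x. x \<in> \<Omega> \<Longrightarrow> norm x < R"
    using \<Omega>(2) unfolding bounded_pos_less by blast
  \<comment> \<open>Any direction will do.\<close>
  define h where "h = (2 * R) *\<^sub>R (SOME i. i \<in> (Basis :: 'a set))"
  have nh: "norm h = 2 * R" using R SOME_Basis norm_Basis[OF SOME_Basis] by (simp add: h_def)
  show ?thesis
  proof (intro exI[of _ "2 * R"] conjI ballI)
    fix \<phi> assume \<phi>: "\<phi> \<in> test_functions \<Omega>"
    note c = test_function_continuous[OF \<phi>]
    have cs: "continuous_on UNIV (\<lambda>x. \<phi> (x + k))" for k
      by (intro continuous_on_compose2[OF c(1)] continuous_intros) auto
    have out: "\<phi> x = 0" if "norm x \<ge> R" for x
      using test_function_outside_domain(1)[OF \<phi>, of x] R(2)[of x] that by force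
    have 0: "\<phi> (x + h) - \<phi> x = - \<phi> x" if "norm x < R" for x
      using out[of "x + h"] norm_diff_ineq[of h x] that nh by (simp add: add.commute)
    have cd: "continuous_on UNIV (\<lambda>x. \<phi> (x + h) - \<phi> x)" by (intro continuous_intros cs c)
    have le: "(LINT x|lborel. norm (\<phi> x) powr r) \<le> (LINT x|lborel. norm (\<phi> (x + h) - \<phi> x) powr r)"
    proof (rule integral_mono)
      show "integrable lborel (\<lambda>x. norm (\<phi> x) powr r)"
        using integrable_lborel_bounded_support[OF continuous_on_norm_powr[OF c(1) r0] bounded_ball[of 0 R]] out by simp
      show "integrable lborel (\<lambda>x. norm (\<phi> (x + h) - \<phi> x) powr r)"
      proof -
        have "norm (\<phi> (x + h) - \<phi> x) powr r = 0" if "x \<notin> cball 0 (3 * R)" for x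
          using that out[of x] out[of "x + h"] norm_diff_ineq[of x h] nh R by auto
        then show ?thesis
          using integrable_lborel_bounded_support[OF continuous_on_norm_powr[OF cd r0] bounded_cball[of 0 "3 * R"]] by simp
      qed
      show "norm (\<phi> x) powr r \<le> norm (\<phi> (x + h) - \<phi> x) powr r" for x
        using 0[of x] out[of x] by (cases "norm x < R") auto
    qed
    have "Lp_norm r UNIV \<phi> \<le> Lp_norm r UNIV (\<lambda>x. \<phi> (x + h) - \<phi> x)"
      unfolding Lp_norm_UNIV[OF cd r0] Lp_norm_UNIV[OF c(1) r0]
      by (rule powr_mono2[OF _ _ le]) (use r0 in auto)
    also have "\<dots> \<le> 2 * R * Lp_norm r UNIV (grad \<phi>)" using Lp_norm_translation_le[OF \<phi> r, of h] nh by simp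
    finally show "Lp_norm r \<Omega> \<phi> \<le> 2 * R * Lp_norm r \<Omega> (grad \<phi>)"
      using test_function_Lp_norm_UNIV[OF \<phi> \<Omega>(1) r0] by simp
  qed (use R in simp)
qed

section \<open>Completeness of the Lebesgue spaces\<close>

lemma Lp_norm_nn_integral:
  assumes u: "u \<in> Lp_space r \<Omega>" and r: "r > 0"
  shows "(\<integral>\<^sup>+x. ennreal (norm (u x) powr r) \<partial>lebesgue_on \<Omega>) = ennreal (Lp_norm r \<Omega> u powr r)"
  unfolding Lp_norm_powr[OF r] by (rule nn_integral_eq_integral[OF Lp_spaceD(2)[OF u]]) simp

text \<open>The Riesz-Fischer theorem: along a subsequence with differences below \<open>4\<^sup>-\<^sup>k\<close>, the weighted sum
\<open>\<Sum> \<bar>2\<^sup>k d\<^sub>k\<bar>\<^sup>r\<close> of the differences is integrable, hence finite almost everywhere, and then the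
differences decay geometrically; Fatou's lemma gives convergence in norm.\<close>
lemma Lp_space_complete:
  fixes U :: "nat \<Rightarrow> 'a::euclidean_space \<Rightarrow> 'b::euclidean_space"
  assumes r: "r > 1" and U: "\<And>n. U n \<in> Lp_space r \<Omega>"
    and cauchy: "\<And>e. e > 0 \<Longrightarrow> \<exists>N. \<forall>m\<ge>N. \<forall>n\<ge>N. Lp_norm r \<Omega> (\<lambda>x. U m x - U n x) < e"
  shows "\<exists>u\<in>Lp_space r \<Omega>. (\<lambda>n. Lp_norm r \<Omega> (\<lambda>x. U n x - u x)) \<longlonglongrightarrow> 0"
proof -
  let ?M = "lebesgue_on \<Omega>"
  have r0: "r > 0" using r by simp
  note [measurable] = Lp_spaceD(1)[OF U]
  have diffL: "(\<lambda>x. U m x - U n x) \<in> Lp_space r \<Omega>" for m n by (intro Lp_space_diff U r0)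
  have "\<forall>k. \<exists>N. \<forall>m\<ge>N. \<forall>n\<ge>N. Lp_norm r \<Omega> (\<lambda>x. U m x - U n x) < (1/4)^k"
    using cauchy by simp
  then obtain N where N: "\<And>k m n. m \<ge> N k \<Longrightarrow> n \<ge> N k \<Longrightarrow> Lp_norm r \<Omega> (\<lambda>x. U m x - U n x) < (1/4)^k"
    by metis
  define s where "s k = (\<Sum>j\<le>k. N j)" for k
  have sN: "s k \<ge> N k" for k unfolding s_def by (rule member_le_sum) auto
  have sk: "s (Suc k) \<ge> N k" for k using sN[of k] by (simp add: s_def)
  define d where "d k x = U (s (Suc k)) x - U (s k) x" for k x
  have [measurable]: "d k \<in> borel_measurable ?M" for k unfolding d_def[abs_def] by measurable
  have nd: "Lp_norm r \<Omega> (d k) \<le> (1/4)^k" for k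
    using N[OF sk sN] unfolding d_def[abs_def] by (simp add: less_imp_le)
  have "(\<integral>\<^sup>+x. suminf (\<lambda>k. ennreal (norm (2^k *\<^sub>R d k x) powr r)) \<partial>?M) = suminf (\<lambda>k. \<integral>\<^sup>+x. ennreal (norm (2^k *\<^sub>R d k x) powr r) \<partial>?M)"
    by (rule nn_integral_suminf) measurable
  also have "\<dots> \<le> (suminf (\<lambda>k. ennreal ((1/2)^k)))"
  proof (intro suminf_le allI)
    fix k
    have dL: "d k \<in> Lp_space r \<Omega>" unfolding d_def[abs_def] by (rule diffL)
    have eq: "(\<integral>\<^sup>+x. ennreal (norm (2^k *\<^sub>R d k x) powr r) \<partial>?M) = ennreal (Lp_norm r \<Omega> (\<lambda>x. 2^k *\<^sub>R d k x) powr r)"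
      by (rule Lp_norm_nn_integral[OF Lp_space_scale[OF dL] r0])
    have "Lp_norm r \<Omega> (\<lambda>x. 2^k *\<^sub>R d k x) = 2^k * Lp_norm r \<Omega> (d k)" by (simp add: Lp_norm_scale[OF r0])
    also have "\<dots> \<le> 2^k * (1/4)^k" by (intro mult_left_mono nd) simp
    also have "\<dots> = (1/2)^k" by (simp flip: power_mult_distrib)
    finally have le: "(\<integral>\<^sup>+x. ennreal (norm (2^k *\<^sub>R d k x) powr r) \<partial>?M) \<le> ennreal (((1/2)^k) powr r)"
      unfolding eq using r0 by (intro ennreal_leI powr_mono2 Lp_norm_nonneg) auto
    have "((1/2)^k) powr r \<le> ((1/2::real)^k) powr 1"
      using r by (intro powr_mono') (auto simp: power_le_one)
    then have "((1/2)^k) powr r \<le> (1/2::real)^k" by simp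
    then show "(\<integral>\<^sup>+x. ennreal (norm (2^k *\<^sub>R d k x) powr r) \<partial>?M) \<le> ennreal ((1/2)^k)"
      using le ennreal_leI order_trans by blast
  qed auto
  also have "\<dots> < \<infinity>"
    using summable_geometric[of "1/2::real"] by (subst suminf_ennreal2) auto
  finally have "(\<integral>\<^sup>+x. (suminf (\<lambda>k. ennreal (norm (2^k *\<^sub>R d k x) powr r))) \<partial>?M) \<noteq> \<infinity>" by simp
  then have AE_fin: "AE x in ?M. (suminf (\<lambda>k. ennreal (norm (2^k *\<^sub>R d k x) powr r))) \<noteq> \<infinity>"
    by (intro nn_integral_PInf_AE) measurable
  define u where "u x = lim (\<lambda>k. U (s k) x)" for x
  have [measurable]: "u \<in> borel_measurable ?M" unfolding u_def[abs_def] by measurable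
  have conv: "AE x in ?M. (\<lambda>k. U (s k) x) \<longlonglongrightarrow> u x"
    using AE_fin
  proof eventually_elim
    fix x assume fin: "(suminf (\<lambda>k. ennreal (norm (2^k *\<^sub>R d k x) powr r))) \<noteq> \<infinity>"
    then obtain S where S: "S \<ge> 0" "(suminf (\<lambda>k. ennreal (norm (2^k *\<^sub>R d k x) powr r))) = ennreal S"
      by (cases "suminf (\<lambda>k. ennreal (norm (2^k *\<^sub>R d k x) powr r))") auto
    have bound: "norm (d k x) \<le> S powr (1/r) * (1/2)^k" for k
    proof -
      have "ennreal (norm (2^k *\<^sub>R d k x) powr r) \<le> (suminf (\<lambda>k. ennreal (norm (2^k *\<^sub>R d k x) powr r)))"
        (is "?F k \<le> _")
      proof -
        have "sum ?F {k} \<le> suminf ?F" by (rule sum_le_suminf) auto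
        then show ?thesis unfolding sum.insert_remove[OF finite.emptyI] by simp
      qed
      then have "norm (2^k *\<^sub>R d k x) powr r \<le> S" unfolding S(2) using S(1) by (subst (asm) ennreal_le_iff)
      then have "(norm (2^k *\<^sub>R d k x) powr r) powr (1/r) \<le> S powr (1/r)" using r0 by (intro powr_mono2) auto
      then have "2^k * norm (d k x) \<le> S powr (1/r)" using r0 by (simp add: powr_powr)
      then show ?thesis by (simp add: power_divide field_simps)
    qed
    have "summable (\<lambda>k. d k x)"
      by (rule summable_comparison_test'[of "\<lambda>k. S powr (1/r) * (1/2)^k" 0]) (use bound in \<open>auto intro: summable_mult\<close>)
    then have "summable (\<lambda>k. U (s (Suc k)) x - U (s k) x)" by (simp add: d_def)
    then have "convergent (\<lambda>k. U (s k) x)"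
      using telescope_summable' summable_LIMSEQ'[of "\<lambda>k. U (s (Suc k)) x - U (s k) x"]
      unfolding summable_iff_convergent sum_lessThan_telescope[where f="\<lambda>k. U (s k) x"]
      using convergent_diff_const_right_iff by blast
    then show "(\<lambda>k. U (s k) x) \<longlonglongrightarrow> u x" by (simp add: u_def convergent_LIMSEQ_iff)
  qed
  have close: "(\<lambda>x. U n x - u x) \<in> Lp_space r \<Omega> \<and> Lp_norm r \<Omega> (\<lambda>x. U n x - u x) \<le> (1/4)^k" if n: "n \<ge> N k" for n k
  proof -
    have "AE x in ?M. (\<lambda>j. ennreal (norm (U n x - U (s j) x) powr r)) \<longlonglongrightarrow> ennreal (norm (U n x - u x) powr r)"
      using conv by eventually_elim (use r0 in \<open>auto intro!: tendsto_ennrealI tendsto_powr' tendsto_intros\<close>)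
    then have "AE x in ?M. ennreal (norm (U n x - u x) powr r) = liminf (\<lambda>j. ennreal (norm (U n x - U (s j) x) powr r))"
    proof eventually_elim
      case (elim x)
      show ?case by (rule lim_imp_Liminf[OF _ elim, symmetric]) simp
    qed
    then have "(\<integral>\<^sup>+x. ennreal (norm (U n x - u x) powr r) \<partial>?M) =
       (\<integral>\<^sup>+x. liminf (\<lambda>j. ennreal (norm (U n x - U (s j) x) powr r)) \<partial>?M)"
      by (rule nn_integral_cong_AE)
    also have "\<dots> \<le> liminf (\<lambda>j. \<integral>\<^sup>+x. ennreal (norm (U n x - U (s j) x) powr r) \<partial>?M)"
      by (rule nn_integral_liminf) measurable
    also have "\<dots> \<le> liminf (\<lambda>j. ennreal (((1/4)^k) powr r))"
    proof (rule Liminf_mono)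
      show "\<forall>\<^sub>F j in sequentially. (\<integral>\<^sup>+x. ennreal (norm (U n x - U (s j) x) powr r) \<partial>?M) \<le> ennreal (((1/4)^k) powr r)"
        unfolding eventually_sequentially
      proof (intro exI[of _ k] allI impI)
        fix j assume "k \<le> j"
        then have "s j \<ge> N k" unfolding s_def by (intro member_le_sum) auto
        then have "Lp_norm r \<Omega> (\<lambda>x. U n x - U (s j) x) powr r \<le> ((1/4)^k) powr r"
          using N[OF n] r0 by (intro powr_mono2 Lp_norm_nonneg) (auto simp: less_imp_le)
        then show "(\<integral>\<^sup>+x. ennreal (norm (U n x - U (s j) x) powr r) \<partial>?M) \<le> ennreal (((1/4)^k) powr r)"
          unfolding Lp_norm_nn_integral[OF diffL r0] by (rule ennreal_leI)
      qed
    qed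
    also have "\<dots> = ennreal (((1/4)^k) powr r)" by (simp add: Liminf_const)
    finally have le: "(\<integral>\<^sup>+x. ennreal (norm (U n x - u x) powr r) \<partial>?M) \<le> ennreal (((1/4)^k) powr r)" .
    have L: "(\<lambda>x. U n x - u x) \<in> Lp_space r \<Omega>"
      unfolding Lp_space_def
    proof (intro CollectI conjI)
      show "integrable ?M (\<lambda>x. norm (U n x - u x) powr r)"
        by (rule integrableI_bounded) (use le in \<open>auto simp: top.not_eq_extremum intro: le_less_trans\<close>)
    qed measurable
    have "Lp_norm r \<Omega> (\<lambda>x. U n x - u x) powr r \<le> ((1/4)^k) powr r"
      using le unfolding Lp_norm_nn_integral[OF L r0] by (simp add: ennreal_le_iff)
    then have "Lp_norm r \<Omega> (\<lambda>x. U n x - u x) \<le> (1/4)^k"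
      using r0 powr_less_mono2[of r "(1/4)^k" "Lp_norm r \<Omega> (\<lambda>x. U n x - u x)"] by (meson not_le zero_le_power less_imp_le zero_le_divide_1_iff zero_le_numeral)
    with L show ?thesis by simp
  qed
  show ?thesis
  proof (intro bexI[of _ u])
    show "(\<lambda>n. Lp_norm r \<Omega> (\<lambda>x. U n x - u x)) \<longlonglongrightarrow> 0"
    proof (rule LIMSEQ_I)
      fix e :: real assume "e > 0"
      then obtain k where "(1/4::real)^k < e" using real_arch_pow_inv[of e "1/4"] by auto
      then have "norm (Lp_norm r \<Omega> (\<lambda>x. U n x - u x) - 0) < e" if "n \<ge> N k" for n
        using close[OF that] Lp_norm_nonneg[of r \<Omega> "\<lambda>x. U n x - u x"] by simp
      then show "\<exists>no. \<forall>n\<ge>no. norm (Lp_norm r \<Omega> (\<lambda>x. U n x - u x) - 0) < e" by blast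
    qed
    have "(\<lambda>x. U (N 0) x - (U (N 0) x - u x)) \<in> Lp_space r \<Omega>"
      by (rule Lp_space_diff[OF r0 U]) (use close[of 0 "N 0"] in simp)
    then show "u \<in> Lp_space r \<Omega>" by simp
  qed
qed

section \<open>Weak gradients\<close>

lemma Lp_integrable:
  assumes "\<Omega> \<in> lmeasurable" "r \<ge> 1" "u \<in> Lp_space r \<Omega>"
  shows "integrable (lebesgue_on \<Omega>) u"
proof -
  have "u \<in> Lp_space 1 \<Omega>" using assms Lp_space_subset[of \<Omega> 1 r u] by simp
  then have "integrable (lebesgue_on \<Omega>) (\<lambda>x. norm (u x))" "u \<in> borel_measurable (lebesgue_on \<Omega>)"
    by (auto simp: Lp_space_def)
  then show ?thesis using integrable_norm_iff by blast
qed

lemma integrable_lebesgue_on_subset: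
  assumes "integrable (lebesgue_on \<Omega>) u" "K \<subseteq> \<Omega>" "K \<in> sets lebesgue" "\<Omega> \<in> sets lebesgue"
  shows "integrable (lebesgue_on K) (u :: 'a::euclidean_space \<Rightarrow> 'b::euclidean_space)"
proof -
  have "integrable lebesgue (\<lambda>x. indicator K x *\<^sub>R (indicator \<Omega> x *\<^sub>R u x))"
  proof (rule integrable_mult_indicator[OF assms(3)])
    show "integrable lebesgue (\<lambda>x. indicator \<Omega> x *\<^sub>R u x)"
      using assms(1,4) by (simp add: integrable_restrict_space)
  qed
  moreover have "(\<lambda>x. indicator K x *\<^sub>R (indicator \<Omega> x *\<^sub>R u x)) = (\<lambda>x. indicator K x *\<^sub>R u x)"
    using assms(2) by (auto simp: indicator_def fun_eq_iff)
  ultimately show ?thesis using assms by (simp add: integrable_restrict_space)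
qed

lemma Lp_locally_integrable:
  assumes "\<Omega> \<in> lmeasurable" "r \<ge> 1" "u \<in> Lp_space r \<Omega>"
  shows "locally_integrable \<Omega> u"
  unfolding locally_integrable_def
  using integrable_lebesgue_on_subset[OF Lp_integrable[OF assms]] assms(1) lmeasurable_compact by auto

lemma has_weak_grad_test_function:
  assumes \<phi>: "\<phi> \<in> test_functions \<Omega>" and \<Omega>: "\<Omega> \<in> lmeasurable"
  shows "has_weak_grad \<Omega> \<phi> (grad \<phi>)"
  unfolding has_weak_grad_def
proof (intro conjI ballI)
  have s: "\<Omega> \<in> sets lebesgue" using \<Omega> by auto
  show "locally_integrable \<Omega> \<phi>" "locally_integrable \<Omega> (grad \<phi>)"
    using Lp_locally_integrable[OF \<Omega>, of 1] test_function_Lp[OF \<phi> s, of 1] by auto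
  fix \<psi> assume \<psi>: "\<psi> \<in> test_functions \<Omega>"
  note c = test_function_continuous[OF \<phi>] test_function_continuous[OF \<psi>]
  note out = test_function_outside_domain[OF \<phi>] test_function_outside_domain[OF \<psi>]
  let ?f = "\<lambda>x. \<phi> x *\<^sub>R grad \<psi> x" and ?g = "\<lambda>x. \<psi> x *\<^sub>R grad \<phi> x"
  have cf: "continuous_on UNIV ?f" and cg: "continuous_on UNIV ?g" by (intro continuous_intros c)+
  note K = compact_imp_bounded[OF test_functionsD(2)[OF \<phi>]]
  have i: "integrable lborel ?f" "integrable lborel ?g"
    by (rule integrable_lborel_bounded_support[OF cf K] integrable_lborel_bounded_support[OF cg K];
        use test_function_outside[OF \<phi>] in simp)+
  have prod: "(\<lambda>x. \<phi> x * \<psi> x) \<in> test_functions \<Omega>" by (rule test_function_mult[OF \<phi> \<psi>])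
  have "(LINT x|lborel. ?f x + ?g x) \<bullet> h = 0" for h
  proof -
    have "(LINT x|lborel. ?f x + ?g x) \<bullet> h = (LINT x|lborel. (?f x + ?g x) \<bullet> h)"
      using i by (intro integral_inner_left[symmetric]) auto
    also have "\<dots> = 0"
      using integral_directional_derivative_zero[OF prod, of h] by (simp add: test_function_mult(2)[OF \<phi> \<psi>])
    finally show ?thesis .
  qed
  then have "(LINT x|lborel. ?f x + ?g x) = 0" by (metis inner_eq_zero_iff)
  then have "integral\<^sup>L lborel ?f = - integral\<^sup>L lborel ?g"
    using i by (simp add: eq_neg_iff_add_eq_0)
  then show "(LINT x|lebesgue_on \<Omega>. ?f x) = - (LINT x|lebesgue_on \<Omega>. ?g x)"
    using out by (simp add: integral_lebesgue_on_eq_lborel(1)[OF s cf] integral_lebesgue_on_eq_lborel(1)[OF s cg])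
qed

text \<open>Boxes generate the Borel sets and are closed under intersection, so the integral vanishes over all
Borel sets and, by completion, over all Lebesgue measurable sets.\<close>
lemma zero_on_boxes_imp_AE_zero:
  fixes h :: "'a::euclidean_space \<Rightarrow> 'b::euclidean_space"
  assumes h: "integrable lebesgue h"
    and supp: "\<And>x. x \<notin> box a b \<Longrightarrow> h x = 0"
    and zero: "\<And>c d. (LINT x:box c d|lebesgue. h x) = 0"
  shows "AE x in lebesgue. h x = 0"
proof -
  interpret B: finite_measure "lebesgue_on (box a b)"
    by (rule finite_measure_lebesgue_on) simp
  have si: "set_integrable lebesgue A h" if "A \<in> sets lebesgue" for A
    unfolding set_integrable_def using h that by (intro integrable_mult_indicator)
  have "(LINT x:UNIV|lebesgue. h x) = (LINT x:box a b|lebesgue. h x)"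
    unfolding set_lebesgue_integral_def
    by (intro Bochner_Integration.integral_cong) (use supp in \<open>auto simp: indicator_def\<close>)
  then have UNIV0: "(LINT x:UNIV|lebesgue. h x) = 0" using zero by simp
  have borel: "(LINT x:A|lebesgue. h x) = 0" if "A \<in> sets borel" for A
  proof -
    let ?G = "range (\<lambda>(a, b). box a b :: 'a set)"
    have sb: "X \<in> sets lebesgue" if "X \<in> sigma_sets UNIV ?G" for X
    proof -
      have "X \<in> sets borel" using that unfolding borel_eq_box by simp
      then show ?thesis by simp
    qed
    have st: "Int_stable ?G" by (auto simp: Int_stable_def box_Int_box)
    have A: "A \<in> sigma_sets UNIV ?G" using that unfolding borel_eq_box by simp
    show ?thesis
      using st subset_UNIV[of ?G, unfolded Pow_UNIV[symmetric]] A
    proof (induction rule: sigma_sets_induct_disjoint)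
      case (basic X)
      then show ?case using zero by auto
    next
      case empty
      then show ?case by (simp add: set_lebesgue_integral_def)
    next
      case (compl X)
      have "(LINT x:X \<union> (UNIV - X)|lebesgue. h x) = (LINT x:X|lebesgue. h x) + (LINT x:UNIV - X|lebesgue. h x)"
        by (rule set_integral_Un) (use sb[OF compl(1)] in \<open>auto intro!: si\<close>)
      then show ?case using UNIV0 compl(2) by simp
    next
      case (union X)
      have m: "X i \<in> sets lebesgue" for i using union(2) by (intro sb) auto
      have "(LINT x:(\<Union>i. X i)|lebesgue. h x) = suminf (\<lambda>i. LINT x:(X i)|lebesgue. h x)"
        by (rule lebesgue_integral_countable_add) (use m union(1) in \<open>auto intro!: si simp: disjoint_family_on_def\<close>)
      then show ?case using union(3) by simp
    qed
  qed
  have leb: "(LINT x:A|lebesgue. h x) = 0" if A: "A \<in> sets lebesgue" for A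
  proof -
    obtain S N N' where S: "A = S \<union> N" "N \<subseteq> N'" "N' \<in> null_sets lborel" "S \<in> sets lborel"
      by (rule sets_completionE[OF A])
    have "AE x in lebesgue. x \<notin> N'" using S(3) by (intro AE_completion AE_not_in)
    then have "AE x in lebesgue. indicator A x *\<^sub>R h x = indicator S x *\<^sub>R h x"
      by eventually_elim (use S(1,2) in \<open>auto simp: indicator_def\<close>)
    then have "(LINT x:A|lebesgue. h x) = (LINT x:S|lebesgue. h x)"
      unfolding set_lebesgue_integral_def
    proof (rule integral_cong_AE[rotated 2])
      have "S \<in> sets lebesgue" using S(4) by simp
      then show "(\<lambda>x. indicator S x *\<^sub>R h x) \<in> borel_measurable lebesgue"
        by (rule borel_measurable_scaleR[OF borel_measurable_indicator borel_measurable_integrable[OF h]])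
      show "(\<lambda>x. indicator A x *\<^sub>R h x) \<in> borel_measurable lebesgue"
        by (rule borel_measurable_scaleR[OF borel_measurable_indicator[OF A] borel_measurable_integrable[OF h]])
    qed
    also have "\<dots> = 0" using S(4) by (intro borel) simp
    finally show ?thesis .
  qed
  have ind: "indicator (box a b) x *\<^sub>R h x = h x" for x using supp by (auto simp: indicator_def)
  have "AE x in lebesgue_on (box a b). h x = 0"
  proof (rule B.density_zero)
    show "integrable (lebesgue_on (box a b)) h" using h by (simp add: integrable_restrict_space ind)
    fix A assume A: "A \<in> sets (lebesgue_on (box a b))"
    then have "A \<in> sets lebesgue" by (auto simp: sets_restrict_space_iff)
    have "set_lebesgue_integral (lebesgue_on (box a b)) A h = (LINT x:A|lebesgue. h x)"
      unfolding set_lebesgue_integral_def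
      by (subst integral_restrict_space, simp, intro Bochner_Integration.integral_cong)
         (use supp in \<open>auto simp: indicator_def\<close>)
    then show "set_lebesgue_integral (lebesgue_on (box a b)) A h = 0"
      using leb[OF \<open>A \<in> sets lebesgue\<close>] by simp
  qed
  then have "AE x in lebesgue. x \<in> box a b \<longrightarrow> h x = 0" by (simp add: AE_restrict_space_iff)
  then show ?thesis by eventually_elim (use supp in auto)
qed

lemma integrable_test_function_times:
  assumes \<phi>: "\<phi> \<in> test_functions \<Omega>" and g: "locally_integrable \<Omega> g" and \<Omega>: "\<Omega> \<in> sets lebesgue"
  shows "integrable (lebesgue_on \<Omega>) (\<lambda>x. \<phi> x *\<^sub>R g x)"
proof -
  let ?K = "closure (support_on UNIV \<phi>)"
  obtain M where M: "M \<ge> 0" "\<And>x. \<bar>\<phi> x\<bar> \<le> M" by (rule test_function_bounded[OF \<phi>]) (erule that, simp)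
  have [measurable]: "\<phi> \<in> borel_measurable borel"
    using test_function_continuous(1)[OF \<phi>] by (rule borel_measurable_continuous_onI)
  have m1: "\<phi> \<in> borel_measurable lebesgue" by (intro measurable_completion) simp
  have "integrable (lebesgue_on ?K) g" using g test_functionsD[OF \<phi>] by (auto simp: locally_integrable_def)
  then have gi: "integrable lebesgue (\<lambda>x. indicator ?K x *\<^sub>R g x)"
    by (simp add: integrable_restrict_space)
  then have m2: "(\<lambda>x. indicator ?K x *\<^sub>R g x) \<in> borel_measurable lebesgue" by simp
  have "integrable lebesgue (\<lambda>x. \<phi> x *\<^sub>R (indicator ?K x *\<^sub>R g x))"
  proof (rule Bochner_Integration.integrable_bound)
    show "integrable lebesgue (\<lambda>x. M *\<^sub>R (indicator ?K x *\<^sub>R g x))" using gi by (rule integrable_scaleR_right)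
    show "(\<lambda>x. \<phi> x *\<^sub>R (indicator ?K x *\<^sub>R g x)) \<in> borel_measurable lebesgue" by (rule borel_measurable_scaleR[OF m1 m2])
    show "AE x in lebesgue. norm (\<phi> x *\<^sub>R (indicator ?K x *\<^sub>R g x)) \<le> norm (M *\<^sub>R (indicator ?K x *\<^sub>R g x))"
      using M by (intro AE_I2) (auto intro!: mult_right_mono simp: indicator_def)
  qed
  moreover have "(\<lambda>x. \<phi> x *\<^sub>R (indicator ?K x *\<^sub>R g x)) = (\<lambda>x. indicator \<Omega> x *\<^sub>R (\<phi> x *\<^sub>R g x))"
    using test_function_outside(1)[OF \<phi>] test_functionsD(3)[OF \<phi>] by (auto simp: indicator_def fun_eq_iff)
  ultimately show ?thesis using \<Omega> by (simp add: integrable_restrict_space)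
qed

text \<open>Test functions converging to the indicator of a box show that \<open>g\<close> has integral zero over each box in
\<open>\<Omega>\<close>; countably many boxes cover \<open>\<Omega>\<close>.\<close>
lemma fundamental_lemma_calculus_of_variations:
  fixes g :: "'a::euclidean_space \<Rightarrow> 'b::euclidean_space"
  assumes \<Omega>: "open \<Omega>" and g: "locally_integrable \<Omega> g"
    and zero: "\<And>\<phi>. \<phi> \<in> test_functions \<Omega> \<Longrightarrow> (LINT x|lebesgue_on \<Omega>. \<phi> x *\<^sub>R g x) = 0"
  shows "AE x in lebesgue_on \<Omega>. g x = 0"
proof -
  have \<Omega>s: "\<Omega> \<in> sets lebesgue" using \<Omega> by auto
  have gK: "integrable lebesgue (\<lambda>x. indicator (cbox c d) x *\<^sub>R g x)" if "cbox c d \<subseteq> \<Omega>" for c d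
  proof -
    have "integrable (lebesgue_on (cbox c d)) g" using g that by (simp add: locally_integrable_def)
    then show ?thesis by (simp add: integrable_restrict_space)
  qed
  have box0: "(LINT x|lebesgue. indicator (box c d) x *\<^sub>R g x) = 0" if cd: "cbox c d \<subseteq> \<Omega>" for c d
  proof -
    obtain \<phi> where \<phi>: "\<And>n. \<phi> n \<in> test_functions \<Omega>" "\<And>n x. 0 \<le> \<phi> n x" "\<And>n x. \<phi> n x \<le> indicator (box c d) x"
      "\<And>x. (\<lambda>n. \<phi> n x) \<longlonglongrightarrow> indicator (box c d) x"
      by (rule indicator_box_test_functions[OF cd]) blast
    have eq: "\<phi> n x *\<^sub>R g x = \<phi> n x *\<^sub>R (indicator (cbox c d) x *\<^sub>R g x)" for n x
      using \<phi>(2,3)[of n x] box_subset_cbox[of c d] by (cases "x \<in> box c d") (auto simp: indicator_def)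
    have m2: "(\<lambda>x. indicator (cbox c d) x *\<^sub>R g x) \<in> borel_measurable lebesgue"
      using gK[OF cd] by simp
    have m: "\<phi> n \<in> borel_measurable lebesgue" for n
      using borel_measurable_continuous_onI[OF test_function_continuous(1)[OF \<phi>(1)[of n]]]
      by (intro measurable_completion) simp
    have "(\<lambda>n. LINT x|lebesgue. \<phi> n x *\<^sub>R (indicator (cbox c d) x *\<^sub>R g x)) \<longlonglongrightarrow>
       (LINT x|lebesgue. indicator (box c d) x *\<^sub>R (indicator (cbox c d) x *\<^sub>R g x))"
    proof (rule integral_dominated_convergence[where w="\<lambda>x. norm (indicator (cbox c d) x *\<^sub>R g x)"])
      show "integrable lebesgue (\<lambda>x. norm (indicator (cbox c d) x *\<^sub>R g x))" using gK[OF cd] by (rule integrable_norm)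
      show "(\<lambda>x. \<phi> n x *\<^sub>R (indicator (cbox c d) x *\<^sub>R g x)) \<in> borel_measurable lebesgue" for n
        by (rule borel_measurable_scaleR[OF m m2])
      show "(\<lambda>x. indicator (box c d) x *\<^sub>R (indicator (cbox c d) x *\<^sub>R g x)) \<in> borel_measurable lebesgue"
        by (rule borel_measurable_scaleR[OF borel_measurable_indicator m2]) simp
      show "AE x in lebesgue. (\<lambda>n. \<phi> n x *\<^sub>R (indicator (cbox c d) x *\<^sub>R g x)) \<longlonglongrightarrow> indicator (box c d) x *\<^sub>R (indicator (cbox c d) x *\<^sub>R g x)"
        by (intro AE_I2 tendsto_scaleR \<phi>(4) tendsto_const)
      have "\<bar>\<phi> n x\<bar> \<le> 1" for n x using \<phi>(2,3)[of n x] by (cases "x \<in> box c d") auto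
      then have "norm (\<phi> n x *\<^sub>R v) \<le> norm v" for n x and v :: 'b
        using mult_right_mono[of "\<bar>\<phi> n x\<bar>" 1 "norm v"] by simp
      then show "AE x in lebesgue. norm (\<phi> n x *\<^sub>R (indicator (cbox c d) x *\<^sub>R g x)) \<le> norm (indicator (cbox c d) x *\<^sub>R g x)" for n
        by (intro AE_I2)
    qed
    moreover have "(LINT x|lebesgue. \<phi> n x *\<^sub>R (indicator (cbox c d) x *\<^sub>R g x)) = 0" for n
    proof -
      have "(LINT x|lebesgue. \<phi> n x *\<^sub>R (indicator (cbox c d) x *\<^sub>R g x)) = (LINT x|lebesgue. indicator \<Omega> x *\<^sub>R (\<phi> n x *\<^sub>R g x))"
        unfolding eq[symmetric] using test_function_outside_domain(1)[OF \<phi>(1)]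
        by (intro Bochner_Integration.integral_cong) (auto simp: indicator_def)
      also have "\<dots> = 0" using zero[OF \<phi>(1)[of n]] \<Omega>s by (simp add: integral_restrict_space)
      finally show ?thesis .
    qed
    ultimately have "(LINT x|lebesgue. indicator (box c d) x *\<^sub>R (indicator (cbox c d) x *\<^sub>R g x)) = 0"
      by (simp add: LIMSEQ_const_iff)
    moreover have "indicator (box c d) x *\<^sub>R (indicator (cbox c d) x *\<^sub>R g x) = indicator (box c d) x *\<^sub>R g x" for x
      using box_subset_cbox[of c d] by (auto simp: indicator_def)
    ultimately show ?thesis by (simp only:)
  qed
  have on_box: "AE x in lebesgue. x \<in> box a b \<longrightarrow> g x = 0" if ab: "cbox a b \<subseteq> \<Omega>" for a b
  proof -
    have sub: "indicator (box a b) x *\<^sub>R (indicator (cbox a b) x *\<^sub>R g x) = indicator (box a b) x *\<^sub>R g x" for x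
      using box_subset_cbox[of a b] by (auto simp: indicator_def)
    have "integrable lebesgue (\<lambda>x. indicator (box a b) x *\<^sub>R (indicator (cbox a b) x *\<^sub>R g x))"
      by (intro integrable_mult_indicator gK ab) auto
    then have i: "integrable lebesgue (\<lambda>x. indicator (box a b) x *\<^sub>R g x)" by (simp only: sub)
    have "AE x in lebesgue. indicator (box a b) x *\<^sub>R g x = 0"
    proof (rule zero_on_boxes_imp_AE_zero[OF i, of a b])
      fix c d
      obtain e f where ef: "box c d \<inter> box a b = box e f" unfolding box_Int_box by blast
      have "(LINT x:box c d|lebesgue. indicator (box a b) x *\<^sub>R g x) = (LINT x|lebesgue. indicator (box e f) x *\<^sub>R g x)"
        unfolding set_lebesgue_integral_def ef[symmetric] by (simp add: indicator_inter_arith)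
      also have "\<dots> = 0"
      proof (cases "box e f = {}")
        case False
        have "box e f \<subseteq> cbox a b" using ef box_subset_cbox[of a b] by blast
        then have "cbox e f \<subseteq> cbox a b"
          using closure_minimal[OF _ closed_cbox, of "box e f" a b] unfolding closure_box[OF False] by simp
        then show ?thesis using ab by (intro box0) auto
      qed simp
      finally show "(LINT x:box c d|lebesgue. indicator (box a b) x *\<^sub>R g x) = 0" .
    qed simp
    then show ?thesis by eventually_elim (auto simp: indicator_def)
  qed
  define \<B> where "\<B> = {B. \<exists>a b. B = box a b \<and> cbox a b \<subseteq> \<Omega>}"
  have cover: "\<Omega> \<subseteq> \<Union>\<B>"
  proof
    fix x assume "x \<in> \<Omega>"
    then obtain a b where "cbox a b \<subseteq> \<Omega>" "x \<in> box a b" using open_contains_cbox[OF \<Omega>, of x] by metis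
    then show "x \<in> \<Union>\<B>" by (auto simp: \<B>_def)
  qed
  obtain \<B>' where B': "\<B>' \<subseteq> \<B>" "countable \<B>'" "\<Union>\<B>' = \<Union>\<B>"
    by (rule Lindelof[of \<B>]) (auto simp: \<B>_def)
  have "AE x in lebesgue. \<forall>B\<in>\<B>'. x \<in> B \<longrightarrow> g x = 0"
    unfolding AE_ball_countable[OF B'(2)] using B'(1) on_box by (auto simp: \<B>_def)
  then have "AE x in lebesgue. x \<in> \<Omega> \<longrightarrow> g x = 0"
    by eventually_elim (use cover B'(3) in blast)
  then show ?thesis using \<Omega>s by (simp add: AE_restrict_space_iff)
qed

lemma weak_grad_unique:
  assumes \<Omega>: "open \<Omega>" and g: "has_weak_grad \<Omega> u g" and g': "has_weak_grad \<Omega> u g'"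
  shows "AE x in lebesgue_on \<Omega>. g x = g' x"
proof -
  have \<Omega>s: "\<Omega> \<in> sets lebesgue" using \<Omega> by auto
  have li: "locally_integrable \<Omega> g" "locally_integrable \<Omega> g'" using g g' by (auto simp: has_weak_grad_def)
  have "AE x in lebesgue_on \<Omega>. g x - g' x = 0"
  proof (rule fundamental_lemma_calculus_of_variations[OF \<Omega>])
    show "locally_integrable \<Omega> (\<lambda>x. g x - g' x)" using li by (auto simp: locally_integrable_def)
    fix \<phi> assume \<phi>: "\<phi> \<in> test_functions \<Omega>"
    have "(LINT x|lebesgue_on \<Omega>. \<phi> x *\<^sub>R g x) = (LINT x|lebesgue_on \<Omega>. \<phi> x *\<^sub>R g' x)"
      using g g' \<phi> unfolding has_weak_grad_def by (metis neg_equal_iff_equal)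
    then show "(LINT x|lebesgue_on \<Omega>. \<phi> x *\<^sub>R (g x - g' x)) = 0"
      using integrable_test_function_times[OF \<phi> li(1) \<Omega>s] integrable_test_function_times[OF \<phi> li(2) \<Omega>s]
      by (simp add: scaleR_diff_right)
  qed
  then show ?thesis by simp
qed

section \<open>The space with zero boundary values\<close>

lemma has_weak_grad_limit:
  fixes u :: "'a::euclidean_space \<Rightarrow> real"
  assumes \<Omega>: "\<Omega> \<in> lmeasurable" and r: "r > 1"
    and u: "u \<in> Lp_space r \<Omega>" and g: "g \<in> Lp_space r \<Omega>"
    and \<phi>: "\<And>n. \<phi> n \<in> test_functions \<Omega>"
    and lu: "(\<lambda>n. Lp_norm r \<Omega> (\<lambda>x. \<phi> n x - u x)) \<longlonglongrightarrow> 0"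
    and lg: "(\<lambda>n. Lp_norm r \<Omega> (\<lambda>x. grad (\<phi> n) x - g x)) \<longlonglongrightarrow> 0"
  shows "has_weak_grad \<Omega> u g"
  unfolding has_weak_grad_def
proof (intro conjI ballI)
  have s: "\<Omega> \<in> sets lebesgue" using \<Omega> by auto
  have r0: "r > 0" using r by simp
  show li: "locally_integrable \<Omega> u" "locally_integrable \<Omega> g"
    using Lp_locally_integrable[OF \<Omega> _ u] Lp_locally_integrable[OF \<Omega> _ g] r by auto
  fix \<psi> assume \<psi>: "\<psi> \<in> test_functions \<Omega>"
  obtain M where M: "M \<ge> 0" "\<And>x. \<bar>\<psi> x\<bar> \<le> M" "\<And>x. norm (grad \<psi> x) \<le> M"
    by (rule test_function_bounded[OF \<psi>]) blast
  have [measurable]: "\<psi> \<in> borel_measurable (lebesgue_on \<Omega>)" "grad \<psi> \<in> borel_measurable (lebesgue_on \<Omega>)"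
    using Lp_spaceD(1)[OF test_function_Lp(1)[OF \<psi> s r0]] Lp_spaceD(1)[OF test_function_Lp(2)[OF \<psi> s r0]] by auto
  obtain K1 where K1: "\<And>w::'a \<Rightarrow> real. w \<in> Lp_space r \<Omega> \<Longrightarrow> Lp_norm 1 \<Omega> w \<le> K1 * Lp_norm r \<Omega> w"
    using Lp_norm_embedding[OF \<Omega>, of 1 r, where 'b=real] r by auto
  obtain K2 where K2: "\<And>w::'a \<Rightarrow> 'a. w \<in> Lp_space r \<Omega> \<Longrightarrow> Lp_norm 1 \<Omega> w \<le> K2 * Lp_norm r \<Omega> w"
    using Lp_norm_embedding[OF \<Omega>, of 1 r, where 'b='a] r by auto
  note \<phi>L = test_function_Lp[OF \<phi> s r0]
  have iu: "integrable (lebesgue_on \<Omega>) (\<lambda>x. w x *\<^sub>R grad \<psi> x)" if "w \<in> Lp_space r \<Omega>" for w :: "'a \<Rightarrow> real"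
  proof (rule Bochner_Integration.integrable_bound)
    have [measurable]: "w \<in> borel_measurable (lebesgue_on \<Omega>)" using that by (rule Lp_spaceD)
    show "integrable (lebesgue_on \<Omega>) (\<lambda>x. M * w x)" using Lp_integrable[OF \<Omega> _ that] r by simp
    show "(\<lambda>x. w x *\<^sub>R grad \<psi> x) \<in> borel_measurable (lebesgue_on \<Omega>)" by (intro borel_measurable_scaleR) measurable
    show "AE x in lebesgue_on \<Omega>. norm (w x *\<^sub>R grad \<psi> x) \<le> norm (M * w x)"
    proof (rule AE_I2)
      fix x
      have "\<bar>w x\<bar> * norm (grad \<psi> x) \<le> \<bar>w x\<bar> * M" by (intro mult_left_mono M) simp
      then show "norm (w x *\<^sub>R grad \<psi> x) \<le> norm (M * w x)" using M(1) by (simp add: abs_mult mult.commute)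
    qed
  qed
  have ig: "integrable (lebesgue_on \<Omega>) (\<lambda>x. \<psi> x *\<^sub>R w x)" if "w \<in> Lp_space r \<Omega>" for w :: "'a \<Rightarrow> 'a"
    using r by (intro integrable_test_function_times[OF \<psi>] Lp_locally_integrable[OF \<Omega> _ that] s) simp
  have "(\<lambda>n. LINT x|lebesgue_on \<Omega>. \<phi> n x *\<^sub>R grad \<psi> x) \<longlonglongrightarrow> (LINT x|lebesgue_on \<Omega>. u x *\<^sub>R grad \<psi> x)"
  proof (rule LIM_zero_cancel, rule Lim_null_comparison[where g="\<lambda>n. M * (K1 * Lp_norm r \<Omega> (\<lambda>x. \<phi> n x - u x))"])
    show "(\<lambda>n. M * (K1 * Lp_norm r \<Omega> (\<lambda>x. \<phi> n x - u x))) \<longlonglongrightarrow> 0"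
      using tendsto_mult[OF tendsto_const[of M] tendsto_mult[OF tendsto_const[of K1] lu]] by simp
    show "\<forall>\<^sub>F n in sequentially. norm ((LINT x|lebesgue_on \<Omega>. \<phi> n x *\<^sub>R grad \<psi> x) - (LINT x|lebesgue_on \<Omega>. u x *\<^sub>R grad \<psi> x))
       \<le> M * (K1 * Lp_norm r \<Omega> (\<lambda>x. \<phi> n x - u x))"
    proof (intro always_eventually allI)
      fix n
      let ?w = "\<lambda>x. \<phi> n x - u x"
      have w: "?w \<in> Lp_space r \<Omega>" by (intro Lp_space_diff r0 \<phi>L u)
      have "(LINT x|lebesgue_on \<Omega>. \<phi> n x *\<^sub>R grad \<psi> x) - (LINT x|lebesgue_on \<Omega>. u x *\<^sub>R grad \<psi> x)
         = (LINT x|lebesgue_on \<Omega>. ?w x *\<^sub>R grad \<psi> x)"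
        unfolding scaleR_diff_left by (intro Bochner_Integration.integral_diff[symmetric] iu \<phi>L u)
      also have "norm \<dots> \<le> (LINT x|lebesgue_on \<Omega>. norm (?w x *\<^sub>R grad \<psi> x))" by (rule integral_norm_bound)
      also have "\<dots> \<le> (LINT x|lebesgue_on \<Omega>. M * norm (?w x) powr 1)"
      proof (rule integral_mono)
        show "integrable (lebesgue_on \<Omega>) (\<lambda>x. norm (?w x *\<^sub>R grad \<psi> x))" by (intro integrable_norm iu w)
        show "integrable (lebesgue_on \<Omega>) (\<lambda>x. M * norm (?w x) powr 1)"
          using Lp_spaceD(2)[OF Lp_space_subset[OF \<Omega> _ _ w, of 1]] r by simp
      qed (use M in \<open>auto simp: mult.commute intro!: mult_right_mono\<close>)
      also have "\<dots> = M * Lp_norm 1 \<Omega> ?w" using Lp_norm_powr[of 1 \<Omega> ?w] Lp_norm_nonneg[of 1 \<Omega> ?w] by simp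
      also have "\<dots> \<le> M * (K1 * Lp_norm r \<Omega> ?w)" by (intro mult_left_mono K1 w M)
      finally show "norm ((LINT x|lebesgue_on \<Omega>. \<phi> n x *\<^sub>R grad \<psi> x) - (LINT x|lebesgue_on \<Omega>. u x *\<^sub>R grad \<psi> x))
       \<le> M * (K1 * Lp_norm r \<Omega> ?w)" .
    qed
  qed
  moreover have "(\<lambda>n. LINT x|lebesgue_on \<Omega>. \<psi> x *\<^sub>R grad (\<phi> n) x) \<longlonglongrightarrow> (LINT x|lebesgue_on \<Omega>. \<psi> x *\<^sub>R g x)"
  proof (rule LIM_zero_cancel, rule Lim_null_comparison[where g="\<lambda>n. M * (K2 * Lp_norm r \<Omega> (\<lambda>x. grad (\<phi> n) x - g x))"])
    show "(\<lambda>n. M * (K2 * Lp_norm r \<Omega> (\<lambda>x. grad (\<phi> n) x - g x))) \<longlonglongrightarrow> 0"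
      using tendsto_mult[OF tendsto_const[of M] tendsto_mult[OF tendsto_const[of K2] lg]] by simp
    show "\<forall>\<^sub>F n in sequentially. norm ((LINT x|lebesgue_on \<Omega>. \<psi> x *\<^sub>R grad (\<phi> n) x) - (LINT x|lebesgue_on \<Omega>. \<psi> x *\<^sub>R g x))
       \<le> M * (K2 * Lp_norm r \<Omega> (\<lambda>x. grad (\<phi> n) x - g x))"
    proof (intro always_eventually allI)
      fix n
      let ?w = "\<lambda>x. grad (\<phi> n) x - g x"
      have w: "?w \<in> Lp_space r \<Omega>" by (intro Lp_space_diff r0 \<phi>L g)
      have "(LINT x|lebesgue_on \<Omega>. \<psi> x *\<^sub>R grad (\<phi> n) x) - (LINT x|lebesgue_on \<Omega>. \<psi> x *\<^sub>R g x)
         = (LINT x|lebesgue_on \<Omega>. \<psi> x *\<^sub>R ?w x)"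
        unfolding scaleR_diff_right by (intro Bochner_Integration.integral_diff[symmetric] ig \<phi>L g)
      also have "norm \<dots> \<le> (LINT x|lebesgue_on \<Omega>. norm (\<psi> x *\<^sub>R ?w x))" by (rule integral_norm_bound)
      also have "\<dots> \<le> (LINT x|lebesgue_on \<Omega>. M * norm (?w x) powr 1)"
      proof (rule integral_mono)
        show "integrable (lebesgue_on \<Omega>) (\<lambda>x. norm (\<psi> x *\<^sub>R ?w x))" by (intro integrable_norm ig w)
        show "integrable (lebesgue_on \<Omega>) (\<lambda>x. M * norm (?w x) powr 1)"
          using Lp_spaceD(2)[OF Lp_space_subset[OF \<Omega> _ _ w, of 1]] r by simp
      qed (use M in \<open>auto intro!: mult_right_mono\<close>)
      also have "\<dots> = M * Lp_norm 1 \<Omega> ?w" using Lp_norm_powr[of 1 \<Omega> ?w] Lp_norm_nonneg[of 1 \<Omega> ?w] by simp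
      also have "\<dots> \<le> M * (K2 * Lp_norm r \<Omega> ?w)" by (intro mult_left_mono K2 w M)
      finally show "norm ((LINT x|lebesgue_on \<Omega>. \<psi> x *\<^sub>R grad (\<phi> n) x) - (LINT x|lebesgue_on \<Omega>. \<psi> x *\<^sub>R g x))
       \<le> M * (K2 * Lp_norm r \<Omega> ?w)" .
    qed
  qed
  moreover have "(LINT x|lebesgue_on \<Omega>. \<phi> n x *\<^sub>R grad \<psi> x) = - (LINT x|lebesgue_on \<Omega>. \<psi> x *\<^sub>R grad (\<phi> n) x)" for n
    using has_weak_grad_test_function[OF \<phi> \<Omega>] \<psi> unfolding has_weak_grad_def by blast
  ultimately have "(\<lambda>n. LINT x|lebesgue_on \<Omega>. \<phi> n x *\<^sub>R grad \<psi> x) \<longlonglongrightarrow> (LINT x|lebesgue_on \<Omega>. u x *\<^sub>R grad \<psi> x)"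
    "(\<lambda>n. LINT x|lebesgue_on \<Omega>. \<phi> n x *\<^sub>R grad \<psi> x) \<longlonglongrightarrow> - (LINT x|lebesgue_on \<Omega>. \<psi> x *\<^sub>R g x)"
    by (auto intro: tendsto_minus)
  then show "(LINT x|lebesgue_on \<Omega>. u x *\<^sub>R grad \<psi> x) = - (LINT x|lebesgue_on \<Omega>. \<psi> x *\<^sub>R g x)"
    by (rule LIMSEQ_unique)
qed

lemma weak_grad_AE_eq:
  assumes \<Omega>: "open \<Omega>" and g: "has_weak_grad \<Omega> u g"
  shows "AE x in lebesgue_on \<Omega>. weak_grad \<Omega> u x = g x"
proof -
  have "has_weak_grad \<Omega> u (weak_grad \<Omega> u)" unfolding weak_grad_def by (rule someI[of "has_weak_grad \<Omega> u", OF g])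
  then show ?thesis using weak_grad_unique[OF \<Omega> _ g] by blast
qed

lemma borel_measurable_lebesgue_on_AE:
  fixes f g :: "'a::euclidean_space \<Rightarrow> 'b::euclidean_space"
  assumes \<Omega>: "\<Omega> \<in> sets lebesgue" and f: "f \<in> borel_measurable (lebesgue_on \<Omega>)"
    and ae: "AE x in lebesgue_on \<Omega>. f x = g x"
  shows "g \<in> borel_measurable (lebesgue_on \<Omega>)"
proof -
  have "(\<lambda>x. if x \<in> \<Omega> then f x else 0) \<in> borel_measurable lebesgue"
    using f \<Omega> by (simp add: borel_measurable_if)
  moreover have "AE x in lebesgue. (if x \<in> \<Omega> then f x else 0) = (if x \<in> \<Omega> then g x else 0)"
    using ae \<Omega> by (simp add: AE_restrict_space_iff)
  ultimately have "(\<lambda>x. if x \<in> \<Omega> then g x else 0) \<in> borel_measurable lebesgue"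
    by (rule borel_measurable_AE)
  then show ?thesis using \<Omega> by (simp add: borel_measurable_if)
qed

lemma Lp_space_AE:
  fixes f g :: "'a::euclidean_space \<Rightarrow> 'b::euclidean_space"
  assumes \<Omega>: "\<Omega> \<in> sets lebesgue" and f: "f \<in> Lp_space r \<Omega>"
    and ae: "AE x in lebesgue_on \<Omega>. f x = g x"
  shows "g \<in> Lp_space r \<Omega>"
proof -
  note g = borel_measurable_lebesgue_on_AE[OF \<Omega> Lp_spaceD(1)[OF f] ae]
  have [measurable]: "g \<in> borel_measurable (lebesgue_on \<Omega>)" "f \<in> borel_measurable (lebesgue_on \<Omega>)"
    using g Lp_spaceD(1)[OF f] by auto
  have "integrable (lebesgue_on \<Omega>) (\<lambda>x. norm (f x) powr r) \<longleftrightarrow> integrable (lebesgue_on \<Omega>) (\<lambda>x. norm (g x) powr r)"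
  proof (rule integrable_cong_AE)
    show "AE x in lebesgue_on \<Omega>. norm (f x) powr r = norm (g x) powr r" using ae by eventually_elim simp
  qed measurable
  then show ?thesis using g Lp_spaceD(2)[OF f] by (simp add: Lp_space_def)
qed

text \<open>A limit of test functions belongs to the Sobolev space with zero boundary values, whichever
representative of the limit of the gradients is at hand.\<close>
lemma W10_I:
  fixes u :: "'a::euclidean_space \<Rightarrow> real"
  assumes \<Omega>: "open \<Omega>" "\<Omega> \<in> lmeasurable" and r: "r > 1"
    and u: "u \<in> Lp_space r \<Omega>" and g: "g \<in> Lp_space r \<Omega>"
    and \<phi>: "\<And>n. \<phi> n \<in> test_functions \<Omega>"
    and lu: "(\<lambda>n. Lp_norm r \<Omega> (\<lambda>x. \<phi> n x - u x)) \<longlonglongrightarrow> 0"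
    and lg: "(\<lambda>n. Lp_norm r \<Omega> (\<lambda>x. grad (\<phi> n) x - g x)) \<longlonglongrightarrow> 0"
  shows "u \<in> W10 r \<Omega>" "AE x in lebesgue_on \<Omega>. weak_grad \<Omega> u x = g x" "weak_grad \<Omega> u \<in> Lp_space r \<Omega>"
proof -
  have s: "\<Omega> \<in> sets lebesgue" using \<Omega> by auto
  have r0: "r > 0" using r by simp
  have wg: "has_weak_grad \<Omega> u g" by (rule has_weak_grad_limit[OF \<Omega>(2) r u g \<phi> lu lg])
  show ae: "AE x in lebesgue_on \<Omega>. weak_grad \<Omega> u x = g x" by (rule weak_grad_AE_eq[OF \<Omega>(1) wg])
  have ae': "AE x in lebesgue_on \<Omega>. g x = weak_grad \<Omega> u x" using ae by eventually_elim simp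
  show wL: "weak_grad \<Omega> u \<in> Lp_space r \<Omega>" by (rule Lp_space_AE[OF s g ae'])
  have "Lp_norm r \<Omega> (\<lambda>x. grad (\<phi> n) x - weak_grad \<Omega> u x) = Lp_norm r \<Omega> (\<lambda>x. grad (\<phi> n) x - g x)" for n
  proof (rule Lp_norm_cong_AE)
    show "AE x in lebesgue_on \<Omega>. grad (\<phi> n) x - weak_grad \<Omega> u x = grad (\<phi> n) x - g x"
      using ae by eventually_elim simp
  qed (intro borel_measurable_diff Lp_spaceD(1)[OF wL] Lp_spaceD(1)[OF g] Lp_spaceD(1)[OF test_function_Lp(2)[OF \<phi> s r0]])+
  then have "(\<lambda>n. Lp_norm r \<Omega> (\<lambda>x. grad (\<phi> n) x - weak_grad \<Omega> u x)) \<longlonglongrightarrow> 0" using lg by simp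
  moreover have "u \<in> W1 r \<Omega>" using u g wg by (auto simp: W1_def)
  ultimately show "u \<in> W10 r \<Omega>" using \<phi> lu unfolding W10_def by blast
qed

lemma W10_D:
  fixes u :: "'a::euclidean_space \<Rightarrow> real"
  assumes \<Omega>: "open \<Omega>" "\<Omega> \<in> lmeasurable" and u: "u \<in> W10 r \<Omega>"
  shows "u \<in> Lp_space r \<Omega>" "weak_grad \<Omega> u \<in> Lp_space r \<Omega>" "has_weak_grad \<Omega> u (weak_grad \<Omega> u)"
    "\<exists>\<phi>. (\<forall>n::nat. \<phi> n \<in> test_functions \<Omega>) \<and>
     (\<lambda>n. Lp_norm r \<Omega> (\<lambda>x. \<phi> n x - u x)) \<longlonglongrightarrow> 0 \<and>
     (\<lambda>n. Lp_norm r \<Omega> (\<lambda>x. grad (\<phi> n) x - weak_grad \<Omega> u x)) \<longlonglongrightarrow> 0"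
proof -
  obtain g where g: "g \<in> Lp_space r \<Omega>" "has_weak_grad \<Omega> u g" and u': "u \<in> Lp_space r \<Omega>"
    using u by (auto simp: W10_def W1_def)
  show "u \<in> Lp_space r \<Omega>" by fact
  show "has_weak_grad \<Omega> u (weak_grad \<Omega> u)" unfolding weak_grad_def by (rule someI[of "has_weak_grad \<Omega> u", OF g(2)])
  have "AE x in lebesgue_on \<Omega>. g x = weak_grad \<Omega> u x"
    using weak_grad_AE_eq[OF \<Omega>(1) g(2)] by eventually_elim simp
  then show "weak_grad \<Omega> u \<in> Lp_space r \<Omega>" using \<Omega>(2) by (intro Lp_space_AE[OF _ g(1)]) auto
  show "\<exists>\<phi>. (\<forall>n::nat. \<phi> n \<in> test_functions \<Omega>) \<and>
     (\<lambda>n. Lp_norm r \<Omega> (\<lambda>x. \<phi> n x - u x)) \<longlonglongrightarrow> 0 \<and>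
     (\<lambda>n. Lp_norm r \<Omega> (\<lambda>x. grad (\<phi> n) x - weak_grad \<Omega> u x)) \<longlonglongrightarrow> 0"
    using u by (auto simp: W10_def)
qed

lemma test_function_W10:
  assumes \<Omega>: "open \<Omega>" "\<Omega> \<in> lmeasurable" and r: "r > 1" and \<phi>: "\<phi> \<in> test_functions \<Omega>"
  shows "\<phi> \<in> W10 r \<Omega>" "AE x in lebesgue_on \<Omega>. weak_grad \<Omega> \<phi> x = grad \<phi> x"
    "Lp_norm r \<Omega> (weak_grad \<Omega> \<phi>) = Lp_norm r \<Omega> (grad \<phi>)"
proof -
  have s: "\<Omega> \<in> sets lebesgue" using \<Omega> by auto
  have r0: "r > 0" using r by simp
  note L = test_function_Lp[OF \<phi> s r0]
  have 0: "(\<lambda>n. Lp_norm r \<Omega> (\<lambda>x. \<phi> x - \<phi> x)) \<longlonglongrightarrow> 0" "(\<lambda>n. Lp_norm r \<Omega> (\<lambda>x. grad \<phi> x - grad \<phi> x)) \<longlonglongrightarrow> 0"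
    by (simp_all add: Lp_norm_def)
  note W = W10_I[OF \<Omega> r L \<phi> 0]
  show "\<phi> \<in> W10 r \<Omega>" by (rule W(1))
  show ae: "AE x in lebesgue_on \<Omega>. weak_grad \<Omega> \<phi> x = grad \<phi> x" by (rule W(2))
  show "Lp_norm r \<Omega> (weak_grad \<Omega> \<phi>) = Lp_norm r \<Omega> (grad \<phi>)"
    by (rule Lp_norm_cong_AE[OF Lp_spaceD(1)[OF W(3)] Lp_spaceD(1)[OF L(2)] ae])
qed

lemma W10_diff:
  fixes u v :: "'a::euclidean_space \<Rightarrow> real"
  assumes \<Omega>: "open \<Omega>" "\<Omega> \<in> lmeasurable" and r: "r > 1" and u: "u \<in> W10 r \<Omega>" and v: "v \<in> W10 r \<Omega>"
  shows "(\<lambda>x. u x - v x) \<in> W10 r \<Omega>"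
    "AE x in lebesgue_on \<Omega>. weak_grad \<Omega> (\<lambda>x. u x - v x) x = weak_grad \<Omega> u x - weak_grad \<Omega> v x"
proof -
  have s: "\<Omega> \<in> sets lebesgue" using \<Omega> by auto
  have r0: "r > 0" using r by simp
  note U = W10_D[OF \<Omega> u] and V = W10_D[OF \<Omega> v]
  obtain \<phi> where \<phi>: "\<And>n::nat. \<phi> n \<in> test_functions \<Omega>" "(\<lambda>n. Lp_norm r \<Omega> (\<lambda>x. \<phi> n x - u x)) \<longlonglongrightarrow> 0"
     "(\<lambda>n. Lp_norm r \<Omega> (\<lambda>x. grad (\<phi> n) x - weak_grad \<Omega> u x)) \<longlonglongrightarrow> 0" using U(4) by auto
  obtain \<psi> where \<psi>: "\<And>n::nat. \<psi> n \<in> test_functions \<Omega>" "(\<lambda>n. Lp_norm r \<Omega> (\<lambda>x. \<psi> n x - v x)) \<longlonglongrightarrow> 0"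
     "(\<lambda>n. Lp_norm r \<Omega> (\<lambda>x. grad (\<psi> n) x - weak_grad \<Omega> v x)) \<longlonglongrightarrow> 0" using V(4) by auto
  define w where "w n x = \<phi> n x + (-1) * \<psi> n x" for n x
  have w: "w n \<in> test_functions \<Omega>" for n
    unfolding w_def[abs_def] by (intro test_function_add \<phi>(1) test_function_scale \<psi>(1))
  have gw: "grad (w n) x = grad (\<phi> n) x - grad (\<psi> n) x" for n x
    unfolding w_def[abs_def]
    using test_function_add(2)[OF \<phi>(1)[of n] test_function_scale(1)[OF \<psi>(1)[of n], of "-1"], of x]
      test_function_scale(2)[OF \<psi>(1)[of n], of "-1" x] by simp
  have lim: "(\<lambda>n. Lp_norm r \<Omega> (\<lambda>x. (a n x - b n x) - (a' x - b' x))) \<longlonglongrightarrow> 0"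
    if "(\<lambda>n. Lp_norm r \<Omega> (\<lambda>x. a n x - a' x)) \<longlonglongrightarrow> 0" "(\<lambda>n. Lp_norm r \<Omega> (\<lambda>x. b n x - b' x)) \<longlonglongrightarrow> 0"
      and L: "\<And>n. a n \<in> Lp_space r \<Omega>" "a' \<in> Lp_space r \<Omega>" "\<And>n. b n \<in> Lp_space r \<Omega>" "b' \<in> Lp_space r \<Omega>"
    for a b :: "nat \<Rightarrow> 'a \<Rightarrow> 'c::euclidean_space" and a' b'
  proof (rule tendsto_sandwich[OF _ _ tendsto_const tendsto_add[OF that(1,2), simplified]])
    show "\<forall>\<^sub>F n in sequentially. 0 \<le> Lp_norm r \<Omega> (\<lambda>x. (a n x - b n x) - (a' x - b' x))" by (simp add: Lp_norm_nonneg)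
    show "\<forall>\<^sub>F n in sequentially. Lp_norm r \<Omega> (\<lambda>x. (a n x - b n x) - (a' x - b' x))
        \<le> Lp_norm r \<Omega> (\<lambda>x. a n x - a' x) + Lp_norm r \<Omega> (\<lambda>x. b n x - b' x)"
    proof (intro always_eventually allI)
      fix n
      have "Lp_norm r \<Omega> (\<lambda>x. (a n x - a' x) + (b' x - b n x)) \<le> Lp_norm r \<Omega> (\<lambda>x. a n x - a' x) + Lp_norm r \<Omega> (\<lambda>x. b' x - b n x)"
        by (intro Lp_norm_triangle r Lp_space_diff r0 L)
      then show "Lp_norm r \<Omega> (\<lambda>x. (a n x - b n x) - (a' x - b' x))
        \<le> Lp_norm r \<Omega> (\<lambda>x. a n x - a' x) + Lp_norm r \<Omega> (\<lambda>x. b n x - b' x)"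
        by (simp add: Lp_norm_minus_commute[of r \<Omega> b'] algebra_simps)
    qed
  qed
  note L = test_function_Lp[OF _ s r0]
  have 1: "(\<lambda>n. Lp_norm r \<Omega> (\<lambda>x. w n x - (u x - v x))) \<longlonglongrightarrow> 0"
    using lim[OF \<phi>(2) \<psi>(2) L(1)[OF \<phi>(1)] U(1) L(1)[OF \<psi>(1)] V(1)] by (simp add: w_def)
  have 2: "(\<lambda>n. Lp_norm r \<Omega> (\<lambda>x. grad (w n) x - (weak_grad \<Omega> u x - weak_grad \<Omega> v x))) \<longlonglongrightarrow> 0"
    unfolding gw by (rule lim[OF \<phi>(3) \<psi>(3) L(2)[OF \<phi>(1)] U(2) L(2)[OF \<psi>(1)] V(2)])
  show "(\<lambda>x. u x - v x) \<in> W10 r \<Omega>"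
    "AE x in lebesgue_on \<Omega>. weak_grad \<Omega> (\<lambda>x. u x - v x) x = weak_grad \<Omega> u x - weak_grad \<Omega> v x"
    by (rule W10_I[OF \<Omega> r _ _ w 1 2]; intro Lp_space_diff r0 U V)+
qed

section \<open>Averages over cubes\<close>

lemma integral_powr_le:
  fixes w :: "'a::euclidean_space \<Rightarrow> real"
  assumes r: "r > 1" and Q: "Q \<in> lmeasurable" and w: "w \<in> Lp_space r Q"
  shows "\<bar>LINT x|lebesgue_on Q. w x\<bar> powr r \<le> measure lebesgue Q powr (r - 1) * (LINT x|lebesgue_on Q. norm (w x) powr r)"
proof -
  interpret finite_measure "lebesgue_on Q" using Q by (rule finite_measure_lebesgue_on)
  have r0: "r > 0" using r by simp
  have one: "(\<lambda>_. 1::real) \<in> Lp_space r Q" by (simp add: Lp_space_def)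
  have m: "measure (lebesgue_on Q) Q = measure lebesgue Q"
    using Q by (simp add: measure_restrict_space fmeasurable_def)
  have n1: "Lp_norm r Q (\<lambda>_. 1::real) = measure lebesgue Q powr (1 / r)"
    using m by (simp add: Lp_norm_def)
  have "\<bar>LINT x|lebesgue_on Q. w x\<bar> \<le> (measure lebesgue Q powr (1 / r)) powr (r - 1) * Lp_norm r Q w"
    using duality_pairing_Holder[OF r one w] n1 by (simp add: duality_pairing_def duality_map_def)
  then have "\<bar>LINT x|lebesgue_on Q. w x\<bar> powr r \<le> ((measure lebesgue Q powr (1 / r)) powr (r - 1) * Lp_norm r Q w) powr r"
    using r0 by (intro powr_mono2) auto
  also have "\<dots> = ((measure lebesgue Q powr (1 / r)) powr (r - 1)) powr r * Lp_norm r Q w powr r"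
    by (rule powr_mult)
  also have "((measure lebesgue Q powr (1 / r)) powr (r - 1)) powr r = measure lebesgue Q powr (r - 1)"
    using r by (simp add: powr_powr)
  finally show ?thesis by (simp add: Lp_norm_powr[OF r0])
qed

definition cube_index :: "real \<Rightarrow> 'a::euclidean_space \<Rightarrow> 'a" where
  "cube_index \<delta> x = (\<Sum>i\<in>Basis. of_int \<lfloor>(x \<bullet> i) / \<delta>\<rfloor> *\<^sub>R i)"

text \<open>For \<open>v\<close> with integral coordinates, the half-open cube of side length \<open>\<delta>\<close> with lowest corner \<open>\<delta> v\<close>.\<close>
definition cube :: "real \<Rightarrow> 'a::euclidean_space \<Rightarrow> 'a set" where
  "cube \<delta> v = {x. cube_index \<delta> x = v}"

lemma cube_index_inner: "i \<in> Basis \<Longrightarrow> cube_index \<delta> x \<bullet> i = of_int \<lfloor>(x \<bullet> i) / \<delta>\<rfloor>"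
  by (simp add: cube_index_def)

lemma cube_index_measurable [measurable]: "cube_index \<delta> \<in> borel_measurable borel"
  unfolding cube_index_def[abs_def] by measurable

lemma cube_measurable [measurable]: "cube \<delta> v \<in> sets borel"
proof -
  have "cube_index \<delta> -` {v} \<inter> space borel \<in> sets borel" by (rule measurable_sets) measurable
  then show ?thesis by (simp add: cube_def vimage_def)
qed

lemma cube_bounds:
  assumes d: "\<delta> > 0" and x: "x \<in> cube \<delta> v" and i: "i \<in> Basis"
  shows "\<delta> * (v \<bullet> i) \<le> x \<bullet> i" "x \<bullet> i < \<delta> * (v \<bullet> i) + \<delta>"
proof -
  have v: "v \<bullet> i = of_int \<lfloor>(x \<bullet> i) / \<delta>\<rfloor>" using x cube_index_inner[OF i, of \<delta> x] by (simp add: cube_def)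
  have a: "of_int \<lfloor>(x \<bullet> i) / \<delta>\<rfloor> \<le> (x \<bullet> i) / \<delta>" and b: "(x \<bullet> i) / \<delta> < of_int \<lfloor>(x \<bullet> i) / \<delta>\<rfloor> + 1" by linarith+
  show "\<delta> * (v \<bullet> i) \<le> x \<bullet> i" using mult_left_mono[OF a, of \<delta>] d unfolding v by simp
  show "x \<bullet> i < \<delta> * (v \<bullet> i) + \<delta>" using mult_strict_left_mono[OF b, of \<delta>] d unfolding v by (simp add: distrib_left)
qed

lemma measure_cube:
  fixes z :: "'a::euclidean_space"
  assumes d: "\<delta> > 0"
  shows "emeasure lborel (cube \<delta> (cube_index \<delta> z)) = ennreal (\<delta> ^ DIM('a))"
proof -
  define v where "v = cube_index \<delta> z"
  have sub1: "cube \<delta> v \<subseteq> cbox (\<delta> *\<^sub>R v) (\<delta> *\<^sub>R v + \<delta> *\<^sub>R One)"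
    using cube_bounds[OF d, of _ v] by (force simp: mem_box inner_simps)
  have sub2: "box (\<delta> *\<^sub>R v) (\<delta> *\<^sub>R v + \<delta> *\<^sub>R One) \<subseteq> cube \<delta> v"
  proof
    fix x assume x: "x \<in> box (\<delta> *\<^sub>R v) (\<delta> *\<^sub>R v + \<delta> *\<^sub>R One)"
    have "cube_index \<delta> x = v"
    proof (rule euclidean_eqI)
      fix i :: 'a assume i: "i \<in> Basis"
      have v: "v \<bullet> i = of_int \<lfloor>(z \<bullet> i) / \<delta>\<rfloor>" unfolding v_def by (rule cube_index_inner[OF i])
      have "\<delta> * (v \<bullet> i) < x \<bullet> i" "x \<bullet> i < \<delta> * (v \<bullet> i) + \<delta>" using x i by (auto simp: mem_box inner_simps)
      then have "v \<bullet> i \<le> (x \<bullet> i) / \<delta>" "(x \<bullet> i) / \<delta> < v \<bullet> i + 1" using d by (simp_all add: field_simps)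
      then have "\<lfloor>(x \<bullet> i) / \<delta>\<rfloor> = \<lfloor>(z \<bullet> i) / \<delta>\<rfloor>" unfolding v by linarith
      then show "cube_index \<delta> x \<bullet> i = v \<bullet> i" unfolding v cube_index_inner[OF i] by simp
    qed
    then show "x \<in> cube \<delta> v" by (simp add: cube_def)
  qed
  have "emeasure lborel (cbox (\<delta> *\<^sub>R v) (\<delta> *\<^sub>R v + \<delta> *\<^sub>R One)) = ennreal (\<delta> ^ DIM('a))"
    using d by (subst emeasure_lborel_cbox) (auto simp: inner_simps)
  moreover have "emeasure lborel (box (\<delta> *\<^sub>R v) (\<delta> *\<^sub>R v + \<delta> *\<^sub>R One)) = ennreal (\<delta> ^ DIM('a))"
    using d by (subst emeasure_lborel_box) (auto simp: inner_simps)
  ultimately show ?thesis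
    unfolding v_def[symmetric] using emeasure_mono[OF sub1, of lborel] emeasure_mono[OF sub2, of lborel] by (simp add: antisym)
qed

lemma finite_cube_indices:
  fixes \<Omega> :: "'a::euclidean_space set"
  assumes d: "\<delta> > 0" and \<Omega>: "bounded \<Omega>"
  shows "finite (cube_index \<delta> ` \<Omega>)"
proof -
  obtain R where R: "\<And>x. x \<in> \<Omega> \<Longrightarrow> norm x \<le> R" using \<Omega> unfolding bounded_iff by blast
  define Z where "Z = {- \<lceil>R / \<delta>\<rceil> - 1..\<lceil>R / \<delta>\<rceil> + 1}"
  let ?f = "\<lambda>k. \<Sum>i\<in>Basis. of_int (k i) *\<^sub>R (i::'a)"
  have "cube_index \<delta> ` \<Omega> \<subseteq> ?f ` (PiE Basis (\<lambda>_. Z))"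
  proof (rule image_subsetI)
    fix x assume x: "x \<in> \<Omega>"
    let ?k = "restrict (\<lambda>i. \<lfloor>(x \<bullet> i) / \<delta>\<rfloor>) Basis"
    have "\<lfloor>(x \<bullet> i) / \<delta>\<rfloor> \<in> Z" if i: "i \<in> Basis" for i
    proof -
      have "\<bar>x \<bullet> i\<bar> \<le> R" using Basis_le_norm[OF i, of x] R[OF x] by linarith
      then have "(x \<bullet> i) / \<delta> \<le> R / \<delta>" "(- R) / \<delta> \<le> (x \<bullet> i) / \<delta>"
        using d by (intro divide_right_mono; linarith)+
      then have "(x \<bullet> i) / \<delta> \<le> R / \<delta>" "- (R / \<delta>) \<le> (x \<bullet> i) / \<delta>" by simp_all
      then show ?thesis unfolding Z_def atLeastAtMost_iff by linarith
    qed
    then have "?k \<in> PiE Basis (\<lambda>_. Z)" by auto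
    moreover have "cube_index \<delta> x = ?f ?k" by (auto simp: cube_index_def intro!: sum.cong)
    ultimately show "cube_index \<delta> x \<in> ?f ` (PiE Basis (\<lambda>_. Z))" by blast
  qed
  moreover have "finite (PiE (Basis :: 'a set) (\<lambda>_. Z))" by (intro finite_PiE) (auto simp: Z_def)
  ultimately show ?thesis by (meson finite_surj)
qed

lemma nn_integral_translation_difference:
  fixes \<phi> :: "'a::euclidean_space \<Rightarrow> real"
  assumes \<phi>: "\<phi> \<in> test_functions \<Omega>" and r: "r > 1" and \<Omega>: "\<Omega> \<in> sets lebesgue"
  shows "(\<integral>\<^sup>+x. ennreal (norm (\<phi> (x + h) - \<phi> x) powr r) \<partial>lborel) \<le> ennreal ((norm h * Lp_norm r \<Omega> (grad \<phi>)) powr r)"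
proof -
  note c = test_function_continuous[OF \<phi>]
  have r0: "r > 0" using r by simp
  have cs: "continuous_on UNIV (\<lambda>x. \<phi> (x + h) - \<phi> x)"
    by (intro continuous_intros c continuous_on_compose2[OF c(1)]) auto
  let ?D = "\<lambda>x. norm (\<phi> (x + h) - \<phi> x) powr r"
  obtain R where R: "\<And>x. x \<in> closure (support_on UNIV \<phi>) \<Longrightarrow> norm x \<le> R"
    using compact_imp_bounded[OF test_functionsD(2)[OF \<phi>]] unfolding bounded_iff by blast
  have 0: "\<phi> x = 0" if "norm x > R" for x using test_function_outside(1)[OF \<phi>] R[of x] that by force
  have i: "integrable lborel ?D"
  proof (rule integrable_lborel_bounded_support[OF continuous_on_norm_powr[OF cs r0]])
    show "bounded (cball (0::'a) (R + norm h))" by simp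
    fix x :: 'a assume "x \<notin> cball 0 (R + norm h)"
    then have "norm x > R + norm h" by simp
    then have "norm x > R" "norm (x + h) > R" using norm_diff_ineq[of x h] norm_ge_zero[of h] by linarith+
    then show "?D x = 0" using 0 by simp
  qed
  have "(\<integral>\<^sup>+x. ennreal (?D x) \<partial>lborel) = ennreal (integral\<^sup>L lborel ?D)"
    by (rule nn_integral_eq_integral[OF i]) simp
  also have "integral\<^sup>L lborel ?D = Lp_norm r UNIV (\<lambda>x. \<phi> (x + h) - \<phi> x) powr r"
    unfolding Lp_norm_UNIV[OF cs r0] using r0 by (simp add: powr_powr)
  also have "ennreal \<dots> \<le> ennreal ((norm h * Lp_norm r \<Omega> (grad \<phi>)) powr r)"
    using Lp_norm_translation_le[OF \<phi> r, of h] r0 test_function_Lp_norm_UNIV(2)[OF \<phi> \<Omega> r0]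
    by (intro ennreal_leI powr_mono2 Lp_norm_nonneg) auto
  finally show ?thesis .
qed

lemma norm_le_cube_diameter:
  fixes h :: "'a::euclidean_space"
  assumes "h \<in> cbox (- (\<delta> *\<^sub>R One)) (\<delta> *\<^sub>R One)"
  shows "norm h \<le> \<delta> * real (DIM('a))"
proof -
  have "norm h \<le> (\<Sum>i\<in>Basis. \<bar>h \<bullet> i\<bar>)" by (rule norm_le_l1)
  also have "\<dots> \<le> (\<Sum>i\<in>(Basis::'a set). \<delta>)"
    using assms by (intro sum_mono) (auto simp: mem_box abs_le_iff inner_simps)
  finally show ?thesis by (simp add: mult.commute)
qed

text \<open>Two points of one cube differ by a vector \<open>h\<close> with coordinates at most \<open>\<delta>\<close>. Integrating over \<open>h\<close> first
turns the double integral into an average of translation differences.\<close>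
lemma cube_oscillation:
  fixes \<phi> :: "'a::euclidean_space \<Rightarrow> real"
  assumes \<phi>: "\<phi> \<in> test_functions \<Omega>" and r: "r > 1" and \<Omega>: "\<Omega> \<in> sets lebesgue" and d: "\<delta> > 0"
  shows "(\<integral>\<^sup>+x. (\<integral>\<^sup>+y. ennreal (indicator (cube \<delta> (cube_index \<delta> x)) y * norm (\<phi> x - \<phi> y) powr r) \<partial>lborel) \<partial>lborel)
    \<le> ennreal ((2 * \<delta>) ^ DIM('a) * (\<delta> * real (DIM('a)) * Lp_norm r \<Omega> (grad \<phi>)) powr r)"
proof -
  let ?B = "cbox (- (\<delta> *\<^sub>R One)) (\<delta> *\<^sub>R One) :: 'a set"
  have [measurable]: "\<phi> \<in> borel_measurable borel"
    using test_function_continuous(1)[OF \<phi>] by (rule borel_measurable_continuous_onI)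
  let ?F = "\<lambda>x h. ennreal (indicator ?B h * norm (\<phi> (x + h) - \<phi> x) powr r)"
  have inner: "(\<integral>\<^sup>+y. ennreal (indicator (cube \<delta> (cube_index \<delta> x)) y * norm (\<phi> x - \<phi> y) powr r) \<partial>lborel)
      \<le> (\<integral>\<^sup>+h. ?F x h \<partial>lborel)" for x
  proof -
    have "(\<integral>\<^sup>+y. ennreal (indicator (cube \<delta> (cube_index \<delta> x)) y * norm (\<phi> x - \<phi> y) powr r) \<partial>lborel)
       \<le> (\<integral>\<^sup>+y. ?F x (y - x) \<partial>lborel)"
    proof (intro nn_integral_mono ennreal_leI)
      fix y
      show "indicator (cube \<delta> (cube_index \<delta> x)) y * norm (\<phi> x - \<phi> y) powr r \<le> indicator ?B (y - x) * norm (\<phi> (x + (y - x)) - \<phi> x) powr r"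
      proof (cases "y \<in> cube \<delta> (cube_index \<delta> x)")
        case True
        have "y - x \<in> ?B"
          using cube_bounds[OF d True] cube_bounds[OF d, of x "cube_index \<delta> x"]
          by (force simp: mem_box inner_simps cube_def)
        then show ?thesis using True by (simp add: norm_minus_commute abs_minus_commute)
      qed simp
    qed
    also have "\<dots> = (\<integral>\<^sup>+y. ?F x (y - x) \<partial>(distr lborel borel ((+) x)))" by (simp add: lborel_distr_plus)
    also have "\<dots> = (\<integral>\<^sup>+h. ?F x (x + h - x) \<partial>lborel)" by (rule nn_integral_distr) measurable
    finally show ?thesis by simp
  qed
  have "(\<integral>\<^sup>+x. (\<integral>\<^sup>+y. ennreal (indicator (cube \<delta> (cube_index \<delta> x)) y * norm (\<phi> x - \<phi> y) powr r) \<partial>lborel) \<partial>lborel)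
     \<le> (\<integral>\<^sup>+x. (\<integral>\<^sup>+h. ?F x h \<partial>lborel) \<partial>lborel)"
    by (intro nn_integral_mono inner)
  also have "\<dots> = (\<integral>\<^sup>+h. (\<integral>\<^sup>+x. ?F x h \<partial>lborel) \<partial>lborel)"
    by (rule lborel_pair.Fubini'[symmetric]) measurable
  also have "\<dots> \<le> (\<integral>\<^sup>+h. ennreal ((\<delta> * real (DIM('a)) * Lp_norm r \<Omega> (grad \<phi>)) powr r) * indicator ?B h \<partial>lborel)"
  proof (rule nn_integral_mono)
    fix h :: 'a
    show "(\<integral>\<^sup>+x. ?F x h \<partial>lborel) \<le> ennreal ((\<delta> * real (DIM('a)) * Lp_norm r \<Omega> (grad \<phi>)) powr r) * indicator ?B h"
    proof (cases "h \<in> ?B")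
      case True
      have "(\<integral>\<^sup>+x. ?F x h \<partial>lborel) \<le> ennreal ((norm h * Lp_norm r \<Omega> (grad \<phi>)) powr r)"
        using nn_integral_translation_difference[OF \<phi> r \<Omega>, of h] True by simp
      also have "\<dots> \<le> ennreal ((\<delta> * real (DIM('a)) * Lp_norm r \<Omega> (grad \<phi>)) powr r)"
        using r norm_le_cube_diameter[OF True]
        by (intro ennreal_leI powr_mono2 mult_right_mono mult_nonneg_nonneg Lp_norm_nonneg) auto
      finally show ?thesis using True by simp
    qed simp
  qed
  also have "\<dots> = ennreal ((\<delta> * real (DIM('a)) * Lp_norm r \<Omega> (grad \<phi>)) powr r) * emeasure lborel ?B"
    by (rule nn_integral_cmult_indicator) simp
  also have "emeasure lborel ?B = ennreal ((2 * \<delta>) ^ DIM('a))"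
    using d by (subst emeasure_lborel_cbox) (auto simp: inner_simps)
  finally show ?thesis using d by (simp add: ennreal_mult[symmetric] mult.commute)
qed

text \<open>On cubes of small side length \<open>\<delta>\<close>, a function differs from its mean by a multiple of \<open>\<delta>\<close> times its
gradient, in the \<open>L\<^sup>r\<close> mean. So, up to a small fraction of the gradient norm, the \<open>L\<^sup>r\<close> norm is controlled by
finitely many linear functionals. Rellich's theorem and the finiteness of the index of a cone are
both consequences.\<close>
lemma Lp_norm_le_gradient_and_averages:
  fixes \<Omega> :: "'a::euclidean_space set"
  assumes \<Omega>: "\<Omega> \<in> sets lebesgue" "bounded \<Omega>" and r: "r > 1" and \<epsilon>: "\<epsilon> > 0"
  shows "\<exists>\<Q> C. finite \<Q> \<and> \<Q> \<subseteq> sets borel \<and> C \<ge> 0 \<and> (\<forall>\<phi>\<in>test_functions \<Omega>.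
     Lp_norm r \<Omega> \<phi> powr r \<le> \<epsilon> * Lp_norm r \<Omega> (grad \<phi>) powr r + C * (\<Sum>Q\<in>\<Q>. \<bar>LINT x:Q|lborel. \<phi> x\<bar> powr r))"
proof -
  have r0: "r > 0" using r by simp
  let ?D = "DIM('a)"
  \<comment> \<open>Chosen so that \<open>2\<^sup>r\<close>, the volume factor \<open>2\<^sup>D\<close> of the range of \<open>h\<close> and the diameter bound combine to \<open>\<epsilon>\<close>.\<close>
  define \<delta> where "\<delta> = (\<epsilon> / (2 powr r * 2 ^ ?D)) powr (1 / r) / real ?D"
  have d: "\<delta> > 0" using \<epsilon> by (simp add: \<delta>_def)
  have dr: "2 powr r * 2 ^ ?D * (\<delta> * real ?D) powr r = \<epsilon>"
    using \<epsilon> r0 by (simp add: \<delta>_def powr_powr)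
  define m where "m = \<delta> ^ ?D"
  have m: "m > 0" using d by (simp add: m_def)
  define V where "V = cube_index \<delta> ` \<Omega>"
  have V: "finite V" unfolding V_def by (rule finite_cube_indices[OF d \<Omega>(2)])
  have emV: "emeasure lborel (cube \<delta> v) = ennreal m" if "v \<in> V" for v
    using that measure_cube[OF d] by (auto simp: V_def m_def)
  have lmV: "cube \<delta> v \<in> lmeasurable" "measure lebesgue (cube \<delta> v) = m" if "v \<in> V" for v
    using emV[OF that] m by (auto simp: fmeasurable_def measure_def)
  define C where "C = 2 powr r * m powr (1 - r)"
  have inj: "inj_on (cube \<delta>) V"
    by (rule inj_onI) (auto simp: V_def cube_def)
  show ?thesis
  proof (intro exI[of _ "cube \<delta> ` V"] exI[of _ C] conjI ballI)
    show "finite (cube \<delta> ` V)" using V by simp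
    show "cube \<delta> ` V \<subseteq> sets borel" by auto
    show "C \<ge> 0" by (simp add: C_def)
    fix \<phi> assume \<phi>: "\<phi> \<in> test_functions \<Omega>"
    have [measurable]: "\<phi> \<in> borel_measurable borel"
      using test_function_continuous(1)[OF \<phi>] by (rule borel_measurable_continuous_onI)
    obtain M where M: "M \<ge> 0" "\<And>x. \<bar>\<phi> x\<bar> \<le> M" by (rule test_function_bounded[OF \<phi>]) (erule that, simp)
    let ?N = "Lp_norm r \<Omega> (grad \<phi>)"
    define l where "l v = (LINT x:cube \<delta> v|lborel. \<phi> x)" for v
    define osc where "osc x = (\<integral>\<^sup>+y. ennreal (indicator (cube \<delta> (cube_index \<delta> x)) y * norm (\<phi> x - \<phi> y) powr r) \<partial>lborel)" for x
    have pointwise: "ennreal (norm (\<phi> x) powr r) \<le> ennreal (2 powr r / m) * osc x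
        + (\<Sum>v\<in>V. ennreal (2 powr r * (\<bar>l v\<bar> / m) powr r) * indicator (cube \<delta> v) x)" if x: "x \<in> \<Omega>" for x
    proof -
      define v where "v = cube_index \<delta> x"
      have vV: "v \<in> V" using x by (simp add: V_def v_def)
      let ?Q = "cube \<delta> v"
      interpret Q: finite_measure "lebesgue_on ?Q" using lmV(1)[OF vV] by (rule finite_measure_lebesgue_on)
      have meas\<phi>: "\<phi> \<in> borel_measurable (lebesgue_on ?Q)"
        by (intro measurable_restrict_space1 measurable_completion) simp
      have QL: "(\<lambda>y. \<phi> x - \<phi> y) \<in> Lp_space r ?Q"
        unfolding Lp_space_def
      proof (intro CollectI conjI)
        show m1: "(\<lambda>y. \<phi> x - \<phi> y) \<in> borel_measurable (lebesgue_on ?Q)" using meas\<phi> by simp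
        show "integrable (lebesgue_on ?Q) (\<lambda>y. norm (\<phi> x - \<phi> y) powr r)"
        proof (rule Q.integrable_const_bound[where B="(2 * M) powr r"])
          have "\<bar>\<phi> x - \<phi> y\<bar> \<le> 2 * M" for y using M(2)[of x] M(2)[of y] by linarith
          then show "AE y in lebesgue_on ?Q. norm (norm (\<phi> x - \<phi> y) powr r) \<le> (2 * M) powr r"
            using r0 by (intro AE_I2) (auto intro!: powr_mono2)
        qed (use m1 in measurable)
      qed
      have to_lborel: "(LINT y|lebesgue_on ?Q. f y) = (LINT y:?Q|lborel. f y)" if "f \<in> borel_measurable borel" for f :: "'a \<Rightarrow> real"
        using that by (simp add: set_lebesgue_integral_def integral_restrict_space integral_completion)
      have int\<phi>: "integrable (lebesgue_on ?Q) \<phi>"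
        by (rule Q.integrable_const_bound[where B=M]) (use M meas\<phi> in auto)
      have "(LINT y|lebesgue_on ?Q. \<phi> x - \<phi> y) = m * \<phi> x - l v"
      proof -
        have "(LINT y|lebesgue_on ?Q. \<phi> x - \<phi> y) = (LINT y|lebesgue_on ?Q. \<phi> x) - (LINT y|lebesgue_on ?Q. \<phi> y)"
          using int\<phi> by (intro Bochner_Integration.integral_diff) auto
        also have "(LINT y|lebesgue_on ?Q. \<phi> x) = m * \<phi> x"
          using lmV[OF vV] by (simp add: measure_restrict_space)
        also have "(LINT y|lebesgue_on ?Q. \<phi> y) = l v" unfolding l_def by (rule to_lborel) simp
        finally show ?thesis .
      qed
      then have J: "\<bar>m * \<phi> x - l v\<bar> powr r \<le> m powr (r - 1) * (LINT y:?Q|lborel. norm (\<phi> x - \<phi> y) powr r)"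
        using integral_powr_le[OF r lmV(1)[OF vV] QL] lmV(2)[OF vV]
        by (simp add: to_lborel)
      have osc_eq: "osc x = ennreal (LINT y:?Q|lborel. norm (\<phi> x - \<phi> y) powr r)"
      proof -
        have "integrable lborel (\<lambda>y. indicator ?Q y * norm (\<phi> x - \<phi> y) powr r)"
        proof -
          have "integrable (lebesgue_on ?Q) (\<lambda>y. norm (\<phi> x - \<phi> y) powr r)" using Lp_spaceD(2)[OF QL] .
          then show ?thesis by (simp add: integrable_restrict_space integrable_completion)
        qed
        then show ?thesis
          unfolding osc_def v_def[symmetric] set_lebesgue_integral_def real_scaleR_def
          by (intro nn_integral_eq_integral) auto
      qed
      define I where "I = (LINT y:?Q|lborel. norm (\<phi> x - \<phi> y) powr r)"
      have I0: "I \<ge> 0" unfolding I_def set_lebesgue_integral_def by (intro Bochner_Integration.integral_nonneg) simp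
      have "norm (\<phi> x) \<le> \<bar>m * \<phi> x - l v\<bar> / m + \<bar>l v\<bar> / m"
      proof -
        have "m * \<bar>\<phi> x\<bar> \<le> \<bar>m * \<phi> x - l v\<bar> + \<bar>l v\<bar>" using abs_triangle_ineq[of "m * \<phi> x - l v" "l v"] m by (simp add: abs_mult)
        then show ?thesis using m by (simp add: field_simps)
      qed
      then have "norm (\<phi> x) powr r \<le> (\<bar>m * \<phi> x - l v\<bar> / m + \<bar>l v\<bar> / m) powr r" using r0 by (intro powr_mono2) auto
      also have "\<dots> \<le> 2 powr r * ((\<bar>m * \<phi> x - l v\<bar> / m) powr r + (\<bar>l v\<bar> / m) powr r)"
        using m r0 by (intro powr_add_le) auto
      also have "(\<bar>m * \<phi> x - l v\<bar> / m) powr r \<le> I / m"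
      proof -
        have "(\<bar>m * \<phi> x - l v\<bar> / m) powr r = \<bar>m * \<phi> x - l v\<bar> powr r / m powr r" using m by (simp add: powr_divide)
        also have "\<dots> \<le> m powr (r - 1) * I / m powr r" using J by (intro divide_right_mono) (auto simp: I_def)
        also have "\<dots> = I / m" using m by (simp add: powr_diff)
        finally show ?thesis .
      qed
      finally have "norm (\<phi> x) powr r \<le> (2 powr r / m) * I + 2 powr r * (\<bar>l v\<bar> / m) powr r"
        by (simp add: algebra_simps)
      then have "ennreal (norm (\<phi> x) powr r) \<le> ennreal ((2 powr r / m) * I + 2 powr r * (\<bar>l v\<bar> / m) powr r)" by (rule ennreal_leI)
      also have "\<dots> = ennreal (2 powr r / m) * osc x + ennreal (2 powr r * (\<bar>l v\<bar> / m) powr r)"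
      proof -
        have oscI: "osc x = ennreal I" using osc_eq by (simp only: I_def)
        show ?thesis unfolding oscI using I0 m by (simp add: ennreal_mult[symmetric] ennreal_plus[symmetric] del: ennreal_plus)
      qed
      also have "ennreal (2 powr r * (\<bar>l v\<bar> / m) powr r) = (\<Sum>w\<in>{v}. ennreal (2 powr r * (\<bar>l w\<bar> / m) powr r) * indicator (cube \<delta> w) x)"
        by (simp add: cube_def v_def)
      also have "\<dots> \<le> (\<Sum>v\<in>V. ennreal (2 powr r * (\<bar>l v\<bar> / m) powr r) * indicator (cube \<delta> v) x)"
        using V vV by (intro sum_mono2) auto
      finally show ?thesis by (simp add: add_left_mono)
    qed
    have osc_meas: "osc \<in> borel_measurable borel"
    proof -
      have "(\<lambda>(x, y). ennreal (indicator (cube \<delta> (cube_index \<delta> x)) y * norm (\<phi> x - \<phi> y) powr r)) \<in> borel_measurable (borel \<Otimes>\<^sub>M lborel)"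
      proof -
        have "(\<lambda>(x, y). ennreal ((if cube_index \<delta> y = cube_index \<delta> x then 1 else 0) * norm (\<phi> x - \<phi> y) powr r)) \<in> borel_measurable (borel \<Otimes>\<^sub>M lborel)"
          by measurable
        then show ?thesis by (simp add: cube_def indicator_def of_bool_def)
      qed
      then show ?thesis unfolding osc_def[abs_def]
        by (intro lborel.borel_measurable_nn_integral)
    qed
    have "ennreal (Lp_norm r \<Omega> \<phi> powr r) = (\<integral>\<^sup>+x. ennreal (norm (\<phi> x) powr r) \<partial>lebesgue_on \<Omega>)"
      by (rule Lp_norm_nn_integral[OF test_function_Lp(1)[OF \<phi> \<Omega>(1) r0] r0, symmetric])
    also have "\<dots> \<le> (\<integral>\<^sup>+x. ennreal (2 powr r / m) * osc x
        + (\<Sum>v\<in>V. ennreal (2 powr r * (\<bar>l v\<bar> / m) powr r) * indicator (cube \<delta> v) x) \<partial>lebesgue_on \<Omega>)"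
      by (intro nn_integral_mono pointwise) simp
    also have "\<dots> \<le> (\<integral>\<^sup>+x. ennreal (2 powr r / m) * osc x
        + (\<Sum>v\<in>V. ennreal (2 powr r * (\<bar>l v\<bar> / m) powr r) * indicator (cube \<delta> v) x) \<partial>lebesgue)"
      using \<Omega>(1) by (subst nn_integral_restrict_space) (auto intro!: nn_integral_mono simp: indicator_def)
    also have "\<dots> = (\<integral>\<^sup>+x. ennreal (2 powr r / m) * osc x
        + (\<Sum>v\<in>V. ennreal (2 powr r * (\<bar>l v\<bar> / m) powr r) * indicator (cube \<delta> v) x) \<partial>lborel)"
      by (rule nn_integral_completion)
    also have "\<dots> = (\<integral>\<^sup>+x. ennreal (2 powr r / m) * osc x \<partial>lborel)
        + (\<integral>\<^sup>+x. (\<Sum>v\<in>V. ennreal (2 powr r * (\<bar>l v\<bar> / m) powr r) * indicator (cube \<delta> v) x) \<partial>lborel)"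
      using osc_meas by (intro nn_integral_add) auto
    also have "(\<integral>\<^sup>+x. ennreal (2 powr r / m) * osc x \<partial>lborel) = ennreal (2 powr r / m) * (\<integral>\<^sup>+x. osc x \<partial>lborel)"
      using osc_meas by (intro nn_integral_cmult) auto
    also have "\<dots> \<le> ennreal (2 powr r / m) * ennreal ((2 * \<delta>) ^ ?D * (\<delta> * real ?D * ?N) powr r)"
      unfolding osc_def by (intro mult_left_mono cube_oscillation[OF \<phi> r \<Omega>(1) d]) simp
    also have "\<dots> = ennreal (\<epsilon> * ?N powr r)"
    proof -
      have "2 powr r / m * ((2 * \<delta>) ^ ?D * (\<delta> * real ?D * ?N) powr r) = \<epsilon> * ?N powr r"
        using d by (subst dr[symmetric]) (simp add: m_def power_mult_distrib powr_mult[of "\<delta> * real ?D" ?N] Lp_norm_nonneg)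
      then show ?thesis using m d by (simp add: ennreal_mult[symmetric])
    qed
    also have "(\<integral>\<^sup>+x. (\<Sum>v\<in>V. ennreal (2 powr r * (\<bar>l v\<bar> / m) powr r) * indicator (cube \<delta> v) x) \<partial>lborel)
        = (\<Sum>v\<in>V. \<integral>\<^sup>+x. ennreal (2 powr r * (\<bar>l v\<bar> / m) powr r) * indicator (cube \<delta> v) x \<partial>lborel)"
      by (intro nn_integral_sum) auto
    also have "\<dots> = (\<Sum>v\<in>V. ennreal (2 powr r * (\<bar>l v\<bar> / m) powr r) * ennreal m)"
      by (intro sum.cong refl) (simp add: nn_integral_cmult_indicator emV)
    also have "\<dots> = (\<Sum>v\<in>V. ennreal (C * \<bar>l v\<bar> powr r))"
    proof (intro sum.cong refl)
      fix v
      have "2 powr r * (\<bar>l v\<bar> / m) powr r * m = C * \<bar>l v\<bar> powr r"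
        using m by (simp add: C_def powr_divide powr_diff)
      then show "ennreal (2 powr r * (\<bar>l v\<bar> / m) powr r) * ennreal m = ennreal (C * \<bar>l v\<bar> powr r)"
        using m by (simp add: ennreal_mult[symmetric])
    qed
    also have "\<dots> = ennreal (C * (\<Sum>v\<in>V. \<bar>l v\<bar> powr r))"
      by (subst sum_ennreal) (auto simp: C_def sum_distrib_left)
    finally have "ennreal (Lp_norm r \<Omega> \<phi> powr r) \<le> ennreal (\<epsilon> * ?N powr r) + ennreal (C * (\<Sum>v\<in>V. \<bar>l v\<bar> powr r))"
      by simp
    also have "\<dots> = ennreal (\<epsilon> * ?N powr r + C * (\<Sum>v\<in>V. \<bar>l v\<bar> powr r))"
      using \<epsilon> by (intro ennreal_plus[symmetric]) (auto simp: C_def intro!: mult_nonneg_nonneg sum_nonneg)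
    finally have "Lp_norm r \<Omega> \<phi> powr r \<le> \<epsilon> * ?N powr r + C * (\<Sum>v\<in>V. \<bar>l v\<bar> powr r)"
      using \<epsilon> by (subst (asm) ennreal_le_iff) (auto simp: C_def intro!: add_nonneg_nonneg mult_nonneg_nonneg sum_nonneg)
    then show "Lp_norm r \<Omega> \<phi> powr r \<le> \<epsilon> * ?N powr r + C * (\<Sum>Q\<in>cube \<delta> ` V. \<bar>LINT x:Q|lborel. \<phi> x\<bar> powr r)"
      using inj by (simp add: sum.reindex l_def)
  qed
qed

section \<open>Test functions as a normed space, and Rellich compactness\<close>

text \<open>The pointwise vector space structure, which makes the test functions a subspace.\<close>
instantiation "fun" :: (type, real_vector) real_vector
begin

definition scaleR_fun :: "real \<Rightarrow> ('a \<Rightarrow> 'b) \<Rightarrow> 'a \<Rightarrow> 'b" where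
  "scaleR_fun c f = (\<lambda>x. c *\<^sub>R f x)"

instance
  by standard (simp_all add: scaleR_fun_def fun_eq_iff scaleR_add_left scaleR_add_right)

end

lemma scaleR_fun_apply [simp]: "(c *\<^sub>R f) x = c *\<^sub>R f x"
  by (simp add: scaleR_fun_def)

lemma minus_fun_eq: "(f - g :: 'a \<Rightarrow> 'b::ab_group_add) = (\<lambda>x. f x - g x)"
  by (simp add: fun_eq_iff)

lemma subspace_test_functions: "subspace (test_functions \<Omega>)"
  unfolding subspace_def zero_fun_def plus_fun_def scaleR_fun_def real_scaleR_def
  by (auto intro: test_function_zero test_function_add test_function_scale)

lemma grad_plus: "\<phi> \<in> test_functions \<Omega> \<Longrightarrow> \<psi> \<in> test_functions \<Omega> \<Longrightarrow> grad (\<phi> + \<psi>) = grad \<phi> + grad \<psi>"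
  using test_function_add(2)[of \<phi> \<Omega> \<psi>] by (auto simp: plus_fun_def fun_eq_iff)

lemma grad_scaleR: "\<phi> \<in> test_functions \<Omega> \<Longrightarrow> grad (c *\<^sub>R \<phi>) = c *\<^sub>R grad \<phi>"
  using test_function_scale(2)[of \<phi> \<Omega> c] by (auto simp: scaleR_fun_def fun_eq_iff)

lemma grad_minus: "\<phi> \<in> test_functions \<Omega> \<Longrightarrow> \<psi> \<in> test_functions \<Omega> \<Longrightarrow> grad (\<phi> - \<psi>) = grad \<phi> - grad \<psi>"
  using grad_plus[of \<phi> \<Omega> "(-1) *\<^sub>R \<psi>"] grad_scaleR[of \<psi> \<Omega> "-1"] subspace_scale[OF subspace_test_functions, of \<psi> \<Omega> "-1"]
  by (simp add: fun_eq_iff)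

lemma seminormed_test_functions:
  assumes \<Omega>: "\<Omega> \<in> sets lebesgue" and p: "p > 1"
  shows "seminormed_subspace (test_functions \<Omega>) (\<lambda>u. Lp_norm p \<Omega> (grad u))"
proof
  have p0: "p > 0" using p by simp
  show "subspace (test_functions \<Omega>)" by (rule subspace_test_functions)
  fix u assume u: "u \<in> test_functions \<Omega>"
  show "Lp_norm p \<Omega> (grad (c *\<^sub>R u)) = \<bar>c\<bar> * Lp_norm p \<Omega> (grad u)" for c
    using Lp_norm_scale[OF p0, of \<Omega> c "grad u"]
    by (subst grad_scaleR[OF u]) (simp add: scaleR_fun_def[where f = "grad u"])
  fix v assume v: "v \<in> test_functions \<Omega>"
  show "Lp_norm p \<Omega> (grad (u + v)) \<le> Lp_norm p \<Omega> (grad u) + Lp_norm p \<Omega> (grad v)"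
    using Lp_norm_triangle[OF p test_function_Lp(2)[OF u \<Omega> p0] test_function_Lp(2)[OF v \<Omega> p0]]
    by (subst grad_plus[OF u v]) (simp add: plus_fun_def[where f = "grad u"])
qed

lemma compact_product_box:
  "compact {x :: nat \<Rightarrow> real. \<forall>i. \<bar>x i\<bar> \<le> B}"
proof -
  have "compact (PiE UNIV (\<lambda>_. {-B..B}) :: (nat \<Rightarrow> real) set)"
    using compactin_PiE[of "\<lambda>_. euclideanreal" UNIV "\<lambda>_. {-B..B}"]
    by (metis compactin_euclidean_iff compact_Icc euclidean_product_topology)
  moreover have "PiE UNIV (\<lambda>_. {-B..B}) = {x :: nat \<Rightarrow> real. \<forall>i. \<bar>x i\<bar> \<le> B}"
    by (auto simp: PiE_UNIV_domain Pi_iff set_eq_iff abs_le_iff minus_le_iff)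
  ultimately show ?thesis by simp
qed

lemma set_integral_test_function:
  fixes \<Omega> :: "'a::euclidean_space set"
  assumes \<Omega>: "\<Omega> \<in> lmeasurable" and p: "p > 1" and bd: "bounded \<Omega>"
  shows "\<exists>K\<ge>0. \<forall>Q\<in>sets borel. \<forall>\<phi>\<in>test_functions \<Omega>. \<bar>LINT x:Q|lborel. \<phi> x\<bar> \<le> K * Lp_norm p \<Omega> (grad \<phi>)"
    and "Q \<in> sets borel \<Longrightarrow> \<phi> \<in> test_functions \<Omega> \<Longrightarrow> \<psi> \<in> test_functions \<Omega> \<Longrightarrow>
      (LINT x:Q|lborel. (\<phi> - \<psi>) x) = (LINT x:Q|lborel. \<phi> x) - (LINT x:Q|lborel. \<psi> x)"
proof -
  have s: "\<Omega> \<in> sets lebesgue" using \<Omega> by auto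
  have i: "integrable lborel \<phi>" if "\<phi> \<in> test_functions \<Omega>" for \<phi>
    by (rule integrable_lborel_bounded_support[OF test_function_continuous(1)[OF that]
          compact_imp_bounded[OF test_functionsD(2)[OF that]]]) (rule test_function_outside[OF that])
  have si: "set_integrable lborel Q \<phi>" if "Q \<in> sets borel" "\<phi> \<in> test_functions \<Omega>" for Q \<phi>
    unfolding set_integrable_def using that i by (intro integrable_mult_indicator) auto
  show "(LINT x:Q|lborel. (\<phi> - \<psi>) x) = (LINT x:Q|lborel. \<phi> x) - (LINT x:Q|lborel. \<psi> x)"
    if "Q \<in> sets borel" "\<phi> \<in> test_functions \<Omega>" "\<psi> \<in> test_functions \<Omega>"
    using set_integral_diff(2)[OF si[OF that(1,2)] si[OF that(1,3)]] by simp
  obtain K1 where K1: "K1 \<ge> 0" "\<And>w::'a \<Rightarrow> real. w \<in> Lp_space p \<Omega> \<Longrightarrow> Lp_norm 1 \<Omega> w \<le> K1 * Lp_norm p \<Omega> w"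
    using Lp_norm_embedding[OF \<Omega>, of 1 p, where 'b=real] p by auto
  obtain C where C: "C > 0" "\<And>\<phi>. \<phi> \<in> test_functions \<Omega> \<Longrightarrow> Lp_norm p \<Omega> \<phi> \<le> C * Lp_norm p \<Omega> (grad \<phi>)"
    using Poincare_inequality[OF s bd p] by blast
  show "\<exists>K\<ge>0. \<forall>Q\<in>sets borel. \<forall>\<phi>\<in>test_functions \<Omega>. \<bar>LINT x:Q|lborel. \<phi> x\<bar> \<le> K * Lp_norm p \<Omega> (grad \<phi>)"
  proof (intro exI[of _ "K1 * C"] conjI ballI)
    fix Q :: "'a set" and \<phi> assume Q: "Q \<in> sets borel" and \<phi>: "\<phi> \<in> test_functions \<Omega>"
    have "\<bar>LINT x:Q|lborel. \<phi> x\<bar> \<le> (LINT x|lborel. \<bar>indicator Q x *\<^sub>R \<phi> x\<bar>)"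
      unfolding set_lebesgue_integral_def by (rule integral_abs_bound)
    also have "\<dots> \<le> (LINT x|lborel. norm (\<phi> x))"
    proof (rule integral_mono)
      show "integrable lborel (\<lambda>x. \<bar>indicator Q x *\<^sub>R \<phi> x\<bar>)"
        using si[OF Q \<phi>] unfolding set_integrable_def by (rule integrable_abs)
      show "integrable lborel (\<lambda>x. norm (\<phi> x))" by (intro integrable_norm i \<phi>)
    qed (auto simp: indicator_def)
    also have "\<dots> = Lp_norm 1 \<Omega> \<phi>"
      using Lp_norm_UNIV[OF test_function_continuous(1)[OF \<phi>], of 1] test_function_Lp_norm_UNIV(1)[OF \<phi> s, of 1]
      by (simp add: integral_nonneg_AE)
    also have "\<dots> \<le> K1 * Lp_norm p \<Omega> \<phi>" using p by (intro K1 test_function_Lp[OF \<phi> s]) simp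
    also have "\<dots> \<le> K1 * (C * Lp_norm p \<Omega> (grad \<phi>))" by (intro mult_left_mono C \<phi> K1)
    finally show "\<bar>LINT x:Q|lborel. \<phi> x\<bar> \<le> K1 * C * Lp_norm p \<Omega> (grad \<phi>)" by simp
  qed (use K1 C in simp)
qed

text \<open>The estimate by averages with \<open>\<epsilon> = 1 / (k + 1)\<close>, for all \<open>k\<close>, involves countably many sets. The
integrals of \<open>u n\<close> over them lie in a compact product of intervals, so they converge along a
subsequence, which the estimate then shows to be Cauchy.\<close>
theorem Rellich_compactness:
  fixes \<Omega> :: "'a::euclidean_space set"
  assumes \<Omega>: "\<Omega> \<in> lmeasurable" "bounded \<Omega>" and p: "p > 1"
    and u: "\<And>n::nat. u n \<in> test_functions \<Omega>" and R: "\<And>n. Lp_norm p \<Omega> (grad (u n)) \<le> R"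
  shows "\<exists>s :: nat \<Rightarrow> nat. strict_mono s \<and> (\<forall>e>0. \<exists>M. \<forall>m\<ge>M. \<forall>n\<ge>M. Lp_norm p \<Omega> (\<lambda>x. u (s m) x - u (s n) x) < e)"
proof -
  have s: "\<Omega> \<in> sets lebesgue" using \<Omega> by auto
  have p0: "p > 0" using p by simp
  let ?P = "\<lambda>k \<Q> C. finite \<Q> \<and> \<Q> \<subseteq> sets borel \<and> C \<ge> 0 \<and> (\<forall>\<phi>\<in>test_functions \<Omega>.
     Lp_norm p \<Omega> \<phi> powr p \<le> (1 / real (Suc k)) * Lp_norm p \<Omega> (grad \<phi>) powr p + C * (\<Sum>Q\<in>\<Q>. \<bar>LINT x:Q|lborel. \<phi> x\<bar> powr p))"
  have "\<forall>k. \<exists>\<Q> C. ?P k \<Q> C"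
  proof
    fix k show "\<exists>\<Q> C. ?P k \<Q> C" by (rule Lp_norm_le_gradient_and_averages[OF s \<Omega>(2) p]) simp
  qed
  then obtain \<Q> C where QC: "\<And>k. ?P k (\<Q> k) (C k)" by metis
  define \<A> where "\<A> = insert {} (\<Union>k. \<Q> k)"
  have cA: "countable \<A>" unfolding \<A>_def using QC countable_finite by (intro countable_insert countable_UN) auto
  define Q where "Q = from_nat_into \<A>"
  have Q: "Q j \<in> sets borel" for j
    using from_nat_into[of \<A> j] QC unfolding Q_def \<A>_def by auto
  have Q_ex: "\<exists>j. Q j = A" if "A \<in> \<Q> k" for A k
    using from_nat_into_surj[OF cA, of A] that unfolding Q_def \<A>_def by auto
  obtain K where K: "K \<ge> 0" "\<And>Q \<phi>. Q \<in> sets borel \<Longrightarrow> \<phi> \<in> test_functions \<Omega> \<Longrightarrow> \<bar>LINT x:Q|lborel. \<phi> x\<bar> \<le> K * Lp_norm p \<Omega> (grad \<phi>)"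
    using set_integral_test_function(1)[OF \<Omega>(1) p \<Omega>(2)] by blast
  define X where "X n = (\<lambda>j. LINT x:Q j|lborel. u n x)" for n
  have "X n \<in> {x. \<forall>i. \<bar>x i\<bar> \<le> K * R}" for n
    using K(2)[OF Q u] mult_left_mono[OF R K(1)] unfolding X_def by (auto intro: order_trans)
  moreover have "seq_compact {x :: nat \<Rightarrow> real. \<forall>i. \<bar>x i\<bar> \<le> K * R}"
    by (rule compact_imp_seq_compact[OF compact_product_box])
  ultimately obtain l r where r: "strict_mono r" "(X \<circ> r) \<longlonglongrightarrow> l"
    unfolding seq_compact_def by meson
  have Xr: "(\<lambda>n. X (r n) j) \<longlonglongrightarrow> l j" for j
    using continuous_on_tendsto_compose[OF continuous_on_coord[OF continuous_on_id, of UNIV j] r(2)] by (simp add: o_def)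
  show ?thesis
  proof (intro exI[of _ r] conjI r(1) allI impI)
    fix e :: real assume e: "e > 0"
    define c where "c = (2 * \<bar>R\<bar>) powr p"
    have c0: "c \<ge> 0" by (simp add: c_def)
    obtain k where k: "c / (e powr p / 2) < real (Suc k)" using reals_Archimedean2 less_Suc_eq of_nat_less_iff order_less_trans by (metis lessI)
    then have k: "(1 / real (Suc k)) * c < e powr p / 2" using e by (simp add: field_simps)
    let ?S = "\<lambda>m n. \<Sum>A\<in>\<Q> k. \<bar>(LINT x:A|lborel. u (r m) x) - (LINT x:A|lborel. u (r n) x)\<bar> powr p"
    have "\<exists>M. \<forall>m\<ge>M. \<forall>n\<ge>M. \<bar>(LINT x:A|lborel. u (r m) x) - (LINT x:A|lborel. u (r n) x)\<bar> < d"
      if "A \<in> \<Q> k" "d > 0" for A d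
    proof -
      obtain j where j: "Q j = A" using Q_ex[OF \<open>A \<in> \<Q> k\<close>] by blast
      have "Cauchy (\<lambda>n. X (r n) j)" using Xr by (rule LIMSEQ_imp_Cauchy)
      then obtain M where "\<And>m n. m \<ge> M \<Longrightarrow> n \<ge> M \<Longrightarrow> dist (X (r m) j) (X (r n) j) < d"
        using \<open>d > 0\<close> unfolding Cauchy_def by meson
      then show ?thesis unfolding X_def j dist_real_def by blast
    qed
    note cau = this
    define b where "b = e powr p / (2 * (C k + 1) * (real (card (\<Q> k)) + 1))"
    have Ck: "C k \<ge> 0" using QC by blast
    have b: "b > 0" using e Ck by (simp add: b_def add_nonneg_pos)
    have "\<forall>A\<in>\<Q> k. \<exists>M. \<forall>m\<ge>M. \<forall>n\<ge>M. \<bar>(LINT x:A|lborel. u (r m) x) - (LINT x:A|lborel. u (r n) x)\<bar> < b powr (1 / p)"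
      using cau b by simp
    then obtain M where M: "\<And>A m n. A \<in> \<Q> k \<Longrightarrow> m \<ge> M A \<Longrightarrow> n \<ge> M A \<Longrightarrow>
        \<bar>(LINT x:A|lborel. u (r m) x) - (LINT x:A|lborel. u (r n) x)\<bar> < b powr (1 / p)"
      by metis
    define M0 where "M0 = (\<Sum>A\<in>\<Q> k. M A)"
    have fin: "finite (\<Q> k)" using QC by blast
    have "Lp_norm p \<Omega> (\<lambda>x. u (r m) x - u (r n) x) < e" if mn: "m \<ge> M0" "n \<ge> M0" for m n
    proof -
      let ?w = "u (r m) - u (r n)"
      have w: "?w \<in> test_functions \<Omega>" by (intro subspace_diff[OF subspace_test_functions] u)
      interpret seminormed_subspace "test_functions \<Omega>" "\<lambda>u. Lp_norm p \<Omega> (grad u)"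
        by (rule seminormed_test_functions[OF s p])
      have Nw: "Lp_norm p \<Omega> (grad ?w) \<le> 2 * \<bar>R\<bar>"
        using N_triangle[OF u T_uminus[OF u], of "r m" "r n"] N_uminus[OF u, of "r n"] R[of "r m"] R[of "r n"] by simp
      have "(\<Sum>A\<in>\<Q> k. \<bar>LINT x:A|lborel. ?w x\<bar> powr p) \<le> (\<Sum>A\<in>\<Q> k. b)"
      proof (rule sum_mono)
        fix A assume A: "A \<in> \<Q> k"
        then have AB: "A \<in> sets borel" using QC by blast
        have MA: "M A \<le> M0" unfolding M0_def by (rule member_le_sum[OF A]) (use fin in auto)
        have "\<bar>LINT x:A|lborel. ?w x\<bar> < b powr (1 / p)"
          using M[OF A] MA mn set_integral_test_function(2)[OF \<Omega>(1) p \<Omega>(2) AB u u] by auto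
        then have "\<bar>LINT x:A|lborel. ?w x\<bar> powr p \<le> (b powr (1 / p)) powr p" using p0 by (intro powr_mono2) auto
        then show "\<bar>LINT x:A|lborel. ?w x\<bar> powr p \<le> b" using p0 b by (simp add: powr_powr)
      qed
      also have "\<dots> = real (card (\<Q> k)) * b" by simp
      finally have S: "(\<Sum>A\<in>\<Q> k. \<bar>LINT x:A|lborel. ?w x\<bar> powr p) \<le> (real (card (\<Q> k)) + 1) * b" using b by (simp add: algebra_simps)
      have "Lp_norm p \<Omega> ?w powr p \<le> (1 / real (Suc k)) * Lp_norm p \<Omega> (grad ?w) powr p + C k * (\<Sum>A\<in>\<Q> k. \<bar>LINT x:A|lborel. ?w x\<bar> powr p)"
        using QC w by blast
      also have "\<dots> \<le> (1 / real (Suc k)) * c + C k * ((real (card (\<Q> k)) + 1) * b)"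
        unfolding c_def using p0 by (intro add_mono mult_left_mono powr_mono2 Nw S Ck Lp_norm_nonneg) auto
      finally have 1: "Lp_norm p \<Omega> ?w powr p \<le> (1 / real (Suc k)) * c + C k * ((real (card (\<Q> k)) + 1) * b)" .
      have 2: "C k * ((real (card (\<Q> k)) + 1) * b) \<le> e powr p / 2"
      proof -
        have "y * (e powr p / (2 * x * y)) = e powr p / (2 * x)" if "x > 0" "y > 0" for x y :: real
          using that by (simp add: field_simps)
        from this[of "C k + 1" "real (card (\<Q> k)) + 1"]
        have "(real (card (\<Q> k)) + 1) * b = e powr p / (2 * (C k + 1))" using Ck by (simp add: b_def add_nonneg_pos)
        also have "C k * \<dots> = (C k / (C k + 1)) * (e powr p / 2)" using Ck by (simp add: field_simps)
        also have "\<dots> \<le> 1 * (e powr p / 2)" using Ck by (intro mult_right_mono) (auto simp: field_simps)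
        finally show ?thesis by simp
      qed
      have "Lp_norm p \<Omega> ?w powr p < e powr p" using 1 2 k by linarith
      then have "Lp_norm p \<Omega> ?w < e"
        using p0 e powr_mono2[of p e "Lp_norm p \<Omega> ?w"] by (meson less_imp_le not_le)
      then show ?thesis by (simp add: minus_fun_eq)
    qed
    then show "\<exists>M. \<forall>m\<ge>M. \<forall>n\<ge>M. Lp_norm p \<Omega> (\<lambda>x. u (r m) x - u (r n) x) < e" by blast
  qed
qed

section \<open>The problem with exponents p and q\<close>

lemma powr_le_small_powr_plus:
  fixes s r \<delta> :: real
  assumes "0 < s" "s < r" "\<delta> > 0"
  shows "\<exists>M\<ge>0. \<forall>x\<ge>0. x powr s \<le> \<delta> * x powr r + M"
proof (intro exI[of _ "(\<delta> powr (- 1 / (r - s))) powr s"] conjI allI impI)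
  fix x :: real assume x: "x \<ge> 0"
  define X where "X = \<delta> powr (- 1 / (r - s))"
  have X: "X > 0" using assms by (simp add: X_def)
  have "- 1 / (r - s) * (s - r) = 1" using assms by (simp add: field_simps)
  then have "X powr (s - r) = \<delta>" using assms unfolding X_def powr_powr by simp
  show "x powr s \<le> \<delta> * x powr r + X powr s"
  proof (cases "x \<le> X")
    case True
    then have "x powr s \<le> X powr s" using x assms by (intro powr_mono2) auto
    then show ?thesis using assms by (simp add: add_increasing)
  next
    case False
    then have x0: "x > 0" using X by simp
    have "x powr s = x powr (s - r) * x powr r" using x0 by (simp flip: powr_add)
    also have "x powr (s - r) \<le> X powr (s - r)" using False X assms by (intro powr_mono2') auto
    then have "x powr (s - r) * x powr r \<le> \<delta> * x powr r"
      unfolding \<open>X powr (s - r) = \<delta>\<close> by (rule mult_right_mono) simp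
    finally show ?thesis by (smt (verit) powr_ge_zero)
  qed
qed simp

lemma Lp_norm_tendsto:
  fixes U :: "nat \<Rightarrow> 'a::euclidean_space \<Rightarrow> 'b::euclidean_space"
  assumes r: "r > 1" and U: "\<And>n. U n \<in> Lp_space r \<Omega>" and u: "u \<in> Lp_space r \<Omega>"
    and lim: "(\<lambda>n. Lp_norm r \<Omega> (\<lambda>x. U n x - u x)) \<longlonglongrightarrow> 0"
  shows "(\<lambda>n. Lp_norm r \<Omega> (U n)) \<longlonglongrightarrow> Lp_norm r \<Omega> u"
proof -
  have "(\<lambda>n. Lp_norm r \<Omega> (U n) - Lp_norm r \<Omega> u) \<longlonglongrightarrow> 0"
    by (rule Lim_null_comparison[OF _ lim]) (use Lp_norm_diff_le[OF r U u] in auto)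
  then show ?thesis by (simp add: LIM_zero_iff)
qed

lemma duality_pairing_tendsto:
  fixes U :: "nat \<Rightarrow> 'a::euclidean_space \<Rightarrow> 'b::euclidean_space"
  assumes r: "r > 1" and U: "\<And>n. U n \<in> Lp_space r \<Omega>" and u: "u \<in> Lp_space r \<Omega>"
    and lim: "(\<lambda>n. Lp_norm r \<Omega> (\<lambda>x. U n x - u x)) \<longlonglongrightarrow> 0" and w: "w \<in> Lp_space r \<Omega>"
  shows "(\<lambda>n. duality_pairing r \<Omega> (U n) w) \<longlonglongrightarrow> duality_pairing r \<Omega> u w"
proof (rule LIMSEQ_I)
  fix e :: real assume e: "e > 0"
  define \<eta> where "\<eta> = e / (Lp_norm r \<Omega> w + 1)"
  have w0: "Lp_norm r \<Omega> w \<ge> 0" by (rule Lp_norm_nonneg)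
  have \<eta>: "\<eta> > 0" using e w0 by (simp add: \<eta>_def)
  obtain s where s: "s > 0" "\<And>v. v \<in> Lp_space r \<Omega> \<Longrightarrow> Lp_norm r \<Omega> (\<lambda>x. v x - u x) \<le> s \<Longrightarrow>
      \<bar>duality_pairing r \<Omega> v w - duality_pairing r \<Omega> u w\<bar> \<le> \<eta> * Lp_norm r \<Omega> w"
    using duality_pairing_uniformly_continuous[OF r \<eta>, of \<Omega> "Lp_norm r \<Omega> u", where 'b='b] u w by blast
  have "\<forall>\<^sub>F n in sequentially. Lp_norm r \<Omega> (\<lambda>x. U n x - u x) < s" by (rule order_tendstoD(2)[OF lim s(1)])
  then obtain M where M: "\<And>n. n \<ge> M \<Longrightarrow> Lp_norm r \<Omega> (\<lambda>x. U n x - u x) < s" by (auto simp: eventually_sequentially)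
  have "\<eta> * Lp_norm r \<Omega> w < e" using e w0 by (simp add: \<eta>_def field_simps)
  then have "norm (duality_pairing r \<Omega> (U n) w - duality_pairing r \<Omega> u w) < e" if "n \<ge> M" for n
    using s(2)[OF U less_imp_le[OF M[OF that]]] by simp
  then show "\<exists>M. \<forall>n\<ge>M. norm (duality_pairing r \<Omega> (U n) w - duality_pairing r \<Omega> u w) < e" by blast
qed

lemma duality_pairing_tendsto_right:
  fixes u :: "'a::euclidean_space \<Rightarrow> 'b::euclidean_space"
  assumes r: "r > 1" and u: "u \<in> Lp_space r \<Omega>" and W: "\<And>n. W n \<in> Lp_space r \<Omega>" and w: "w \<in> Lp_space r \<Omega>"
    and lim: "(\<lambda>n. Lp_norm r \<Omega> (\<lambda>x. W n x - w x)) \<longlonglongrightarrow> 0"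
  shows "(\<lambda>n. duality_pairing r \<Omega> u (W n)) \<longlonglongrightarrow> duality_pairing r \<Omega> u w"
proof -
  have "(\<lambda>n. duality_pairing r \<Omega> u (W n) - duality_pairing r \<Omega> u w) \<longlonglongrightarrow> 0"
  proof (rule Lim_null_comparison)
    show "(\<lambda>n. Lp_norm r \<Omega> u powr (r - 1) * Lp_norm r \<Omega> (\<lambda>x. W n x - w x)) \<longlonglongrightarrow> 0"
      using tendsto_mult[OF tendsto_const lim] by simp
    show "\<forall>\<^sub>F n in sequentially. norm (duality_pairing r \<Omega> u (W n) - duality_pairing r \<Omega> u w)
        \<le> Lp_norm r \<Omega> u powr (r - 1) * Lp_norm r \<Omega> (\<lambda>x. W n x - w x)"
      using duality_pairing_diff[OF r u W w] duality_pairing_Holder[OF r u Lp_space_diff[OF _ W w]] r by simp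
  qed
  then show ?thesis by (simp add: LIM_zero_iff)
qed

text \<open>The data of the problem without \<open>\<alpha>\<close>, which will be varied.\<close>
locale pq_problem =
  fixes \<Omega> :: "'a::euclidean_space set" and p q \<beta> :: real and f :: "('a \<Rightarrow> real) \<Rightarrow> real"
  assumes open_\<Omega>: "open \<Omega>" and bounded_\<Omega>: "bounded \<Omega>" and q1: "1 < q" and qp: "q < p"
    and f: "f \<in> W10_dual p \<Omega>"
begin

lemma lmeasurable_\<Omega>: "\<Omega> \<in> lmeasurable"
  using bounded_\<Omega> open_\<Omega> by (rule lmeasurable_open)

lemma sets_\<Omega>: "\<Omega> \<in> sets lebesgue"
  using lmeasurable_\<Omega> by auto

lemma p1: "p > 1" and p0: "p > 0" and q0: "q > 0"
  using q1 qp by auto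

abbreviation T :: "('a \<Rightarrow> real) set" where "T \<equiv> test_functions \<Omega>"
abbreviation N :: "('a \<Rightarrow> real) \<Rightarrow> real" where "N u \<equiv> Lp_norm p \<Omega> (grad u)"

sublocale seminormed_subspace "test_functions \<Omega>" "\<lambda>u. Lp_norm p \<Omega> (grad u)"
  by (rule seminormed_test_functions[OF sets_\<Omega> p1])

lemmas T_Lp = test_function_Lp[OF _ sets_\<Omega> p0] test_function_Lp[OF _ sets_\<Omega> q0]
lemmas T_W10 = test_function_W10[OF open_\<Omega> lmeasurable_\<Omega> p1]
lemmas W10_Lp = W10_D(1,2)[OF open_\<Omega> lmeasurable_\<Omega>]
lemmas Lp_Lq = Lp_space_subset[OF lmeasurable_\<Omega> q0 less_imp_le[OF qp]]
lemmas Lp_diff = Lp_space_diff[OF p0]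

lemma grad_diff: "u \<in> T \<Longrightarrow> v \<in> T \<Longrightarrow> grad (u - v) = (\<lambda>x. grad u x - grad v x)"
  using grad_minus[of u \<Omega> v] minus_fun_eq by metis

lemma grad_scale: "u \<in> T \<Longrightarrow> grad (c *\<^sub>R u) = (\<lambda>x. c *\<^sub>R grad u x)"
  using grad_scaleR[of u \<Omega> c] scaleR_fun_def by metis

lemma f_bounded: "\<exists>C. \<forall>u\<in>W10 p \<Omega>. \<bar>f u\<bar> \<le> C * Lp_norm p \<Omega> (weak_grad \<Omega> u)"
  using f by (simp add: W10_dual_def)

lemma Lp_null_imp_Lq_null:
  fixes W :: "nat \<Rightarrow> 'a \<Rightarrow> 'b::euclidean_space"
  assumes W: "\<And>n. W n \<in> Lp_space p \<Omega>" and lim: "(\<lambda>n. Lp_norm p \<Omega> (W n)) \<longlonglongrightarrow> 0"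
  shows "(\<lambda>n. Lp_norm q \<Omega> (W n)) \<longlonglongrightarrow> 0"
proof -
  obtain K where K: "\<And>u::'a \<Rightarrow> 'b. u \<in> Lp_space p \<Omega> \<Longrightarrow> Lp_norm q \<Omega> u \<le> K * Lp_norm p \<Omega> u"
    using Lp_norm_embedding[OF lmeasurable_\<Omega> q0 less_imp_le[OF qp]] by blast
  show ?thesis
    by (rule Lim_null_comparison[OF _ tendsto_mult_right_zero[OF lim, of K]]) (simp add: K W Lp_norm_nonneg)
qed

lemma embedding_constants:
  obtains K where "K > 0"
    "\<And>u::'a \<Rightarrow> real. u \<in> Lp_space p \<Omega> \<Longrightarrow> Lp_norm q \<Omega> u \<le> K * Lp_norm p \<Omega> u"
    "\<And>u. u \<in> T \<Longrightarrow> Lp_norm p \<Omega> u \<le> K * N u"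
    "\<And>u. u \<in> T \<Longrightarrow> Lp_norm q \<Omega> u \<le> K * N u"
    "\<And>u. u \<in> T \<Longrightarrow> Lp_norm q \<Omega> (grad u) \<le> K * N u"
    "\<And>u. u \<in> T \<Longrightarrow> \<bar>f u\<bar> \<le> K * N u"
proof -
  obtain K1 where K1: "K1 \<ge> 0" "\<And>u::'a \<Rightarrow> real. u \<in> Lp_space p \<Omega> \<Longrightarrow> Lp_norm q \<Omega> u \<le> K1 * Lp_norm p \<Omega> u"
    using Lp_norm_embedding[OF lmeasurable_\<Omega> q0 less_imp_le[OF qp]] by blast
  obtain K2 where K2: "K2 \<ge> 0" "\<And>u::'a \<Rightarrow> 'a. u \<in> Lp_space p \<Omega> \<Longrightarrow> Lp_norm q \<Omega> u \<le> K2 * Lp_norm p \<Omega> u"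
    using Lp_norm_embedding[OF lmeasurable_\<Omega> q0 less_imp_le[OF qp]] by blast
  obtain P where P: "P > 0" "\<And>u. u \<in> T \<Longrightarrow> Lp_norm p \<Omega> u \<le> P * N u"
    using Poincare_inequality[OF sets_\<Omega> bounded_\<Omega> p1] by blast
  obtain C where C: "\<And>u. u \<in> W10 p \<Omega> \<Longrightarrow> \<bar>f u\<bar> \<le> C * Lp_norm p \<Omega> (weak_grad \<Omega> u)"
    using f_bounded by blast
  define K where "K = 1 + K1 + K2 + P + K1 * P + \<bar>C\<bar>"
  have k: "K1 \<le> K" "K2 \<le> K" "P \<le> K" "K1 * P \<le> K" "C \<le> K" "K > 0"
    using K1(1) K2(1) P(1) mult_nonneg_nonneg[OF K1(1) less_imp_le[OF P(1)]] unfolding K_def by linarith+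
  show thesis
  proof (rule that[of K])
    show "Lp_norm q \<Omega> u \<le> K * Lp_norm p \<Omega> u" if "u \<in> Lp_space p \<Omega>" for u :: "'a \<Rightarrow> real"
      using K1(2)[OF that] mult_right_mono[OF k(1) Lp_norm_nonneg, of p \<Omega> u] by linarith
    fix u assume u: "u \<in> T"
    show "Lp_norm p \<Omega> u \<le> K * N u"
      using P(2)[OF u] mult_right_mono[OF k(3) Lp_norm_nonneg, of p \<Omega> "grad u"] by linarith
    show "Lp_norm q \<Omega> u \<le> K * N u"
      using K1(2)[OF T_Lp(1)[OF u]] mult_left_mono[OF P(2)[OF u] K1(1)]
        mult_right_mono[OF k(4) Lp_norm_nonneg, of p \<Omega> "grad u"] by (simp add: mult.assoc)
    show "Lp_norm q \<Omega> (grad u) \<le> K * N u"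
      using K2(2)[OF T_Lp(2)[OF u]] mult_right_mono[OF k(2) Lp_norm_nonneg, of p \<Omega> "grad u"] by linarith
    show "\<bar>f u\<bar> \<le> K * N u"
      using C[OF T_W10(1)[OF u]] T_W10(3)[OF u] mult_right_mono[OF k(5) Lp_norm_nonneg, of p \<Omega> "grad u"] by simp
  qed (rule k(6))
qed

lemma f_diff: "u \<in> W10 p \<Omega> \<Longrightarrow> v \<in> W10 p \<Omega> \<Longrightarrow> f (\<lambda>x. u x - v x) = f u - f v"
proof -
  assume u: "u \<in> W10 p \<Omega>" and v: "v \<in> W10 p \<Omega>"
  have "f (\<lambda>x. u x + v x) = f u + f v" if "u \<in> W10 p \<Omega>" "v \<in> W10 p \<Omega>" for u v
    using f that by (simp add: W10_dual_def)
  from this[OF W10_diff(1)[OF open_\<Omega> lmeasurable_\<Omega> p1 u v] v] show ?thesis by simp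
qed

lemma f_add: "u \<in> T \<Longrightarrow> v \<in> T \<Longrightarrow> f (u + v) = f u + f v"
  using f T_W10(1) unfolding W10_dual_def plus_fun_def by blast

lemma f_minus: "u \<in> T \<Longrightarrow> v \<in> T \<Longrightarrow> f (u - v) = f u - f v"
  using f_diff[OF T_W10(1) T_W10(1)] by (simp add: minus_fun_eq)

lemma f_scale: "u \<in> T \<Longrightarrow> f (c *\<^sub>R u) = c * f u"
  using f T_W10(1) unfolding W10_dual_def scaleR_fun_def by auto

lemma f_tendsto:
  assumes \<psi>: "\<And>n::nat. \<psi> n \<in> T" and \<phi>: "\<phi> \<in> W10 p \<Omega>"
    and lim: "(\<lambda>n. Lp_norm p \<Omega> (\<lambda>x. grad (\<psi> n) x - weak_grad \<Omega> \<phi> x)) \<longlonglongrightarrow> 0"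
  shows "(\<lambda>n. f (\<psi> n)) \<longlonglongrightarrow> f \<phi>"
proof -
  obtain C where C: "\<And>u. u \<in> W10 p \<Omega> \<Longrightarrow> \<bar>f u\<bar> \<le> C * Lp_norm p \<Omega> (weak_grad \<Omega> u)"
    using f_bounded by blast
  have "\<bar>f (\<psi> n) - f \<phi>\<bar> \<le> C * Lp_norm p \<Omega> (\<lambda>x. grad (\<psi> n) x - weak_grad \<Omega> \<phi> x)" for n
  proof -
    note W = T_W10(1)[OF \<psi>, of n]
    note d = W10_diff[OF open_\<Omega> lmeasurable_\<Omega> p1 W \<phi>]
    have "Lp_norm p \<Omega> (weak_grad \<Omega> (\<lambda>x. \<psi> n x - \<phi> x)) = Lp_norm p \<Omega> (\<lambda>x. grad (\<psi> n) x - weak_grad \<Omega> \<phi> x)"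
    proof (rule Lp_norm_cong_AE)
      show "weak_grad \<Omega> (\<lambda>x. \<psi> n x - \<phi> x) \<in> borel_measurable (lebesgue_on \<Omega>)"
        by (rule Lp_spaceD(1)[OF W10_Lp(2)[OF d(1)]])
      show "(\<lambda>x. grad (\<psi> n) x - weak_grad \<Omega> \<phi> x) \<in> borel_measurable (lebesgue_on \<Omega>)"
        by (rule Lp_spaceD(1)[OF Lp_diff[OF T_Lp(2)[OF \<psi>] W10_Lp(2)[OF \<phi>]]])
      show "AE x in lebesgue_on \<Omega>. weak_grad \<Omega> (\<lambda>x. \<psi> n x - \<phi> x) x = grad (\<psi> n) x - weak_grad \<Omega> \<phi> x"
        using d(2) T_W10(2)[OF \<psi>, of n] by eventually_elim simp
    qed
    then show ?thesis using C[OF d(1)] f_diff[OF W \<phi>] by simp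
  qed
  then have "(\<lambda>n. f (\<psi> n) - f \<phi>) \<longlonglongrightarrow> 0"
    by (intro Lim_null_comparison[OF _ tendsto_mult_right_zero[OF lim, of C]]) auto
  then show ?thesis by (simp add: LIM_zero_iff)
qed

text \<open>The left-hand side minus the right-hand side of the weak equation without \<open>f\<close>, with \<open>a\<close> in the role of
\<open>\<alpha>\<close> and a weight \<open>\<tau>\<close> at the terms of exponent \<open>q\<close>: \<open>\<tau> = 1\<close> gives the problem itself, \<open>\<tau> = 0\<close> the
eigenvalue problem of the \<open>p\<close>-Laplacian, and the values in between occur when solutions are rescaled.
The gradients are separate arguments, as they are classical for test functions and weak for the limits.\<close>
definition form :: "real \<Rightarrow> real \<Rightarrow> ('a \<Rightarrow> real) \<Rightarrow> ('a \<Rightarrow> 'a) \<Rightarrow> ('a \<Rightarrow> real) \<Rightarrow> ('a \<Rightarrow> 'a) \<Rightarrow> real" where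
  "form a \<tau> u g \<phi> \<gamma> = duality_pairing p \<Omega> g \<gamma> - a * duality_pairing p \<Omega> u \<phi>
     + \<tau> * (duality_pairing q \<Omega> g \<gamma> - \<beta> * duality_pairing q \<Omega> u \<phi>)"

lemma form_tendsto:
  assumes U: "\<And>n::nat. U n \<in> Lp_space p \<Omega>" "u \<in> Lp_space p \<Omega>" "(\<lambda>n. Lp_norm p \<Omega> (\<lambda>x. U n x - u x)) \<longlonglongrightarrow> 0"
    and H: "\<And>n::nat. H n \<in> Lp_space p \<Omega>" "g \<in> Lp_space p \<Omega>" "(\<lambda>n. Lp_norm p \<Omega> (\<lambda>x. H n x - g x)) \<longlonglongrightarrow> 0"
    and a: "a \<longlonglongrightarrow> a'" and \<tau>: "\<tau> \<longlonglongrightarrow> \<tau>'" and \<phi>: "\<phi> \<in> Lp_space p \<Omega>" "\<gamma> \<in> Lp_space p \<Omega>"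
  shows "(\<lambda>n. form (a n) (\<tau> n) (U n) (H n) \<phi> \<gamma>) \<longlonglongrightarrow> form a' \<tau>' u g \<phi> \<gamma>"
proof -
  have qU: "(\<lambda>n. Lp_norm q \<Omega> (\<lambda>x. U n x - u x)) \<longlonglongrightarrow> 0"
    by (rule Lp_null_imp_Lq_null[OF Lp_diff[OF U(1,2)] U(3)])
  have qH: "(\<lambda>n. Lp_norm q \<Omega> (\<lambda>x. H n x - g x)) \<longlonglongrightarrow> 0"
    by (rule Lp_null_imp_Lq_null[OF Lp_diff[OF H(1,2)] H(3)])
  show "(\<lambda>n. form (a n) (\<tau> n) (U n) (H n) \<phi> \<gamma>) \<longlonglongrightarrow> form a' \<tau>' u g \<phi> \<gamma>"
    unfolding form_def
    by (intro tendsto_intros a \<tau> duality_pairing_tendsto p1 q1 U H \<phi> qU qH Lp_Lq)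
qed

lemma form_tendsto_right:
  assumes \<Phi>: "\<And>n::nat. \<Phi> n \<in> Lp_space p \<Omega>" "\<phi> \<in> Lp_space p \<Omega>" "(\<lambda>n. Lp_norm p \<Omega> (\<lambda>x. \<Phi> n x - \<phi> x)) \<longlonglongrightarrow> 0"
    and \<Gamma>: "\<And>n::nat. \<Gamma> n \<in> Lp_space p \<Omega>" "\<gamma> \<in> Lp_space p \<Omega>" "(\<lambda>n. Lp_norm p \<Omega> (\<lambda>x. \<Gamma> n x - \<gamma> x)) \<longlonglongrightarrow> 0"
    and u: "u \<in> Lp_space p \<Omega>" "g \<in> Lp_space p \<Omega>"
  shows "(\<lambda>n. form a \<tau> u g (\<Phi> n) (\<Gamma> n)) \<longlonglongrightarrow> form a \<tau> u g \<phi> \<gamma>"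
proof -
  have q\<Phi>: "(\<lambda>n. Lp_norm q \<Omega> (\<lambda>x. \<Phi> n x - \<phi> x)) \<longlonglongrightarrow> 0"
    by (rule Lp_null_imp_Lq_null[OF Lp_diff[OF \<Phi>(1,2)] \<Phi>(3)])
  have q\<Gamma>: "(\<lambda>n. Lp_norm q \<Omega> (\<lambda>x. \<Gamma> n x - \<gamma> x)) \<longlonglongrightarrow> 0"
    by (rule Lp_null_imp_Lq_null[OF Lp_diff[OF \<Gamma>(1,2)] \<Gamma>(3)])
  show ?thesis
    unfolding form_def
    by (intro tendsto_intros duality_pairing_tendsto_right p1 q1 \<Phi> \<Gamma> u q\<Phi> q\<Gamma> Lp_Lq)
qed

text \<open>The two exponents scale differently; the discrepancy is absorbed by the weight.\<close>
lemma form_scale: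
  assumes "c > 0"
  shows "form a (c powr (p - q)) (\<lambda>x. c * u x) (\<lambda>x. c *\<^sub>R g x) \<phi> \<gamma> = c powr (p - 1) * form a 1 u g \<phi> \<gamma>"
proof -
  have 1: "c powr (p - 1) = c powr (p - q) * c powr (q - 1)" by (simp flip: powr_add)
  show ?thesis
    using duality_pairing_scale_left[OF assms, of p \<Omega> u \<phi>] duality_pairing_scale_left[OF assms, of p \<Omega> g \<gamma>]
      duality_pairing_scale_left[OF assms, of q \<Omega> u \<phi>] duality_pairing_scale_left[OF assms, of q \<Omega> g \<gamma>]
    by (simp add: form_def 1 algebra_simps)
qed

lemma weak_solutionI:
  assumes u: "u \<in> W10 p \<Omega>"
    and eq: "\<And>\<phi>. \<phi> \<in> W10 p \<Omega> \<Longrightarrow> form \<alpha> 1 u (weak_grad \<Omega> u) \<phi> (weak_grad \<Omega> \<phi>) = f \<phi>"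
  shows "weak_solution \<Omega> p q \<alpha> \<beta> f u"
  unfolding weak_solution_def
proof (intro conjI u ballI)
  fix \<phi> assume \<phi>: "\<phi> \<in> W10 p \<Omega>"
  let ?g = "weak_grad \<Omega> u" and ?\<gamma> = "weak_grad \<Omega> \<phi>" and ?M = "lebesgue_on \<Omega>"
  note uL = W10_Lp[OF u] and \<phi>L = W10_Lp[OF \<phi>]
  note I = integrable_duality[OF p1 uL(2) \<phi>L(2)] integrable_duality[OF q1 Lp_Lq[OF uL(2)] Lp_Lq[OF \<phi>L(2)]]
    and J = integrable_duality[OF p1 uL(1) \<phi>L(1)] integrable_duality[OF q1 Lp_Lq[OF uL(1)] Lp_Lq[OF \<phi>L(1)]]
  have "(LINT x|?M. (norm (?g x) powr (p - 2) + norm (?g x) powr (q - 2)) * (?g x \<bullet> ?\<gamma> x))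
      = (LINT x|?M. duality_map p (?g x) \<bullet> ?\<gamma> x + duality_map q (?g x) \<bullet> ?\<gamma> x)"
    by (rule Bochner_Integration.integral_cong) (auto simp: duality_map_def algebra_simps)
  also have "\<dots> = duality_pairing p \<Omega> ?g ?\<gamma> + duality_pairing q \<Omega> ?g ?\<gamma>"
    unfolding duality_pairing_def by (rule Bochner_Integration.integral_add[OF I])
  finally have L: "(LINT x|?M. (norm (?g x) powr (p - 2) + norm (?g x) powr (q - 2)) * (?g x \<bullet> ?\<gamma> x))
      = duality_pairing p \<Omega> ?g ?\<gamma> + duality_pairing q \<Omega> ?g ?\<gamma>" .
  have "(LINT x|?M. (\<alpha> * \<bar>u x\<bar> powr (p - 2) * u x + \<beta> * \<bar>u x\<bar> powr (q - 2) * u x) * \<phi> x)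
      = (LINT x|?M. \<alpha> * (duality_map p (u x) \<bullet> \<phi> x) + \<beta> * (duality_map q (u x) \<bullet> \<phi> x))"
    by (rule Bochner_Integration.integral_cong) (auto simp: duality_map_def algebra_simps)
  also have "\<dots> = (LINT x|?M. \<alpha> * (duality_map p (u x) \<bullet> \<phi> x)) + (LINT x|?M. \<beta> * (duality_map q (u x) \<bullet> \<phi> x))"
    by (rule Bochner_Integration.integral_add) (intro integrable_mult_right J)+
  also have "\<dots> = \<alpha> * duality_pairing p \<Omega> u \<phi> + \<beta> * duality_pairing q \<Omega> u \<phi>"
    by (simp add: duality_pairing_def)
  finally have "(LINT x|?M. (\<alpha> * \<bar>u x\<bar> powr (p - 2) * u x + \<beta> * \<bar>u x\<bar> powr (q - 2) * u x) * \<phi> x)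
      = \<alpha> * duality_pairing p \<Omega> u \<phi> + \<beta> * duality_pairing q \<Omega> u \<phi>" .
  then show "(LINT x|?M. (norm (?g x) powr (p - 2) + norm (?g x) powr (q - 2)) * (?g x \<bullet> ?\<gamma> x))
     = (LINT x|?M. (\<alpha> * \<bar>u x\<bar> powr (p - 2) * u x + \<beta> * \<bar>u x\<bar> powr (q - 2) * u x) * \<phi> x) + f \<phi>"
    using L eq[OF \<phi>] by (simp add: form_def)
qed

lemma ES_I:
  assumes u: "u \<in> W10 p \<Omega>"
    and eq: "\<And>\<phi>. \<phi> \<in> W10 p \<Omega> \<Longrightarrow> form \<alpha> 0 u (weak_grad \<Omega> u) \<phi> (weak_grad \<Omega> \<phi>) = 0"
  shows "u \<in> ES \<Omega> p \<alpha>"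
proof -
  have "(LINT x|lebesgue_on \<Omega>. norm (weak_grad \<Omega> u x) powr (p - 2) * (weak_grad \<Omega> u x \<bullet> weak_grad \<Omega> \<phi> x))
      = duality_pairing p \<Omega> (weak_grad \<Omega> u) (weak_grad \<Omega> \<phi>)" for \<phi>
    by (simp add: duality_pairing_def duality_map_def)
  moreover have "(LINT x|lebesgue_on \<Omega>. \<alpha> * \<bar>u x\<bar> powr (p - 2) * u x * \<phi> x) = \<alpha> * duality_pairing p \<Omega> u \<phi>" for \<phi>
    by (simp add: duality_pairing_def duality_map_def mult.assoc)
  ultimately show ?thesis using u eq by (auto simp: ES_def form_def)
qed

end

section \<open>Convergence of almost solutions\<close>

context pq_problem
begin

lemma pairings_bounded_by_Lp_norm:
  "\<exists>c\<ge>0. \<forall>u\<in>T. \<forall>d\<in>T. N u \<le> R \<longrightarrow>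
     \<bar>duality_pairing p \<Omega> u d\<bar> \<le> c * Lp_norm p \<Omega> d \<and> \<bar>duality_pairing q \<Omega> u d\<bar> \<le> c * Lp_norm p \<Omega> d \<and>
     \<bar>duality_pairing q \<Omega> (grad u) (grad d)\<bar> \<le> c * N d"
proof -
  obtain K where K: "K > 0"
    "\<And>u::'a \<Rightarrow> real. u \<in> Lp_space p \<Omega> \<Longrightarrow> Lp_norm q \<Omega> u \<le> K * Lp_norm p \<Omega> u"
    "\<And>u. u \<in> T \<Longrightarrow> Lp_norm p \<Omega> u \<le> K * N u" "\<And>u. u \<in> T \<Longrightarrow> Lp_norm q \<Omega> u \<le> K * N u"
    "\<And>u. u \<in> T \<Longrightarrow> Lp_norm q \<Omega> (grad u) \<le> K * N u"
    using embedding_constants by metis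
  define X where "X = K * \<bar>R\<bar>"
  define c where "c = X powr (p - 1) + X powr (q - 1) * K"
  have X: "X \<ge> 0" using K(1) by (simp add: X_def)
  have c: "X powr (p - 1) \<le> c" "X powr (q - 1) * K \<le> c" "c \<ge> 0" using K(1) by (simp_all add: c_def)
  show ?thesis
  proof (intro exI[of _ c] conjI c ballI impI)
    fix u d assume u: "u \<in> T" and d: "d \<in> T" and R: "N u \<le> R"
    have NR: "K * N u \<le> X" unfolding X_def using R K(1) by (intro mult_left_mono) auto
    have pow: "m powr (r - 1) \<le> X powr (r - 1)" if "m \<le> K * N u" "m \<ge> 0" "r > 1" for m r
      using that NR by (intro powr_mono2) auto
    have "\<bar>duality_pairing p \<Omega> u d\<bar> \<le> Lp_norm p \<Omega> u powr (p - 1) * Lp_norm p \<Omega> d"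
      by (intro duality_pairing_Holder p1 T_Lp u d)
    also have "\<dots> \<le> c * Lp_norm p \<Omega> d"
      using pow[OF K(3)[OF u] Lp_norm_nonneg p1] c(1) by (intro mult_right_mono Lp_norm_nonneg) linarith
    finally show "\<bar>duality_pairing p \<Omega> u d\<bar> \<le> c * Lp_norm p \<Omega> d" .
    have "\<bar>duality_pairing q \<Omega> u d\<bar> \<le> Lp_norm q \<Omega> u powr (q - 1) * Lp_norm q \<Omega> d"
      by (intro duality_pairing_Holder q1 T_Lp u d)
    also have "\<dots> \<le> X powr (q - 1) * (K * Lp_norm p \<Omega> d)"
      by (intro mult_mono pow[OF K(4)[OF u] Lp_norm_nonneg q1] K(2) T_Lp d) (auto simp: Lp_norm_nonneg)
    also have "\<dots> \<le> c * Lp_norm p \<Omega> d"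
      using c(2) mult_right_mono[OF c(2) Lp_norm_nonneg, of p \<Omega> d] by (simp add: mult.assoc)
    finally show "\<bar>duality_pairing q \<Omega> u d\<bar> \<le> c * Lp_norm p \<Omega> d" .
    have "\<bar>duality_pairing q \<Omega> (grad u) (grad d)\<bar> \<le> Lp_norm q \<Omega> (grad u) powr (q - 1) * Lp_norm q \<Omega> (grad d)"
      by (intro duality_pairing_Holder q1 T_Lp u d)
    also have "\<dots> \<le> X powr (q - 1) * (K * N d)"
      by (intro mult_mono pow[OF K(5)[OF u] Lp_norm_nonneg q1] K(5) d) (auto simp: Lp_norm_nonneg)
    also have "\<dots> \<le> c * N d"
      using mult_right_mono[OF c(2) Lp_norm_nonneg, of p \<Omega> "grad d"] by (simp add: mult.assoc)
    finally show "\<bar>duality_pairing q \<Omega> (grad u) (grad d)\<bar> \<le> c * N d" .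
  qed
qed

text \<open>Subtract the equations of \<open>u m\<close> and \<open>u n\<close> tested with \<open>u m - u n\<close>. The terms of exponent \<open>q\<close> in the
gradient have a good sign by monotonicity, up to the difference of the weights; the terms without
gradients are small in \<open>L\<^sup>p\<close>.\<close>
lemma almost_solutions_gradient_pairing:
  assumes u: "\<And>n::nat. u n \<in> T" and R: "\<And>n. N (u n) \<le> R"
    and a: "a \<longlonglongrightarrow> a'" and \<tau>: "\<tau> \<longlonglongrightarrow> \<tau>'" "\<And>n. \<tau> n \<ge> 0"
    and eq: "\<And>n \<phi>. \<phi> \<in> T \<Longrightarrow> \<bar>form (a n) (\<tau> n) (u n) (grad (u n)) \<phi> (grad \<phi>) - \<sigma> n * f \<phi>\<bar> \<le> \<epsilon> n * N \<phi>"
  shows "\<exists>M\<ge>0. \<forall>m n. duality_pairing p \<Omega> (grad (u m)) (grad (u m - u n)) - duality_pairing p \<Omega> (grad (u n)) (grad (u m - u n))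
     \<le> M * (\<bar>\<epsilon> m\<bar> + \<bar>\<epsilon> n\<bar> + \<bar>\<sigma> m - \<sigma> n\<bar> + \<bar>\<tau> m - \<tau> n\<bar> + Lp_norm p \<Omega> (\<lambda>x. u m x - u n x))"
proof -
  obtain c where c: "c \<ge> 0" "\<And>u d. u \<in> T \<Longrightarrow> d \<in> T \<Longrightarrow> N u \<le> R \<Longrightarrow> \<bar>duality_pairing p \<Omega> u d\<bar> \<le> c * Lp_norm p \<Omega> d"
     "\<And>u d. u \<in> T \<Longrightarrow> d \<in> T \<Longrightarrow> N u \<le> R \<Longrightarrow> \<bar>duality_pairing q \<Omega> u d\<bar> \<le> c * Lp_norm p \<Omega> d"
     "\<And>u d. u \<in> T \<Longrightarrow> d \<in> T \<Longrightarrow> N u \<le> R \<Longrightarrow> \<bar>duality_pairing q \<Omega> (grad u) (grad d)\<bar> \<le> c * N d"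
    using pairings_bounded_by_Lp_norm[of R] by blast
  obtain K where K: "K > 0" "\<And>u. u \<in> T \<Longrightarrow> \<bar>f u\<bar> \<le> K * N u"
    using embedding_constants by metis
  obtain A0 where A0: "\<And>n. \<bar>a n\<bar> \<le> A0"
    using Bseq_def convergentI[OF a, THEN convergent_imp_Bseq] by (metis BseqE real_norm_def)
  obtain T0 where T0: "\<And>n. \<bar>\<tau> n\<bar> \<le> T0"
    using convergentI[OF \<tau>(1), THEN convergent_imp_Bseq] by (metis BseqE real_norm_def)
  have R0: "R \<ge> 0" using R[of 0] N_nonneg[OF u[of 0]] by linarith
  have A00: "A0 \<ge> 0" using A0[of 0] by linarith
  have T00: "T0 \<ge> 0" using T0[of 0] by linarith
  define M where "M = 2 * R * (1 + K + c) + 2 * A0 * c + 2 * T0 * \<bar>\<beta>\<bar> * c"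
  have M0: "M \<ge> 0" using R0 A00 T00 K(1) c(1) by (simp add: M_def)
  show ?thesis
  proof (intro exI[of _ M] conjI M0 allI)
    fix m n
    define d where "d = u m - u n"
    have d: "d \<in> T" unfolding d_def by (intro T_diff u)
    have Nd: "N d \<le> 2 * R"
      using N_triangle[OF u T_uminus[OF u], of m n] N_uminus[OF u, of n] R[of m] R[of n] by (simp add: d_def)
    have Nd0: "N d \<ge> 0" by (rule N_nonneg[OF d])
    define l where "l = Lp_norm p \<Omega> d"
    have l0: "l \<ge> 0" by (simp add: l_def Lp_norm_nonneg)
    have ld: "Lp_norm p \<Omega> (\<lambda>x. u m x - u n x) = l" by (simp add: l_def d_def minus_fun_eq)
    let ?P = "\<lambda>k. duality_pairing p \<Omega> (grad (u k)) (grad d)" and ?p = "\<lambda>k. duality_pairing p \<Omega> (u k) d"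
    let ?Q = "\<lambda>k. duality_pairing q \<Omega> (grad (u k)) (grad d)" and ?q = "\<lambda>k. duality_pairing q \<Omega> (u k) d"
    let ?F = "\<lambda>k. form (a k) (\<tau> k) (u k) (grad (u k)) d (grad d)"
    have id: "?P m - ?P n = (?F m - \<sigma> m * f d) - (?F n - \<sigma> n * f d) + (\<sigma> m - \<sigma> n) * f d
       + (a m * ?p m - a n * ?p n) + (\<beta> * (\<tau> m * ?q m) - \<beta> * (\<tau> n * ?q n))
       - \<tau> m * (?Q m - ?Q n) - (\<tau> m - \<tau> n) * ?Q n"
      by (simp add: form_def algebra_simps)
    have F: "\<bar>?F k - \<sigma> k * f d\<bar> \<le> \<bar>\<epsilon> k\<bar> * (2 * R)" for k
    proof -
      have "\<epsilon> k * N d \<le> \<bar>\<epsilon> k\<bar> * (2 * R)" using Nd Nd0 by (intro mult_mono) auto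
      then show ?thesis using eq[OF d, of k] by linarith
    qed
    have S: "\<bar>(\<sigma> m - \<sigma> n) * f d\<bar> \<le> \<bar>\<sigma> m - \<sigma> n\<bar> * (K * (2 * R))"
      unfolding abs_mult using order_trans[OF K(2)[OF d] mult_left_mono[OF Nd less_imp_le[OF K(1)]]]
      by (rule mult_left_mono) simp
    have A: "\<bar>a k * ?p k\<bar> \<le> A0 * (c * l)" for k
      unfolding abs_mult l_def by (intro mult_mono A0 c(2) u d R A00 abs_ge_zero)
    have B: "\<bar>\<beta> * (\<tau> k * ?q k)\<bar> \<le> \<bar>\<beta>\<bar> * (T0 * (c * l))" for k
      unfolding abs_mult l_def by (intro mult_left_mono mult_mono T0 c(3) u d R T00 abs_ge_zero)
    have mono: "?Q m - ?Q n \<ge> 0"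
      using duality_pairing_monotone[OF q1 T_Lp(4)[OF u] T_Lp(4)[OF u], of m n] by (simp add: d_def grad_diff u)
    have Q: "\<tau> m * (?Q m - ?Q n) \<ge> 0" by (rule mult_nonneg_nonneg[OF \<tau>(2) mono])
    have t: "\<bar>(\<tau> m - \<tau> n) * ?Q n\<bar> \<le> \<bar>\<tau> m - \<tau> n\<bar> * (c * (2 * R))"
      unfolding abs_mult using c(4)[OF u d R, of n] mult_left_mono[OF Nd c(1)] by (intro mult_left_mono) auto
    have "?P m - ?P n \<le> (\<bar>\<epsilon> m\<bar> + \<bar>\<epsilon> n\<bar>) * (2 * R) + \<bar>\<sigma> m - \<sigma> n\<bar> * (K * (2 * R)) + 2 * (A0 * (c * l))
       + 2 * (\<bar>\<beta>\<bar> * (T0 * (c * l))) + \<bar>\<tau> m - \<tau> n\<bar> * (c * (2 * R))"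
      unfolding id
      using F[of m, THEN abs_le_D1] F[of n, THEN abs_le_D2] S[THEN abs_le_D1] A[of m, THEN abs_le_D1] A[of n, THEN abs_le_D2]
        B[of m, THEN abs_le_D1] B[of n, THEN abs_le_D2] Q t[THEN abs_le_D2] distrib_right[of "\<bar>\<epsilon> m\<bar>" "\<bar>\<epsilon> n\<bar>" "2 * R"]
      by linarith
    also have "\<dots> = (2 * R) * (\<bar>\<epsilon> m\<bar> + \<bar>\<epsilon> n\<bar>) + (2 * R * K) * \<bar>\<sigma> m - \<sigma> n\<bar> + (2 * A0 * c + 2 * T0 * \<bar>\<beta>\<bar> * c) * l
       + (2 * R * c) * \<bar>\<tau> m - \<tau> n\<bar>" by (simp add: algebra_simps)
    also have "\<dots> \<le> M * (\<bar>\<epsilon> m\<bar> + \<bar>\<epsilon> n\<bar>) + M * \<bar>\<sigma> m - \<sigma> n\<bar> + M * l + M * \<bar>\<tau> m - \<tau> n\<bar>"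
      using R0 A00 T00 K(1) c(1) l0 by (intro add_mono mult_right_mono) (auto simp: M_def algebra_simps)
    finally show "?P m - ?P n \<le> M * (\<bar>\<epsilon> m\<bar> + \<bar>\<epsilon> n\<bar> + \<bar>\<sigma> m - \<sigma> n\<bar> + \<bar>\<tau> m - \<tau> n\<bar> + Lp_norm p \<Omega> (\<lambda>x. u m x - u n x))"
      by (simp add: ld algebra_simps)
  qed
qed

text \<open>The Palais-Smale condition for bounded sequences, with variable coefficients: Rellich's theorem gives
convergence in \<open>L\<^sup>p\<close>, then the previous estimate and strong monotonicity of the \<open>p\<close>-Laplacian give
convergence of the gradients, so that the equation passes to the limit; it extends from test functions
to the whole Sobolev space by density.\<close>
lemma almost_solutions_converge:
  assumes u: "\<And>n::nat. u n \<in> T" and R: "\<And>n. N (u n) \<le> R"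
    and a: "a \<longlonglongrightarrow> a'" and \<tau>: "\<tau> \<longlonglongrightarrow> \<tau>'" "\<And>n. \<tau> n \<ge> 0" and \<sigma>: "\<sigma> \<longlonglongrightarrow> \<sigma>'" and \<epsilon>: "\<epsilon> \<longlonglongrightarrow> 0"
    and eq: "\<And>n \<phi>. \<phi> \<in> T \<Longrightarrow> \<bar>form (a n) (\<tau> n) (u n) (grad (u n)) \<phi> (grad \<phi>) - \<sigma> n * f \<phi>\<bar> \<le> \<epsilon> n * N \<phi>"
  shows "\<exists>r v. strict_mono (r :: nat \<Rightarrow> nat) \<and> v \<in> W10 p \<Omega> \<and>
     (\<lambda>n. Lp_norm p \<Omega> (\<lambda>x. u (r n) x - v x)) \<longlonglongrightarrow> 0 \<and>
     (\<lambda>n. Lp_norm p \<Omega> (\<lambda>x. grad (u (r n)) x - weak_grad \<Omega> v x)) \<longlonglongrightarrow> 0 \<and>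
     (\<forall>\<phi>\<in>W10 p \<Omega>. form a' \<tau>' v (weak_grad \<Omega> v) \<phi> (weak_grad \<Omega> \<phi>) = \<sigma>' * f \<phi>)"
proof -
  obtain r :: "nat \<Rightarrow> nat" where r: "strict_mono r"
    and cau: "\<And>e. e > 0 \<Longrightarrow> \<exists>M. \<forall>m\<ge>M. \<forall>n\<ge>M. Lp_norm p \<Omega> (\<lambda>x. u (r m) x - u (r n) x) < e"
    using Rellich_compactness[where u = u and R = R, OF lmeasurable_\<Omega> bounded_\<Omega> p1 u R] by blast
  define w where "w n = u (r n)" for n
  have w: "w n \<in> T" for n by (simp add: w_def u)
  note lim_r = LIMSEQ_subseq_LIMSEQ[OF _ r, unfolded o_def]
  obtain M where M: "M \<ge> 0" "\<And>m n. duality_pairing p \<Omega> (grad (w m)) (grad (w m - w n)) - duality_pairing p \<Omega> (grad (w n)) (grad (w m - w n))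
     \<le> M * (\<bar>\<epsilon> (r m)\<bar> + \<bar>\<epsilon> (r n)\<bar> + \<bar>\<sigma> (r m) - \<sigma> (r n)\<bar> + \<bar>\<tau> (r m) - \<tau> (r n)\<bar> + Lp_norm p \<Omega> (\<lambda>x. w m x - w n x))"
    using almost_solutions_gradient_pairing[OF u R a \<tau> eq] unfolding w_def by blast
  have small: "\<exists>k. \<forall>m\<ge>k. \<forall>n\<ge>k. \<bar>\<epsilon> (r m)\<bar> + \<bar>\<epsilon> (r n)\<bar> + \<bar>\<sigma> (r m) - \<sigma> (r n)\<bar> + \<bar>\<tau> (r m) - \<tau> (r n)\<bar>
      + Lp_norm p \<Omega> (\<lambda>x. w m x - w n x) < e" if e: "e > 0" for e
  proof -
    have e5: "e / 5 > 0" using e by simp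
    obtain k1 where k1: "\<forall>n\<ge>k1. norm (\<epsilon> (r n) - 0) < e / 5" using LIMSEQ_D[OF lim_r[OF \<epsilon>] e5] by blast
    obtain k2 where k2: "\<forall>m\<ge>k2. \<forall>n\<ge>k2. norm (\<sigma> (r m) - \<sigma> (r n)) < e / 5"
      using CauchyD[OF LIMSEQ_imp_Cauchy[OF lim_r[OF \<sigma>]] e5] by blast
    obtain k3 where k3: "\<forall>m\<ge>k3. \<forall>n\<ge>k3. norm (\<tau> (r m) - \<tau> (r n)) < e / 5"
      using CauchyD[OF LIMSEQ_imp_Cauchy[OF lim_r[OF \<tau>(1)]] e5] by blast
    obtain k4 where k4: "\<forall>m\<ge>k4. \<forall>n\<ge>k4. Lp_norm p \<Omega> (\<lambda>x. w m x - w n x) < e / 5"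
      using cau[OF e5] unfolding w_def by blast
    show ?thesis
    proof (intro exI[of _ "k1 + k2 + k3 + k4"] allI impI)
      fix m n assume "k1 + k2 + k3 + k4 \<le> m" "k1 + k2 + k3 + k4 \<le> n"
      then have "\<bar>\<epsilon> (r m)\<bar> < e / 5" "\<bar>\<epsilon> (r n)\<bar> < e / 5" "\<bar>\<sigma> (r m) - \<sigma> (r n)\<bar> < e / 5" "\<bar>\<tau> (r m) - \<tau> (r n)\<bar> < e / 5"
        "Lp_norm p \<Omega> (\<lambda>x. w m x - w n x) < e / 5"
        using k1 k2 k3 k4 by auto
      then show "\<bar>\<epsilon> (r m)\<bar> + \<bar>\<epsilon> (r n)\<bar> + \<bar>\<sigma> (r m) - \<sigma> (r n)\<bar> + \<bar>\<tau> (r m) - \<tau> (r n)\<bar>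
        + Lp_norm p \<Omega> (\<lambda>x. w m x - w n x) < e" by linarith
    qed
  qed
  have cau_grad: "\<exists>k. \<forall>m\<ge>k. \<forall>n\<ge>k. Lp_norm p \<Omega> (\<lambda>x. grad (w m) x - grad (w n) x) < e" if e: "e > 0" for e
  proof -
    have e2: "e / 2 > 0" using e by simp
    obtain s where s: "s > 0" "\<And>u v :: 'a \<Rightarrow> 'a. u \<in> Lp_space p \<Omega> \<Longrightarrow> v \<in> Lp_space p \<Omega> \<Longrightarrow>
        Lp_norm p \<Omega> u \<le> R \<Longrightarrow> Lp_norm p \<Omega> v \<le> R \<Longrightarrow>
        duality_pairing p \<Omega> u (\<lambda>x. u x - v x) - duality_pairing p \<Omega> v (\<lambda>x. u x - v x) \<le> s \<Longrightarrow>
        Lp_norm p \<Omega> (\<lambda>x. u x - v x) \<le> e / 2"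
      using duality_pairing_strongly_monotone[OF p1 e2, of \<Omega> R, where 'b='a] by blast
    have sM: "s / (M + 1) > 0" using s(1) M(1) by simp
    obtain k where k: "\<And>m n. m \<ge> k \<Longrightarrow> n \<ge> k \<Longrightarrow> \<bar>\<epsilon> (r m)\<bar> + \<bar>\<epsilon> (r n)\<bar> + \<bar>\<sigma> (r m) - \<sigma> (r n)\<bar> + \<bar>\<tau> (r m) - \<tau> (r n)\<bar>
        + Lp_norm p \<Omega> (\<lambda>x. w m x - w n x) < s / (M + 1)" using small[OF sM] by blast
    have "Lp_norm p \<Omega> (\<lambda>x. grad (w m) x - grad (w n) x) < e" if mn: "m \<ge> k" "n \<ge> k" for m n
    proof -
      have "M * (s / (M + 1)) \<le> s" using M(1) s(1) by (simp add: field_simps)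
      then have "duality_pairing p \<Omega> (grad (w m)) (grad (w m - w n)) - duality_pairing p \<Omega> (grad (w n)) (grad (w m - w n)) \<le> s"
        using M(2)[of m n] mult_left_mono[OF less_imp_le[OF k[OF mn]] M(1)] by linarith
      then have "Lp_norm p \<Omega> (\<lambda>x. grad (w m) x - grad (w n) x) \<le> e / 2"
        using R by (intro s(2) T_Lp w) (auto simp: grad_diff w, auto simp: w_def)
      then show ?thesis using e by simp
    qed
    then show ?thesis by blast
  qed
  obtain v where v: "v \<in> Lp_space p \<Omega>" "(\<lambda>n. Lp_norm p \<Omega> (\<lambda>x. w n x - v x)) \<longlonglongrightarrow> 0"
    using Lp_space_complete[where U = w, OF p1 T_Lp(1)[OF w]] cau unfolding w_def by blast
  obtain g where g: "g \<in> Lp_space p \<Omega>" "(\<lambda>n. Lp_norm p \<Omega> (\<lambda>x. grad (w n) x - g x)) \<longlonglongrightarrow> 0"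
    using Lp_space_complete[where U = "\<lambda>n. grad (w n)", OF p1 T_Lp(2)[OF w]] cau_grad by blast
  note W = W10_I[OF open_\<Omega> lmeasurable_\<Omega> p1 v(1) g(1) w v(2) g(2)]
  have "Lp_norm p \<Omega> (\<lambda>x. grad (w n) x - g x) = Lp_norm p \<Omega> (\<lambda>x. grad (w n) x - weak_grad \<Omega> v x)" for n
  proof (rule Lp_norm_cong_AE)
    show "(\<lambda>x. grad (w n) x - g x) \<in> borel_measurable (lebesgue_on \<Omega>)"
      "(\<lambda>x. grad (w n) x - weak_grad \<Omega> v x) \<in> borel_measurable (lebesgue_on \<Omega>)"
      by (intro Lp_spaceD(1)[OF Lp_diff[OF T_Lp(2)[OF w]]] g W)+
    show "AE x in lebesgue_on \<Omega>. grad (w n) x - g x = grad (w n) x - weak_grad \<Omega> v x"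
      using W(2) by eventually_elim simp
  qed
  then have gv: "(\<lambda>n. Lp_norm p \<Omega> (\<lambda>x. grad (w n) x - weak_grad \<Omega> v x)) \<longlonglongrightarrow> 0" using g(2) by simp
  have onT: "form a' \<tau>' v (weak_grad \<Omega> v) \<phi> (grad \<phi>) = \<sigma>' * f \<phi>" if \<phi>: "\<phi> \<in> T" for \<phi>
  proof -
    have "(\<lambda>n. form (a (r n)) (\<tau> (r n)) (w n) (grad (w n)) \<phi> (grad \<phi>)) \<longlonglongrightarrow> form a' \<tau>' v (weak_grad \<Omega> v) \<phi> (grad \<phi>)"
      by (intro form_tendsto T_Lp w v W(3) gv lim_r a \<tau>(1) \<phi>)
    then have "(\<lambda>n. form (a (r n)) (\<tau> (r n)) (w n) (grad (w n)) \<phi> (grad \<phi>) - \<sigma> (r n) * f \<phi>)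
        \<longlonglongrightarrow> form a' \<tau>' v (weak_grad \<Omega> v) \<phi> (grad \<phi>) - \<sigma>' * f \<phi>"
      by (intro tendsto_intros lim_r \<sigma>)
    moreover have "(\<lambda>n. form (a (r n)) (\<tau> (r n)) (w n) (grad (w n)) \<phi> (grad \<phi>) - \<sigma> (r n) * f \<phi>) \<longlonglongrightarrow> 0"
      by (rule Lim_null_comparison[OF _ tendsto_mult_left_zero[OF lim_r[OF \<epsilon>], of "N \<phi>"]]) (simp add: w_def eq \<phi>)
    ultimately show ?thesis using LIMSEQ_unique by fastforce
  qed
  have "form a' \<tau>' v (weak_grad \<Omega> v) \<phi> (weak_grad \<Omega> \<phi>) = \<sigma>' * f \<phi>" if \<phi>: "\<phi> \<in> W10 p \<Omega>" for \<phi>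
  proof -
    obtain \<psi> where \<psi>: "\<And>n::nat. \<psi> n \<in> T" "(\<lambda>n. Lp_norm p \<Omega> (\<lambda>x. \<psi> n x - \<phi> x)) \<longlonglongrightarrow> 0"
      "(\<lambda>n. Lp_norm p \<Omega> (\<lambda>x. grad (\<psi> n) x - weak_grad \<Omega> \<phi> x)) \<longlonglongrightarrow> 0"
      using W10_D(4)[OF open_\<Omega> lmeasurable_\<Omega> \<phi>] by blast
    have "(\<lambda>n. form a' \<tau>' v (weak_grad \<Omega> v) (\<psi> n) (grad (\<psi> n))) \<longlonglongrightarrow> form a' \<tau>' v (weak_grad \<Omega> v) \<phi> (weak_grad \<Omega> \<phi>)"
      by (intro form_tendsto_right T_Lp \<psi> W10_Lp \<phi> v W)
    moreover have "(\<lambda>n. \<sigma>' * f (\<psi> n)) \<longlonglongrightarrow> \<sigma>' * f \<phi>"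
      by (intro tendsto_intros f_tendsto \<psi> \<phi>)
    ultimately show ?thesis using onT[OF \<psi>(1)] LIMSEQ_unique by simp
  qed
  then show ?thesis using r W(1) v(2) gv unfolding w_def by blast
qed

definition energy :: "real \<Rightarrow> ('a \<Rightarrow> real) \<Rightarrow> real" where
  "energy a u = (N u powr p - a * Lp_norm p \<Omega> u powr p) / p
     + (Lp_norm q \<Omega> (grad u) powr q - \<beta> * Lp_norm q \<Omega> u powr q) / q - f u"

text \<open>In \<open>p E(u) - E'(u) u\<close> the terms of order \<open>p\<close> cancel, and what remains for large \<open>u\<close> is a positive
multiple of \<open>G\<close>, whose sign the hypothesis controls.\<close>
lemma energy_identity:
  "p * energy a u - (form a 1 u (grad u) u (grad u) - f u) =
     (p / q - 1) * (Lp_norm q \<Omega> (grad u) powr q - \<beta> * Lp_norm q \<Omega> u powr q) - (p - 1) * f u"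
  using p0 q0 by (simp add: energy_def form_def duality_pairing_self field_simps)

lemma not_null_if_weak_grad_norm_pos:
  assumes v: "v \<in> W10 p \<Omega>" and pos: "Lp_norm p \<Omega> (weak_grad \<Omega> v) > 0"
  shows "v \<notin> null_functions \<Omega>"
proof
  assume "v \<in> null_functions \<Omega>"
  then have ae: "AE x in lebesgue_on \<Omega>. v x = 0" by (simp add: null_functions_def)
  have z: "(\<lambda>x::'a. 0::real) \<in> Lp_space p \<Omega>" by (simp add: Lp_space_def)
  have z': "(\<lambda>x::'a. 0::'a) \<in> Lp_space p \<Omega>" by (simp add: Lp_space_def)
  have n0: "Lp_norm p \<Omega> (\<lambda>x::'a. 0::'a) = 0" by (simp add: Lp_norm_def)
  have "Lp_norm p \<Omega> (\<lambda>x. 0 - v x) = Lp_norm p \<Omega> (\<lambda>x::'a. 0::real)"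
  proof (rule Lp_norm_cong_AE)
    show "(\<lambda>x. 0 - v x) \<in> borel_measurable (lebesgue_on \<Omega>)"
      by (rule Lp_spaceD(1)[OF Lp_diff[OF z W10_Lp(1)[OF v]]])
    show "AE x in lebesgue_on \<Omega>. 0 - v x = 0" using ae by eventually_elim simp
  qed simp
  then have l: "Lp_norm p \<Omega> (\<lambda>x. 0 - v x) = 0" by (simp add: Lp_norm_def)
  have g0: "grad (\<lambda>_::'a. 0::real) x = 0" for x
    by (rule grad_eqI) simp
  have "AE x in lebesgue_on \<Omega>. weak_grad \<Omega> v x = 0"
    by (rule W10_I(2)[OF open_\<Omega> lmeasurable_\<Omega> p1 W10_Lp(1)[OF v] z' test_function_zero])
      (use l in \<open>simp_all add: g0 n0\<close>)
  then have "Lp_norm p \<Omega> (weak_grad \<Omega> v) = Lp_norm p \<Omega> (\<lambda>x::'a. 0::'a)"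
    by (intro Lp_norm_cong_AE Lp_spaceD(1)[OF W10_Lp(2)[OF v]]) simp_all
  then show False using pos n0 by simp
qed

end

section \<open>Almost critical sequences and regularity of the energy\<close>

context pq_problem
begin

text \<open>The sign condition on \<open>G\<close> excludes unbounded sequences; \<open>\<kappa> = 1\<close> and \<open>\<kappa> = -1\<close> treat both signs at once.
The normalised functions of an unbounded sequence solve the equation with weights tending to \<open>0\<close>, so
they converge to an eigenfunction \<open>w\<close> for \<open>\<alpha>\<close> with \<open>\<parallel>\<nabla>w\<parallel>\<^sub>p = 1\<close>. Dividing the energy identity by
\<open>\<parallel>\<nabla>u\<parallel>\<^sup>q\<close> and using the energy bound, one gets \<open>\<kappa> G(w) \<le> 0\<close> in the limit.\<close>
lemma almost_critical_sequence_solves: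
  assumes G: "\<And>u. u \<in> ES \<Omega> p \<alpha> - null_functions \<Omega> \<Longrightarrow> \<kappa> * G \<Omega> q \<beta> u > 0" and \<kappa>: "\<bar>\<kappa>\<bar> = 1"
    and u: "\<And>n::nat. u n \<in> T" and a: "a \<longlonglongrightarrow> \<alpha>" and \<epsilon>: "\<epsilon> \<longlonglongrightarrow> 0"
    and eq: "\<And>n \<phi>. \<phi> \<in> T \<Longrightarrow> \<bar>form (a n) 1 (u n) (grad (u n)) \<phi> (grad \<phi>) - f \<phi>\<bar> \<le> \<epsilon> n * N \<phi>"
    and B: "\<And>n. \<kappa> * energy (a n) (u n) \<le> B"
  shows "\<exists>v. weak_solution \<Omega> p q \<alpha> \<beta> f v"
proof (cases "\<exists>R. \<forall>n. N (u n) \<le> R")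
  case True
  then obtain R where R: "\<And>n. N (u n) \<le> R" by blast
  have eq1: "\<bar>form (a n) 1 (u n) (grad (u n)) \<phi> (grad \<phi>) - 1 * f \<phi>\<bar> \<le> \<epsilon> n * N \<phi>" if "\<phi> \<in> T" for n \<phi>
    using eq[OF that, of n] by simp
  obtain v where "v \<in> W10 p \<Omega>" "\<forall>\<phi>\<in>W10 p \<Omega>. form \<alpha> 1 v (weak_grad \<Omega> v) \<phi> (weak_grad \<Omega> \<phi>) = 1 * f \<phi>"
    using almost_solutions_converge[where \<tau> = "\<lambda>_. 1" and \<sigma> = "\<lambda>_. 1", OF u R a tendsto_const zero_le_one tendsto_const \<epsilon> eq1] by blast
  then show ?thesis by (intro exI weak_solutionI) auto
next
  case False
  have "\<exists>n\<ge>k. real k + 1 \<le> N (u n)" for k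
  proof (rule ccontr)
    assume "\<not> ?thesis"
    then have k: "\<And>n. n \<ge> k \<Longrightarrow> N (u n) < real k + 1" by (meson not_le)
    have "N (u n) \<le> (real k + 1) + (\<Sum>i<k. N (u i))" for n
    proof (cases "n < k")
      case True
      then have "N (u n) \<le> (\<Sum>i<k. N (u i))" by (intro member_le_sum) (auto simp: Lp_norm_nonneg)
      then show ?thesis by simp
    next
      case False
      then show ?thesis using k[of n] sum_nonneg[of "{..<k}" "\<lambda>i. N (u i)"] by (simp add: Lp_norm_nonneg)
    qed
    then show False using False by blast
  qed
  then obtain r where r: "\<And>k. r k \<ge> k" "\<And>k. real k + 1 \<le> N (u (r k))" by metis
  have r_lim: "filterlim r at_top sequentially"
    by (rule filterlim_at_top_mono[OF filterlim_ident]) (simp add: r)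
  define c where "c k = 1 / N (u (r k))" for k
  have Npos: "N (u (r k)) > 0" for k using r(2)[of k] by linarith
  have c0: "c k > 0" for k using Npos[of k] by (simp add: c_def)
  have c1: "c k \<le> 1" for k using r(2)[of k] Npos[of k] by (simp add: c_def)
  have c_lim: "c \<longlonglongrightarrow> 0"
  proof (rule Lim_null_comparison[OF _ LIMSEQ_inverse_real_of_nat])
    show "\<forall>\<^sub>F k in sequentially. norm (c k) \<le> inverse (real (Suc k))"
      using r(2) Npos c0 by (intro always_eventually allI) (simp add: c_def inverse_eq_divide frac_le add.commute less_imp_le)
  qed
  have c_powr: "(\<lambda>k. c k powr e) \<longlonglongrightarrow> 0" if "e > 0" for e
    by (rule tendsto_zero_powrI[OF c_lim tendsto_const _ that]) (simp add: c0 less_imp_le)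
  define v where "v k = c k *\<^sub>R u (r k)" for k
  have v: "v k \<in> T" for k unfolding v_def by (intro T_scale u)
  have Nv: "N (v k) = 1" for k
    unfolding v_def N_scale[OF u] using c0[of k] Npos[of k] by (simp add: c_def)
  have v_fun: "v k = (\<lambda>x. c k * u (r k) x)" "grad (v k) = (\<lambda>x. c k *\<^sub>R grad (u (r k)) x)" for k
    unfolding v_def using grad_scale[OF u] by (simp_all add: fun_eq_iff)
  have eqv: "\<bar>form (a (r k)) (c k powr (p - q)) (v k) (grad (v k)) \<phi> (grad \<phi>) - c k powr (p - 1) * f \<phi>\<bar> \<le> \<bar>\<epsilon> (r k)\<bar> * N \<phi>"
    if \<phi>: "\<phi> \<in> T" for k \<phi>
  proof -
    have "\<bar>form (a (r k)) (c k powr (p - q)) (v k) (grad (v k)) \<phi> (grad \<phi>) - c k powr (p - 1) * f \<phi>\<bar>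
      = c k powr (p - 1) * \<bar>form (a (r k)) 1 (u (r k)) (grad (u (r k))) \<phi> (grad \<phi>) - f \<phi>\<bar>"
      unfolding v_fun(2) unfolding v_fun(1) form_scale[OF c0] by (simp add: abs_mult flip: right_diff_distrib)
    also have "\<dots> \<le> 1 * (\<bar>\<epsilon> (r k)\<bar> * N \<phi>)"
    proof (rule mult_mono)
      show "c k powr (p - 1) \<le> 1" using c0[of k] c1[of k] p1 by (intro powr_le1) auto
      show "\<bar>form (a (r k)) 1 (u (r k)) (grad (u (r k))) \<phi> (grad \<phi>) - f \<phi>\<bar> \<le> \<bar>\<epsilon> (r k)\<bar> * N \<phi>"
        by (rule order_trans[OF eq[OF \<phi>] mult_right_mono]) (simp_all add: Lp_norm_nonneg)
    qed auto
    finally show ?thesis by simp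
  qed
  note lim_r = filterlim_compose[OF _ r_lim]
  have \<epsilon>r: "(\<lambda>k. \<bar>\<epsilon> (r k)\<bar>) \<longlonglongrightarrow> 0" by (rule tendsto_rabs_zero[OF lim_r[OF \<epsilon>]])
  have pq: "p - q > 0" "p - 1 > 0" "q - 1 > 0" using q1 qp by auto
  obtain s w where s: "strict_mono (s :: nat \<Rightarrow> nat)" and w: "w \<in> W10 p \<Omega>"
    "(\<lambda>n. Lp_norm p \<Omega> (\<lambda>x. v (s n) x - w x)) \<longlonglongrightarrow> 0"
    "(\<lambda>n. Lp_norm p \<Omega> (\<lambda>x. grad (v (s n)) x - weak_grad \<Omega> w x)) \<longlonglongrightarrow> 0"
    "\<forall>\<phi>\<in>W10 p \<Omega>. form \<alpha> 0 w (weak_grad \<Omega> w) \<phi> (weak_grad \<Omega> \<phi>) = 0 * f \<phi>"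
    using almost_solutions_converge[where u = v and R = 1, OF v eq_refl[OF Nv] lim_r[OF a] c_powr[OF pq(1)] powr_ge_zero c_powr[OF pq(2)] \<epsilon>r eqv]
    by blast
  have wES: "w \<in> ES \<Omega> p \<alpha>" by (rule ES_I) (use w in auto)
  have "(\<lambda>n. N (v (s n))) \<longlonglongrightarrow> Lp_norm p \<Omega> (weak_grad \<Omega> w)"
    by (intro Lp_norm_tendsto p1 T_Lp v W10_Lp w)
  then have "Lp_norm p \<Omega> (weak_grad \<Omega> w) = 1" unfolding Nv using LIMSEQ_unique tendsto_const by blast
  then have "w \<notin> null_functions \<Omega>" using not_null_if_weak_grad_norm_pos[OF w(1)] by simp
  then have pos: "\<kappa> * G \<Omega> q \<beta> w > 0" using G wES by blast
  define H where "H z = Lp_norm q \<Omega> (grad z) powr q - \<beta> * Lp_norm q \<Omega> z powr q" for z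
  have "(\<lambda>n. H (v (s n))) \<longlonglongrightarrow> G \<Omega> q \<beta> w"
    unfolding H_def G_def
    by (intro tendsto_diff tendsto_mult tendsto_const tendsto_powr2 always_eventually allI Lp_norm_nonneg q0
        Lp_norm_tendsto[OF q1] Lp_Lq T_Lp v W10_Lp w(1) Lp_null_imp_Lq_null Lp_diff w(2,3))
  then have H_lim: "(\<lambda>n. \<kappa> * (p / q - 1) * H (v (s n))) \<longlonglongrightarrow> \<kappa> * (p / q - 1) * G \<Omega> q \<beta> w"
    by (intro tendsto_intros)
  obtain K where K: "K > 0" "\<And>u. u \<in> T \<Longrightarrow> \<bar>f u\<bar> \<le> K * N u" using embedding_constants by metis
  have bound: "\<kappa> * (p / q - 1) * H (v k) \<le> c k powr q * (p * \<bar>B\<bar>) + c k powr (q - 1) * (\<bar>\<epsilon> (r k)\<bar> + (p - 1) * K)" for k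
  proof -
    define z where "z = u (r k)"
    have z: "z \<in> T" by (simp add: z_def u)
    define y where "y = form (a (r k)) 1 z (grad z) z (grad z) - f z"
    have Hz: "H (v k) = c k powr q * H z"
      unfolding H_def v_fun(2) unfolding v_fun(1) z_def using Lp_norm_scale[OF q0, of \<Omega> "c k" z] Lp_norm_scale[OF q0, of \<Omega> "c k" "grad z"] c0[of k]
      by (simp add: z_def powr_mult Lp_norm_nonneg algebra_simps)
    have "\<bar>y\<bar> \<le> \<bar>\<epsilon> (r k)\<bar> * N z"
      unfolding y_def using eq[OF z, of "r k"] mult_right_mono[OF abs_ge_self Lp_norm_nonneg, of "\<epsilon> (r k)" p \<Omega> "grad z"]
      by (simp add: z_def)
    then have y: "- (\<kappa> * y) \<le> \<bar>\<epsilon> (r k)\<bar> * N z" using \<kappa> by (simp add: abs_if split: if_splits)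
    have "(p - 1) * \<bar>f z\<bar> \<le> (p - 1) * (K * N z)" using K(2)[OF z] p1 by (intro mult_left_mono) auto
    moreover have "\<kappa> * ((p - 1) * f z) \<le> (p - 1) * \<bar>f z\<bar>"
      using \<kappa> p1 by (auto simp: abs_if mult_le_0_iff split: if_splits)
    ultimately have fz: "\<kappa> * ((p - 1) * f z) \<le> (p - 1) * (K * N z)" by linarith
    have E: "p * (\<kappa> * energy (a (r k)) z) \<le> p * \<bar>B\<bar>"
      using B[of "r k"] p0 unfolding z_def by (intro mult_left_mono) auto
    have "\<kappa> * (p / q - 1) * H z = p * (\<kappa> * energy (a (r k)) z) - \<kappa> * y + \<kappa> * ((p - 1) * f z)"
      using arg_cong[OF energy_identity[of "a (r k)" z], of "\<lambda>x. \<kappa> * x"] by (simp add: H_def y_def algebra_simps)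
    also have "\<dots> \<le> p * \<bar>B\<bar> + \<bar>\<epsilon> (r k)\<bar> * N z + (p - 1) * (K * N z)" using E y fz by linarith
    also have "\<dots> = p * \<bar>B\<bar> + N z * (\<bar>\<epsilon> (r k)\<bar> + (p - 1) * K)" by (simp add: algebra_simps)
    finally have "c k powr q * (\<kappa> * (p / q - 1) * H z) \<le> c k powr q * (p * \<bar>B\<bar> + N z * (\<bar>\<epsilon> (r k)\<bar> + (p - 1) * K))"
      by (rule mult_left_mono) simp
    moreover have "c k powr q * N z = c k powr (q - 1)"
      using c0[of k] Npos[of k] by (simp add: c_def z_def powr_diff)
    moreover have "c k powr q * (p * \<bar>B\<bar> + N z * (\<bar>\<epsilon> (r k)\<bar> + (p - 1) * K))
        = c k powr q * (p * \<bar>B\<bar>) + (c k powr q * N z) * (\<bar>\<epsilon> (r k)\<bar> + (p - 1) * K)" by (simp only: distrib_left mult.assoc)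
    moreover have "\<kappa> * (p / q - 1) * H (v k) = c k powr q * (\<kappa> * (p / q - 1) * H z)"
      unfolding Hz by (simp only: mult.left_commute)
    ultimately show ?thesis by (simp only:)
  qed
  have "(\<lambda>n. c (s n) powr q * (p * \<bar>B\<bar>) + c (s n) powr (q - 1) * (\<bar>\<epsilon> (r (s n))\<bar> + (p - 1) * K))
      \<longlonglongrightarrow> 0 * (p * \<bar>B\<bar>) + 0 * (0 + (p - 1) * K)"
    by (intro tendsto_intros LIMSEQ_subseq_LIMSEQ[OF _ s, unfolded o_def] c_powr q0 pq \<epsilon>r)
  then have "\<kappa> * (p / q - 1) * G \<Omega> q \<beta> w \<le> 0"
    using LIMSEQ_le[OF H_lim] bound by fastforce
  moreover have "\<kappa> * (p / q - 1) * G \<Omega> q \<beta> w = (p / q - 1) * (\<kappa> * G \<Omega> q \<beta> w)" by simp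
  moreover have "p / q - 1 > 0" using q1 qp by simp
  ultimately show ?thesis using mult_pos_pos[of "p / q - 1", OF _ pos] by linarith
qed

text \<open>The four terms of the energy have this form, with \<open>L\<close> the gradient or the identity.\<close>
lemma C1_Lp_norm_powr:
  fixes L :: "('a \<Rightarrow> real) \<Rightarrow> 'a \<Rightarrow> 'b::euclidean_space"
  assumes r: "r > 1" and L: "\<And>u. u \<in> T \<Longrightarrow> L u \<in> Lp_space r \<Omega>"
    and diff: "\<And>u v. u \<in> T \<Longrightarrow> v \<in> T \<Longrightarrow> L (u - v) = (\<lambda>x. L u x - L v x)"
    and bd: "\<And>u. u \<in> T \<Longrightarrow> Lp_norm r \<Omega> (L u) \<le> K * N u" and K: "K > 0" and \<eta>: "\<eta> > 0"
  shows "\<exists>s>0. \<forall>u\<in>T. \<forall>v\<in>T. N u \<le> R \<longrightarrow> N (v - u) \<le> s \<longrightarrow>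
    \<bar>Lp_norm r \<Omega> (L v) powr r / r - Lp_norm r \<Omega> (L u) powr r / r - duality_pairing r \<Omega> (L u) (L (v - u))\<bar> \<le> \<eta> * N (v - u) \<and>
    (\<forall>w\<in>T. \<bar>duality_pairing r \<Omega> (L v) (L w) - duality_pairing r \<Omega> (L u) (L w)\<bar> \<le> \<eta> * N w)"
proof -
  have \<eta>K: "\<eta> / K > 0" using \<eta> K by simp
  obtain s where s: "s > 0" "\<And>u v w :: 'a \<Rightarrow> 'b. u \<in> Lp_space r \<Omega> \<Longrightarrow> v \<in> Lp_space r \<Omega> \<Longrightarrow> w \<in> Lp_space r \<Omega> \<Longrightarrow>
      Lp_norm r \<Omega> u \<le> K * R \<Longrightarrow> Lp_norm r \<Omega> (\<lambda>x. v x - u x) \<le> s \<Longrightarrow>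
      \<bar>duality_pairing r \<Omega> v w - duality_pairing r \<Omega> u w\<bar> \<le> (\<eta> / K) * Lp_norm r \<Omega> w"
    using duality_pairing_uniformly_continuous[OF r \<eta>K, of \<Omega> "K * R", where 'b='b] by blast
  show ?thesis
  proof (intro exI[of _ "s / K"] conjI ballI impI)
    show "s / K > 0" using s(1) K by simp
    fix u v assume u: "u \<in> T" and v: "v \<in> T" and R: "N u \<le> R" and d: "N (v - u) \<le> s / K"
    have Lu: "Lp_norm r \<Omega> (L u) \<le> K * R" using bd[OF u] mult_left_mono[OF R less_imp_le[OF K]] by linarith
    have "K * N (v - u) \<le> s" using d K by (simp add: field_simps)
    then have Ld: "Lp_norm r \<Omega> (\<lambda>x. L v x - L u x) \<le> s"
      using bd[OF T_diff[OF v u]] by (simp add: diff[OF v u])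
    show all: "\<bar>duality_pairing r \<Omega> (L v) (L w) - duality_pairing r \<Omega> (L u) (L w)\<bar> \<le> \<eta> * N w" if w: "w \<in> T" for w
    proof -
      have "(\<eta> / K) * Lp_norm r \<Omega> (L w) \<le> (\<eta> / K) * (K * N w)" using \<eta>K by (intro mult_left_mono bd w) simp
      then show ?thesis using s(2)[OF L[OF u] L[OF v] L[OF w] Lu Ld] K by simp
    qed
    have "\<bar>Lp_norm r \<Omega> (L v) powr r - Lp_norm r \<Omega> (L u) powr r - r * duality_pairing r \<Omega> (L u) (L (v - u))\<bar> \<le> r * (\<eta> * N (v - u))"
      using order_trans[OF Lp_norm_powr_derivative[OF r L[OF u] L[OF v]] mult_left_mono[OF all[OF T_diff[OF v u], unfolded diff[OF v u]]]] r
      unfolding diff[OF v u] by simp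
    moreover have "Lp_norm r \<Omega> (L v) powr r - Lp_norm r \<Omega> (L u) powr r - r * duality_pairing r \<Omega> (L u) (L (v - u))
      = r * (Lp_norm r \<Omega> (L v) powr r / r - Lp_norm r \<Omega> (L u) powr r / r - duality_pairing r \<Omega> (L u) (L (v - u)))"
      using r by (simp add: field_simps)
    ultimately show "\<bar>Lp_norm r \<Omega> (L v) powr r / r - Lp_norm r \<Omega> (L u) powr r / r - duality_pairing r \<Omega> (L u) (L (v - u))\<bar> \<le> \<eta> * N (v - u)"
      using r by (simp add: abs_mult)
  qed
qed

lemma C1_energy: "C1_functional T N (energy a) (\<lambda>u \<phi>. form a 1 u (grad u) \<phi> (grad \<phi>) - f \<phi>)"
proof unfold_locales
  obtain K where K: "K > 0" "\<And>u. u \<in> T \<Longrightarrow> Lp_norm p \<Omega> u \<le> K * N u" "\<And>u. u \<in> T \<Longrightarrow> Lp_norm q \<Omega> u \<le> K * N u"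
    "\<And>u. u \<in> T \<Longrightarrow> Lp_norm q \<Omega> (grad u) \<le> K * N u" "\<And>u. u \<in> T \<Longrightarrow> \<bar>f u\<bar> \<le> K * N u"
    using embedding_constants by metis
  let ?D = "\<lambda>u \<phi>. form a 1 u (grad u) \<phi> (grad \<phi>) - f \<phi>"
  show add: "?D u (v + w) = ?D u v + ?D u w" if "u \<in> T" "v \<in> T" "w \<in> T" for u v w
    unfolding form_def grad_plus[OF that(2,3)] f_add[OF that(2,3)] unfolding plus_fun_def
    by (simp add: duality_pairing_add p1 q1 T_Lp that algebra_simps)
  show "?D u (c *\<^sub>R v) = c * ?D u v" if "u \<in> T" "v \<in> T" for u v c
    unfolding form_def grad_scale[OF that(2)] f_scale[OF that(2)] unfolding scaleR_fun_def duality_pairing_scale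
    by (simp add: algebra_simps)
  show "\<exists>C. \<forall>v\<in>T. \<bar>?D u v\<bar> \<le> C * N v" if u: "u \<in> T" for u
  proof -
    obtain c where c: "c \<ge> 0" "\<And>d. d \<in> T \<Longrightarrow> \<bar>duality_pairing p \<Omega> u d\<bar> \<le> c * Lp_norm p \<Omega> d"
       "\<And>d. d \<in> T \<Longrightarrow> \<bar>duality_pairing q \<Omega> u d\<bar> \<le> c * Lp_norm p \<Omega> d"
       "\<And>d. d \<in> T \<Longrightarrow> \<bar>duality_pairing q \<Omega> (grad u) (grad d)\<bar> \<le> c * N d"
      using pairings_bounded_by_Lp_norm[of "N u"] u by blast
    show ?thesis
    proof (intro exI[of _ "N u powr (p - 1) + \<bar>a\<bar> * (c * K) + c + \<bar>\<beta>\<bar> * (c * K) + K"] ballI)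
      fix v assume v: "v \<in> T"
      have cK: "c * Lp_norm p \<Omega> v \<le> c * K * N v" using mult_left_mono[OF K(2)[OF v] c(1)] by (simp add: mult.assoc)
      have 1: "\<bar>duality_pairing p \<Omega> (grad u) (grad v)\<bar> \<le> N u powr (p - 1) * N v"
        by (intro duality_pairing_Holder p1 T_Lp u v)
      have 2: "\<bar>a * duality_pairing p \<Omega> u v\<bar> \<le> \<bar>a\<bar> * (c * K * N v)"
        unfolding abs_mult by (rule mult_left_mono[OF order_trans[OF c(2)[OF v] cK]]) simp
      have 3: "\<bar>\<beta> * duality_pairing q \<Omega> u v\<bar> \<le> \<bar>\<beta>\<bar> * (c * K * N v)"
        unfolding abs_mult by (rule mult_left_mono[OF order_trans[OF c(3)[OF v] cK]]) simp
      show "\<bar>?D u v\<bar> \<le> (N u powr (p - 1) + \<bar>a\<bar> * (c * K) + c + \<bar>\<beta>\<bar> * (c * K) + K) * N v"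
        using 1 2 3 c(4)[OF v] K(5)[OF v] unfolding form_def distrib_right abs_le_iff mult.assoc mult_1_left by linarith
    qed
  qed
  fix \<eta> R :: real assume \<eta>: "\<eta> > 0"
  \<comment> \<open>The four terms enter with coefficients \<open>1, a, 1, \<beta>\<close>.\<close>
  define \<delta> where "\<delta> = \<eta> / (2 + \<bar>a\<bar> + \<bar>\<beta>\<bar>)"
  have den: "2 + \<bar>a\<bar> + \<bar>\<beta>\<bar> > 0" by (simp add: add_pos_nonneg)
  have \<delta>: "\<delta> > 0" using \<eta> den by (simp add: \<delta>_def)
  have \<delta>_sum: "\<delta> * x + \<bar>a\<bar> * (\<delta> * x) + (\<delta> * x + \<bar>\<beta>\<bar> * (\<delta> * x)) = \<eta> * x" for x
  proof -
    have "\<delta> * x + \<bar>a\<bar> * (\<delta> * x) + (\<delta> * x + \<bar>\<beta>\<bar> * (\<delta> * x)) = (\<delta> * (2 + \<bar>a\<bar> + \<bar>\<beta>\<bar>)) * x" by (simp add: algebra_simps)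
    also have "\<delta> * (2 + \<bar>a\<bar> + \<bar>\<beta>\<bar>) = \<eta>" using den by (simp add: \<delta>_def)
    finally show ?thesis .
  qed
  let ?X = "\<lambda>r (L :: ('a \<Rightarrow> real) \<Rightarrow> 'a \<Rightarrow> real) u v. \<bar>Lp_norm r \<Omega> (L v) powr r / r - Lp_norm r \<Omega> (L u) powr r / r - duality_pairing r \<Omega> (L u) (L (v - u))\<bar> \<le> \<delta> * N (v - u) \<and>
    (\<forall>w\<in>T. \<bar>duality_pairing r \<Omega> (L v) (L w) - duality_pairing r \<Omega> (L u) (L w)\<bar> \<le> \<delta> * N w)"
  let ?Y = "\<lambda>r (L :: ('a \<Rightarrow> real) \<Rightarrow> 'a \<Rightarrow> 'a) u v. \<bar>Lp_norm r \<Omega> (L v) powr r / r - Lp_norm r \<Omega> (L u) powr r / r - duality_pairing r \<Omega> (L u) (L (v - u))\<bar> \<le> \<delta> * N (v - u) \<and>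
    (\<forall>w\<in>T. \<bar>duality_pairing r \<Omega> (L v) (L w) - duality_pairing r \<Omega> (L u) (L w)\<bar> \<le> \<delta> * N w)"
  have "\<exists>s>0. \<forall>u\<in>T. \<forall>v\<in>T. N u \<le> R \<longrightarrow> N (v - u) \<le> s \<longrightarrow> ?Y p grad u v"
    by (rule C1_Lp_norm_powr[where K = 1]) (simp_all add: p1 T_Lp grad_diff \<delta>)
  then obtain s1 where s1: "s1 > 0" "\<And>u v. u \<in> T \<Longrightarrow> v \<in> T \<Longrightarrow> N u \<le> R \<Longrightarrow> N (v - u) \<le> s1 \<Longrightarrow> ?Y p grad u v" by blast
  have "\<exists>s>0. \<forall>u\<in>T. \<forall>v\<in>T. N u \<le> R \<longrightarrow> N (v - u) \<le> s \<longrightarrow> ?X p (\<lambda>u. u) u v"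
    by (rule C1_Lp_norm_powr[where K = K]) (simp_all add: p1 T_Lp minus_fun_eq \<delta> K)
  then obtain s2 where s2: "s2 > 0" "\<And>u v. u \<in> T \<Longrightarrow> v \<in> T \<Longrightarrow> N u \<le> R \<Longrightarrow> N (v - u) \<le> s2 \<Longrightarrow> ?X p (\<lambda>u. u) u v" by blast
  have "\<exists>s>0. \<forall>u\<in>T. \<forall>v\<in>T. N u \<le> R \<longrightarrow> N (v - u) \<le> s \<longrightarrow> ?Y q grad u v"
    by (rule C1_Lp_norm_powr[where K = K]) (simp_all add: q1 T_Lp grad_diff \<delta> K)
  then obtain s3 where s3: "s3 > 0" "\<And>u v. u \<in> T \<Longrightarrow> v \<in> T \<Longrightarrow> N u \<le> R \<Longrightarrow> N (v - u) \<le> s3 \<Longrightarrow> ?Y q grad u v" by blast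
  have "\<exists>s>0. \<forall>u\<in>T. \<forall>v\<in>T. N u \<le> R \<longrightarrow> N (v - u) \<le> s \<longrightarrow> ?X q (\<lambda>u. u) u v"
    by (rule C1_Lp_norm_powr[where K = K]) (simp_all add: q1 T_Lp minus_fun_eq \<delta> K)
  then obtain s4 where s4: "s4 > 0" "\<And>u v. u \<in> T \<Longrightarrow> v \<in> T \<Longrightarrow> N u \<le> R \<Longrightarrow> N (v - u) \<le> s4 \<Longrightarrow> ?X q (\<lambda>u. u) u v" by blast
  have four: "\<bar>x1 - a * x2 + (x3 - \<beta> * x4)\<bar> \<le> \<eta> * x" if "\<bar>x1\<bar> \<le> \<delta> * x" "\<bar>x2\<bar> \<le> \<delta> * x" "\<bar>x3\<bar> \<le> \<delta> * x" "\<bar>x4\<bar> \<le> \<delta> * x" for x x1 x2 x3 x4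
  proof -
    have "\<bar>a * x2\<bar> \<le> \<bar>a\<bar> * (\<delta> * x)" "\<bar>\<beta> * x4\<bar> \<le> \<bar>\<beta>\<bar> * (\<delta> * x)"
      unfolding abs_mult by (intro mult_left_mono that abs_ge_zero)+
    then show ?thesis using that(1,3) \<delta>_sum[of x] by linarith
  qed
  show "\<exists>s>0. \<forall>u\<in>T. \<forall>v\<in>T. N u \<le> R \<longrightarrow> N (v - u) \<le> s \<longrightarrow>
      \<bar>energy a v - energy a u - ?D u (v - u)\<bar> \<le> \<eta> * N (v - u) \<and> (\<forall>w\<in>T. \<bar>?D v w - ?D u w\<bar> \<le> \<eta> * N w)"
  proof (intro exI[of _ "min (min s1 s2) (min s3 s4)"] conjI ballI impI)
    show "0 < min (min s1 s2) (min s3 s4)" using s1 s2 s3 s4 by simp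
    fix u v assume u: "u \<in> T" and v: "v \<in> T" and R: "N u \<le> R" and d: "N (v - u) \<le> min (min s1 s2) (min s3 s4)"
    have d': "N (v - u) \<le> s1" "N (v - u) \<le> s2" "N (v - u) \<le> s3" "N (v - u) \<le> s4" using d by auto
    note S = s1(2)[OF u v R d'(1)] s2(2)[OF u v R d'(2)] s3(2)[OF u v R d'(3)] s4(2)[OF u v R d'(4)]
    have e: "energy a v - energy a u - ?D u (v - u) =
        (N v powr p / p - N u powr p / p - duality_pairing p \<Omega> (grad u) (grad (v - u)))
      - a * (Lp_norm p \<Omega> v powr p / p - Lp_norm p \<Omega> u powr p / p - duality_pairing p \<Omega> u (v - u))
      + ((Lp_norm q \<Omega> (grad v) powr q / q - Lp_norm q \<Omega> (grad u) powr q / q - duality_pairing q \<Omega> (grad u) (grad (v - u)))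
      - \<beta> * (Lp_norm q \<Omega> v powr q / q - Lp_norm q \<Omega> u powr q / q - duality_pairing q \<Omega> u (v - u)))"
      by (simp add: energy_def form_def f_minus[OF v u] diff_divide_distrib algebra_simps)
    show "\<bar>energy a v - energy a u - ?D u (v - u)\<bar> \<le> \<eta> * N (v - u)"
      unfolding e by (intro four) (use S in blast)+
    fix w assume w: "w \<in> T"
    have e: "?D v w - ?D u w = (duality_pairing p \<Omega> (grad v) (grad w) - duality_pairing p \<Omega> (grad u) (grad w))
      - a * (duality_pairing p \<Omega> v w - duality_pairing p \<Omega> u w)
      + ((duality_pairing q \<Omega> (grad v) (grad w) - duality_pairing q \<Omega> (grad u) (grad w))
      - \<beta> * (duality_pairing q \<Omega> v w - duality_pairing q \<Omega> u w))"
      by (simp add: form_def algebra_simps)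
    show "\<bar>?D v w - ?D u w\<bar> \<le> \<eta> * N w"
      unfolding e by (intro four) (use S w in blast)+
  qed
qed

end

section \<open>Cones and their index\<close>

context pq_problem
begin

text \<open>The functions whose Rayleigh quotient for the \<open>p\<close>-Laplacian is below \<open>\<Lambda>\<close>. The leading part
\<open>\<parallel>\<nabla>u\<parallel>\<^sup>p - a \<parallel>u\<parallel>\<^sup>p\<close> of the energy is negative definite on the cone of a level below \<open>a\<close>, and positive
definite outside the cone of a level above \<open>a\<close>.\<close>
definition eigencone :: "real \<Rightarrow> ('a \<Rightarrow> real) set" where
  "eigencone \<Lambda> = {u \<in> T. N u powr p < \<Lambda> * Lp_norm p \<Omega> u powr p}"

text \<open>For \<open>k = 0\<close> the sphere is empty, so the property holds for every cone, even an empty one.\<close>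
definition has_index :: "real \<Rightarrow> nat \<Rightarrow> bool" where
  "has_index \<Lambda> k \<longleftrightarrow> (\<exists>h. odd_sphere_map k (eigencone \<Lambda>) h)"

lemma eigencone_mono: "\<Lambda> \<le> \<Lambda>' \<Longrightarrow> eigencone \<Lambda> \<subseteq> eigencone \<Lambda>'"
  unfolding eigencone_def using mult_right_mono[of \<Lambda> \<Lambda>'] by (fastforce intro: less_le_trans)

lemma eigencone_scale:
  assumes "u \<in> eigencone \<Lambda>" "c \<noteq> 0"
  shows "c *\<^sub>R u \<in> eigencone \<Lambda>"
proof -
  have u: "u \<in> T" and lt: "N u powr p < \<Lambda> * Lp_norm p \<Omega> u powr p" using assms by (auto simp: eigencone_def)
  have "Lp_norm p \<Omega> (c *\<^sub>R u) = \<bar>c\<bar> * Lp_norm p \<Omega> u"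
    using Lp_norm_scale[OF p0, of \<Omega> c u] by (simp add: scaleR_fun_def[of c u])
  moreover have "\<bar>c\<bar> powr p * (N u powr p) < \<bar>c\<bar> powr p * (\<Lambda> * Lp_norm p \<Omega> u powr p)"
    using lt assms(2) by (intro mult_strict_left_mono) auto
  ultimately show ?thesis
    using u by (auto simp: eigencone_def T_scale N_scale powr_mult Lp_norm_nonneg mult.left_commute)
qed

lemma eigencone_uminus: "u \<in> eigencone \<Lambda> \<Longrightarrow> - u \<in> eigencone \<Lambda>"
  using eigencone_scale[of u \<Lambda> "-1"] by simp

lemma eigencone_N_pos:
  assumes "u \<in> eigencone \<Lambda>"
  shows "N u > 0"
proof (rule ccontr)
  assume "\<not> N u > 0"
  then have 0: "N u = 0" using Lp_norm_nonneg[of p \<Omega> "grad u"] by linarith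
  obtain K where "\<And>u. u \<in> T \<Longrightarrow> Lp_norm p \<Omega> u \<le> K * N u" using embedding_constants by metis
  from this[of u] have "Lp_norm p \<Omega> u = 0" using assms 0 Lp_norm_nonneg[of p \<Omega> u] by (auto simp: eigencone_def)
  then show False using assms 0 p0 by (simp add: eigencone_def)
qed

lemma has_index_0: "has_index \<Lambda> 0"
  unfolding has_index_def odd_sphere_map_def ncontinuous_on_def by (auto simp: sphere_nat_def)

lemma has_index_mono: "has_index \<Lambda> k \<Longrightarrow> \<Lambda> \<le> \<Lambda>' \<Longrightarrow> has_index \<Lambda>' k"
  unfolding has_index_def odd_sphere_map_def using eigencone_mono by blast

text \<open>In a cone the \<open>L\<^sup>p\<close> norm controls the gradient, so by the estimate by averages no function of the cone
has vanishing integrals over all cubes of a fine mesh. By the Borsuk-Ulam theorem an odd map from a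
sphere whose dimension is at least the number of cubes would hit such a function.\<close>
lemma has_index_bounded: "\<exists>m. \<forall>k. has_index \<Lambda> k \<longrightarrow> k \<le> m"
proof -
  \<comment> \<open>Small enough for \<open>\<bar>\<Lambda>\<bar> \<epsilon> \<le> 1\<close>.\<close>
  define \<epsilon> where "\<epsilon> = 1 / (2 * (\<bar>\<Lambda>\<bar> + 1))"
  have \<epsilon>: "\<epsilon> > 0" by (simp add: \<epsilon>_def)
  obtain \<Q> C where \<Q>: "finite \<Q>" "\<Q> \<subseteq> sets borel" and C: "C \<ge> 0" "\<And>\<phi>. \<phi> \<in> T \<Longrightarrow>
     Lp_norm p \<Omega> \<phi> powr p \<le> \<epsilon> * N \<phi> powr p + C * (\<Sum>Q\<in>\<Q>. \<bar>LINT x:Q|lborel. \<phi> x\<bar> powr p)"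
    using Lp_norm_le_gradient_and_averages[OF sets_\<Omega> bounded_\<Omega> p1 \<epsilon>] by blast
  obtain B where B: "bij_betw B {..<card \<Q>} \<Q>" using ex_bij_betw_nat_finite[OF \<Q>(1)] by (auto simp: atLeast0LessThan)
  obtain K where K: "\<And>Q \<phi>. Q \<in> sets borel \<Longrightarrow> \<phi> \<in> T \<Longrightarrow> \<bar>LINT x:Q|lborel. \<phi> x\<bar> \<le> K * N \<phi>"
    using set_integral_test_function(1)[OF lmeasurable_\<Omega> p1 bounded_\<Omega>] by blast
  have "k \<le> card \<Q>" if idx: "has_index \<Lambda> k" for k
  proof (rule ccontr)
    assume gt: "\<not> k \<le> card \<Q>"
    define l where "l = k - 1"
    have k: "k = Suc l" and l: "card \<Q> \<le> l" using gt unfolding l_def by linarith+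
    obtain h where "odd_sphere_map (Suc l) (eigencone \<Lambda>) h" using idx unfolding has_index_def k by blast
    then have h: "ncontinuous_on (sphere_nat (Suc l)) h" "\<And>x. x \<in> sphere_nat (Suc l) \<Longrightarrow> h x \<in> eigencone \<Lambda>"
      "\<And>x. x \<in> sphere_nat (Suc l) \<Longrightarrow> h (\<lambda>i. - x i) = - h x"
      by (auto simp: odd_sphere_map_def)
    \<comment> \<open>Padded with zeros up to the dimension of the sphere.\<close>
    define g where "g j x = (if j < card \<Q> then LINT y:B j|lborel. h x y else 0)" for j x
    have Bj: "B j \<in> sets borel" if "j < card \<Q>" for j
      using B \<Q>(2) that bij_betwE by blast
    have "\<exists>x\<in>sphere_nat (Suc l). \<forall>j<l. g j x = 0"
    proof (rule Borsuk_Ulam_sphere_nat)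
      fix j assume "j < l"
      show "continuous_on (sphere_nat (Suc l)) (g j)"
      proof (cases "j < card \<Q>")
        case True
        have "ncontinuous (\<lambda>u. LINT y:B j|lborel. u y)"
          by (rule ncontinuous_linear[where C = K])
            (use set_integral_test_function(2)[OF lmeasurable_\<Omega> p1 bounded_\<Omega> Bj[OF True]] K[OF Bj[OF True]] in auto)
        then show ?thesis using continuous_on_ncontinuous[OF _ h(1)] True by (simp add: g_def)
      qed (simp add: g_def)
      fix x assume x: "x \<in> sphere_nat (Suc l)"
      show "g j (\<lambda>i. - x i) = - g j x"
        using h(3)[OF x] by (simp add: g_def set_lebesgue_integral_def)
    qed
    then obtain x where x: "x \<in> sphere_nat (Suc l)" and 0: "\<And>j. j < l \<Longrightarrow> g j x = 0" by blast
    have hx: "h x \<in> T" "N (h x) powr p < \<Lambda> * Lp_norm p \<Omega> (h x) powr p" using h(2)[OF x] by (auto simp: eigencone_def)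
    have "(LINT y:Q|lborel. h x y) = 0" if Q: "Q \<in> \<Q>" for Q
    proof -
      have "Q \<in> B ` {..<card \<Q>}" using Q B by (simp add: bij_betw_def)
      then obtain j where "j < card \<Q>" "B j = Q" by auto
      then show ?thesis using 0[of j] l by (simp add: g_def)
    qed
    then have le: "Lp_norm p \<Omega> (h x) powr p \<le> \<epsilon> * N (h x) powr p" using C(2)[OF hx(1)] p0 by simp
    have "N (h x) powr p < \<bar>\<Lambda>\<bar> * Lp_norm p \<Omega> (h x) powr p"
      by (rule less_le_trans[OF hx(2) mult_right_mono]) auto
    also have "\<dots> \<le> \<bar>\<Lambda>\<bar> * (\<epsilon> * N (h x) powr p)" by (intro mult_left_mono le) simp
    also have "\<dots> = (\<bar>\<Lambda>\<bar> * \<epsilon>) * N (h x) powr p" by simp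
    also have "\<dots> \<le> 1 * N (h x) powr p" by (intro mult_right_mono) (auto simp: \<epsilon>_def field_simps)
    finally show False by simp
  qed
  then show ?thesis by blast
qed

section \<open>Linking between two cones, and the existence theorem\<close>

lemma energy_antimono: "a \<le> a' \<Longrightarrow> energy a' u \<le> energy a u"
  unfolding energy_def using p0 q0 by (intro diff_mono add_mono divide_right_mono mult_right_mono) auto

lemma lower_order_terms:
  "\<exists>K>0. \<forall>u\<in>T. \<bar>(Lp_norm q \<Omega> (grad u) powr q - \<beta> * Lp_norm q \<Omega> u powr q) / q - f u\<bar> \<le> K * (N u powr q + N u powr 1)"
proof -
  obtain K where K: "K > 0" "\<And>u. u \<in> T \<Longrightarrow> Lp_norm q \<Omega> u \<le> K * N u"
    "\<And>u. u \<in> T \<Longrightarrow> Lp_norm q \<Omega> (grad u) \<le> K * N u" "\<And>u. u \<in> T \<Longrightarrow> \<bar>f u\<bar> \<le> K * N u"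
    using embedding_constants by metis
  define M where "M = (1 + \<bar>\<beta>\<bar>) * K powr q + K"
  have M: "M > 0" using K(1) by (simp add: M_def add_nonneg_pos)
  show ?thesis
  proof (intro exI[of _ M] conjI M ballI)
    fix u assume u: "u \<in> T"
    have N1: "N u powr 1 = N u" by (simp add: Lp_norm_nonneg)
    have pow: "m powr q \<le> K powr q * N u powr q" if "m \<le> K * N u" "m \<ge> 0" for m
      using powr_mono2[OF less_imp_le[OF q0] that(2,1)] K(1) by (simp add: powr_mult Lp_norm_nonneg)
    have 1: "\<bar>Lp_norm q \<Omega> (grad u) powr q\<bar> \<le> K powr q * N u powr q" using pow[OF K(3)[OF u] Lp_norm_nonneg] by simp
    have 2: "\<bar>\<beta> * Lp_norm q \<Omega> u powr q\<bar> \<le> \<bar>\<beta>\<bar> * (K powr q * N u powr q)"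
      unfolding abs_mult using pow[OF K(2)[OF u] Lp_norm_nonneg] by (intro mult_left_mono) auto
    let ?x = "Lp_norm q \<Omega> (grad u) powr q - \<beta> * Lp_norm q \<Omega> u powr q"
    have "\<bar>?x\<bar> \<le> (1 + \<bar>\<beta>\<bar>) * (K powr q * N u powr q)" using 1 2 unfolding distrib_right by linarith
    moreover have "\<bar>?x / q\<bar> \<le> \<bar>?x\<bar>" using q1 by (simp add: divide_le_eq mult_le_cancel_left1)
    ultimately have "\<bar>?x / q - f u\<bar> \<le> (1 + \<bar>\<beta>\<bar>) * K powr q * N u powr q + K * N u"
      using K(4)[OF u] unfolding mult.assoc by linarith
    also have "\<dots> \<le> M * N u powr q + M * N u powr 1"
      unfolding N1 using K(1) by (intro add_mono mult_right_mono) (auto simp: M_def Lp_norm_nonneg)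
    finally show "\<bar>?x / q - f u\<bar> \<le> M * (N u powr q + N u powr 1)" by (simp add: distrib_left)
  qed
qed

lemma lower_order_absorbed:
  assumes c: "c > 0"
  shows "\<exists>M\<ge>0. \<forall>u\<in>T. \<bar>(Lp_norm q \<Omega> (grad u) powr q - \<beta> * Lp_norm q \<Omega> u powr q) / q - f u\<bar> \<le> c * N u powr p + M"
proof -
  obtain K where K: "K > 0" "\<And>u. u \<in> T \<Longrightarrow> \<bar>(Lp_norm q \<Omega> (grad u) powr q - \<beta> * Lp_norm q \<Omega> u powr q) / q - f u\<bar> \<le> K * (N u powr q + N u powr 1)"
    using lower_order_terms by blast
  have cK: "c / (2 * K) > 0" using c K(1) by simp
  obtain M1 where M1: "M1 \<ge> 0" "\<And>x. x \<ge> 0 \<Longrightarrow> x powr q \<le> c / (2 * K) * x powr p + M1"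
    using powr_le_small_powr_plus[OF q0 qp cK] by blast
  obtain M2 where M2: "M2 \<ge> 0" "\<And>x. x \<ge> 0 \<Longrightarrow> x powr 1 \<le> c / (2 * K) * x powr p + M2"
    using powr_le_small_powr_plus[OF zero_less_one p1 cK] by blast
  show ?thesis
  proof (intro exI[of _ "K * (M1 + M2)"] conjI ballI)
    show "K * (M1 + M2) \<ge> 0" using K(1) M1(1) M2(1) by simp
    fix u assume u: "u \<in> T"
    have "K * (N u powr q + N u powr 1) \<le> K * ((c / (2 * K) * N u powr p + M1) + (c / (2 * K) * N u powr p + M2))"
      using K(1) by (intro mult_left_mono add_mono M1(2) M2(2) Lp_norm_nonneg) auto
    also have "\<dots> = c * N u powr p + K * (M1 + M2)" using K(1) by (simp add: field_simps)
    finally show "\<bar>(Lp_norm q \<Omega> (grad u) powr q - \<beta> * Lp_norm q \<Omega> u powr q) / q - f u\<bar> \<le> c * N u powr p + K * (M1 + M2)"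
      using K(2)[OF u] by linarith
  qed
qed

text \<open>Outside the cone the leading part of the energy is at least \<open>c \<parallel>\<nabla>u\<parallel>\<^sup>p\<close>, which dominates the lower
order terms.\<close>
lemma energy_bounded_below_outside_cone:
  assumes a: "a < \<Lambda>"
  shows "\<exists>A. \<forall>u\<in>T. u \<notin> eigencone \<Lambda> \<longrightarrow> A \<le> energy a u"
proof -
  \<comment> \<open>For \<open>a \<le> 0\<close> the term \<open>- a \<parallel>u\<parallel>\<^sup>p\<close> is nonnegative; otherwise it costs at most the fraction \<open>a / \<Lambda>\<close>.\<close>
  define c where "c = (if a \<le> 0 then 1 else 1 - a / \<Lambda>)"
  have c: "c > 0" using a by (simp add: c_def)
  have cp: "c / p > 0" using c p0 by simp
  obtain M where M: "\<And>u. u \<in> T \<Longrightarrow> \<bar>(Lp_norm q \<Omega> (grad u) powr q - \<beta> * Lp_norm q \<Omega> u powr q) / q - f u\<bar> \<le> c / p * N u powr p + M"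
    using lower_order_absorbed[OF cp] by blast
  have "- M \<le> energy a u" if u: "u \<in> T" "u \<notin> eigencone \<Lambda>" for u
  proof -
    have ge: "N u powr p \<ge> \<Lambda> * Lp_norm p \<Omega> u powr p" using u by (auto simp: eigencone_def)
    have "c * N u powr p \<le> N u powr p - a * Lp_norm p \<Omega> u powr p"
    proof (cases "a \<le> 0")
      case True
      then show ?thesis by (simp add: c_def mult_nonpos_nonneg)
    next
      case False
      then have "a / \<Lambda> * (\<Lambda> * Lp_norm p \<Omega> u powr p) \<le> a / \<Lambda> * N u powr p" using a by (intro mult_left_mono ge) auto
      then show ?thesis using False a by (simp add: c_def left_diff_distrib)
    qed
    then have "c / p * N u powr p \<le> (N u powr p - a * Lp_norm p \<Omega> u powr p) / p"
      using divide_right_mono[of "c * N u powr p" _ p] p0 by simp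
    then show ?thesis using M[OF u(1)] unfolding energy_def by linarith
  qed
  then show ?thesis by blast
qed

lemma energy_on_cone:
  assumes a: "\<Lambda> < a"
  shows "\<exists>c>0. \<exists>B\<ge>0. \<forall>u\<in>eigencone \<Lambda>. energy a u \<le> B - c * N u powr p"
proof (cases "\<Lambda> > 0")
  case False
  then have "eigencone \<Lambda> = {}"
    using mult_nonpos_nonneg[of \<Lambda>] by (auto simp: eigencone_def not_less) (smt (verit) powr_ge_zero mult_nonpos_nonneg)
  then show ?thesis by (intro exI[of _ 1]) auto
next
  case True
  define c where "c = (a / \<Lambda> - 1) / (2 * p)"
  have c: "c > 0" using True a p0 by (simp add: c_def)
  obtain M where M: "M \<ge> 0" "\<And>u. u \<in> T \<Longrightarrow> \<bar>(Lp_norm q \<Omega> (grad u) powr q - \<beta> * Lp_norm q \<Omega> u powr q) / q - f u\<bar> \<le> c * N u powr p + M"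
    using lower_order_absorbed[OF c] by blast
  have "energy a u \<le> M - c * N u powr p" if u: "u \<in> eigencone \<Lambda>" for u
  proof -
    have uT: "u \<in> T" and lt: "N u powr p \<le> \<Lambda> * Lp_norm p \<Omega> u powr p" using u by (auto simp: eigencone_def)
    have "a / \<Lambda> * N u powr p \<le> a / \<Lambda> * (\<Lambda> * Lp_norm p \<Omega> u powr p)" using True a by (intro mult_left_mono lt) auto
    then have "N u powr p - a * Lp_norm p \<Omega> u powr p \<le> (1 - a / \<Lambda>) * N u powr p" using True by (simp add: left_diff_distrib)
    then have "(N u powr p - a * Lp_norm p \<Omega> u powr p) / p \<le> (1 - a / \<Lambda>) * N u powr p / p"
      using p0 by (intro divide_right_mono) auto
    also have "\<dots> = - (2 * c * N u powr p)" using p0 by (simp add: c_def field_simps)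
    finally show ?thesis using M(2)[OF uT] unfolding energy_def by linarith
  qed
  then show ?thesis using c M(1) by blast
qed

lemma energy_0: "energy a 0 = 0"
proof -
  have "grad (0 :: 'a \<Rightarrow> real) = (\<lambda>_. 0)" using grad_scale[OF T_0, of 0] by simp
  moreover have "Lp_norm r \<Omega> (0 :: 'a \<Rightarrow> real) = 0" if "r > 0" for r using Lp_norm_scale[OF that, of \<Omega> 0 "\<lambda>_. 0 :: real"] by (simp add: zero_fun_def)
  moreover have "Lp_norm r \<Omega> (\<lambda>_. 0 :: 'a) = 0" if "r > 0" for r using Lp_norm_scale[OF that, of \<Omega> 0 "\<lambda>_. 0 :: 'a"] by simp
  moreover have "f 0 = 0" using f_scale[OF T_0, of 0] by simp
  ultimately show ?thesis using p0 q0 by (simp add: energy_def)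
qed

text \<open>The linking principle for cones on both sides of the parameter \<open>a\<close>, which may itself be an eigenvalue.
On the ray through a function of the inner cone the energy tends to \<open>-\<infinity>\<close>, uniformly over the sphere,
so a multiple \<open>R\<close> of the sphere map lies below the level outside the outer cone. The levels \<open>A\<close> and \<open>B\<close>
delimit the energy of the point found; they are what has to be uniform as \<open>a\<close> tends to \<open>\<alpha>\<close>.\<close>
lemma almost_critical_point_between_cones:
  assumes 1: "\<Lambda>\<^sub>1 < a" "a < \<Lambda>\<^sub>2" and k: "has_index \<Lambda>\<^sub>1 k" "\<not> has_index \<Lambda>\<^sub>2 (Suc k)"
    and A: "\<And>u. u \<in> T \<Longrightarrow> u \<notin> eigencone \<Lambda>\<^sub>2 \<Longrightarrow> A \<le> energy a u"
    and B: "\<And>u. u \<in> eigencone \<Lambda>\<^sub>1 \<Longrightarrow> energy a u \<le> B" "B \<ge> 0" and \<epsilon>: "\<epsilon> > 0"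
  shows "\<exists>u\<in>T. min A 0 - 2 \<le> energy a u \<and> energy a u \<le> B \<and>
    (\<forall>\<phi>\<in>T. \<bar>form a 1 u (grad u) \<phi> (grad \<phi>) - f \<phi>\<bar> \<le> \<epsilon> * N \<phi>)"
proof -
  let ?D = "\<lambda>u \<phi>. form a 1 u (grad u) \<phi> (grad \<phi>) - f \<phi>"
  interpret E: C1_functional T N "energy a" ?D by (rule C1_energy)
  obtain h where h: "odd_sphere_map k (eigencone \<Lambda>\<^sub>1) h" using k(1) unfolding has_index_def by blast
  then have hc: "ncontinuous_on (sphere_nat k) h" and h1: "\<And>x. x \<in> sphere_nat k \<Longrightarrow> h x \<in> eigencone \<Lambda>\<^sub>1"
    by (auto simp: odd_sphere_map_def)
  have "\<exists>m>0. \<forall>x\<in>sphere_nat k. m \<le> N (h x)"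
  proof (cases "sphere_nat k = {}")
    case False
    then obtain x where "x \<in> sphere_nat k" "\<forall>y\<in>sphere_nat k. N (h x) \<le> N (h y)"
      using continuous_attains_inf[OF compact_sphere_nat False continuous_on_ncontinuous[OF ncontinuous_N hc]] by blast
    then show ?thesis using eigencone_N_pos[OF h1] by blast
  qed (auto intro: exI[of _ 1])
  then obtain m where m: "m > 0" "\<And>x. x \<in> sphere_nat k \<Longrightarrow> m \<le> N (h x)" by blast
  obtain c B' where c: "c > 0" "B' \<ge> 0" "\<And>u. u \<in> eigencone \<Lambda>\<^sub>1 \<Longrightarrow> energy a u \<le> B' - c * N u powr p"
    using energy_on_cone[OF 1(1)] by blast
  \<comment> \<open>The linking principle needs a gap of more than \<open>1\<close> below \<open>A\<close>, and a lower level not above \<open>B\<close>.\<close>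
  define A' where "A' = min A 0 - 2"
  define X where "X = (B' - A') / c"
  define R where "R = X powr (1 / p) / m"
  have X: "X > 0" using c by (simp add: X_def A'_def)
  have R: "R > 0" using X m by (simp add: R_def)
  have T1: "h x \<in> T" if "x \<in> sphere_nat k" for x using h1[OF that] by (simp add: eigencone_def)
  have low: "energy a (R *\<^sub>R h x) \<le> A'" if x: "x \<in> sphere_nat k" for x
  proof -
    have "X powr (1 / p) = R * m" using m(1) by (simp add: R_def)
    also have "\<dots> \<le> R * N (h x)" using R by (intro mult_left_mono m(2) x) simp
    also have "\<dots> = N (R *\<^sub>R h x)" using R by (simp add: N_scale T1 x)
    finally have "X powr (1 / p) \<le> N (R *\<^sub>R h x)" .
    then have "(X powr (1 / p)) powr p \<le> N (R *\<^sub>R h x) powr p" using p0 by (intro powr_mono2) auto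
    then have "c * X \<le> c * N (R *\<^sub>R h x) powr p" using X p0 c(1) by (simp add: powr_powr)
    then have "B' - A' \<le> c * N (R *\<^sub>R h x) powr p" using c(1) by (simp add: X_def)
    then show ?thesis using c(3)[OF eigencone_scale[OF h1[OF x]], of R] R by simp
  qed
  have "\<exists>u\<in>T. A' \<le> energy a u \<and> energy a u \<le> B \<and> (\<forall>v\<in>T. N v \<le> 1 \<longrightarrow> \<bar>?D u v\<bar> \<le> \<epsilon>)"
  proof (rule E.odd_linking_almost_critical_point[where ?C1.0 = "eigencone \<Lambda>\<^sub>1" and ?C2.0 = "eigencone \<Lambda>\<^sub>2" and R = R])
    show "odd_sphere_map k (eigencone \<Lambda>\<^sub>1) h" by (rule h)
    show "eigencone \<Lambda>\<^sub>1 \<subseteq> eigencone \<Lambda>\<^sub>2" using 1 by (intro eigencone_mono) simp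
    show "- u \<in> eigencone \<Lambda>\<^sub>2" if "u \<in> eigencone \<Lambda>\<^sub>2" for u by (rule eigencone_uminus[OF that])
    show "\<nexists>g. odd_sphere_map (Suc k) (eigencone \<Lambda>\<^sub>2) g" using k(2) unfolding has_index_def .
    show "A' + 1 < energy a u" if "u \<in> T" "u \<notin> eigencone \<Lambda>\<^sub>2" for u using A[OF that] by (simp add: A'_def)
    show "energy a (R *\<^sub>R h x) \<le> A'" if "x \<in> sphere_nat k" for x by (rule low[OF that])
    show "energy a (s *\<^sub>R h x) \<le> B" if "x \<in> sphere_nat k" "s \<ge> 0" for x s
      using B(1)[OF eigencone_scale[OF h1[OF that(1)]], of s] B(2) energy_0 by (cases "s = 0") auto
  qed (use R B(2) \<epsilon> in \<open>auto simp: A'_def energy_0\<close>)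
  then obtain u where u: "u \<in> T" "A' \<le> energy a u" "energy a u \<le> B" "\<And>v. v \<in> T \<Longrightarrow> N v \<le> 1 \<Longrightarrow> \<bar>?D u v\<bar> \<le> \<epsilon>" by blast
  have "\<bar>?D u \<phi>\<bar> \<le> \<epsilon> * N \<phi>" if \<phi>: "\<phi> \<in> T" for \<phi>
  proof (cases "N \<phi> = 0")
    case True
    obtain C where "\<And>v. v \<in> T \<Longrightarrow> \<bar>?D u v\<bar> \<le> C * N v" using E.D_bounded[OF u(1)] by blast
    then show ?thesis using \<phi> True by force
  next
    case False
    then have pos: "N \<phi> > 0" using Lp_norm_nonneg[of p \<Omega> "grad \<phi>"] by linarith
    have "\<bar>?D u ((1 / N \<phi>) *\<^sub>R \<phi>)\<bar> \<le> \<epsilon>"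
      using pos by (intro u(4) T_scale \<phi>) (simp add: N_scale \<phi>)
    then have "\<bar>(1 / N \<phi>) * ?D u \<phi>\<bar> \<le> \<epsilon>" unfolding E.D_scale[OF u(1) \<phi>] .
    then have "\<bar>?D u \<phi>\<bar> / N \<phi> \<le> \<epsilon>" using pos by (simp add: abs_mult)
    then show ?thesis using pos by (simp add: divide_le_eq)
  qed
  then show ?thesis using u unfolding A'_def by blast
qed

lemma inverse_Suc_tendsto_0: "(\<lambda>n. d / real (Suc (Suc n))) \<longlonglongrightarrow> 0"
  using LIMSEQ_Suc[OF LIMSEQ_Suc[OF lim_const_over_n[of d]]] by simp

text \<open>For positive \<open>G\<close> upper bounds of the energies are needed. Take the largest index \<open>k\<close> of a cone of a
level below \<open>\<alpha>\<close>, attained at \<open>\<Lambda>\<close>, and let \<open>a n\<close> increase to \<open>\<alpha>\<close>. The inner cone is always that of \<open>\<Lambda>\<close>,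
on which the energies are bounded above uniformly; the outer one, halfway between \<open>a n\<close> and \<open>\<alpha>\<close>,
still has no larger index.\<close>
lemma solution_if_G_positive:
  assumes G: "\<And>u. u \<in> ES \<Omega> p \<alpha> - null_functions \<Omega> \<Longrightarrow> G \<Omega> q \<beta> u > 0"
  shows "\<exists>v. weak_solution \<Omega> p q \<alpha> \<beta> f v"
proof -
  let ?S = "{k. \<exists>\<Lambda><\<alpha>. has_index \<Lambda> k}"
  obtain m where m: "\<And>k. has_index \<alpha> k \<Longrightarrow> k \<le> m" using has_index_bounded by blast
  have "?S \<subseteq> {..m}" using m has_index_mono by (auto intro: less_imp_le)
  then have fin: "finite ?S" by (rule finite_subset) simp
  have "0 \<in> ?S" using has_index_0 lt_ex by auto
  then have "Max ?S \<in> ?S" using fin Max_in by blast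
  then obtain \<Lambda> where \<Lambda>: "\<Lambda> < \<alpha>" "has_index \<Lambda> (Max ?S)" by blast
  have no: "\<not> has_index \<Lambda>' (Suc (Max ?S))" if "\<Lambda>' < \<alpha>" for \<Lambda>'
    using Max_ge[OF fin, of "Suc (Max ?S)"] that by auto
  define a where "a n = \<alpha> - (\<alpha> - \<Lambda>) / real (Suc (Suc n))" for n
  have a1: "(\<alpha> + \<Lambda>) / 2 \<le> a n" "a n < \<alpha>" for n
  proof -
    have "(\<alpha> - \<Lambda>) / real (Suc (Suc n)) \<le> (\<alpha> - \<Lambda>) / 2" using \<Lambda>(1) by (intro divide_left_mono) auto
    then show "(\<alpha> + \<Lambda>) / 2 \<le> a n" unfolding a_def by (simp add: field_simps)
    show "a n < \<alpha>" unfolding a_def using \<Lambda>(1) by simp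
  qed
  have a_lim: "a \<longlonglongrightarrow> \<alpha>" unfolding a_def using tendsto_diff[OF tendsto_const inverse_Suc_tendsto_0] by fastforce
  have mid: "\<Lambda> < (\<alpha> + \<Lambda>) / 2" using \<Lambda>(1) by simp
  obtain c B where c: "c > 0" and B: "B \<ge> 0" "\<And>u. u \<in> eigencone \<Lambda> \<Longrightarrow> energy ((\<alpha> + \<Lambda>) / 2) u \<le> B - c * N u powr p"
    using energy_on_cone[OF mid] by blast
  have "\<exists>u\<in>T. energy (a n) u \<le> B \<and>
    (\<forall>\<phi>\<in>T. \<bar>form (a n) 1 u (grad u) \<phi> (grad \<phi>) - f \<phi>\<bar> \<le> 1 / real (Suc (Suc n)) * N \<phi>)" for n
  proof -
    have a2: "a n < (a n + \<alpha>) / 2" "(a n + \<alpha>) / 2 < \<alpha>" "\<Lambda> < a n" using a1[of n] mid by (simp_all add: field_simps)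
    obtain A where A: "\<And>u. u \<in> T \<Longrightarrow> u \<notin> eigencone ((a n + \<alpha>) / 2) \<Longrightarrow> A \<le> energy (a n) u"
      using energy_bounded_below_outside_cone[OF a2(1)] by blast
    have "energy (a n) u \<le> B" if "u \<in> eigencone \<Lambda>" for u
      using energy_antimono[OF a1(1)[of n], of u] B(2)[OF that] mult_nonneg_nonneg[OF less_imp_le[OF c] powr_ge_zero, of "N u" p] by linarith
    from almost_critical_point_between_cones[OF a2(3,1) \<Lambda>(2) no[OF a2(2)] A this B(1), of "1 / real (Suc (Suc n))"]
    show ?thesis by auto
  qed
  then obtain u where u: "\<And>n. u n \<in> T" "\<And>n. energy (a n) (u n) \<le> B"
    "\<And>n \<phi>. \<phi> \<in> T \<Longrightarrow> \<bar>form (a n) 1 (u n) (grad (u n)) \<phi> (grad \<phi>) - f \<phi>\<bar> \<le> 1 / real (Suc (Suc n)) * N \<phi>"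
    by metis
  show ?thesis
    by (rule almost_critical_sequence_solves[where \<kappa> = 1, OF _ _ u(1) a_lim inverse_Suc_tendsto_0 u(3)]) (use G u(2) in auto)
qed

text \<open>For negative \<open>G\<close> lower bounds are needed. Take a level \<open>\<Lambda> > \<alpha>\<close> for which the index of the cone is
minimal; it is then the same for all levels in between. Let \<open>a n\<close> decrease to \<open>\<alpha>\<close>. The outer cone is
always that of \<open>\<Lambda>\<close>, outside which the energies are bounded below uniformly; the inner one, halfway
between \<open>\<alpha>\<close> and \<open>a n\<close>, has the same index.\<close>
lemma solution_if_G_negative:
  assumes G: "\<And>u. u \<in> ES \<Omega> p \<alpha> - null_functions \<Omega> \<Longrightarrow> G \<Omega> q \<beta> u < 0"
  shows "\<exists>v. weak_solution \<Omega> p q \<alpha> \<beta> f v"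
proof -
  let ?i = "\<lambda>\<Lambda>. Max {k. has_index \<Lambda> k}"
  have fin: "finite {k. has_index \<Lambda> k}" for \<Lambda>
    using has_index_bounded[of \<Lambda>] finite_subset[of "{k. has_index \<Lambda> k}" "{.._}"] by auto
  have attained: "has_index \<Lambda> (?i \<Lambda>)" for \<Lambda>
    using Max_in[OF fin, of \<Lambda>] has_index_0 by blast
  obtain \<Lambda> where \<Lambda>: "\<Lambda> > \<alpha>" and least: "\<And>\<Lambda>'. \<Lambda>' > \<alpha> \<Longrightarrow> ?i \<Lambda> \<le> ?i \<Lambda>'"
    using ex_has_least_nat[of "\<lambda>\<Lambda>. \<Lambda> > \<alpha>" "\<alpha> + 1" ?i] by auto
  have no: "\<not> has_index \<Lambda> (Suc (?i \<Lambda>))" using Max_ge[OF fin, of "Suc (?i \<Lambda>)" \<Lambda>] by auto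
  have all: "has_index \<Lambda>' (?i \<Lambda>)" if "\<alpha> < \<Lambda>'" "\<Lambda>' \<le> \<Lambda>" for \<Lambda>'
  proof -
    have "?i \<Lambda>' \<le> ?i \<Lambda>" using Max_ge[OF fin] has_index_mono[OF attained that(2)] by blast
    then have "?i \<Lambda>' = ?i \<Lambda>" using least[OF that(1)] by simp
    then show ?thesis using attained[of \<Lambda>'] by simp
  qed
  define a where "a n = \<alpha> + (\<Lambda> - \<alpha>) / real (Suc (Suc n))" for n
  have a1: "a n \<le> (\<alpha> + \<Lambda>) / 2" "\<alpha> < a n" for n
  proof -
    have "(\<Lambda> - \<alpha>) / real (Suc (Suc n)) \<le> (\<Lambda> - \<alpha>) / 2" using \<Lambda> by (intro divide_left_mono) auto
    then show "a n \<le> (\<alpha> + \<Lambda>) / 2" unfolding a_def by (simp add: field_simps)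
    show "\<alpha> < a n" unfolding a_def using \<Lambda> by simp
  qed
  have a_lim: "a \<longlonglongrightarrow> \<alpha>" unfolding a_def using tendsto_add[OF tendsto_const inverse_Suc_tendsto_0] by fastforce
  have mid: "(\<alpha> + \<Lambda>) / 2 < \<Lambda>" using \<Lambda> by simp
  obtain A where A: "\<And>u. u \<in> T \<Longrightarrow> u \<notin> eigencone \<Lambda> \<Longrightarrow> A \<le> energy ((\<alpha> + \<Lambda>) / 2) u"
    using energy_bounded_below_outside_cone[OF mid] by blast
  have "\<exists>u\<in>T. min A 0 - 2 \<le> energy (a n) u \<and>
    (\<forall>\<phi>\<in>T. \<bar>form (a n) 1 u (grad u) \<phi> (grad \<phi>) - f \<phi>\<bar> \<le> 1 / real (Suc (Suc n)) * N \<phi>)" for n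
  proof -
    have a2: "\<alpha> < (\<alpha> + a n) / 2" "(\<alpha> + a n) / 2 < a n" "a n < \<Lambda>" using a1[of n] mid by (simp_all add: field_simps)
    have k: "has_index ((\<alpha> + a n) / 2) (?i \<Lambda>)" using a2 by (intro all) auto
    obtain c B where c: "c > 0" and B: "B \<ge> 0" "\<And>u. u \<in> eigencone ((\<alpha> + a n) / 2) \<Longrightarrow> energy (a n) u \<le> B - c * N u powr p"
      using energy_on_cone[OF a2(2)] by blast
    have B': "energy (a n) u \<le> B" if "u \<in> eigencone ((\<alpha> + a n) / 2)" for u
      using B(2)[OF that] mult_nonneg_nonneg[OF less_imp_le[OF c] powr_ge_zero, of "N u" p] by linarith
    have A': "A \<le> energy (a n) u" if "u \<in> T" "u \<notin> eigencone \<Lambda>" for u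
      using A[OF that] energy_antimono[OF a1(1)[of n], of u] by linarith
    from almost_critical_point_between_cones[OF a2(2,3) k no A' B' B(1), of "1 / real (Suc (Suc n))"]
    show ?thesis by auto
  qed
  then obtain u where u: "\<And>n. u n \<in> T" "\<And>n. min A 0 - 2 \<le> energy (a n) (u n)"
    "\<And>n \<phi>. \<phi> \<in> T \<Longrightarrow> \<bar>form (a n) 1 (u n) (grad (u n)) \<phi> (grad \<phi>) - f \<phi>\<bar> \<le> 1 / real (Suc (Suc n)) * N \<phi>"
    by metis
  show ?thesis
    by (rule almost_critical_sequence_solves[where \<kappa> = "-1" and B = "2 - min A 0", OF _ _ u(1) a_lim inverse_Suc_tendsto_0 u(3)])
      (use G u(2) in \<open>auto simp: algebra_simps\<close>)
qed

end

theorem theorem2p1: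
  fixes \<Omega> :: "'a::euclidean_space set"
    and p q \<alpha> \<beta> :: real
    and f :: "('a \<Rightarrow> real) \<Rightarrow> real"
  assumes "bounded_C2_domain \<Omega>"
    and "1 < q" and "q < p"
    and "f \<in> W10_dual p \<Omega>"
    and "(\<forall>u \<in> ES \<Omega> p \<alpha> - null_functions \<Omega>. G \<Omega> q \<beta> u < 0) \<or>
         (\<forall>u \<in> ES \<Omega> p \<alpha> - null_functions \<Omega>. G \<Omega> q \<beta> u > 0)"
  shows "\<exists>u. weak_solution \<Omega> p q \<alpha> \<beta> f u"
proof -
  interpret pq_problem \<Omega> p q \<beta> f
    using assms by unfold_locales (auto simp: bounded_C2_domain_def)
  show ?thesis
    using assms(5) solution_if_G_negative solution_if_G_positive by blast
qed

end
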